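(* Let $K$ be a field of characteristic zero, let $m,n\ge 1$, and let $\mathbb{X}$ be a (nonempty finite) set of $s$ distinct points in $\mathbb{P}^m\times\mathbb{P}^n$ over $K$. Then the following are equivalent. (a) $\mathbb{X}=CI(d_1,\dots,d_m,d'_1,\dots,d'_n)$ for some positive integers $d_i,d'_j\ge 1$. (b) $\mathbb{X}=\mathbb{X}_1\times\mathbb{X}_2$, $\mathbb{X}$ has the Cayley-Bacharach property, and $\operatorname{HF}_{\vartheta_{\mathbb{X}}}(r_{\mathbb{X}_1},r_{\mathbb{X}_2})\neq 0$.
   Context: $S=K[X_0,\dots,X_m,Y_0,\dots,Y_n]$ is $\mathbb{Z}^2$-graded by $\deg X_i=(1,0)$, $\deg Y_j=(0,1)$. Points of $\mathbb{P}^m\times\mathbb{P}^n$ have coordinates in $K$. $I_{\mathbb{X}}\subseteq S$ is the bihomogeneous vanishing ideal of $\mathbb{X}$, $R_{\mathbb{X}}=S/I_{\mathbb{X}}$, and $x_i,y_j$ are the images of $X_i,Y_j$ in $R_{\mathbb{X}}$. For a bigraded module $M$, $\operatorname{HF}_M(i,j)=\dim_K M_{i,j}$; $\operatorname{HF}_{\mathbb{X}}:=\operatorname{HF}_{R_{\mathbb{X}}}$. $\pi_1,\pi_2$ are the projections of $\mathbb{P}^m\times\mathbb{P}^n$ to $\mathbb{P}^m$ and $\mathbb{P}^n$; $\mathbb{X}_k=\pi_k(\mathbb{X})$. $\operatorname{HF}_{\mathbb{X}_k}$ is the Hilbert function of the homogeneous coordinate ring of $\mathbb{X}_k$, and its regularity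 index $r_{\mathbb{X}_k}$ is the least integer $i_0$ with $\operatorname{HF}_{\mathbb{X}_k}(i)=|\mathbb{X}_k|$ for all $i\ge i_0$. $\mathbb{X}=CI(d_1,\dots,d_m,d'_1,\dots,d'_n)$ (complete intersection of type $(d_1,\dots,d_m,d'_1,\dots,d'_n)$) means that $I_{\mathbb{X}}$ is generated by a bihomogeneous regular sequence $F_1,\dots,F_m,G_1,\dots,G_n$ with $\deg F_i=(d_i,0)$ and $\deg G_j=(0,d'_j)$. $\mathbb{X}$ has the Cayley-Bacharach property if the Hilbert function of $\mathbb{X}\setminus\{p\}$ is independent of the choice of $p\in\mathbb{X}$. $\mathbb{X}$ is arithmetically Cohen-Macaulay (ACM) if $R_{\mathbb{X}}$ is Cohen-Macaulay (equivalently $\operatorname{depth}R_{\mathbb{X}}=2$). Every $\mathbb{X}$ with $\mathbb{X}=\mathbb{X}_1\times\mathbb{X}_2$ is ACM. For ACM $\mathbb{X}$ the coordinates are always assumed to be chosen (by linear changes of the $X_i$ and of the $Y_j$) so that $x_0,y_0$ is a regular sequence in $R_{\mathbb{X}}$. Then the Kähler different $\vartheta_{\mathbb{X}}$ is the bihomogeneous ideal of $R_{\mathbb{X}}$ generated by the images of all $(m+n)$-minors of the Jacobian matrix with rows $\left(\frac{\partial F_k}{\partial X_1},\dots,\frac{\partial F_k}{\partial X_m},\frac{\partial F_k}{\partial Y_1},\dots,\frac{\partial F_k}{\partial Y_n}\right)$, where $\{F_k\}$ is a finite bihomogeneous system of generators of $I_{\mathbb{X}}$ (the initial Fitting ideal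 of $\Omega^1_{R_{\mathbb{X}}/K[x_0,y_0]}$; independent of the generators). *)

theory Defs
  imports "HOL-Analysis.Determinants" "HOL-Library.Poly_Mapping" "HOL-Library.Extended_Nat"
begin

section \<open>Polynomials in the variables indexed by a finite type\<close>

text \<open>
  Polynomials with variables indexed by \<open>'i\<close> are finitely supported maps from exponent vectors
  to coefficients; ring operations are those of \<^theory>\<open>HOL-Library.Poly_Mapping\<close>.
  The coordinate ring of \<open>P^m\<close> has variables indexed by \<open>'m option\<close> with \<open>m = CARD('m)\<close>:
  \<open>None\<close> is the index \<open>0\<close>, and \<open>Some i\<close> runs through the indices \<open>1, ..., m\<close>.
  In the bigraded ring \<open>S\<close> of \<open>P^m \<times> P^n\<close>, \<open>Inl\<close> indexes the \<open>X\<close>-variables and \<open>Inr\<close> the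
  \<open>Y\<close>-variables. Finite types are nonempty, so \<open>m, n \<ge> 1\<close>.
\<close>

type_synonym ('i, 'k) mpoly = "('i \<Rightarrow>\<^sub>0 nat) \<Rightarrow>\<^sub>0 'k"

type_synonym ('m, 'n, 'k) bipoly = "('m option + 'n option, 'k) mpoly"

definition Var :: "'i \<Rightarrow> ('i, 'k::comm_ring_1) mpoly" where
  "Var v = Poly_Mapping.single (Poly_Mapping.single v 1) 1"

definition peval :: "('i \<Rightarrow> 'k) \<Rightarrow> ('i, 'k::comm_ring_1) mpoly \<Rightarrow> 'k" where
  "peval a p = (\<Sum>t\<in>Poly_Mapping.keys p. Poly_Mapping.lookup p t *
     (\<Prod>v\<in>Poly_Mapping.keys t. a v ^ Poly_Mapping.lookup t v))"

text \<open>Where \<open>v\<close> does not occur in \<open>t\<close>, the subtraction truncates but the coefficient is zero.\<close>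

definition partial_deriv :: "'i \<Rightarrow> ('i, 'k::comm_ring_1) mpoly \<Rightarrow> ('i, 'k) mpoly" where
  "partial_deriv v p = (\<Sum>t\<in>Poly_Mapping.keys p.
     Poly_Mapping.single (t - Poly_Mapping.single v 1)
       (of_nat (Poly_Mapping.lookup t v) * Poly_Mapping.lookup p t))"

definition hom_comp :: "nat \<Rightarrow> ('i::finite, 'k::comm_ring_1) mpoly set" where
  "hom_comp d = {p. \<forall>t\<in>Poly_Mapping.keys p. (\<Sum>v\<in>UNIV. Poly_Mapping.lookup t v) = d}"

definition bihom_comp :: "nat \<Rightarrow> nat \<Rightarrow> ('m::finite, 'n::finite, 'k::comm_ring_1) bipoly set" where
  "bihom_comp i j = {p. \<forall>t\<in>Poly_Mapping.keys p.
     (\<Sum>v\<in>UNIV. Poly_Mapping.lookup t (Inl v)) = i \<and>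
     (\<Sum>v\<in>UNIV. Poly_Mapping.lookup t (Inr v)) = j}"


section \<open>Ideals, regular sequences, depth\<close>

lemma module_ring_mult: "module ((*) :: 'a::comm_ring_1 \<Rightarrow> 'a \<Rightarrow> 'a)"
  by unfold_locales (simp_all add: algebra_simps)

definition ideal_gen :: "'a::comm_ring_1 set \<Rightarrow> 'a set" where
  "ideal_gen B = module.span (*) B"

text \<open>
  The quotient ring \<open>S/I\<close> is handled through ideals of \<open>S\<close> that contain \<open>I\<close>: the residue classes
  of \<open>fs\<close> form a regular sequence in \<open>S/I\<close>. Taking \<open>I = {0}\<close> gives regular sequences in \<open>S\<close>.
\<close>

definition regular_seq_mod :: "'a::comm_ring_1 set \<Rightarrow> 'a list \<Rightarrow> bool" where
  "regular_seq_mod I fs \<longleftrightarrow>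
     (\<forall>k<length fs. \<forall>g. fs ! k * g \<in> ideal_gen (I \<union> set (take k fs))
                       \<longrightarrow> g \<in> ideal_gen (I \<union> set (take k fs))) \<and>
     ideal_gen (I \<union> set fs) \<noteq> UNIV"

text \<open>Depth of \<open>S/I\<close> with respect to the maximal ideal generated by all variables.\<close>

definition depth_mod :: "('i, 'k::field) mpoly set \<Rightarrow> enat" where
  "depth_mod I = (SUP fs \<in> {fs. set fs \<subseteq> ideal_gen (range Var) \<and> regular_seq_mod I fs}.
     enat (length fs))"


section \<open>Hilbert functions of subquotients\<close>

lemma vector_space_mpoly:
  "vector_space (\<lambda>(c::'k::field) (p::('i, 'k) mpoly). Poly_Mapping.single 0 c * p)"
  by unfold_locales
    (simp_all add: distrib_left distrib_right single_add mult_single flip: mult.assoc)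

definition Kdim :: "('i, 'k::field) mpoly set \<Rightarrow> nat" where
  "Kdim V = vector_space.dim (\<lambda>c p. Poly_Mapping.single 0 c * p) V"

text \<open>
  For homogeneous ideals \<open>I \<subseteq> J\<close> and a (finite-dimensional) graded component \<open>C\<close> of \<open>S\<close>, the
  dimension of the corresponding component \<open>(J \<inter> C) / (I \<inter> C)\<close> of the graded module \<open>J/I\<close>.
\<close>

definition comp_dim ::
  "('i, 'k::field) mpoly set \<Rightarrow> ('i, 'k) mpoly set \<Rightarrow> ('i, 'k) mpoly set \<Rightarrow> nat" where
  "comp_dim J I C = Kdim (J \<inter> C) - Kdim (I \<inter> C)"


section \<open>Points and vanishing ideals\<close>

text \<open>A point of projective space is the set of all its homogeneous coordinate vectors.\<close>

definition proj_point :: "('i \<Rightarrow> 'k::field) \<Rightarrow> ('i \<Rightarrow> 'k) set" where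
  "proj_point v = {\<lambda>i. c * v i |c. c \<noteq> 0}"

definition proj_space :: "('i \<Rightarrow> 'k::field) set set" where
  "proj_space = proj_point ` {v. v \<noteq> (\<lambda>_. 0)}"

type_synonym ('m, 'n, 'k) bipoint = "('m option \<Rightarrow> 'k) set \<times> ('n option \<Rightarrow> 'k) set"

definition van_ideal :: "('i::finite \<Rightarrow> 'k::field) set set \<Rightarrow> ('i, 'k) mpoly set" where
  "van_ideal Z = ideal_gen {F. (\<exists>d. F \<in> hom_comp d) \<and> (\<forall>P\<in>Z. \<forall>u\<in>P. peval u F = 0)}"

definition bivan_ideal ::
  "('m::finite, 'n::finite, 'k::field) bipoint set \<Rightarrow> ('m, 'n, 'k) bipoly set" where
  "bivan_ideal X = ideal_gen {F. (\<exists>i j. F \<in> bihom_comp i j) \<and>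
     (\<forall>(P, Q)\<in>X. \<forall>u\<in>P. \<forall>w\<in>Q. peval (case_sum u w) F = 0)}"

definition HF_proj :: "('i::finite \<Rightarrow> 'k::field) set set \<Rightarrow> nat \<Rightarrow> nat" where
  "HF_proj Z d = comp_dim UNIV (van_ideal Z) (hom_comp d)"

definition reg_index :: "('i::finite \<Rightarrow> 'k::field) set set \<Rightarrow> nat" where
  "reg_index Z = (LEAST i0. \<forall>i\<ge>i0. HF_proj Z i = card Z)"

definition HF_bi ::
  "('m::finite, 'n::finite, 'k::field) bipoint set \<Rightarrow> nat \<Rightarrow> nat \<Rightarrow> nat" where
  "HF_bi X i j = comp_dim UNIV (bivan_ideal X) (bihom_comp i j)"


section \<open>Complete intersections, Cayley-Bacharach property, ACM, Kaehler different\<close>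

definition complete_intersection ::
  "nat list \<Rightarrow> nat list \<Rightarrow> ('m::finite, 'n::finite, 'k::field) bipoint set \<Rightarrow> bool" where
  "complete_intersection ds ds' X \<longleftrightarrow> (\<exists>Fs Gs.
     length ds = CARD('m) \<and> length Fs = CARD('m) \<and>
     length ds' = CARD('n) \<and> length Gs = CARD('n) \<and>
     (\<forall>i<CARD('m). Fs ! i \<in> bihom_comp (ds ! i) 0) \<and>
     (\<forall>j<CARD('n). Gs ! j \<in> bihom_comp 0 (ds' ! j)) \<and>
     regular_seq_mod {0} (Fs @ Gs) \<and>
     ideal_gen (set (Fs @ Gs)) = bivan_ideal X)"

definition cayley_bacharach :: "('m::finite, 'n::finite, 'k::field) bipoint set \<Rightarrow> bool" where
  "cayley_bacharach X \<longleftrightarrow> (\<forall>p\<in>X. \<forall>q\<in>X. HF_bi (X - {p}) = HF_bi (X - {q}))"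

text \<open>
  For nonempty finite \<open>X\<close> the ring \<open>S/I(X)\<close> has Krull dimension \<open>2\<close>, so it is Cohen-Macaulay
  if and only if its depth is \<open>2\<close>.
\<close>

definition arith_CM :: "('m::finite, 'n::finite, 'k::field) bipoint set \<Rightarrow> bool" where
  "arith_CM X \<longleftrightarrow> depth_mod (bivan_ideal X) = 2"

text \<open>
  The minors of size \<open>m + n\<close> of the Jacobian matrix of \<open>Fs\<close> with respect to all variables except
  \<open>X_0\<close> and \<open>Y_0\<close>. An injective \<open>r\<close> selects \<open>m + n\<close> distinct rows; listing the same rows in
  another order changes the minor only by a sign.
\<close>

definition jacobian_minors ::
  "('m::finite, 'n::finite, 'k::field) bipoly set \<Rightarrow> ('m, 'n, 'k) bipoly set" where
  "jacobian_minors Fs =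
     {det (\<chi> k (c::'m + 'n). partial_deriv (map_sum Some Some c) (r k)) |r.
        inj r \<and> range r \<subseteq> Fs}"

text \<open>
  The Kaehler different, formed with the system of generators \<open>Fs\<close> of \<open>I(X)\<close>, as an ideal of
  \<open>S\<close> containing \<open>I(X)\<close>; the ideal of \<open>S/I(X)\<close> itself is its image.
\<close>

definition kaehler_different ::
  "('m::finite, 'n::finite, 'k::field) bipoly set \<Rightarrow> ('m, 'n, 'k) bipoint set
     \<Rightarrow> ('m, 'n, 'k) bipoly set" where
  "kaehler_different Fs X = ideal_gen (bivan_ideal X \<union> jacobian_minors Fs)"

definition HF_kaehler ::
  "('m::finite, 'n::finite, 'k::field) bipoly set \<Rightarrow> ('m, 'n, 'k) bipoint set
     \<Rightarrow> nat \<Rightarrow> nat \<Rightarrow> nat" where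
  "HF_kaehler Fs X i j = comp_dim (kaehler_different Fs X) (bivan_ideal X) (bihom_comp i j)"

end

theory Submission
  imports Defs "HOL-Library.Product_Plus" "HOL-Computational_Algebra.Formal_Power_Series"
begin

text \<open>
  Everything reduces to one projective space. Let \<open>A\<close> be a finite set of vectors
  \<open>q\<close> with \<open>q_0 = 1\<close>, representing points of \<open>P^m\<close>, let
  \<open>F_1, ..., F_m\<close> be forms of positive degrees \<open>d_i\<close> vanishing on
  \<open>A\<close>, and put \<open>rho = (d_1 - 1) + ... + (d_m - 1)\<close>. For
  \<open>q\<close> in \<open>A\<close>, telescoping divided differences give \<open>F_i =
  \<Sum>j. a_ij * (X_j - q_j * X_0)\<close>. The Bezoutian \<open>B_q = det (a_ij)\<close> is a
  form of degree \<open>rho\<close>; by Cramer's rule \<open>(X_j - q_j * X_0) * B_q\<close>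
  lies in the ideal of the \<open>F_i\<close>, so \<open>B_q\<close> vanishes at the other
  points of \<open>A\<close>, and its value at \<open>q\<close> is the Jacobian
  \<open>J(q)\<close> of the \<open>F_i\<close> (\<open>bez_other\<close>,
  \<open>bez_self\<close>).

  The key is how \<open>B_q\<close> depends on \<open>q\<close>: the coefficient of a monomial
  \<open>X^t\<close> is the value at \<open>q\<close> of a form of degree \<open>t_0\<close>
  (\<open>poly_family\<close>). If weights \<open>c_q\<close> satisfy \<open>\<Sum>q. c_q * G(q)
  = 0\<close> for all forms \<open>G\<close> of degree below \<open>rho\<close>, then
  \<open>\<Sum>q. c_q * h_q\<close> is divisible by \<open>X_0^rho\<close> for every family
  \<open>h\<close> of this kind. For \<open>B\<close> itself the degree leaves only
  \<open>\<Sum>q. c_q * B_q = gamma * X_0^rho\<close>, and evaluation gives \<open>c_q * J(q) =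
  gamma\<close> for all \<open>q\<close>, an Euler-Jacobi formula (\<open>residue\<close>).
  Suppose \<open>gamma\<close> is not zero. For \<open>G\<close> vanishing on \<open>A\<close>,
  the product \<open>G * B_q\<close> is a combination of the \<open>F_i\<close> whose
  coefficients form such families; the weighted sum over \<open>q\<close> can be divided by
  \<open>X_0^rho\<close>, so \<open>gamma * G\<close> lies in the ideal of the
  \<open>F_i\<close> (\<open>generate\<close>). Applied to a syzygy of the \<open>F_i\<close>,
  the same argument shows that it is a Koszul syzygy (\<open>koszul\<close>), whence the
  \<open>F_i\<close> form a regular sequence (\<open>koszul_regular\<close>).

  Suitable weights exist as soon as some \<open>u\<close> in \<open>A\<close> with
  \<open>J(u)\<close> nonzero is not separated from the rest of \<open>A\<close> by a form of
  degree below \<open>rho\<close>; then the \<open>F_i\<close> generate the vanishing ideal and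
  form a regular sequence (\<open>jacobian_generates\<close>). Conversely, for a complete
  intersection the Hilbert series provides a form of degree \<open>rho\<close> outside the ideal
  of the \<open>F_i\<close> and \<open>X_0\<close>. This yields weights as above that are not
  all zero, and \<open>c_q * J(q) = gamma\<close> makes every single weight nonzero. So every
  point is separated exactly by the forms of degree at least \<open>rho\<close>
  (\<open>complete_intersection_separators\<close>), and \<open>rho\<close> is the regularity
  index.

  For a product \<open>X = X1 \<times> X2\<close>, a point is separated in bidegree \<open>(i,
  j)\<close> iff its two coordinates are separated in degrees \<open>i\<close> and
  \<open>j\<close>. Hence the Cayley-Bacharach property says that in each factor all points have
  the same minimal separator degree, which is then the regularity index of that factor
  (\<open>cayley_bacharach_separates\<close>). Generators of bidegrees \<open>(d, 0)\<close> and
  \<open>(0, d')\<close> force \<open>X\<close> to be a product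
  (\<open>complete_intersection_product\<close>). A product is arithmetically Cohen-Macaulay
  (\<open>product_arith_CM\<close>), so the coordinates are regular, which means that
  \<open>X_0\<close> and \<open>Y_0\<close> vanish at no point
  (\<open>regular_coordinates_affine\<close>), and the above applies to both factors.

  If \<open>X\<close> is a complete intersection, the Jacobian determinant of its generators has
  bidegree \<open>(rho1, rho2)\<close>, lies in the Kaehler different and does not vanish at the
  points (\<open>complete_intersection_kaehler\<close>). Conversely, a nonzero element of the
  Kaehler different in the bidegree of the regularity indices yields a Jacobian minor of
  bidegree at most that, nonzero at some point \<open>(u, w)\<close>. Separating the
  \<open>X\<close>-columns from the \<open>Y\<close>-columns (\<open>det_two_blocks\<close>)
  selects \<open>m\<close> rows and \<open>n\<close> rows; evaluating the former in \<open>Y =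
  w\<close> and the latter in \<open>X = u\<close> gives forms with nonzero Jacobian at
  \<open>u\<close> and at \<open>w\<close>. The bidegree bounds their \<open>rho\<close> by the
  regularity index of the factor, and by the Cayley-Bacharach property no separators exist below
  it, so \<open>jacobian_generates\<close> applies on both sides
  (\<open>kaehler_complete_intersection\<close>).
\<close>

abbreviation Const :: "'k::zero \<Rightarrow> ('i, 'k) mpoly" where
  "Const c \<equiv> Poly_Mapping.single 0 c"

lemma mpoly_sum_monomials:
  "(p :: ('i, 'k::comm_ring_1) mpoly) =
     (\<Sum>t\<in>Poly_Mapping.keys p. Poly_Mapping.single t (Poly_Mapping.lookup p t))"
  by (rule poly_mapping_eqI)
    (auto simp: lookup_sum lookup_single when_def sum.delta in_keys_iff)

lemma mpoly_induct [case_names monom add]: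
  fixes p :: "('i, 'k::comm_ring_1) mpoly"
  assumes "\<And>t c. P (Poly_Mapping.single t c)" "\<And>p q. P p \<Longrightarrow> P q \<Longrightarrow> P (p + q)"
  shows "P p"
proof -
  have *: "P (\<Sum>t\<in>T. Poly_Mapping.single t (Poly_Mapping.lookup p t))" if "finite T" for T
    using that
  proof (induction T)
    case empty
    have "P (Poly_Mapping.single 0 0)" by (rule assms)
    then show ?case by simp
  qed (simp add: assms)
  show ?thesis
    using *[of "Poly_Mapping.keys p"] mpoly_sum_monomials[of p] by simp
qed

section \<open>Evaluation and substitution of polynomials\<close>

text \<open>
  \<open>peval\<close>, \<open>subst\<close>, \<open>partial_deriv\<close> and the divided
  differences below are all linear extensions of a map on monomials; the coefficients enter
  through a homomorphism, which is the identity or \<open>Const\<close>.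
\<close>

definition coef_hom :: "('k::comm_ring_1 \<Rightarrow> 'r::comm_ring_1) \<Rightarrow> bool" where
  "coef_hom c \<longleftrightarrow> c 1 = 1 \<and> (\<forall>x y. c (x + y) = c x + c y) \<and> (\<forall>x y. c (x * y) = c x * c y)"

lemma coef_hom_zero: "coef_hom c \<Longrightarrow> c 0 = 0"
  unfolding coef_hom_def by (metis add_cancel_right_right)

lemma coef_hom_id [simp]: "coef_hom (\<lambda>x. x)"
  by (simp add: coef_hom_def)

lemma coef_hom_Const [simp]: "coef_hom Const"
  by (simp add: coef_hom_def single_add mult_single)

definition lin_ext ::
  "('k::comm_ring_1 \<Rightarrow> 'r::comm_ring_1) \<Rightarrow> (('i \<Rightarrow>\<^sub>0 nat) \<Rightarrow> 'r) \<Rightarrow> ('i, 'k) mpoly \<Rightarrow> 'r" where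
  "lin_ext c \<phi> p = (\<Sum>t\<in>Poly_Mapping.keys p. c (Poly_Mapping.lookup p t) * \<phi> t)"

lemma lin_ext_superset:
  assumes "coef_hom c" "finite T" "Poly_Mapping.keys p \<subseteq> T"
  shows "lin_ext c \<phi> p = (\<Sum>t\<in>T. c (Poly_Mapping.lookup p t) * \<phi> t)"
  unfolding lin_ext_def using assms
  by (intro sum.mono_neutral_left) (auto simp: in_keys_iff coef_hom_zero)

lemma lin_ext_add:
  assumes "coef_hom c"
  shows "lin_ext c \<phi> (p + q) = lin_ext c \<phi> p + lin_ext c \<phi> q"
proof -
  let ?T = "Poly_Mapping.keys p \<union> Poly_Mapping.keys q"
  have T: "finite ?T" "Poly_Mapping.keys (p + q) \<subseteq> ?T" using keys_add[of p q] by auto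
  show ?thesis
    using assms T
    by (simp add: lin_ext_superset[of c ?T] lookup_add coef_hom_def sum.distrib algebra_simps)
qed

lemma lin_ext_single:
  assumes "coef_hom c"
  shows "lin_ext c \<phi> (Poly_Mapping.single t x) = c x * \<phi> t"
  using assms by (simp add: lin_ext_superset[of c "{t}"] coef_hom_zero)

lemma lin_ext_zero: "lin_ext c \<phi> 0 = 0"
  by (simp add: lin_ext_def)

lemma lin_ext_mult:
  assumes c: "coef_hom c" and \<phi>: "\<And>s t. \<phi> (s + t) = \<phi> s * \<phi> t"
  shows "lin_ext c \<phi> (p * q) = lin_ext c \<phi> p * lin_ext c \<phi> q"
proof (induction p rule: mpoly_induct)
  case (monom s x)
  show ?case
  proof (induction q rule: mpoly_induct)
    case (monom t y)
    show ?case using c by (simp add: mult_single lin_ext_single \<phi> coef_hom_def)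
  qed (simp add: lin_ext_add[OF c] distrib_left)
qed (simp add: lin_ext_add[OF c] distrib_right)

definition mon :: "('i \<Rightarrow> 'r::comm_ring_1) \<Rightarrow> ('i \<Rightarrow>\<^sub>0 nat) \<Rightarrow> 'r" where
  "mon a t = (\<Prod>v\<in>Poly_Mapping.keys t. a v ^ Poly_Mapping.lookup t v)"

lemma mon_superset:
  assumes "finite T" "Poly_Mapping.keys t \<subseteq> T"
  shows "mon a t = (\<Prod>v\<in>T. a v ^ Poly_Mapping.lookup t v)"
  unfolding mon_def using assms by (intro prod.mono_neutral_left) (auto simp: in_keys_iff)

lemma mon_UNIV: "mon a (t :: 'i::finite \<Rightarrow>\<^sub>0 nat) = (\<Prod>v\<in>UNIV. a v ^ Poly_Mapping.lookup t v)"
  by (rule mon_superset) auto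

lemma mon_add: "mon a (s + t) = mon a s * mon a t"
proof -
  let ?T = "Poly_Mapping.keys s \<union> Poly_Mapping.keys t"
  have T: "finite ?T" "Poly_Mapping.keys (s + t) \<subseteq> ?T" using keys_add[of s t] by auto
  show ?thesis
    using T by (simp add: mon_superset[of ?T] lookup_add power_add prod.distrib)
qed

lemma mon_0 [simp]: "mon a 0 = 1"
  by (simp add: mon_def)

lemma mon_single [simp]: "mon a (Poly_Mapping.single v n) = a v ^ n"
  by (simp add: mon_superset[of "{v}"])

lemma peval_eq_lin_ext: "peval a = lin_ext (\<lambda>x. x) (mon a)"
  by (simp add: peval_def lin_ext_def mon_def fun_eq_iff)

definition subst :: "('i \<Rightarrow> ('j, 'k) mpoly) \<Rightarrow> ('i, 'k::comm_ring_1) mpoly \<Rightarrow> ('j, 'k) mpoly" where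
  "subst a = lin_ext Const (mon a)"

lemma additive_sum:
  assumes "f 0 = (0::'b::comm_monoid_add)" "\<And>x y. f (x + y) = f x + f y"
  shows "f (sum g S) = (\<Sum>x\<in>S. f (g x))"
  by (induction S rule: infinite_finite_induct) (simp_all add: assms)

lemma additive_minus:
  assumes "\<And>x y. f (x + y) = f x + (f y :: 'b::ab_group_add)"
  shows "f (x - y) = f x - f (y :: 'a::ab_group_add)"
  by (metis assms add_diff_cancel_right' diff_add_cancel)

lemma multiplicative_prod:
  assumes "f 1 = (1::'b::comm_monoid_mult)" "\<And>x y. f (x * y) = f x * f y"
  shows "f (prod g S) = (\<Prod>x\<in>S. f (g x))"
  by (induction S rule: infinite_finite_induct) (simp_all add: assms)

lemma peval_single [simp]: "peval a (Poly_Mapping.single t x) = x * mon a t"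
  by (simp add: peval_eq_lin_ext lin_ext_single)
lemma peval_Const: "peval a (Const x) = x" by simp
lemma peval_0 [simp]: "peval a 0 = 0" by (simp add: peval_eq_lin_ext lin_ext_zero)
lemma peval_1 [simp]: "peval a 1 = 1" using peval_Const[of a 1] by (simp del: peval_single)
lemma peval_add [simp]: "peval a (p + q) = peval a p + peval a q"
  by (simp add: peval_eq_lin_ext lin_ext_add)
lemma peval_mult [simp]: "peval a (p * q) = peval a p * peval a q"
  by (simp add: peval_eq_lin_ext lin_ext_mult mon_add)
lemma peval_diff [simp]: "peval a (p - q) = peval a p - peval a q"
  by (rule additive_minus) simp
lemma peval_sum [simp]: "peval a (sum g S) = (\<Sum>x\<in>S. peval a (g x))"
  by (rule additive_sum) simp_all
lemma peval_prod [simp]: "peval a (prod g S) = (\<Prod>x\<in>S. peval a (g x))"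
  by (rule multiplicative_prod) simp_all
lemma peval_power [simp]: "peval a (p ^ n) = peval a p ^ n"
  by (induction n) simp_all
lemma peval_of_int [simp]: "peval a (of_int n) = of_int n"
  using peval_Const[of a "of_int n"] by (simp del: peval_single)
lemma peval_Var [simp]: "peval a (Var v) = a v"
  by (simp add: Var_def)

lemma subst_single: "subst a (Poly_Mapping.single t x) = Const x * mon a t"
  by (simp add: subst_def lin_ext_single)
lemma subst_Const [simp]: "subst a (Const x) = Const x" by (simp add: subst_single)
lemma subst_0 [simp]: "subst a 0 = 0" by (simp add: subst_def lin_ext_zero)
lemma subst_1 [simp]: "subst a 1 = 1"
  using subst_Const[of a 1] by simp
lemma subst_add [simp]: "subst a (p + q) = subst a p + subst a q"
  by (simp add: subst_def lin_ext_add)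
lemma subst_mult [simp]: "subst a (p * q) = subst a p * subst a q"
  by (simp add: subst_def lin_ext_mult mon_add)
lemma subst_diff [simp]: "subst a (p - q) = subst a p - subst a q"
  by (rule additive_minus) simp
lemma subst_sum [simp]: "subst a (sum g S) = (\<Sum>x\<in>S. subst a (g x))"
  by (rule additive_sum) simp_all
lemma subst_prod [simp]: "subst a (prod g S) = (\<Prod>x\<in>S. subst a (g x))"
  by (rule multiplicative_prod) simp_all
lemma subst_power [simp]: "subst a (p ^ n) = subst a p ^ n"
  by (induction n) simp_all
lemma subst_Var [simp]: "subst a (Var v) = a v"
  by (simp add: Var_def subst_single)

lemma Var_power: "Var v ^ n = Poly_Mapping.single (Poly_Mapping.single v n) 1"
  by (induction n) (simp_all add: Var_def mult_single single_add[symmetric])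

lemma mon_Var: "mon Var t = Poly_Mapping.single t 1"
proof -
  have "(\<Prod>v\<in>S. Poly_Mapping.single (Poly_Mapping.single v (Poly_Mapping.lookup t v)) (1::'k::comm_ring_1))
     = Poly_Mapping.single (\<Sum>v\<in>S. Poly_Mapping.single v (Poly_Mapping.lookup t v)) 1" for S
    by (induction S rule: infinite_finite_induct) (simp_all add: mult_single)
  moreover have "(\<Sum>v\<in>Poly_Mapping.keys t. Poly_Mapping.single v (Poly_Mapping.lookup t v)) = t"
    by (rule poly_mapping_eqI) (auto simp: lookup_sum lookup_single when_def sum.delta in_keys_iff)
  ultimately show ?thesis unfolding mon_def Var_power by metis
qed

lemma single_eq_mon: "Poly_Mapping.single t c = Const c * mon Var t"
  by (simp add: mon_Var mult_single)

lemma mpoly_ring_induct [case_names Const Var add mult]: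
  fixes p :: "('i, 'k::comm_ring_1) mpoly"
  assumes C: "\<And>c. P (Const c)" and V: "\<And>v. P (Var v)"
    and A: "\<And>p q. P p \<Longrightarrow> P q \<Longrightarrow> P (p + q)" and M: "\<And>p q. P p \<Longrightarrow> P q \<Longrightarrow> P (p * q)"
  shows "P p"
proof (induction p rule: mpoly_induct)
  case (monom t c)
  have 1: "P 1" using C[of 1] by simp
  have pw: "P (Var v ^ n)" for v n by (induction n) (simp_all add: 1 M V)
  have "P (\<Prod>v\<in>S. Var v ^ Poly_Mapping.lookup t v)" for S
    by (induction S rule: infinite_finite_induct) (simp_all add: 1 M pw)
  then have "P (Const c * mon Var t)" unfolding mon_def by (intro M C)
  then show ?case by (simp only: single_eq_mon[of t c, symmetric])
qed (rule A)

lemma subst_Var_id [simp]: "subst Var p = p"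
  by (induction p rule: mpoly_ring_induct) simp_all

section \<open>Gradings\<close>

definition additive_wt :: "(('i \<Rightarrow>\<^sub>0 nat) \<Rightarrow> 'w::cancel_comm_monoid_add) \<Rightarrow> bool" where
  "additive_wt wt \<longleftrightarrow> (\<forall>s t. wt (s + t) = wt s + wt t)"

lemma additive_wt_0: "additive_wt wt \<Longrightarrow> wt 0 = 0"
  unfolding additive_wt_def by (metis add_cancel_right_right)

text \<open>
  One notion of homogeneity serves both gradings: the weight of a monomial is its degree or its
  bidegree.
\<close>

definition whom :: "(('i \<Rightarrow>\<^sub>0 nat) \<Rightarrow> 'w) \<Rightarrow> 'w \<Rightarrow> ('i, 'k::zero) mpoly set" where
  "whom wt d = {p. \<forall>t\<in>Poly_Mapping.keys p. wt t = d}"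

lemma whom_iff: "p \<in> whom wt d \<longleftrightarrow> (\<forall>t. Poly_Mapping.lookup p t \<noteq> 0 \<longrightarrow> wt t = d)"
  by (auto simp: whom_def in_keys_iff)

lemma whom_0 [simp]: "0 \<in> whom wt d"
  by (simp add: whom_def)

lemma whom_add: "p \<in> whom wt d \<Longrightarrow> q \<in> whom wt d \<Longrightarrow> p + q \<in> whom wt d"
  for p :: "('i, 'k::comm_ring_1) mpoly"
  by (auto simp: whom_iff lookup_add) (metis add_cancel_right_left)

lemma whom_uminus: "p \<in> whom wt d \<Longrightarrow> - p \<in> whom wt d"
  for p :: "('i, 'k::comm_ring_1) mpoly"
  by (auto simp: whom_iff)

lemma whom_diff: "p \<in> whom wt d \<Longrightarrow> q \<in> whom wt d \<Longrightarrow> p - q \<in> whom wt d"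
  for p :: "('i, 'k::comm_ring_1) mpoly"
  using whom_add[of p wt d "- q"] by (simp add: whom_uminus)

lemma whom_sum: "(\<And>x. x \<in> S \<Longrightarrow> f x \<in> whom wt d) \<Longrightarrow> sum f S \<in> whom wt d"
  for f :: "_ \<Rightarrow> ('i, 'k::comm_ring_1) mpoly"
  by (induction S rule: infinite_finite_induct) (simp_all add: whom_add)

lemma whom_single: "wt t = d \<Longrightarrow> Poly_Mapping.single t c \<in> whom wt d"
  by (simp add: whom_def)

lemma whom_mult:
  fixes p q :: "('i, 'k::comm_ring_1) mpoly"
  assumes "additive_wt wt" "p \<in> whom wt d" "q \<in> whom wt e"
  shows "p * q \<in> whom wt (d + e)"
proof -
  have "wt t = d + e" if "t \<in> Poly_Mapping.keys (p * q)" for t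
  proof -
    from that obtain a b where "t = a + b" "a \<in> Poly_Mapping.keys p" "b \<in> Poly_Mapping.keys q"
      using keys_mult by blast
    then show ?thesis using assms by (auto simp: whom_def additive_wt_def)
  qed
  then show ?thesis by (simp add: whom_def)
qed

lemma whom_Const: "additive_wt wt \<Longrightarrow> Const c \<in> whom wt 0"
  by (simp add: whom_single additive_wt_0)

lemma whom_one: "additive_wt wt \<Longrightarrow> (1 :: ('i, 'k::comm_ring_1) mpoly) \<in> whom wt 0"
  using whom_Const[of wt "1::'k"] by simp

lemma whom_scale: "additive_wt wt \<Longrightarrow> p \<in> whom wt d \<Longrightarrow> Const c * p \<in> whom wt d"
  for p :: "('i, 'k::comm_ring_1) mpoly"
  using whom_mult[of wt "Const c" 0 p d] by (simp add: whom_Const)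

lemma whom_prod:
  fixes f :: "_ \<Rightarrow> ('i, 'k::comm_ring_1) mpoly"
  assumes "additive_wt wt" "\<And>x. x \<in> S \<Longrightarrow> f x \<in> whom wt (d x)"
  shows "prod f S \<in> whom wt (sum d S)"
  using assms(2)
  by (induction S rule: infinite_finite_induct) (simp_all add: whom_one whom_mult assms(1))

definition pcomp :: "(('i \<Rightarrow>\<^sub>0 nat) \<Rightarrow> 'w) \<Rightarrow> 'w \<Rightarrow> ('i, 'k::zero) mpoly \<Rightarrow> ('i, 'k) mpoly" where
  "pcomp wt d p = Poly_Mapping.mapp (\<lambda>t c. if wt t = d then c else 0) p"

lemma lookup_pcomp:
  "Poly_Mapping.lookup (pcomp wt d p) t = (if wt t = d then Poly_Mapping.lookup p t else 0)"
  by (simp add: pcomp_def lookup_mapp when_def in_keys_iff)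

lemma pcomp_in_whom [simp]: "pcomp wt d p \<in> whom wt d"
  by (simp add: whom_iff lookup_pcomp)

lemma pcomp_add [simp]: "pcomp wt d (p + q) = pcomp wt d p + pcomp wt d q"
  for p :: "('i, 'k::comm_ring_1) mpoly"
  by (rule poly_mapping_eqI) (simp add: lookup_pcomp lookup_add)

lemma pcomp_0 [simp]: "pcomp wt d 0 = 0"
  by (rule poly_mapping_eqI) (simp add: lookup_pcomp)

lemma pcomp_uminus [simp]: "pcomp wt d (- p) = - pcomp wt d p"
  for p :: "('i, 'k::comm_ring_1) mpoly"
  by (rule poly_mapping_eqI) (simp add: lookup_pcomp)

lemma pcomp_sum [simp]: "pcomp wt d (sum f S) = (\<Sum>x\<in>S. pcomp wt d (f x))"
  for f :: "_ \<Rightarrow> ('i, 'k::comm_ring_1) mpoly"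
  by (rule additive_sum) simp_all

lemma pcomp_whom: "p \<in> whom wt d \<Longrightarrow> pcomp wt e p = (if e = d then p else 0)"
  by (rule poly_mapping_eqI) (auto simp: lookup_pcomp whom_iff)

lemma sum_pcomp:
  fixes p :: "('i, 'k::comm_ring_1) mpoly"
  shows "p = (\<Sum>d\<in>wt ` Poly_Mapping.keys p. pcomp wt d p)"
  by (rule poly_mapping_eqI) (auto simp: lookup_sum lookup_pcomp sum.delta in_keys_iff)

lemma pcomp_mult_whom:
  fixes p q :: "('i, 'k::comm_ring_1) mpoly"
  assumes wt: "additive_wt wt" and p: "p \<in> whom wt d"
  shows "pcomp wt (d + e) (p * q) = p * pcomp wt e q"
proof (induction q rule: mpoly_induct)
  case (monom t c)
  have "p * Poly_Mapping.single t c \<in> whom wt (d + wt t)"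
    by (intro whom_mult wt p whom_single refl)
  moreover have "Poly_Mapping.single t c \<in> whom wt (wt t)" by (simp add: whom_single)
  ultimately show ?case by (simp add: pcomp_whom)
qed (simp add: distrib_left)

lemma pcomp_mult_whom_0:
  fixes p q :: "('i, 'k::comm_ring_1) mpoly"
  assumes wt: "additive_wt wt" and p: "p \<in> whom wt d" and "\<And>e. f \<noteq> d + e"
  shows "pcomp wt f (p * q) = 0"
proof (induction q rule: mpoly_induct)
  case (monom t c)
  have "p * Poly_Mapping.single t c \<in> whom wt (d + wt t)"
    by (intro whom_mult wt p whom_single refl)
  then show ?case using assms(3) by (simp add: pcomp_whom)
qed (simp add: distrib_left)

definition tdeg :: "('i::finite \<Rightarrow>\<^sub>0 nat) \<Rightarrow> nat" where
  "tdeg t = (\<Sum>v\<in>UNIV. Poly_Mapping.lookup t v)"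

definition bideg :: "(('a::finite + 'b::finite) \<Rightarrow>\<^sub>0 nat) \<Rightarrow> nat \<times> nat" where
  "bideg t = (\<Sum>v\<in>UNIV. Poly_Mapping.lookup t (Inl v), \<Sum>v\<in>UNIV. Poly_Mapping.lookup t (Inr v))"

lemma additive_tdeg [simp]: "additive_wt tdeg"
  by (simp add: additive_wt_def tdeg_def lookup_add sum.distrib)

lemma additive_bideg [simp]: "additive_wt bideg"
  by (simp add: additive_wt_def bideg_def lookup_add sum.distrib)

lemma hom_comp_whom: "hom_comp d = whom tdeg d"
  by (simp add: hom_comp_def whom_def tdeg_def)

lemma bihom_comp_whom: "bihom_comp i j = whom bideg (i, j)"
  by (simp add: bihom_comp_def whom_def bideg_def)

lemma tdeg_single [simp]: "tdeg (Poly_Mapping.single v n) = n"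
  by (simp add: tdeg_def lookup_single when_def)

lemma bideg_single_Inl [simp]: "bideg (Poly_Mapping.single (Inl v) n) = (n, 0)"
  by (simp add: bideg_def lookup_single when_def)

lemma bideg_single_Inr [simp]: "bideg (Poly_Mapping.single (Inr v) n) = (0, n)"
  by (simp add: bideg_def lookup_single when_def)

lemma tdeg_0 [simp]: "tdeg 0 = 0"
  by (simp add: tdeg_def)

lemma bideg_0 [simp]: "bideg 0 = (0, 0)"
  by (simp add: bideg_def)

lemma tdeg_add: "tdeg (s + t) = tdeg s + tdeg t"
  using additive_tdeg unfolding additive_wt_def by blast

lemma Var_hom: "Var v \<in> hom_comp 1"
  by (simp add: hom_comp_whom Var_def whom_single)

lemma mon_scale:
  fixes a :: "'i::finite \<Rightarrow> 'k::comm_ring_1"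
  shows "mon (\<lambda>v. c * a v) t = c ^ tdeg t * mon a t"
  by (simp add: mon_UNIV tdeg_def power_mult_distrib prod.distrib power_sum)

lemma peval_scale_hom:
  assumes "p \<in> hom_comp d"
  shows "peval (\<lambda>v. c * a v) p = c ^ d * peval a p"
  using assms unfolding peval_eq_lin_ext lin_ext_def mon_scale sum_distrib_left hom_comp_whom
  by (intro sum.cong) (auto simp: whom_def)

lemma prod_UNIV_sum:
  "(\<Prod>v\<in>(UNIV :: ('a::finite + 'b::finite) set). f v)
     = (\<Prod>v\<in>UNIV. f (Inl v)) * (\<Prod>v\<in>UNIV. f (Inr v))"
  by (subst UNIV_Plus_UNIV[symmetric], subst prod.Plus) (simp_all add: comp_def)

lemma mon_case_sum_scale:
  fixes a :: "'i::finite \<Rightarrow> 'k::comm_ring_1" and b :: "'j::finite \<Rightarrow> 'k"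
  shows "mon (case_sum (\<lambda>v. c * a v) (\<lambda>v. c' * b v)) t
     = c ^ fst (bideg t) * c' ^ snd (bideg t) * mon (case_sum a b) t"
  by (simp add: mon_UNIV bideg_def power_mult_distrib prod.distrib power_sum prod_UNIV_sum)

lemma peval_scale_bihom:
  assumes "p \<in> bihom_comp i j"
  shows "peval (case_sum (\<lambda>v. c * a v) (\<lambda>v. c' * b v)) p = c ^ i * c' ^ j * peval (case_sum a b) p"
  using assms unfolding peval_eq_lin_ext lin_ext_def mon_case_sum_scale sum_distrib_left bihom_comp_whom
  by (intro sum.cong) (auto simp: whom_def)

lemma lookup_mult_single:
  fixes p :: "('i, 'k::comm_ring_1) mpoly"
  shows "Poly_Mapping.lookup (Poly_Mapping.single s c * p) (s + t) = c * Poly_Mapping.lookup p t"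
  by (induction p rule: mpoly_induct)
    (auto simp: mult_single lookup_single when_def distrib_left lookup_add)

lemma mult_single_cancel:
  fixes p :: "('i, 'k::comm_ring_1) mpoly"
  assumes "Poly_Mapping.single s 1 * p = Poly_Mapping.single s 1 * q"
  shows "p = q"
  by (rule poly_mapping_eqI) (metis assms lookup_mult_single mult_1)

section \<open>Ideals\<close>

interpretation ideal: module "(*) :: 'a::comm_ring_1 \<Rightarrow> 'a \<Rightarrow> 'a"
  by (rule module_ring_mult)

definition is_ideal :: "'a::comm_ring_1 set \<Rightarrow> bool" where
  "is_ideal J \<longleftrightarrow> 0 \<in> J \<and> (\<forall>a\<in>J. \<forall>b\<in>J. a + b \<in> J) \<and> (\<forall>a\<in>J. \<forall>c. c * a \<in> J)"

lemma is_idealI: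
  assumes "0 \<in> J" "\<And>a b. a \<in> J \<Longrightarrow> b \<in> J \<Longrightarrow> a + b \<in> J" "\<And>a c. a \<in> J \<Longrightarrow> c * a \<in> J"
  shows "is_ideal J"
  using assms by (simp add: is_ideal_def)

lemma is_ideal_subspace: "is_ideal J \<longleftrightarrow> ideal.subspace J"
  by (auto simp: is_ideal_def ideal.subspace_def)

lemma is_ideal_gen [simp]: "is_ideal (ideal_gen B)"
  by (simp add: is_ideal_subspace ideal_gen_def)

lemma ideal_zero: "is_ideal J \<Longrightarrow> 0 \<in> J" by (simp add: is_ideal_def)
lemma ideal_add: "is_ideal J \<Longrightarrow> a \<in> J \<Longrightarrow> b \<in> J \<Longrightarrow> a + b \<in> J" by (simp add: is_ideal_def)
lemma ideal_mult: "is_ideal J \<Longrightarrow> a \<in> J \<Longrightarrow> c * a \<in> J" by (simp add: is_ideal_def)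
lemma ideal_mult_right: "is_ideal J \<Longrightarrow> a \<in> J \<Longrightarrow> a * c \<in> J" by (metis ideal_mult mult.commute)
lemma ideal_uminus: "is_ideal J \<Longrightarrow> a \<in> J \<Longrightarrow> - a \<in> J" by (metis ideal_mult mult_minus1)
lemma ideal_diff: "is_ideal J \<Longrightarrow> a \<in> J \<Longrightarrow> b \<in> J \<Longrightarrow> a - b \<in> J"
  using ideal_add[of J a "- b"] by (simp add: ideal_uminus)
lemma ideal_sum: "is_ideal J \<Longrightarrow> (\<And>x. x \<in> S \<Longrightarrow> f x \<in> J) \<Longrightarrow> sum f S \<in> J"
  by (induction S rule: infinite_finite_induct) (simp_all add: ideal_zero ideal_add)

lemma ideal_gen_superset: "a \<in> B \<Longrightarrow> a \<in> ideal_gen B"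
  by (simp add: ideal_gen_def ideal.span_base)

lemma ideal_gen_least: "is_ideal J \<Longrightarrow> B \<subseteq> J \<Longrightarrow> ideal_gen B \<subseteq> J"
  by (simp add: ideal_gen_def is_ideal_subspace ideal.span_minimal)

lemma ideal_gen_mono: "B \<subseteq> C \<Longrightarrow> ideal_gen B \<subseteq> ideal_gen C"
  by (simp add: ideal_gen_def ideal.span_mono)

lemma ideal_gen_ideal: "is_ideal J \<Longrightarrow> ideal_gen J = J"
  by (simp add: ideal_gen_def is_ideal_subspace)

lemma ideal_gen_Un_idem: "ideal_gen (ideal_gen B \<union> C) = ideal_gen (B \<union> C)"
proof (rule antisym; rule ideal_gen_least)
  show "ideal_gen B \<union> C \<subseteq> ideal_gen (B \<union> C)"
    using ideal_gen_mono[of B "B \<union> C"] ideal_gen_superset[of _ "B \<union> C"] by auto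
  show "B \<union> C \<subseteq> ideal_gen (ideal_gen B \<union> C)"
    using ideal_gen_superset[of _ "ideal_gen B \<union> C"] ideal_gen_superset[of _ B] by auto
qed simp_all

lemma ideal_gen_insert:
  assumes "x \<in> ideal_gen (insert f B)"
  obtains g where "x - g * f \<in> ideal_gen B"
proof -
  let ?J = "{x. \<exists>g. x - g * f \<in> ideal_gen B}"
  have "is_ideal ?J"
    unfolding is_ideal_def
  proof (intro conjI ballI allI)
    have "0 - 0 * f \<in> ideal_gen B" by (simp add: ideal_zero)
    then show "0 \<in> ?J" by blast
  next
    fix a b assume "a \<in> ?J" "b \<in> ?J"
    then obtain g h where gh: "a - g * f \<in> ideal_gen B" "b - h * f \<in> ideal_gen B" by blast
    have "(a + b) - (g + h) * f = (a - g * f) + (b - h * f)" by (simp add: algebra_simps)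
    then have "(a + b) - (g + h) * f \<in> ideal_gen B"
      using ideal_add[OF is_ideal_gen gh] by (simp only:)
    then show "a + b \<in> ?J" by blast
  next
    fix a c assume "a \<in> ?J"
    then obtain g where g: "a - g * f \<in> ideal_gen B" by auto
    have "c * a - (c * g) * f = c * (a - g * f)" by (simp only: right_diff_distrib mult.assoc)
    then have "c * a - (c * g) * f \<in> ideal_gen B"
      using ideal_mult[OF is_ideal_gen g, of c] by (simp only:)
    then show "c * a \<in> ?J" by blast
  qed
  moreover have "insert f B \<subseteq> ?J"
  proof
    fix b assume b: "b \<in> insert f B"
    show "b \<in> ?J"
    proof (cases "b = f")
      case True
      then have "b - 1 * f \<in> ideal_gen B" by (simp add: ideal_zero)
      then show ?thesis by blast
    next
      case False
      with b have "b - 0 * f \<in> ideal_gen B" by (simp add: ideal_gen_superset)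
      then show ?thesis by blast
    qed
  qed
  ultimately have "ideal_gen (insert f B) \<subseteq> ?J" by (rule ideal_gen_least)
  then show thesis using assms that by blast
qed

lemma ideal_gen_image:
  assumes "finite S"
  shows "x \<in> ideal_gen (f ` S) \<longleftrightarrow> (\<exists>g. x = (\<Sum>i\<in>S. g i * f i))"
proof
  assume "x \<in> ideal_gen (f ` S)"
  with assms show "\<exists>g. x = (\<Sum>i\<in>S. g i * f i)"
  proof (induction S arbitrary: x)
    case empty
    then have "x = 0" by (simp add: ideal_gen_def)
    then show ?case by simp
  next
    case (insert i S)
    from insert.prems obtain h where "x - h * f i \<in> ideal_gen (f ` S)"
      by (auto elim: ideal_gen_insert)
    with insert.IH obtain g where g: "x - h * f i = (\<Sum>j\<in>S. g j * f j)" by blast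
    have "(\<Sum>j\<in>S. (g(i := h)) j * f j) = (\<Sum>j\<in>S. g j * f j)"
      using insert.hyps by (intro sum.cong) auto
    then have "x = (\<Sum>j\<in>insert i S. (g(i := h)) j * f j)"
      using insert.hyps g by (simp add: diff_eq_eq algebra_simps)
    then show ?case by blast
  qed
next
  assume "\<exists>g. x = (\<Sum>i\<in>S. g i * f i)"
  then obtain g where g: "x = (\<Sum>i\<in>S. g i * f i)" by (elim exE)
  show "x \<in> ideal_gen (f ` S)"
    unfolding g by (intro ideal_sum ideal_mult is_ideal_gen ideal_gen_superset imageI)
qed

text \<open>
  Membership in a homogeneous ideal can be tested component by component: multiplying a
  generator by one monomial only shifts its degree.
\<close>

lemma ideal_gen_homogeneous:
  fixes B :: "('i, 'k::comm_ring_1) mpoly set"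
  assumes wt: "additive_wt wt" and B: "\<And>b. b \<in> B \<Longrightarrow> \<exists>d. b \<in> whom wt d" and x: "x \<in> ideal_gen B"
  shows "pcomp wt e x \<in> ideal_gen B"
proof -
  let ?J = "{x. \<forall>e. pcomp wt e x \<in> ideal_gen B}"
  have mono: "pcomp wt e (Poly_Mapping.single t c * a) \<in> ideal_gen B" if "a \<in> ?J" for t c a e
  proof (cases "\<exists>e'. e = wt t + e'")
    case True
    then obtain e' where "e = wt t + e'" by blast
    then show ?thesis
      using that pcomp_mult_whom[OF wt whom_single[OF refl], of t e' c a]
      by (simp add: ideal_mult)
  next
    case False
    then show ?thesis
      using pcomp_mult_whom_0[OF wt whom_single[OF refl], of e t c a] by (simp add: ideal_zero)
  qed
  have "is_ideal ?J"
    unfolding is_ideal_def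
  proof (intro conjI ballI allI)
    show "0 \<in> ?J" by (simp add: ideal_zero)
  next
    fix a b assume "a \<in> ?J" "b \<in> ?J"
    then show "a + b \<in> ?J" by (simp add: ideal_add)
  next
    fix a c assume a: "a \<in> ?J"
    show "c * a \<in> ?J"
      by (induction c rule: mpoly_induct)
        (use mono[OF a] in \<open>auto simp: distrib_right ideal_add\<close>)
  qed
  moreover have "B \<subseteq> ?J"
  proof
    fix b assume "b \<in> B"
    moreover from this obtain d where "b \<in> whom wt d" using B by blast
    ultimately show "b \<in> ?J" by (auto simp: pcomp_whom ideal_gen_superset ideal_zero)
  qed
  ultimately have "ideal_gen B \<subseteq> ?J" by (rule ideal_gen_least)
  with x show ?thesis by auto
qed

lemma ideal_gen_subst:
  assumes "x \<in> ideal_gen B"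
  shows "subst a x \<in> ideal_gen (subst a ` B)"
proof -
  have "is_ideal {x. subst a x \<in> ideal_gen (subst a ` B)}"
    by (rule is_idealI) (simp_all add: ideal_zero ideal_add ideal_mult)
  moreover have "B \<subseteq> {x. subst a x \<in> ideal_gen (subst a ` B)}"
    by (auto intro: ideal_gen_superset)
  ultimately have "ideal_gen B \<subseteq> {x. subst a x \<in> ideal_gen (subst a ` B)}" by (rule ideal_gen_least)
  with assms show ?thesis by auto
qed

lemma ideal_gen_insert_zero: "ideal_gen (insert 0 B) = ideal_gen B"
  by (rule antisym; rule ideal_gen_least) (auto intro: ideal_gen_superset ideal_zero)

section \<open>Cramer rules for the first and second adjugates\<close>

definition repl_col :: "'r^'n^'n \<Rightarrow> 'n \<Rightarrow> ('n \<Rightarrow> 'r) \<Rightarrow> 'r::comm_ring_1^'n^'n" where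
  "repl_col a j u = (\<chi> i l. if l = j then u i else a $ i $ l)"

definition repl_row :: "'r^'n^'n \<Rightarrow> 'n \<Rightarrow> ('n \<Rightarrow> 'r) \<Rightarrow> 'r::comm_ring_1^'n^'n" where
  "repl_row a k u = (\<chi> i l. if i = k then u l else a $ i $ l)"

definition unit_fun :: "'n \<Rightarrow> 'n \<Rightarrow> 'r::comm_ring_1" where
  "unit_fun k = (\<lambda>i. if i = k then 1 else 0)"

lemma det_repl_row_sum:
  fixes a :: "'r::comm_ring_1^'n^'n"
  assumes "finite S"
  shows "det (repl_row a k (\<lambda>l. \<Sum>s\<in>S. c s * u s l)) = (\<Sum>s\<in>S. c s * det (repl_row a k (u s)))"
proof -
  have "repl_row a k (\<lambda>l. \<Sum>s\<in>S. c s * u s l)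
      = (\<chi> i. if i = k then sum (\<lambda>s. c s *s (\<chi> l. u s l)) S else a $ i)"
    by (simp add: repl_row_def vec_eq_iff sum_component)
  moreover have "repl_row a k (u s) = (\<chi> i. if i = k then (\<chi> l. u s l) else a $ i)" for s
    by (simp add: repl_row_def vec_eq_iff)
  ultimately show ?thesis
    using det_linear_row_sum[OF assms, of k "\<lambda>i s. c s *s (\<chi> l. u s l)" "\<lambda>i. a $ i"]
    by (simp add: det_row_mul)
qed

lemma repl_col_transpose: "repl_col a j u = transpose (repl_row (transpose a) j u)"
  by (simp add: repl_col_def repl_row_def transpose_def vec_eq_iff)

lemma repl_row_transpose: "repl_row a j u = transpose (repl_col (transpose a) j u)"
  by (simp add: repl_col_def repl_row_def transpose_def vec_eq_iff)

lemma det_repl_col_sum: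
  fixes a :: "'r::comm_ring_1^'n^'n"
  assumes "finite S"
  shows "det (repl_col a j (\<lambda>i. \<Sum>s\<in>S. c s * u s i)) = (\<Sum>s\<in>S. c s * det (repl_col a j (u s)))"
  by (simp only: repl_col_transpose det_transpose det_repl_row_sum[OF assms])

lemma repl_col_self: "repl_col a j (\<lambda>i. a $ i $ j) = a"
  by (simp add: repl_col_def vec_eq_iff)

lemma det_repl_col_other:
  assumes "l \<noteq> j"
  shows "det (repl_col a j (\<lambda>i. a $ i $ l)) = 0"
  by (rule det_identical_columns[OF assms]) (simp add: repl_col_def column_def vec_eq_iff)

lemma unit_fun_expand: "f (i :: 'n::finite) = (\<Sum>k\<in>UNIV. f k * unit_fun k i)"
proof -
  have "(\<Sum>k\<in>UNIV. f k * unit_fun k i) = (\<Sum>k\<in>UNIV. if k = i then f k else 0)"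
    by (rule sum.cong) (auto simp: unit_fun_def)
  then show ?thesis by simp
qed

lemma det_repl_col_swap:
  fixes a :: "'r::comm_ring_1^'n^'n"
  assumes "j \<noteq> l"
  shows "det (repl_col (repl_col a l u) j v) = - det (repl_col (repl_col a l v) j u)"
proof -
  let ?p = "Transposition.transpose j l"
  let ?A = "repl_col (repl_col a l v) j u"
  have p: "?p permutes UNIV" by (simp add: permutes_swap_id)
  have "det (\<chi> i k. ?A $ i $ ?p k) = of_int (sign ?p) * det ?A"
    by (rule det_permute_columns[OF p])
  moreover have "(\<chi> i k. ?A $ i $ ?p k) = repl_col (repl_col (\<chi> i k. a $ i $ k) l u) j v"
    using assms by (auto simp: repl_col_def vec_eq_iff Transposition.transpose_def)
  moreover have "(\<chi> i k. a $ i $ k) = a" by (simp add: vec_eq_iff)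
  ultimately show ?thesis using assms by (simp add: sign_swap_id)
qed

text \<open>
  The entry \<open>(j, k)\<close> of the adjugate matrix, and below its second-order analogue,
  are written as determinants of matrices with unit columns, so that all identities follow from
  multilinearity and alternation in the columns.
\<close>

definition adjg :: "'r^'n^'n \<Rightarrow> 'n \<Rightarrow> 'n \<Rightarrow> 'r::comm_ring_1" where
  "adjg a j k = det (repl_col a j (unit_fun k))"

lemma det_repl_col_adjg: "det (repl_col a j F) = (\<Sum>k\<in>UNIV. F k * adjg a j k)"
proof -
  have "det (repl_col a j F) = det (repl_col a j (\<lambda>i. \<Sum>k\<in>UNIV. F k * unit_fun k i))"
    by (rule arg_cong[of F _ "\<lambda>f. det (repl_col a j f)"], rule ext, rule unit_fun_expand)
  then show ?thesis by (simp only: det_repl_col_sum[OF finite] adjg_def)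
qed

lemma det_repl_col_comb:
  assumes "\<And>i. F i = (\<Sum>l\<in>UNIV. a $ i $ l * x l)"
  shows "det (repl_col b j F) = (\<Sum>l\<in>UNIV. x l * det (repl_col b j (\<lambda>i. a $ i $ l)))"
proof -
  have "F = (\<lambda>i. \<Sum>l\<in>UNIV. x l * a $ i $ l)" by (simp add: assms mult.commute fun_eq_iff)
  then show ?thesis by (simp only: det_repl_col_sum[OF finite])
qed

text \<open>
  By linearity, putting \<open>F = a * x\<close> into column \<open>j\<close> splits the
  determinant over the columns of \<open>a\<close>; a column other than the \<open>j\<close>-th
  then occurs twice.
\<close>

lemma cramer_adjg:
  fixes a :: "'r::comm_ring_1^'n^'n"
  assumes F: "\<And>i. F i = (\<Sum>l\<in>UNIV. a $ i $ l * x l)"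
  shows "x j * det a = (\<Sum>k\<in>UNIV. F k * adjg a j k)"
proof -
  have "(\<Sum>l\<in>UNIV. x l * det (repl_col a j (\<lambda>i. a $ i $ l)))
      = (\<Sum>l\<in>UNIV. if l = j then x l * det a else 0)"
    by (rule sum.cong) (auto simp: repl_col_self det_repl_col_other)
  then show ?thesis
    using det_repl_col_adjg[of a j F] det_repl_col_comb[OF F, of a j] by simp
qed

text \<open>
  Column \<open>j\<close> is the \<open>k\<close>-th unit vector, so multiples of it can be
  added to the other columns until row \<open>k\<close> becomes a unit vector too.
\<close>

lemma cofactor_col_row:
  fixes a :: "'r::comm_ring_1^'n^'n"
  shows "det (repl_col a j (unit_fun k)) = det (repl_row (repl_col a j (unit_fun k)) k (unit_fun j))"
proof -
  let ?M = "repl_col a j (unit_fun k)"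
  have "?M = repl_row ?M k (\<lambda>l. \<Sum>s\<in>UNIV. ?M $ k $ s * unit_fun s l)"
    by (subst unit_fun_expand[symmetric]) (simp add: repl_row_def vec_eq_iff)
  then have "det ?M = det (repl_row ?M k (\<lambda>l. \<Sum>s\<in>UNIV. ?M $ k $ s * unit_fun s l))"
    by (rule arg_cong)
  also have "\<dots> = (\<Sum>s\<in>UNIV. ?M $ k $ s * det (repl_row ?M k (unit_fun s)))"
    by (rule det_repl_row_sum[OF finite])
  also have "\<dots> = (\<Sum>s\<in>UNIV. if s = j then det (repl_row ?M k (unit_fun j)) else 0)"
  proof (rule sum.cong)
    fix s :: 'n
    show "?M $ k $ s * det (repl_row ?M k (unit_fun s))
        = (if s = j then det (repl_row ?M k (unit_fun j)) else 0)"
    proof (cases "s = j")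
      case True then show ?thesis by (simp add: repl_col_def unit_fun_def)
    next
      case False
      have "transpose (repl_row ?M k (unit_fun s))
          = (\<chi> i. if i = j then 0 else transpose (repl_row ?M k (unit_fun s)) $ i)"
        using False by (auto simp: repl_row_def repl_col_def transpose_def vec_eq_iff unit_fun_def)
      then have "det (transpose (repl_row ?M k (unit_fun s))) = 0"
        by (metis det_row_0)
      then show ?thesis using False by simp
    qed
  qed simp
  finally show ?thesis by simp
qed

lemma adjg_row: "adjg a j k = det (repl_row a k (unit_fun j))"
proof -
  have "repl_row (repl_col a j (unit_fun k)) k (unit_fun j)
      = transpose (repl_row (repl_col (transpose a) k (unit_fun j)) j (unit_fun k))"
    by (auto simp: repl_row_def repl_col_def transpose_def vec_eq_iff unit_fun_def)
  then have "adjg a j k = det (repl_col (transpose a) k (unit_fun j))"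
    unfolding adjg_def using cofactor_col_row[of a j k] cofactor_col_row[of "transpose a" k j] by simp
  then show ?thesis by (simp add: repl_row_transpose)
qed

lemma laplace_adjg:
  fixes a :: "'r::comm_ring_1^'n^'n"
  shows "(\<Sum>j\<in>UNIV. a $ i $ j * adjg a j k) = (if i = k then det a else 0)"
proof -
  have "det (repl_row a k (\<lambda>l. a $ i $ l)) = det (repl_row a k (\<lambda>l. \<Sum>j\<in>UNIV. a $ i $ j * unit_fun j l))"
    by (subst unit_fun_expand[symmetric]) simp
  then have "(\<Sum>j\<in>UNIV. a $ i $ j * adjg a j k) = det (repl_row a k (\<lambda>l. a $ i $ l))"
    by (simp only: adjg_row det_repl_row_sum[OF finite])
  moreover have "repl_row a i (\<lambda>l. a $ i $ l) = a" by (simp add: repl_row_def vec_eq_iff)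
  moreover have "det (repl_row a k (\<lambda>l. a $ i $ l)) = 0" if "i \<noteq> k"
    by (rule det_identical_rows[OF that]) (use that in \<open>simp add: repl_row_def row_def vec_eq_iff\<close>)
  ultimately show ?thesis by auto
qed

definition adjg2 :: "'r^'n^'n \<Rightarrow> 'n \<Rightarrow> 'n \<Rightarrow> 'n \<Rightarrow> 'n \<Rightarrow> 'r::comm_ring_1" where
  "adjg2 a j l k m = det (repl_col (repl_col a l (unit_fun k)) j (unit_fun m))"

lemma adjg2_swap: "j \<noteq> l \<Longrightarrow> adjg2 a j l m k = - adjg2 a j l k m"
  unfolding adjg2_def by (rule det_repl_col_swap)

lemma adjg2_same: "j \<noteq> l \<Longrightarrow> adjg2 a j l k k = 0"
  unfolding adjg2_def
  by (rule det_identical_columns[of j l]) (auto simp: repl_col_def column_def vec_eq_iff)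

text \<open>
  Cramer's rule for the matrix whose column \<open>l\<close> is the \<open>k\<close>-th unit
  vector: if \<open>F = a * x\<close> is put into its column \<open>j\<close>, only the columns
  \<open>j\<close> and \<open>l\<close> of \<open>a\<close> contribute, as all others occur
  twice.
\<close>

lemma cramer_adjg2:
  fixes a :: "'r::comm_ring_1^'n^'n"
  assumes F: "\<And>i. F i = (\<Sum>l\<in>UNIV. a $ i $ l * x l)" and jl: "j \<noteq> l"
  shows "x j * adjg a l k - x l * adjg a j k = (\<Sum>m\<in>UNIV. F m * adjg2 a j l k m)"
proof -
  let ?N = "repl_col a l (unit_fun k)"
  let ?d = "\<lambda>s. det (repl_col ?N j (\<lambda>i. a $ i $ s))"
  have dj: "?d j = adjg a l k"
  proof -
    have "repl_col ?N j (\<lambda>i. a $ i $ j) = ?N" using jl by (auto simp: repl_col_def vec_eq_iff)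
    then show ?thesis by (simp add: adjg_def)
  qed
  have dl: "?d l = - adjg a j k"
    using det_repl_col_swap[OF jl, of a "unit_fun k" "\<lambda>i. a $ i $ l"]
    by (simp add: repl_col_self adjg_def)
  have d0: "?d s = 0" if "s \<noteq> j" "s \<noteq> l" for s
    by (rule det_identical_columns[OF that(1)])
      (use that in \<open>simp add: repl_col_def column_def vec_eq_iff\<close>)
  have "(\<Sum>m\<in>UNIV. F m * adjg2 a j l k m) = det (repl_col ?N j F)"
    by (simp only: adjg2_def det_repl_col_adjg[of ?N j F] adjg_def)
  also have "\<dots> = (\<Sum>s\<in>UNIV. x s * ?d s)"
    by (rule det_repl_col_comb[OF F])
  also have "\<dots> = (\<Sum>s\<in>{j, l}. x s * ?d s)"
    by (rule sum.mono_neutral_right) (auto simp: d0)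
  also have "\<dots> = x j * adjg a l k - x l * adjg a j k"
    using jl by (simp add: dj dl)
  finally show ?thesis by simp
qed

section \<open>Partial derivatives\<close>

lemma partial_deriv_lin_ext:
  "partial_deriv v = lin_ext Const
     (\<lambda>t. Poly_Mapping.single (t - Poly_Mapping.single v 1) (of_nat (Poly_Mapping.lookup t v)))"
  by (simp add: partial_deriv_def lin_ext_def fun_eq_iff mult_single mult.commute)

lemma partial_deriv_add [simp]: "partial_deriv v (p + q) = partial_deriv v p + partial_deriv v q"
  by (simp add: partial_deriv_lin_ext lin_ext_add)

lemma partial_deriv_0 [simp]: "partial_deriv v 0 = 0"
  by (simp add: partial_deriv_lin_ext lin_ext_zero)

lemma partial_deriv_single:
  "partial_deriv v (Poly_Mapping.single t c) =
     Poly_Mapping.single (t - Poly_Mapping.single v 1) (c * of_nat (Poly_Mapping.lookup t v))"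
  by (simp add: partial_deriv_lin_ext lin_ext_single mult_single)

lemma partial_deriv_sum [simp]: "partial_deriv v (sum f S) = (\<Sum>x\<in>S. partial_deriv v (f x))"
  by (rule additive_sum) simp_all

lemma partial_deriv_diff [simp]: "partial_deriv v (p - q) = partial_deriv v p - partial_deriv v q"
  by (rule additive_minus) simp

lemma partial_deriv_Const [simp]: "partial_deriv v (Const c) = 0"
  by (simp add: partial_deriv_single)

lemma partial_deriv_Var: "partial_deriv v (Var w) = (if v = w then 1 else 0)"
  by (auto simp: Var_def partial_deriv_single lookup_single when_def)

lemma exponent_diff_add:
  fixes s t :: "'i \<Rightarrow>\<^sub>0 nat"
  assumes "Poly_Mapping.lookup s v \<noteq> 0"
  shows "s + t - Poly_Mapping.single v 1 = (s - Poly_Mapping.single v 1) + t"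
  by (rule poly_mapping_eqI) (use assms in \<open>auto simp: lookup_add lookup_minus lookup_single when_def\<close>)

lemma partial_deriv_mult:
  "partial_deriv v (p * q) = partial_deriv v p * q + p * partial_deriv v q"
proof (induction p rule: mpoly_induct)
  case (monom s a)
  show ?case
  proof (induction q rule: mpoly_induct)
    case (monom t b)
    let ?s = "Poly_Mapping.lookup s v" and ?t = "Poly_Mapping.lookup t v"
    let ?e = "Poly_Mapping.single v (1::nat)"
    have 1: "Poly_Mapping.single (s + t - ?e) (a * b * of_nat ?s)
        = Poly_Mapping.single (s - ?e + t) (a * of_nat ?s * b)"
    proof (cases "?s = 0")
      case False
      have "a * b * of_nat ?s = a * of_nat ?s * b" by (simp only: ac_simps)
      then show ?thesis by (simp only: exponent_diff_add[OF False])
    qed simp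
    have 2: "Poly_Mapping.single (s + t - ?e) (a * b * of_nat ?t)
        = Poly_Mapping.single (s + (t - ?e)) (a * (b * of_nat ?t))"
    proof (cases "?t = 0")
      case False
      have "s + t - ?e = s + (t - ?e)"
        using exponent_diff_add[OF False, of s] by (simp only: add.commute)
      then show ?thesis by (simp only: mult.assoc)
    qed simp
    have "partial_deriv v (Poly_Mapping.single s a * Poly_Mapping.single t b)
        = Poly_Mapping.single (s + t - ?e) (a * b * of_nat ?s)
          + Poly_Mapping.single (s + t - ?e) (a * b * of_nat ?t)"
      by (simp only: mult_single partial_deriv_single lookup_add of_nat_add distrib_left single_add)
    also have "\<dots> = partial_deriv v (Poly_Mapping.single s a) * Poly_Mapping.single t b
        + Poly_Mapping.single s a * partial_deriv v (Poly_Mapping.single t b)"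
      by (simp only: 1 2 mult_single partial_deriv_single)
    finally show ?case .
  qed (simp add: distrib_left add.assoc add.left_commute)
qed (simp add: distrib_right add.assoc add.left_commute)

lemma partial_deriv_whom:
  assumes "p \<in> whom wt d" "additive_wt wt" "wt (Poly_Mapping.single v 1) + e = d"
  shows "partial_deriv v p \<in> whom wt e"
proof -
  have *: "partial_deriv v (Poly_Mapping.single t (Poly_Mapping.lookup p t)) \<in> whom wt e"
    if "t \<in> Poly_Mapping.keys p" for t
  proof (cases "Poly_Mapping.lookup t v = 0")
    case False
    have "t = Poly_Mapping.single v 1 + (t - Poly_Mapping.single v 1)"
      by (rule poly_mapping_eqI) (use False in \<open>auto simp: lookup_add lookup_minus lookup_single when_def\<close>)
    then have "wt t = wt (Poly_Mapping.single v 1) + wt (t - Poly_Mapping.single v 1)"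
      using assms(2) unfolding additive_wt_def by metis
    moreover have "wt t = d" using assms(1) that by (simp add: whom_def)
    ultimately have "wt (t - Poly_Mapping.single v 1) = e" using assms(3) by (metis add_left_cancel)
    then show ?thesis by (simp add: partial_deriv_single whom_single)
  qed (simp add: partial_deriv_single)
  have "partial_deriv v p = (\<Sum>t\<in>Poly_Mapping.keys p. partial_deriv v (Poly_Mapping.single t (Poly_Mapping.lookup p t)))"
    using arg_cong[OF mpoly_sum_monomials[of p], of "partial_deriv v"] by (simp only: partial_deriv_sum)
  also have "\<dots> \<in> whom wt e" by (rule whom_sum) (rule *)
  finally show ?thesis .
qed

lemma partial_deriv_whom_0:
  assumes "p \<in> whom wt d" "additive_wt wt" "\<And>e. wt (Poly_Mapping.single v 1) + e \<noteq> d"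
  shows "partial_deriv v p = 0"
proof -
  have *: "partial_deriv v (Poly_Mapping.single t (Poly_Mapping.lookup p t)) = 0"
    if "t \<in> Poly_Mapping.keys p" for t
  proof (cases "Poly_Mapping.lookup t v = 0")
    case False
    have "t = Poly_Mapping.single v 1 + (t - Poly_Mapping.single v 1)"
      by (rule poly_mapping_eqI) (use False in \<open>auto simp: lookup_add lookup_minus lookup_single when_def\<close>)
    then have "wt t = wt (Poly_Mapping.single v 1) + wt (t - Poly_Mapping.single v 1)"
      using assms(2) unfolding additive_wt_def by metis
    moreover have "wt t = d" using assms(1) that by (simp add: whom_def)
    ultimately show ?thesis using assms(3) by metis
  qed (simp add: partial_deriv_single)
  have "partial_deriv v p = (\<Sum>t\<in>Poly_Mapping.keys p. partial_deriv v (Poly_Mapping.single t (Poly_Mapping.lookup p t)))"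
    using arg_cong[OF mpoly_sum_monomials[of p], of "partial_deriv v"] by (simp only: partial_deriv_sum)
  also have "\<dots> = 0" by (rule sum.neutral) (use * in blast)
  finally show ?thesis .
qed

lemma peval_det: "peval a (det A) = det (\<chi> i j. peval a (A $ i $ j))"
  by (simp add: det_def)

section \<open>Divided differences\<close>

text \<open>
  Divided differences replace the variables one after another, so the index type needs an
  enumeration; any one will do.
\<close>

definition var_ix :: "'m::finite \<Rightarrow> nat" where
  "var_ix = (SOME f. bij_betw f UNIV {..<CARD('m)})"

lemma var_ix_bij: "bij_betw (var_ix :: 'm::finite \<Rightarrow> nat) UNIV {..<CARD('m)}"
proof -
  obtain h where "bij_betw h (UNIV :: 'm set) {0..<CARD('m)}"
    using ex_bij_betw_finite_nat[OF finite, of "UNIV :: 'm set"] by auto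
  then show ?thesis unfolding var_ix_def atLeast0LessThan
    by (rule someI[of "\<lambda>f. bij_betw f (UNIV :: 'm set) {..<CARD('m)}"])
qed

lemma var_ix_inj: "var_ix i = var_ix j \<longleftrightarrow> i = j"
  using var_ix_bij by (auto simp: bij_betw_def inj_on_def)

lemma var_ix_less: "var_ix (i :: 'm::finite) < CARD('m)"
  using var_ix_bij by (auto simp: bij_betw_def)

lemma var_ix_surj: "k < CARD('m::finite) \<Longrightarrow> \<exists>i :: 'm::finite. var_ix i = k"
  using var_ix_bij[where 'm = 'm] unfolding bij_betw_def by (metis imageE lessThan_iff)

text \<open>
  The substitution after \<open>k\<close> steps of the telescope: the first \<open>k\<close>
  variables \<open>X_l\<close> have been replaced by \<open>q_l * X_0\<close>, which makes all
  steps homogeneous.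
\<close>

definition stage ::
  "('m::finite option \<Rightarrow> 'k::comm_ring_1) \<Rightarrow> nat \<Rightarrow> 'm option \<Rightarrow> ('m option, 'k) mpoly" where
  "stage q k v = (case v of None \<Rightarrow> Var None
     | Some l \<Rightarrow> if var_ix l < k then Const (q (Some l)) * Var None else Var (Some l))"

definition xi :: "('m option \<Rightarrow> 'k::comm_ring_1) \<Rightarrow> 'm \<Rightarrow> ('m option, 'k) mpoly" where
  "xi q j = Var (Some j) - Const (q (Some j)) * Var None"

text \<open>
  The quotient \<open>(x^n - y^n) / (x - y)\<close>.
\<close>

primrec geo :: "'r::comm_ring_1 \<Rightarrow> 'r \<Rightarrow> nat \<Rightarrow> 'r" where
  "geo x y 0 = 0"
| "geo x y (Suc n) = x ^ n + y * geo x y n"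

lemma geo_diff: "(x - y) * geo x y n = x ^ n - y ^ n"
proof (induction n)
  case (Suc n)
  have "(x - y) * geo x y (Suc n) = (x - y) * x ^ n + y * ((x - y) * geo x y n)"
    by (simp only: geo.simps distrib_left mult.left_commute)
  also have "\<dots> = (x - y) * x ^ n + y * (x ^ n - y ^ n)"
    by (simp only: Suc.IH)
  also have "\<dots> = x ^ Suc n - y ^ Suc n"
    by (simp add: left_diff_distrib right_diff_distrib)
  finally show ?case .
qed simp

lemma geo_add: "geo x y (a + b) = y ^ a * geo x y b + x ^ b * geo x y a"
proof (induction a)
  case (Suc a)
  have "geo x y (Suc a + b) = x ^ (a + b) + y * (y ^ a * geo x y b + x ^ b * geo x y a)"
    by (simp only: add_Suc geo.simps Suc.IH)
  also have "\<dots> = y ^ Suc a * geo x y b + x ^ b * geo x y (Suc a)"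
    by (simp only: geo.simps power_Suc power_add distrib_left ac_simps)
  finally show ?case .
qed simp

definition dd_mon ::
  "('m::finite option \<Rightarrow> 'k::comm_ring_1) \<Rightarrow> 'm \<Rightarrow> ('m option \<Rightarrow>\<^sub>0 nat) \<Rightarrow> ('m option, 'k) mpoly" where
  "dd_mon q j t = mon (\<lambda>v. if v = Some j then 1 else stage q (var_ix j) v) t *
     geo (Var (Some j)) (Const (q (Some j)) * Var None) (Poly_Mapping.lookup t (Some j))"

text \<open>
  The divided difference of step \<open>j\<close>: the difference of \<open>p\<close> before and
  after \<open>X_j\<close> is replaced by \<open>q_j * X_0\<close>, divided by \<open>X_j - q_j
  * X_0\<close> (see \<open>dd_step\<close>).
\<close>

definition dd ::
  "('m::finite option \<Rightarrow> 'k::comm_ring_1) \<Rightarrow> 'm \<Rightarrow> ('m option, 'k) mpoly \<Rightarrow> ('m option, 'k) mpoly" where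
  "dd q j = lin_ext Const (dd_mon q j)"

lemma dd_add [simp]: "dd q j (p + r) = dd q j p + dd q j r"
  by (simp add: dd_def lin_ext_add)

lemma dd_0 [simp]: "dd q j 0 = 0"
  by (simp add: dd_def lin_ext_zero)

lemma dd_single: "dd q j (Poly_Mapping.single t c) = Const c * dd_mon q j t"
  by (simp add: dd_def lin_ext_single)

lemma dd_sum [simp]: "dd q j (sum f S) = (\<Sum>x\<in>S. dd q j (f x))"
  by (rule additive_sum) simp_all

lemma mon_split:
  fixes t :: "'i::finite \<Rightarrow>\<^sub>0 nat"
  shows "mon a t = mon (\<lambda>v. if v = w then 1 else a v) t * a w ^ Poly_Mapping.lookup t w"
proof -
  have "(\<Prod>v\<in>UNIV - {w}. (if v = w then 1 else a v) ^ Poly_Mapping.lookup t v)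
      = (\<Prod>v\<in>UNIV - {w}. a v ^ Poly_Mapping.lookup t v)"
    by (rule prod.cong) auto
  then show ?thesis
    unfolding mon_UNIV by (simp add: prod.remove[of UNIV w] mult.commute)
qed

lemma mon_stage:
  "mon (stage q (var_ix j)) t = mon (\<lambda>v. if v = Some j then 1 else stage q (var_ix j) v) t
     * Var (Some j) ^ Poly_Mapping.lookup t (Some j)"
  by (subst mon_split[of _ t "Some j"]) (simp add: stage_def)

lemma mon_stage_Suc:
  "mon (stage q (Suc (var_ix j))) t = mon (\<lambda>v. if v = Some j then 1 else stage q (var_ix j) v) t
     * (Const (q (Some j)) * Var None) ^ Poly_Mapping.lookup t (Some j)"
proof -
  have "(\<lambda>v. if v = Some j then 1 else stage q (Suc (var_ix j)) v)
      = (\<lambda>v. if v = Some j then 1 else stage q (var_ix j) v)"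
    by (auto simp: stage_def fun_eq_iff less_Suc_eq var_ix_inj split: option.splits)
  moreover have "stage q (Suc (var_ix j)) (Some j) = Const (q (Some j)) * Var None"
    by (simp add: stage_def)
  ultimately show ?thesis by (subst mon_split[of _ t "Some j"]) (simp only:)
qed

lemma dd_step:
  "subst (stage q (var_ix j)) p - subst (stage q (Suc (var_ix j))) p = xi q j * dd q j p"
proof (induction p rule: mpoly_induct)
  case (monom t c)
  let ?m = "mon (\<lambda>v. if v = Some j then 1 else stage q (var_ix j) v) t"
  let ?x = "Var (Some j) :: ('a option, 'b) mpoly" and ?y = "Const (q (Some j)) * Var None :: ('a option, 'b) mpoly"
  let ?n = "Poly_Mapping.lookup t (Some j)"
  have "subst (stage q (var_ix j)) (Poly_Mapping.single t c) - subst (stage q (Suc (var_ix j))) (Poly_Mapping.single t c)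
      = Const c * (?m * (?x ^ ?n - ?y ^ ?n))"
    by (simp only: subst_single mon_stage mon_stage_Suc right_diff_distrib)
  also have "\<dots> = Const c * (?m * ((?x - ?y) * geo ?x ?y ?n))"
    by (simp only: geo_diff)
  also have "\<dots> = xi q j * dd q j (Poly_Mapping.single t c)"
    by (simp only: dd_single dd_mon_def xi_def ac_simps)
  finally show ?case .
next
  case (add p r)
  then show ?case by (simp only: subst_add dd_add distrib_left add_diff_add)
qed

lemma dd_telescope:
  fixes q :: "'m::finite option \<Rightarrow> 'k::comm_ring_1"
  assumes "a \<le> b" "b \<le> CARD('m)"
  shows "subst (stage q a) p - subst (stage q b) p
    = (\<Sum>j\<in>{j :: 'm. a \<le> var_ix j \<and> var_ix j < b}. xi q j * dd q j p)"
  using assms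
proof (induction b rule: dec_induct)
  case base
  have "{j :: 'm. a \<le> var_ix j \<and> var_ix j < a} = {}" by auto
  then show ?case by (simp only: sum.empty diff_self)
next
  case (step b)
  from step.prems obtain i :: 'm where i: "var_ix i = b"
    using var_ix_surj[of b, where 'm = 'm] by (auto simp: Suc_le_eq)
  have "{j :: 'm. a \<le> var_ix j \<and> var_ix j < Suc b} = insert i {j. a \<le> var_ix j \<and> var_ix j < b}"
  proof -
    have "var_ix j = b \<longleftrightarrow> j = i" for j using i var_ix_inj[of j i] by simp
    moreover have "a \<le> var_ix i" using step.hyps i by simp
    ultimately show ?thesis by (auto simp: less_Suc_eq)
  qed
  moreover have "i \<notin> {j. a \<le> var_ix j \<and> var_ix j < b}" using i by simp
  moreover have "subst (stage q a) p - subst (stage q b) p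
    = (\<Sum>j\<in>{j :: 'm. a \<le> var_ix j \<and> var_ix j < b}. xi q j * dd q j p)"
    using step by simp
  ultimately have "(\<Sum>j\<in>{j :: 'm. a \<le> var_ix j \<and> var_ix j < Suc b}. xi q j * dd q j p)
      = xi q i * dd q i p + (subst (stage q a) p - subst (stage q b) p)"
    by simp
  also have "\<dots> = subst (stage q a) p - subst (stage q (Suc b)) p"
    unfolding dd_step[symmetric] i by simp
  finally show ?case by simp
qed

definition tops :: "('m::finite option \<Rightarrow> 'k::comm_ring_1) \<Rightarrow> ('m option, 'k) mpoly \<Rightarrow> ('m option, 'k) mpoly" where
  "tops q = subst (stage q CARD('m))"

lemma stage_0: "stage q 0 = Var"
  by (auto simp: stage_def fun_eq_iff split: option.splits)

lemma dd_expand: "p = tops q p + (\<Sum>j\<in>UNIV. xi q j * dd q j p)"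
  for q :: "'m::finite option \<Rightarrow> 'k::comm_ring_1"
  using dd_telescope[of 0 "CARD('m)" q p]
  by (simp add: stage_0 var_ix_less tops_def diff_eq_eq add.commute)

text \<open>
  The end of the telescope has replaced every \<open>X_l\<close> by \<open>q_l * X_0\<close>,
  which leaves a multiple of a power of \<open>X_0\<close>.
\<close>

lemma tops_hom:
  fixes q :: "'m::finite option \<Rightarrow> 'k::comm_ring_1"
  assumes "p \<in> hom_comp d" "q None = 1"
  shows "tops q p = Const (peval q p) * Var None ^ d"
proof -
  have st: "stage q CARD('m) = (\<lambda>v. Const (q v) * Var None)"
    using assms(2) by (auto simp: stage_def fun_eq_iff var_ix_less split: option.splits)
  have m: "mon (\<lambda>v. Const (q v) * Var None :: ('m option, 'k) mpoly) t = Const (mon q t) * Var None ^ tdeg t" for t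
  proof -
    have "Const (mon q t) = (mon (\<lambda>v. Const (q v)) t :: ('m option, 'k) mpoly)"
    proof -
      have p: "Const (x ^ n) = (Const x ^ n :: ('m option, 'k) mpoly)" for x :: 'k and n
        by (induction n) (simp_all add: mult_single[of 0 _ 0, simplified, symmetric])
      have "Const (\<Prod>v\<in>S. f v) = (\<Prod>v\<in>S. Const (f v) :: ('m option, 'k) mpoly)" for f :: "'m option \<Rightarrow> 'k" and S
        by (rule multiplicative_prod) (simp_all add: mult_single)
      then show ?thesis by (simp only: mon_UNIV p)
    qed
    then show ?thesis
      by (simp add: mon_UNIV power_mult_distrib prod.distrib tdeg_def power_sum)
  qed
  have "tops q p = (\<Sum>t\<in>Poly_Mapping.keys p. Const (Poly_Mapping.lookup p t) * (Const (mon q t) * Var None ^ d))"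
    unfolding tops_def st subst_def lin_ext_def m
    using assms(1) by (intro sum.cong) (auto simp: hom_comp_whom whom_def)
  also have "\<dots> = (\<Sum>t\<in>Poly_Mapping.keys p. Const (Poly_Mapping.lookup p t * mon q t)) * Var None ^ d"
    by (simp add: sum_distrib_right mult.assoc[symmetric] mult_single)
  also have "(\<Sum>t\<in>Poly_Mapping.keys p. Const (Poly_Mapping.lookup p t * mon q t)) = Const (peval q p)"
    unfolding peval_eq_lin_ext lin_ext_def by (rule additive_sum[symmetric]) (simp_all add: single_add)
  finally show ?thesis .
qed

text \<open>
  The Leibniz rule, with the two factors taken at consecutive stages.
\<close>

lemma dd_mult:
  "dd q j (G * F) = subst (stage q (Suc (var_ix j))) G * dd q j F + subst (stage q (var_ix j)) F * dd q j G"
proof (induction G rule: mpoly_induct)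
  case (monom s a)
  show ?case
  proof (induction F rule: mpoly_induct)
    case (monom t b)
    let ?o = "mon (\<lambda>v. if v = Some j then 1 else stage q (var_ix j) v)"
    let ?x = "Var (Some j) :: ('a option, 'b) mpoly" and ?y = "Const (q (Some j)) * Var None :: ('a option, 'b) mpoly"
    let ?s = "Poly_Mapping.lookup s (Some j)" and ?t = "Poly_Mapping.lookup t (Some j)"
    have "dd q j (Poly_Mapping.single s a * Poly_Mapping.single t b)
       = (Const a * Const b) * (?o s * ?o t * (?y ^ ?s * geo ?x ?y ?t + ?x ^ ?t * geo ?x ?y ?s))"
      by (simp only: mult_single dd_single dd_mon_def mon_add lookup_add geo_add add_0)
    also have "\<dots> = Const a * (?o s * ?y ^ ?s) * (Const b * (?o t * geo ?x ?y ?t))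
        + Const b * (?o t * ?x ^ ?t) * (Const a * (?o s * geo ?x ?y ?s))"
      by (simp only: distrib_left ac_simps)
    also have "\<dots> = subst (stage q (Suc (var_ix j))) (Poly_Mapping.single s a) * dd q j (Poly_Mapping.single t b)
        + subst (stage q (var_ix j)) (Poly_Mapping.single t b) * dd q j (Poly_Mapping.single s a)"
      by (simp only: subst_single mon_stage mon_stage_Suc dd_single dd_mon_def)
    finally show ?case .
  qed (simp add: distrib_left distrib_right add.assoc add.left_commute)
qed (simp add: distrib_left distrib_right add.assoc add.left_commute)

text \<open>
  The correction when, in the Leibniz rule \<open>dd_mult\<close>, the intermediate stages are
  replaced by the end of the telescope for \<open>G\<close> and by its beginning for
  \<open>F\<close>. It is antisymmetric in \<open>j\<close> and \<open>l\<close>, and this is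
  what makes syzygies Koszul.
\<close>

definition kap ::
  "('m::finite option \<Rightarrow> 'k::comm_ring_1) \<Rightarrow> ('m option, 'k) mpoly \<Rightarrow> ('m option, 'k) mpoly \<Rightarrow>
     'm \<Rightarrow> 'm \<Rightarrow> ('m option, 'k) mpoly" where
  "kap q G F j l = (if var_ix j < var_ix l then dd q l G * dd q j F
     else if var_ix l < var_ix j then - (dd q l F * dd q j G) else 0)"

lemma kap_antisym: "kap q G F l j = - kap q G F j l"
  by (auto simp: kap_def mult.commute)

text \<open>
  Telescoping \<open>G\<close> from stage \<open>j + 1\<close> to the end involves the
  differences of the steps after \<open>j\<close>, telescoping \<open>F\<close> from the
  beginning to stage \<open>j\<close> those of the steps before \<open>j\<close>.
\<close>

lemma dd_mult_kap:
  fixes q :: "'m::finite option \<Rightarrow> 'k::comm_ring_1"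
  shows "dd q j (G * F) = tops q G * dd q j F + F * dd q j G + (\<Sum>l\<in>UNIV. kap q G F j l * xi q l)"
proof -
  let ?U = "{l :: 'm. Suc (var_ix j) \<le> var_ix l \<and> var_ix l < CARD('m)}"
  let ?L = "{l :: 'm. 0 \<le> var_ix l \<and> var_ix l < var_ix j}"
  have 1: "subst (stage q (Suc (var_ix j))) G = tops q G + (\<Sum>l\<in>?U. xi q l * dd q l G)"
    using dd_telescope[of "Suc (var_ix j)" "CARD('m)" q G] var_ix_less[of j]
    by (simp add: tops_def diff_eq_eq add.commute)
  have 2: "subst (stage q (var_ix j)) F = F - (\<Sum>l\<in>?L. xi q l * dd q l F)"
    using dd_telescope[of 0 "var_ix j" q F] var_ix_less[of j]
    by (simp add: stage_0 algebra_simps)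
  have "(\<Sum>l\<in>UNIV. kap q G F j l * xi q l)
      = (\<Sum>l\<in>?U \<union> ?L. kap q G F j l * xi q l)"
    by (rule sum.mono_neutral_right) (auto simp: kap_def var_ix_less)
  also have "\<dots> = (\<Sum>l\<in>?U. kap q G F j l * xi q l) + (\<Sum>l\<in>?L. kap q G F j l * xi q l)"
    by (rule sum.union_disjoint) auto
  also have "(\<Sum>l\<in>?U. kap q G F j l * xi q l) = (\<Sum>l\<in>?U. xi q l * dd q l G) * dd q j F"
    unfolding sum_distrib_right
  proof (rule sum.cong)
    fix l :: 'm assume "l \<in> ?U"
    then have "kap q G F j l = dd q l G * dd q j F" by (simp add: kap_def)
    then show "kap q G F j l * xi q l = xi q l * dd q l G * dd q j F" by (simp only: ac_simps)
  qed simp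
  also have "(\<Sum>l\<in>?L. kap q G F j l * xi q l) = - ((\<Sum>l\<in>?L. xi q l * dd q l F) * dd q j G)"
    unfolding sum_distrib_right sum_negf[symmetric]
  proof (rule sum.cong)
    fix l :: 'm assume "l \<in> ?L"
    then have "kap q G F j l = - (dd q l F * dd q j G)" by (simp add: kap_def)
    then have "kap q G F j l * xi q l = - (dd q l F * dd q j G * xi q l)"
      by (simp only: mult_minus_left)
    then show "kap q G F j l * xi q l = - (xi q l * dd q l F * dd q j G)" by (simp only: ac_simps)
  qed simp
  finally have "(\<Sum>l\<in>UNIV. kap q G F j l * xi q l)
      = (\<Sum>l\<in>?U. xi q l * dd q l G) * dd q j F + - ((\<Sum>l\<in>?L. xi q l * dd q l F) * dd q j G)" .
  then show ?thesis unfolding dd_mult 1 2 by (simp only: distrib_right left_diff_distrib) simp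
qed

lemma mon_whom:
  fixes t :: "'i::finite \<Rightarrow>\<^sub>0 nat"
  assumes "additive_wt wt" "\<And>v. a v \<in> whom wt (e v)"
  shows "mon a t \<in> whom wt (\<Sum>v\<in>UNIV. of_nat (Poly_Mapping.lookup t v) * (e v :: nat))"
proof -
  have "a v ^ n \<in> whom wt (n * e v)" for v n
    by (induction n) (simp_all add: whom_one assms whom_mult)
  then show ?thesis unfolding mon_UNIV by (intro whom_prod assms(1)) simp
qed

lemma dd_hom:
  fixes q :: "'m::finite option \<Rightarrow> 'k::comm_ring_1"
  assumes "p \<in> hom_comp d"
  shows "dd q j p \<in> hom_comp (d - 1)"
proof -
  let ?x = "Var (Some j) :: ('m option, 'k) mpoly" and ?y = "Const (q (Some j)) * Var None :: ('m option, 'k) mpoly"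
  have V: "Var v \<in> whom tdeg 1" for v :: "'m option"
    using Var_hom[of v] by (simp add: hom_comp_whom)
  have C: "Const c * Var v \<in> whom tdeg 1" for v :: "'m option" and c :: 'k
    by (intro whom_scale V additive_tdeg)
  have Vp: "?x ^ n \<in> whom tdeg n" for n
    by (induction n) (use whom_mult[OF additive_tdeg V[of "Some j"]] whom_one[of tdeg] in auto)
  have geo: "geo ?x ?y (Suc n) \<in> whom tdeg n" for n
  proof (induction n)
    case 0 show ?case by (simp add: whom_one)
  next
    case (Suc n)
    have "?y * geo ?x ?y (Suc n) \<in> whom tdeg (1 + n)"
      by (intro whom_mult additive_tdeg C Suc)
    then show ?case using Vp[of "Suc n"] by (simp only: geo.simps(2)[of _ _ "Suc n"] whom_add plus_1_eq_Suc)
  qed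
  have m: "dd_mon q j t \<in> whom tdeg (tdeg t - 1)" for t
  proof (cases "Poly_Mapping.lookup t (Some j)")
    case 0 then show ?thesis by (simp add: dd_mon_def)
  next
    case (Suc n)
    let ?e = "\<lambda>v. if v = Some j then 0 else (1::nat)"
    have o: "mon (\<lambda>v. if v = Some j then 1 else stage q (var_ix j) v) t
        \<in> whom tdeg (\<Sum>v\<in>UNIV. of_nat (Poly_Mapping.lookup t v) * ?e v)"
      by (rule mon_whom) (auto simp: stage_def whom_one V[simplified] C[simplified] split: option.splits)
    have "tdeg t = Poly_Mapping.lookup t (Some j) + (\<Sum>v\<in>UNIV - {Some j}. Poly_Mapping.lookup t v)"
      unfolding tdeg_def by (rule sum.remove) auto
    moreover have "(\<Sum>v\<in>UNIV. of_nat (Poly_Mapping.lookup t v) * ?e v)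
        = (\<Sum>v\<in>UNIV - {Some j}. Poly_Mapping.lookup t v)"
      by (subst sum.remove[of UNIV "Some j"]) (auto intro: sum.cong)
    ultimately have "tdeg t - 1 = (\<Sum>v\<in>UNIV. of_nat (Poly_Mapping.lookup t v) * ?e v) + n"
      using Suc by simp
    then show ?thesis
      unfolding dd_mon_def Suc using whom_mult[OF additive_tdeg o geo[of n]] by (simp only:)
  qed
  show ?thesis
    unfolding dd_def lin_ext_def hom_comp_whom
  proof (rule whom_sum)
    fix t assume "t \<in> Poly_Mapping.keys p"
    then have "tdeg t = d" using assms by (simp add: hom_comp_whom whom_def)
    then show "Const (Poly_Mapping.lookup p t) * dd_mon q j t \<in> whom tdeg (d - 1)"
      using m[of t] by (simp add: whom_scale)
  qed
qed

section \<open>Families of polynomials parametrized by points\<close>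

text \<open>
  Polynomials that depend on a point \<open>q\<close> with \<open>q_0 = 1\<close> in such a way
  that the coefficient of \<open>X^t\<close> is the value at \<open>q\<close> of a form whose
  degree is the exponent of \<open>X_0\<close> in \<open>t\<close>. Equivalently,
  \<open>h_q(X)\<close> is a polynomial in \<open>X_1, ..., X_m\<close> and the products
  \<open>q_l * X_0\<close>, where \<open>q_0 * X_0 = X_0\<close> is included. Products of such
  families are again such families because the exponents and the degrees both add up.
\<close>

inductive poly_family ::
  "(('m::finite option \<Rightarrow> 'k::field) \<Rightarrow> ('m option, 'k) mpoly) \<Rightarrow> bool" where
  pf_zero: "poly_family (\<lambda>q. 0)"
| pf_mono: "G \<in> hom_comp (Poly_Mapping.lookup t None) \<Longrightarrow> (\<And>q. q None = 1 \<Longrightarrow> v q = peval q G)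
     \<Longrightarrow> poly_family (\<lambda>q. Poly_Mapping.single t (v q))"
| pf_add: "poly_family h \<Longrightarrow> poly_family h' \<Longrightarrow> poly_family (\<lambda>q. h q + h' q)"

lemma pf_const: "poly_family (\<lambda>q. p)"
proof (induction p rule: mpoly_induct)
  case (monom t c)
  let ?n = "Poly_Mapping.lookup t None"
  have "Poly_Mapping.single (Poly_Mapping.single None ?n) c \<in> hom_comp ?n"
    by (simp add: hom_comp_whom whom_single)
  then show ?case by (rule pf_mono) simp
qed (rule pf_add)

lemma pf_mult:
  assumes "poly_family h" "poly_family h'"
  shows "poly_family (\<lambda>q. h q * h' q)"
  using assms(1)
proof induction
  case pf_zero
  show ?case using poly_family.pf_zero by simp
next
  case (pf_add h1 h2)
  from poly_family.pf_add[OF pf_add.IH] show ?case by (simp add: distrib_right)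
next
  case (pf_mono G t v)
  note 1 = pf_mono
  from assms(2) show ?case
  proof induction
    case pf_zero
    show ?case using poly_family.pf_zero by simp
  next
    case (pf_add h1 h2)
    from poly_family.pf_add[OF pf_add.IH] show ?case by (simp add: distrib_left)
  next
    case (pf_mono G' t' v')
    have "G * G' \<in> hom_comp (Poly_Mapping.lookup (t + t') None)"
      using 1(1) pf_mono(1) by (simp add: hom_comp_whom lookup_add whom_mult)
    then have "poly_family (\<lambda>q. Poly_Mapping.single (t + t') (v q * v' q))"
      by (rule poly_family.pf_mono) (simp add: 1(2) pf_mono(2))
    then show ?case by (simp add: mult_single)
  qed
qed

lemma pf_uminus: "poly_family h \<Longrightarrow> poly_family (\<lambda>q. - h q)"
  using pf_mult[OF pf_const[of "-1"], of h] by simp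

lemma pf_diff: "poly_family h \<Longrightarrow> poly_family h' \<Longrightarrow> poly_family (\<lambda>q. h q - h' q)"
  using pf_add[OF _ pf_uminus, of h h'] by simp

lemma pf_sum: "(\<And>x. x \<in> S \<Longrightarrow> poly_family (h x)) \<Longrightarrow> poly_family (\<lambda>q. \<Sum>x\<in>S. h x q)"
  by (induction S rule: infinite_finite_induct) (simp_all add: pf_zero pf_add)

lemma pf_prod: "(\<And>x. x \<in> S \<Longrightarrow> poly_family (h x)) \<Longrightarrow> poly_family (\<lambda>q. \<Prod>x\<in>S. h x q)"
  by (induction S rule: infinite_finite_induct) (simp_all add: pf_const pf_mult)

lemma pf_power: "poly_family h \<Longrightarrow> poly_family (\<lambda>q. h q ^ n)"
  by (induction n) (simp_all add: pf_const pf_mult)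

lemma pf_det:
  assumes "\<And>i j. poly_family (\<lambda>q. A q $ i $ j)"
  shows "poly_family (\<lambda>q. det (A q))"
  unfolding det_def by (intro pf_sum pf_mult pf_const pf_prod assms)

lemma pf_coord: "poly_family (\<lambda>q. Const (q (Some l)) * Var None)"
proof -
  have "poly_family (\<lambda>q. Poly_Mapping.single (Poly_Mapping.single None 1) (q (Some l)))"
    by (rule pf_mono[of "Var (Some l)"]) (use Var_hom[of "Some l"] in simp_all)
  then show ?thesis by (simp add: Var_def mult_single)
qed

lemma pf_stage: "poly_family (\<lambda>q. stage q k v)"
proof (cases v)
  case None
  then show ?thesis by (simp add: stage_def pf_const)
next
  case (Some a)
  then show ?thesis by (cases "var_ix a < k") (simp_all add: stage_def pf_const pf_coord)
qed

lemma pf_geo: "poly_family x \<Longrightarrow> poly_family y \<Longrightarrow> poly_family (\<lambda>q. geo (x q) (y q) n)"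
  by (induction n) (simp_all add: pf_const pf_add pf_mult pf_power)

lemma pf_dd: "poly_family (\<lambda>q. dd q j p)"
proof -
  have "poly_family (\<lambda>q. if v = Some j then 1 else stage q (var_ix j) v)" for v
    by (cases "v = Some j") (simp_all add: pf_const pf_stage)
  then show ?thesis
    unfolding dd_def lin_ext_def dd_mon_def mon_UNIV
    by (intro pf_sum pf_mult pf_const pf_prod pf_power pf_geo pf_coord)
qed

lemma pf_kap: "poly_family (\<lambda>q. kap q G F j l)"
  by (cases "var_ix j < var_ix l"; cases "var_ix l < var_ix j")
    (simp_all add: kap_def pf_zero pf_mult pf_dd pf_uminus)

text \<open>
  In the weighted sum, the coefficient of a monomial with \<open>X_0\<close>-exponent \<open>k <
  \<rho>\<close> is the weighted sum of the values of a form of degree \<open>k\<close>, and so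
  it vanishes.
\<close>

lemma poly_family_residue:
  fixes A :: "('m::finite option \<Rightarrow> 'k::field) set"
  assumes "poly_family h" and A: "\<And>q. q \<in> A \<Longrightarrow> q None = 1"
    and c: "\<And>k G. k < \<rho> \<Longrightarrow> G \<in> hom_comp k \<Longrightarrow> (\<Sum>q\<in>A. c q * peval q G) = 0"
  shows "\<exists>H. (\<Sum>q\<in>A. Const (c q) * h q) = Var None ^ \<rho> * H"
  using assms(1)
proof induction
  case pf_zero
  then show ?case by (auto intro: exI[of _ 0])
next
  case (pf_add h h')
  then obtain H H' where "(\<Sum>q\<in>A. Const (c q) * h q) = Var None ^ \<rho> * H"
    "(\<Sum>q\<in>A. Const (c q) * h' q) = Var None ^ \<rho> * H'" by blast
  then have "(\<Sum>q\<in>A. Const (c q) * (h q + h' q)) = Var None ^ \<rho> * (H + H')"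
    by (simp add: distrib_left sum.distrib)
  then show ?case by blast
next
  case (pf_mono G t v)
  have "(\<Sum>q\<in>A. Const (c q) * Poly_Mapping.single t (v q)) = (\<Sum>q\<in>A. Poly_Mapping.single t (c q * v q))"
    by (simp add: mult_single)
  also have "\<dots> = Poly_Mapping.single t (\<Sum>q\<in>A. c q * v q)"
    by (rule additive_sum[symmetric]) (simp_all add: single_add)
  also have "(\<Sum>q\<in>A. c q * v q) = (\<Sum>q\<in>A. c q * peval q G)"
    by (rule sum.cong) (simp_all add: A pf_mono)
  finally have eq: "(\<Sum>q\<in>A. Const (c q) * Poly_Mapping.single t (v q))
    = Poly_Mapping.single t (\<Sum>q\<in>A. c q * peval q G)" .
  show ?case
  proof (cases "Poly_Mapping.lookup t None < \<rho>")
    case True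
    then have "(\<Sum>q\<in>A. c q * peval q G) = 0" using c pf_mono(1) by blast
    then show ?thesis unfolding eq by (intro exI[of _ 0]) simp
  next
    case False
    have "t = Poly_Mapping.single None \<rho> + (t - Poly_Mapping.single None \<rho>)"
      by (rule poly_mapping_eqI) (use False in \<open>auto simp: lookup_add lookup_minus lookup_single when_def\<close>)
    then have "Poly_Mapping.single t (\<Sum>q\<in>A. c q * peval q G)
      = Var None ^ \<rho> * Poly_Mapping.single (t - Poly_Mapping.single None \<rho>) (\<Sum>q\<in>A. c q * peval q G)"
      unfolding Var_power mult_single by simp
    then show ?thesis unfolding eq by blast
  qed
qed

section \<open>Bezoutians and the residue functional\<close>

lemma of_int_Const: "(of_int n :: ('i, 'k::comm_ring_1) mpoly) = Const (of_int n)"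
  by simp

text \<open>
  Homogeneity is assumed for the products along permutations and not for the entries, since the
  degree of an entry may be a truncated difference that is meaningless where the entry is zero.
\<close>

lemma det_whom:
  fixes M :: "(('i, 'k::comm_ring_1) mpoly)^'n^'n"
  assumes wt: "additive_wt wt"
    and M: "\<And>\<sigma>. \<sigma> permutes UNIV \<Longrightarrow> (\<Prod>i\<in>UNIV. M $ i $ \<sigma> i) \<in> whom wt d"
  shows "det M \<in> whom wt d"
  unfolding det_def of_int_Const by (intro whom_sum whom_scale wt) (simp add: M)

locale jacobian_forms =
  fixes A :: "('m::finite option \<Rightarrow> 'k::field) set"
    and F :: "'m \<Rightarrow> ('m option, 'k) mpoly" and d :: "'m \<Rightarrow> nat"
  assumes finite_A: "finite A"
    and normalized: "q \<in> A \<Longrightarrow> q None = 1"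
    and F_hom: "F i \<in> hom_comp (d i)"
    and d_pos: "d i \<ge> 1"
    and F_vanish: "q \<in> A \<Longrightarrow> peval q (F i) = 0"
begin

definition dmat :: "('m option \<Rightarrow> 'k) \<Rightarrow> (('m option, 'k) mpoly)^'m^'m" where
  "dmat q = (\<chi> i j. dd q j (F i))"

definition bez :: "('m option \<Rightarrow> 'k) \<Rightarrow> ('m option, 'k) mpoly" where
  "bez q = det (dmat q)"

definition rho :: nat where "rho = (\<Sum>i\<in>UNIV. d i - 1)"

definition jac :: "('m option \<Rightarrow> 'k) \<Rightarrow> 'k" where
  "jac q = det (\<chi> i j. peval q (partial_deriv (Some j) (F i)))"

lemma dmat_nth [simp]: "dmat q $ i $ j = dd q j (F i)"
  by (simp add: dmat_def)

lemma tops_F: "q \<in> A \<Longrightarrow> tops q (F i) = 0"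
  by (simp add: tops_hom[OF F_hom] normalized F_vanish)

lemma F_expand: "q \<in> A \<Longrightarrow> F i = (\<Sum>j\<in>UNIV. dmat q $ i $ j * xi q j)"
  using dd_expand[of "F i" q] by (simp add: tops_F mult.commute)

lemma bez_hom: "bez q \<in> hom_comp rho"
  unfolding bez_def hom_comp_whom
proof (rule det_whom)
  fix \<sigma> :: "'m \<Rightarrow> 'm"
  show "(\<Prod>i\<in>UNIV. dmat q $ i $ \<sigma> i) \<in> whom tdeg rho"
    unfolding rho_def
    by (rule whom_prod) (use dd_hom[OF F_hom] in \<open>auto simp: hom_comp_whom\<close>)
qed simp

lemma bez_cramer: "q \<in> A \<Longrightarrow> xi q j * bez q = (\<Sum>k\<in>UNIV. F k * adjg (dmat q) j k)"
  unfolding bez_def by (rule cramer_adjg) (rule F_expand)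

lemma peval_xi: "peval q' (xi q j) = q' (Some j) - q (Some j) * q' None"
  by (simp add: xi_def)

text \<open>
  Some \<open>X_j - q_j * X_0\<close> is nonzero at \<open>q'\<close>, and its product with the
  Bezoutian lies in the ideal of the \<open>F i\<close>, hence vanishes there.
\<close>

lemma bez_other:
  assumes "q \<in> A" "q' \<in> A" "q \<noteq> q'"
  shows "peval q' (bez q) = 0"
proof -
  obtain v where v: "q v \<noteq> q' v" using assms(3) by auto
  have "q None = q' None" using normalized[OF assms(1)] normalized[OF assms(2)] by simp
  then obtain j where j: "v = Some j" using v by (cases v) auto
  have "peval q' (xi q j * bez q) = 0"
    by (simp add: bez_cramer assms F_vanish del: peval_mult) (simp add: F_vanish assms)
  then show ?thesis using v j assms by (simp add: peval_xi normalized)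
qed

text \<open>
  At \<open>q\<close> itself the divided differences become the partial derivatives.
\<close>

lemma bez_self:
  assumes q: "q \<in> A"
  shows "peval q (bez q) = jac q"
proof -
  have "peval q (dd q j (F i)) = peval q (partial_deriv (Some j) (F i))" for i j
  proof -
    have 1: "partial_deriv (Some j) (xi q l) = (if j = l then 1 else 0)" for l
      by (simp add: xi_def partial_deriv_mult partial_deriv_Var)
    have 2: "peval q (xi q l) = 0" for l
      using q by (simp add: peval_xi normalized)
    have "peval q (partial_deriv (Some j) (F i))
        = peval q (partial_deriv (Some j) (\<Sum>l\<in>UNIV. dmat q $ i $ l * xi q l))"
      using F_expand[OF q, of i] by (rule arg_cong)
    also have "\<dots> = (\<Sum>l\<in>UNIV. peval q (dd q l (F i)) * (if j = l then 1 else 0))"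
      unfolding partial_deriv_sum peval_sum
      by (rule sum.cong) (simp_all add: partial_deriv_mult 1 2)
    also have "\<dots> = (\<Sum>l\<in>UNIV. if j = l then peval q (dd q l (F i)) else 0)"
      by (rule sum.cong) simp_all
    also have "\<dots> = peval q (dd q j (F i))" by simp
    finally show ?thesis by simp
  qed
  then show ?thesis by (simp add: bez_def peval_det jac_def)
qed

definition kills :: "(('m option \<Rightarrow> 'k) \<Rightarrow> 'k) \<Rightarrow> bool" where
  "kills c \<longleftrightarrow> (\<forall>k<rho. \<forall>G\<in>hom_comp k. (\<Sum>q\<in>A. c q * peval q G) = 0)"

lemma family_sum:
  assumes "kills c" "poly_family h"
  shows "\<exists>H. (\<Sum>q\<in>A. Const (c q) * h q) = Var None ^ rho * H"
  by (rule poly_family_residue[OF assms(2), of A]) (use assms(1) normalized in \<open>auto simp: kills_def\<close>)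

lemma pf_bez: "poly_family bez"
  unfolding bez_def by (intro pf_det) (simp add: pf_dd)

text \<open>
  The Euler-Jacobi formula: the weighted sum of the Bezoutians is divisible by
  \<open>X_0^rho\<close> and of degree \<open>rho\<close>, so it is a constant times this power,
  and its value at \<open>q\<close> involves only the term of \<open>q\<close>.
\<close>

lemma residue:
  assumes c: "kills c"
  obtains \<gamma> where "(\<Sum>q\<in>A. Const (c q) * bez q) = Const \<gamma> * Var None ^ rho"
    and "\<And>q. q \<in> A \<Longrightarrow> c q * jac q = \<gamma>"
proof -
  obtain H where H: "(\<Sum>q\<in>A. Const (c q) * bez q) = Var None ^ rho * H"
    using family_sum[OF c pf_bez] by blast
  have "Var None ^ rho * H \<in> whom tdeg rho"
    unfolding H[symmetric]
    by (intro whom_sum whom_scale additive_tdeg) (use bez_hom in \<open>auto simp: hom_comp_whom\<close>)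
  then have "Poly_Mapping.lookup H t = 0" if "t \<noteq> 0" for t
  proof -
    have "Poly_Mapping.lookup (Var None ^ rho * H) (Poly_Mapping.single None rho + t) = Poly_Mapping.lookup H t"
      unfolding Var_power lookup_mult_single by simp
    moreover have "tdeg (Poly_Mapping.single None rho + t) \<noteq> rho"
    proof -
      have "tdeg t \<noteq> 0" using that by (auto simp: tdeg_def poly_mapping_eq_iff fun_eq_iff)
      then show ?thesis by (simp add: tdeg_add)
    qed
    ultimately show ?thesis
      using \<open>Var None ^ rho * H \<in> whom tdeg rho\<close> unfolding whom_iff by metis
  qed
  then have Hc: "H = Const (Poly_Mapping.lookup H 0)"
    by (intro poly_mapping_eqI) (auto simp: lookup_single when_def)
  define \<gamma> where "\<gamma> = Poly_Mapping.lookup H 0"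
  have eq: "(\<Sum>q\<in>A. Const (c q) * bez q) = Const \<gamma> * Var None ^ rho"
    using H Hc unfolding \<gamma>_def[symmetric] by (simp add: mult.commute)
  have "c q * jac q = \<gamma>" if q: "q \<in> A" for q
  proof -
    have "peval q (\<Sum>r\<in>A. Const (c r) * bez r) = (\<Sum>r\<in>A. if r = q then c q * jac q else 0)"
      unfolding peval_sum
      by (rule sum.cong) (auto simp: bez_self bez_other q)
    also have "\<dots> = c q * jac q" using q finite_A by simp
    finally show ?thesis unfolding eq using normalized[OF q] by simp
  qed
  with eq that show thesis by blast
qed

text \<open>
  \<open>G * B_q\<close> is a combination of the \<open>F k\<close> with coefficients in
  families, by Cramer's rule. The weighted sum over \<open>q\<close> turns the left side into a
  multiple of \<open>X_0^rho * G\<close> and the coefficients into multiples of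
  \<open>X_0^rho\<close>, which cancels.
\<close>

lemma generate:
  assumes c: "kills c" and \<gamma>: "(\<Sum>q\<in>A. Const (c q) * bez q) = Const \<gamma> * Var None ^ rho" "\<gamma> \<noteq> 0"
    and G: "\<And>q. q \<in> A \<Longrightarrow> tops q G = 0"
  shows "G \<in> ideal_gen (range F)"
proof -
  define h where "h k q = (\<Sum>j\<in>UNIV. dd q j G * adjg (dmat q) j k)" for k q
  have 1: "G * bez q = (\<Sum>k\<in>UNIV. h k q * F k)" if "q \<in> A" for q
  proof -
    have "G * bez q = (tops q G + (\<Sum>j\<in>UNIV. xi q j * dd q j G)) * bez q"
      by (rule arg_cong[OF dd_expand, of "\<lambda>g. g * bez q"])
    also have "\<dots> = (\<Sum>j\<in>UNIV. dd q j G * (xi q j * bez q))"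
      unfolding G[OF that] add_0 sum_distrib_right by (simp only: ac_simps)
    also have "\<dots> = (\<Sum>j\<in>UNIV. \<Sum>k\<in>UNIV. dd q j G * (F k * adjg (dmat q) j k))"
      by (simp only: bez_cramer[OF that] sum_distrib_left)
    also have "\<dots> = (\<Sum>k\<in>UNIV. \<Sum>j\<in>UNIV. dd q j G * (F k * adjg (dmat q) j k))"
      by (rule sum.swap)
    also have "\<dots> = (\<Sum>k\<in>UNIV. h k q * F k)"
      unfolding h_def sum_distrib_right by (intro sum.cong refl) (simp only: ac_simps)
    finally show ?thesis .
  qed
  have "poly_family (h k)" for k
    unfolding h_def adjg_def repl_col_def unit_fun_def
  proof (intro pf_sum pf_mult pf_dd pf_det)
    fix i l j
    show "poly_family (\<lambda>q. (\<chi> i l. if l = j then if i = k then 1 else 0 else dmat q $ i $ l) $ i $ l)"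
      by (cases "l = j") (simp_all add: pf_const pf_dd)
  qed
  then have "\<exists>H. (\<Sum>q\<in>A. Const (c q) * h k q) = Var None ^ rho * H" for k
    by (rule family_sum[OF c])
  then obtain H where H: "\<And>k. (\<Sum>q\<in>A. Const (c q) * h k q) = Var None ^ rho * H k" by metis
  have "Var None ^ rho * (Const \<gamma> * G) = G * (\<Sum>q\<in>A. Const (c q) * bez q)"
    unfolding \<gamma>(1) by (simp only: ac_simps)
  also have "\<dots> = (\<Sum>q\<in>A. Const (c q) * (G * bez q))"
    unfolding sum_distrib_left by (simp only: ac_simps)
  also have "\<dots> = (\<Sum>q\<in>A. \<Sum>k\<in>UNIV. Const (c q) * h k q * F k)"
    by (rule sum.cong) (simp_all only: 1 sum_distrib_left mult.assoc)
  also have "\<dots> = (\<Sum>k\<in>UNIV. \<Sum>q\<in>A. Const (c q) * h k q * F k)"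
    by (rule sum.swap)
  also have "\<dots> = Var None ^ rho * (\<Sum>k\<in>UNIV. H k * F k)"
    unfolding sum_distrib_right[symmetric] H by (simp only: sum_distrib_left mult.assoc)
  finally have "Const \<gamma> * G = (\<Sum>k\<in>UNIV. H k * F k)"
    unfolding Var_power by (rule mult_single_cancel)
  then have "Const \<gamma> * G \<in> ideal_gen (range F)"
    using ideal_gen_image[of UNIV "Const \<gamma> * G" F] by auto
  then have "Const (1 / \<gamma>) * (Const \<gamma> * G) \<in> ideal_gen (range F)" by (rule ideal_mult[OF is_ideal_gen])
  moreover have "Const (1 / \<gamma>) * (Const \<gamma> * G) = G"
    using \<gamma>(2) by (simp add: mult.assoc[symmetric] mult_single)
  ultimately show ?thesis by simp
qed

text \<open>
  Applying \<open>dd q j\<close> to the syzygy and using the Leibniz rule in the form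
  \<open>dd_mult_kap\<close> gives a linear system for the \<open>tops q (G k)\<close> with
  matrix \<open>dmat q\<close>, up to terms with a factor \<open>F i\<close>. Contracting with
  the adjugate expresses \<open>tops q (G k) * B_q\<close> by the antisymmetric
  \<open>\<kappa>\<close>, and the second Cramer rule brings out factors \<open>F m\<close>. The
  factor \<open>2\<close> symmetrizes the sum over \<open>j\<close> and \<open>l\<close>, so
  that the coefficients of the \<open>F m\<close> come out antisymmetric.
\<close>

lemma koszul_local:
  fixes G :: "'m \<Rightarrow> ('m option, 'k) mpoly"
  assumes q: "q \<in> A" and syz: "(\<Sum>i\<in>UNIV. G i * F i) = 0"
  defines "\<kappa> \<equiv> \<lambda>j l. \<Sum>i\<in>UNIV. kap q (G i) (F i) j l"
    and "\<beta> \<equiv> \<lambda>k l. \<Sum>j\<in>UNIV. dd q j (G k) * adjg (dmat q) j l"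
  shows "2 * (G k * bez q) = (\<Sum>m\<in>UNIV. ((\<Sum>j\<in>UNIV. \<Sum>l\<in>UNIV. \<kappa> j l * adjg2 (dmat q) j l k m)
     + 2 * \<beta> k m - 2 * \<beta> m k) * F m)"
proof -
  let ?a = "dmat q" and ?\<gamma> = "\<lambda>i. tops q (G i)"
  define \<tau> where "\<tau> j = (\<Sum>i\<in>UNIV. ?\<gamma> i * dd q j (F i) + F i * dd q j (G i))" for j
  have \<kappa>_anti: "\<kappa> l j = - \<kappa> j l" for j l
    unfolding \<kappa>_def by (simp add: kap_antisym[of q _ _ l j] sum_negf)
  have \<tau>: "\<tau> j = - (\<Sum>l\<in>UNIV. \<kappa> j l * xi q l)" for j
  proof -
    have "0 = dd q j (\<Sum>i\<in>UNIV. G i * F i)" by (simp add: syz)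
    also have "\<dots> = (\<Sum>i\<in>UNIV. ?\<gamma> i * dd q j (F i) + F i * dd q j (G i)
        + (\<Sum>l\<in>UNIV. kap q (G i) (F i) j l * xi q l))"
      by (simp only: dd_sum dd_mult_kap)
    also have "\<dots> = \<tau> j + (\<Sum>i\<in>UNIV. \<Sum>l\<in>UNIV. kap q (G i) (F i) j l * xi q l)"
      by (simp only: \<tau>_def sum.distrib)
    also have "(\<Sum>i\<in>UNIV. \<Sum>l\<in>UNIV. kap q (G i) (F i) j l * xi q l) = (\<Sum>l\<in>UNIV. \<kappa> j l * xi q l)"
      unfolding \<kappa>_def sum_distrib_right by (rule sum.swap)
    finally show ?thesis by (simp add: eq_neg_iff_add_eq_0)
  qed
  have \<tau>adj: "(\<Sum>j\<in>UNIV. \<tau> j * adjg ?a j k) = ?\<gamma> k * bez q + (\<Sum>i\<in>UNIV. \<beta> i k * F i)"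
  proof -
    have "(\<Sum>j\<in>UNIV. \<tau> j * adjg ?a j k)
      = (\<Sum>j\<in>UNIV. \<Sum>i\<in>UNIV. ?\<gamma> i * (?a $ i $ j * adjg ?a j k) + dd q j (G i) * adjg ?a j k * F i)"
      unfolding \<tau>_def sum_distrib_right
      by (intro sum.cong refl) (simp only: dmat_nth distrib_left distrib_right ac_simps)
    also have "\<dots> = (\<Sum>i\<in>UNIV. \<Sum>j\<in>UNIV. ?\<gamma> i * (?a $ i $ j * adjg ?a j k) + dd q j (G i) * adjg ?a j k * F i)"
      by (rule sum.swap)
    also have "\<dots> = (\<Sum>i\<in>UNIV. ?\<gamma> i * (\<Sum>j\<in>UNIV. ?a $ i $ j * adjg ?a j k) + \<beta> i k * F i)"
      by (simp only: sum.distrib \<beta>_def sum_distrib_left sum_distrib_right)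
    also have "\<dots> = (\<Sum>i\<in>UNIV. (if i = k then ?\<gamma> i * bez q else 0) + \<beta> i k * F i)"
      unfolding laplace_adjg bez_def[symmetric] by (intro sum.cong refl) simp
    also have "\<dots> = ?\<gamma> k * bez q + (\<Sum>i\<in>UNIV. \<beta> i k * F i)"
      by (simp add: sum.distrib)
    finally show ?thesis .
  qed
  let ?S = "\<Sum>j\<in>UNIV. \<Sum>l\<in>UNIV. \<kappa> j l * xi q l * adjg ?a j k"
  have S1: "(\<Sum>j\<in>UNIV. \<tau> j * adjg ?a j k) = - ?S"
    unfolding \<tau> by (simp only: mult_minus_left sum_negf sum_distrib_right)
  have "?S = (\<Sum>l\<in>UNIV. \<Sum>j\<in>UNIV. \<kappa> j l * xi q l * adjg ?a j k)"
    by (rule sum.swap)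
  also have "\<dots> = - (\<Sum>j\<in>UNIV. \<Sum>l\<in>UNIV. \<kappa> j l * xi q j * adjg ?a l k)"
    unfolding sum_negf[symmetric]
    by (intro sum.cong refl) (subst \<kappa>_anti, simp only: mult_minus_left)
  (* ?S with j and l exchanged; the average of both expressions fits the second Cramer rule *)
  finally have S2: "- ?S = (\<Sum>j\<in>UNIV. \<Sum>l\<in>UNIV. \<kappa> j l * xi q j * adjg ?a l k)" by simp
  have "2 * (- ?S) = (- ?S) + (- ?S)" by (rule mult_2)
  also have "\<dots> = (\<Sum>j\<in>UNIV. \<Sum>l\<in>UNIV. \<kappa> j l * xi q j * adjg ?a l k) - ?S"
    by (subst S2) simp
  also have "\<dots> = (\<Sum>j\<in>UNIV. \<Sum>l\<in>UNIV. \<kappa> j l * (xi q j * adjg ?a l k - xi q l * adjg ?a j k))"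
    by (simp only: sum_subtractf[symmetric] right_diff_distrib mult.assoc)
  also have "\<dots> = (\<Sum>j\<in>UNIV. \<Sum>l\<in>UNIV. \<Sum>m\<in>UNIV. \<kappa> j l * adjg2 ?a j l k m * F m)"
  proof (intro sum.cong refl)
    fix j l
    show "\<kappa> j l * (xi q j * adjg ?a l k - xi q l * adjg ?a j k)
        = (\<Sum>m\<in>UNIV. \<kappa> j l * adjg2 ?a j l k m * F m)"
    proof (cases "j = l")
      case True
      then show ?thesis by (simp add: \<kappa>_def kap_def)
    next
      case False
      have "xi q j * adjg ?a l k - xi q l * adjg ?a j k = (\<Sum>m\<in>UNIV. F m * adjg2 ?a j l k m)"
        by (rule cramer_adjg2[OF F_expand[OF q] False])
      then show ?thesis by (simp only: sum_distrib_left ac_simps)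
    qed
  qed
  also have "\<dots> = (\<Sum>j\<in>UNIV. \<Sum>m\<in>UNIV. \<Sum>l\<in>UNIV. \<kappa> j l * adjg2 ?a j l k m * F m)"
    by (intro sum.cong refl sum.swap)
  also have "\<dots> = (\<Sum>m\<in>UNIV. \<Sum>j\<in>UNIV. \<Sum>l\<in>UNIV. \<kappa> j l * adjg2 ?a j l k m * F m)"
    by (rule sum.swap)
  also have "\<dots> = (\<Sum>m\<in>UNIV. (\<Sum>j\<in>UNIV. \<Sum>l\<in>UNIV. \<kappa> j l * adjg2 ?a j l k m) * F m)"
    by (simp only: sum_distrib_right)
  finally have S3: "2 * (- ?S) = (\<Sum>m\<in>UNIV. (\<Sum>j\<in>UNIV. \<Sum>l\<in>UNIV. \<kappa> j l * adjg2 ?a j l k m) * F m)" .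
  have GB: "G k * bez q = ?\<gamma> k * bez q + (\<Sum>m\<in>UNIV. \<beta> k m * F m)"
  proof -
    have "G k * bez q = (?\<gamma> k + (\<Sum>j\<in>UNIV. xi q j * dd q j (G k))) * bez q"
      by (rule arg_cong[OF dd_expand, of "\<lambda>g. g * bez q"])
    also have "\<dots> = ?\<gamma> k * bez q + (\<Sum>j\<in>UNIV. dd q j (G k) * (xi q j * bez q))"
      unfolding distrib_right sum_distrib_right by (simp only: ac_simps)
    also have "(\<Sum>j\<in>UNIV. dd q j (G k) * (xi q j * bez q))
        = (\<Sum>j\<in>UNIV. \<Sum>m\<in>UNIV. dd q j (G k) * adjg ?a j m * F m)"
      unfolding bez_cramer[OF q] sum_distrib_left by (simp only: ac_simps)
    also have "\<dots> = (\<Sum>m\<in>UNIV. \<Sum>j\<in>UNIV. dd q j (G k) * adjg ?a j m * F m)"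
      by (rule sum.swap)
    also have "\<dots> = (\<Sum>m\<in>UNIV. \<beta> k m * F m)"
      by (simp only: \<beta>_def sum_distrib_right)
    finally show ?thesis .
  qed
  let ?K = "\<lambda>m. \<Sum>j\<in>UNIV. \<Sum>l\<in>UNIV. \<kappa> j l * adjg2 ?a j l k m"
  have \<gamma>B: "?\<gamma> k * bez q = - ?S - (\<Sum>i\<in>UNIV. \<beta> i k * F i)"
    using \<tau>adj S1 by (simp add: eq_diff_eq)
  have "2 * (G k * bez q) = 2 * (- ?S) - 2 * (\<Sum>i\<in>UNIV. \<beta> i k * F i) + 2 * (\<Sum>m\<in>UNIV. \<beta> k m * F m)"
    unfolding GB \<gamma>B by (simp only: distrib_left right_diff_distrib)
  also have "\<dots> = (\<Sum>m\<in>UNIV. ?K m * F m) - (\<Sum>m\<in>UNIV. 2 * \<beta> m k * F m) + (\<Sum>m\<in>UNIV. 2 * \<beta> k m * F m)"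
    unfolding S3 by (simp only: sum_distrib_left mult.assoc)
  also have "\<dots> = (\<Sum>m\<in>UNIV. (?K m + 2 * \<beta> k m - 2 * \<beta> m k) * F m)"
    unfolding sum_subtractf[symmetric] sum.distrib[symmetric]
    by (intro sum.cong refl) (simp only: left_diff_distrib distrib_right diff_add_eq)
  finally show ?thesis .
qed

text \<open>
  The coefficients in \<open>koszul_local\<close> are families that are antisymmetric for every
  \<open>q\<close>. The weighted sum over \<open>q\<close> is then divided by
  \<open>X_0^rho\<close> as in \<open>generate\<close>, and antisymmetry survives.
\<close>

lemma koszul:
  fixes G :: "'m \<Rightarrow> ('m option, 'k) mpoly"
  assumes c: "kills c" and \<gamma>: "(\<Sum>q\<in>A. Const (c q) * bez q) = Const \<gamma> * Var None ^ rho" "\<gamma> \<noteq> 0"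
    and two: "(2 :: 'k) \<noteq> 0"
    and syz: "(\<Sum>i\<in>UNIV. G i * F i) = 0"
  obtains \<omega> where "\<And>k l. \<omega> l k = - \<omega> k l" "\<And>k. \<omega> k k = 0" "\<And>k. G k = (\<Sum>l\<in>UNIV. \<omega> k l * F l)"
proof -
  define \<kappa> where "\<kappa> q j l = (\<Sum>i\<in>UNIV. kap q (G i) (F i) j l)" for q j l
  define \<beta> where "\<beta> q k l = (\<Sum>j\<in>UNIV. dd q j (G k) * adjg (dmat q) j l)" for q k l
  define \<omega> where "\<omega> q k m = (\<Sum>j\<in>UNIV. \<Sum>l\<in>UNIV. \<kappa> q j l * adjg2 (dmat q) j l k m)
     + 2 * \<beta> q k m - 2 * \<beta> q m k" for q k m
  have loc: "2 * (G k * bez q) = (\<Sum>m\<in>UNIV. \<omega> q k m * F m)" if "q \<in> A" for q k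
    unfolding \<omega>_def \<kappa>_def \<beta>_def by (rule koszul_local[OF that syz])
  have \<kappa>0: "\<kappa> q j j = 0" for q j by (simp add: \<kappa>_def kap_def)
  have anti: "\<omega> q m k = - \<omega> q k m" for q k m
  proof -
    have "(\<Sum>j\<in>UNIV. \<Sum>l\<in>UNIV. \<kappa> q j l * adjg2 (dmat q) j l m k)
        = - (\<Sum>j\<in>UNIV. \<Sum>l\<in>UNIV. \<kappa> q j l * adjg2 (dmat q) j l k m)"
      unfolding sum_negf[symmetric]
    proof (intro sum.cong refl)
      fix j l
      show "\<kappa> q j l * adjg2 (dmat q) j l m k = - (\<kappa> q j l * adjg2 (dmat q) j l k m)"
        by (cases "j = l") (simp_all add: \<kappa>0 adjg2_swap[of j l _ m k])
    qed
    then show ?thesis by (simp add: \<omega>_def)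
  qed
  have diag: "\<omega> q k k = 0" for q k
  proof -
    have "\<kappa> q j l * adjg2 (dmat q) j l k k = 0" for j l
      by (cases "j = l") (simp_all add: \<kappa>0 adjg2_same)
    then show ?thesis by (simp add: \<omega>_def)
  qed
  have pf_adjg: "poly_family (\<lambda>q. adjg (dmat q) j l)" for j l
    unfolding adjg_def
  proof (rule pf_det)
    fix i i'
    show "poly_family (\<lambda>q. repl_col (dmat q) j (unit_fun l) $ i $ i')"
      by (cases "i' = j") (simp_all add: repl_col_def pf_const pf_dd)
  qed
  have pf_adjg2: "poly_family (\<lambda>q. adjg2 (dmat q) j l k m)" for j l k m
    unfolding adjg2_def
  proof (rule pf_det)
    fix i i'
    show "poly_family (\<lambda>q. repl_col (repl_col (dmat q) l (unit_fun k)) j (unit_fun m) $ i $ i')"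
      by (cases "i' = j"; cases "i' = l") (simp_all add: repl_col_def pf_const pf_dd)
  qed
  have "poly_family (\<lambda>q. \<omega> q k m)" for k m
    unfolding \<omega>_def \<kappa>_def \<beta>_def
    by (intro pf_diff pf_add pf_sum pf_mult pf_const pf_kap pf_dd pf_adjg pf_adjg2)
  then have "\<exists>H. (\<Sum>q\<in>A. Const (c q) * \<omega> q k m) = Var None ^ rho * H" for k m
    by (rule family_sum[OF c])
  then obtain H where H: "\<And>k m. (\<Sum>q\<in>A. Const (c q) * \<omega> q k m) = Var None ^ rho * H k m" by metis
  have H_anti: "H m k = - H k m" for k m
  proof -
    have "Var None ^ rho * H m k = - (Var None ^ rho * H k m)"
      unfolding H[symmetric] sum_negf[symmetric]
      by (intro sum.cong refl) (subst anti, simp only: mult_minus_right)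
    then have "Var None ^ rho * H m k = Var None ^ rho * (- H k m)" by simp
    then show ?thesis unfolding Var_power by (rule mult_single_cancel)
  qed
  have H_diag: "H k k = 0" for k
  proof -
    have "Var None ^ rho * H k k = Var None ^ rho * 0" unfolding H[symmetric] diag by simp
    then show ?thesis unfolding Var_power by (rule mult_single_cancel)
  qed
  have GH: "2 * (Const \<gamma> * G k) = (\<Sum>m\<in>UNIV. H k m * F m)" for k
  proof -
    have "Var None ^ rho * (2 * (Const \<gamma> * G k)) = 2 * (G k * (\<Sum>q\<in>A. Const (c q) * bez q))"
      unfolding \<gamma>(1) by (simp only: ac_simps)
    also have "\<dots> = (\<Sum>q\<in>A. Const (c q) * (2 * (G k * bez q)))"
      unfolding sum_distrib_left by (simp only: ac_simps)
    also have "\<dots> = (\<Sum>q\<in>A. \<Sum>m\<in>UNIV. Const (c q) * \<omega> q k m * F m)"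
      by (rule sum.cong) (simp_all only: loc sum_distrib_left mult.assoc)
    also have "\<dots> = (\<Sum>m\<in>UNIV. \<Sum>q\<in>A. Const (c q) * \<omega> q k m * F m)"
      by (rule sum.swap)
    also have "\<dots> = Var None ^ rho * (\<Sum>m\<in>UNIV. H k m * F m)"
      unfolding sum_distrib_right[symmetric] H by (simp only: sum_distrib_left mult.assoc)
    finally show ?thesis unfolding Var_power by (rule mult_single_cancel)
  qed
  let ?u = "Const (1 / (2 * \<gamma>)) :: ('m option, 'k) mpoly"
  have two_Const: "(2 :: ('m option, 'k) mpoly) = Const 2" by (rule single_numeral[symmetric])
  have "?u * (2 * (Const \<gamma> * g)) = g" for g
    unfolding two_Const using \<gamma>(2) two by (simp add: mult.assoc[symmetric] mult_single del: single_numeral)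
  then have "G k = ?u * (\<Sum>m\<in>UNIV. H k m * F m)" for k
    by (metis GH)
  then have "G k = (\<Sum>l\<in>UNIV. (?u * H k l) * F l)" for k
    by (simp only: sum_distrib_left mult.assoc)
  moreover have "?u * H l k = - (?u * H k l)" for k l by (subst H_anti) simp
  moreover have "?u * H k k = 0" for k by (simp add: H_diag)
  ultimately show thesis by (rule that[rotated 2])
qed

end

section \<open>Dimensions of spaces of polynomials\<close>

text \<open>
  Repeats the structure behind \<open>Kdim\<close>, so that the theory of bases becomes
  available for it.
\<close>

interpretation mp: vector_space "\<lambda>(c::'k::field) (p::('i, 'k) mpoly). Const c * p"
  by (rule vector_space_mpoly)

lemma Kdim_dim: "Kdim V = mp.dim V"
  by (simp add: Kdim_def)

definition fin_dim :: "('i, 'k::field) mpoly set \<Rightarrow> bool" where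
  "fin_dim V \<longleftrightarrow> (\<exists>B. finite B \<and> V \<subseteq> mp.span B)"

lemma fin_dim_subset: "fin_dim W \<Longrightarrow> V \<subseteq> W \<Longrightarrow> fin_dim V"
  unfolding fin_dim_def by blast

lemma fin_dim_independent:
  assumes "fin_dim V" "B \<subseteq> V" "mp.independent B"
  shows "finite B"
proof -
  obtain S where S: "finite S" "V \<subseteq> mp.span S" using assms(1) unfolding fin_dim_def by blast
  then have "B \<subseteq> mp.span S" using assms(2) by blast
  with S(1) assms(3) show ?thesis using mp.independent_span_bound by blast
qed

lemma Kdim_basis:
  assumes "fin_dim V" "mp.subspace V"
  obtains B where "B \<subseteq> V" "finite B" "mp.independent B" "mp.span B = V" "card B = Kdim V"
proof -
  obtain B where B: "B \<subseteq> V" "mp.independent B" "V \<subseteq> mp.span B" "card B = mp.dim V"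
    using mp.basis_exists[of V] by blast
  moreover have "mp.span B \<subseteq> V" using B(1) assms(2) by (rule mp.span_minimal)
  ultimately have "mp.span B = V" by blast
  then show thesis using that[OF B(1) fin_dim_independent[OF assms(1) B(1,2)] B(2)] B(4) by (simp add: Kdim_dim)
qed

lemma Kdim_unique: "B \<subseteq> V \<Longrightarrow> V \<subseteq> mp.span B \<Longrightarrow> mp.independent B \<Longrightarrow> card B = n \<Longrightarrow> Kdim V = n"
  unfolding Kdim_dim by (rule mp.dim_unique)

lemma Kdim_extend:
  assumes "fin_dim W" "mp.subspace W" "B \<subseteq> W" "mp.independent B"
  obtains C where "B \<subseteq> C" "finite C" "mp.independent C" "mp.span C = W" "card C = Kdim W"
proof -
  obtain C where C: "B \<subseteq> C" "C \<subseteq> W" "mp.independent C" "W \<subseteq> mp.span C"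
    using mp.maximal_independent_subset_extend[OF assms(3,4)] by blast
  have "finite C" by (rule fin_dim_independent[OF assms(1) C(2,3)])
  moreover have "mp.span C = W" using C mp.span_minimal[OF C(2) assms(2)] by blast
  moreover have "card C = Kdim W" using Kdim_unique[OF C(2,4,3)] by metis
  ultimately show thesis using that[OF C(1) _ C(3)] by simp
qed

lemma Kdim_mono:
  assumes "fin_dim W" "mp.subspace V" "mp.subspace W" "V \<subseteq> W"
  shows "Kdim V \<le> Kdim W"
proof -
  obtain B where B: "B \<subseteq> V" "finite B" "mp.independent B" "mp.span B = V" "card B = Kdim V"
    by (rule Kdim_basis[OF fin_dim_subset[OF assms(1,4)] assms(2)])
  have "B \<subseteq> W" using B(1) assms(4) by blast
  then obtain C where C: "B \<subseteq> C" "finite C" "mp.independent C" "mp.span C = W" "card C = Kdim W"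
    by (rule Kdim_extend[OF assms(1,3) _ B(3)])
  show ?thesis using card_mono[OF C(2,1)] B(5) C(5) by simp
qed

lemma Kdim_eq_imp:
  assumes "fin_dim W" "mp.subspace V" "mp.subspace W" "V \<subseteq> W" "Kdim V = Kdim W"
  shows "V = W"
proof -
  obtain B where B: "B \<subseteq> V" "finite B" "mp.independent B" "mp.span B = V" "card B = Kdim V"
    by (rule Kdim_basis[OF fin_dim_subset[OF assms(1,4)] assms(2)])
  have "B \<subseteq> W" using B(1) assms(4) by blast
  then obtain C where C: "B \<subseteq> C" "finite C" "mp.independent C" "mp.span C = W" "card C = Kdim W"
    by (rule Kdim_extend[OF assms(1,3) _ B(3)])
  have "B = C" using card_subset_eq[OF C(2,1)] B(5) C(5) assms(5) by simp
  then show ?thesis using B(4) C(4) by simp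
qed

lemma Kdim_zero [simp]: "Kdim {0 :: ('i, 'k::field) mpoly} = 0"
  by (rule Kdim_unique[of "{}"]) (simp_all add: mp.independent_empty)

lemma subspace_Const: "mp.subspace V \<longleftrightarrow>
    0 \<in> V \<and> (\<forall>p\<in>V. \<forall>q\<in>V. p + q \<in> V) \<and> (\<forall>c. \<forall>p\<in>V. Const c * p \<in> V)"
  unfolding mp.subspace_def by blast

lemma Kdim_add_vector:
  assumes J: "fin_dim J" "mp.subspace J" and v: "v \<notin> J"
  shows "Kdim {p. \<exists>j\<in>J. \<exists>c. p = j + Const c * v} = Kdim J + 1"
    and "fin_dim {p. \<exists>j\<in>J. \<exists>c. p = j + Const c * v}"
    and "mp.subspace {p. \<exists>j\<in>J. \<exists>c. p = j + Const c * v}"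
proof -
  let ?W = "{p. \<exists>j\<in>J. \<exists>c. p = j + Const c * v}"
  obtain B where B: "B \<subseteq> J" "finite B" "mp.independent B" "mp.span B = J" "card B = Kdim J"
    by (rule Kdim_basis[OF J])
  have W: "?W = mp.span (insert v B)"
  proof (rule set_eqI)
    fix p
    have "p \<in> mp.span (insert v B) \<longleftrightarrow> (\<exists>c. p - Const c * v \<in> J)"
      by (simp add: mp.span_insert B(4))
    also have "\<dots> \<longleftrightarrow> p \<in> ?W"
    proof
      assume "\<exists>c. p - Const c * v \<in> J"
      then obtain c where "p - Const c * v \<in> J" by blast
      moreover have "p = (p - Const c * v) + Const c * v" by simp
      ultimately show "p \<in> ?W" by blast
    next
      assume "p \<in> ?W"
      then obtain j c where "j \<in> J" "p = j + Const c * v" by blast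
      then have "p - Const c * v \<in> J" by simp
      then show "\<exists>c. p - Const c * v \<in> J" by blast
    qed
    finally show "p \<in> ?W \<longleftrightarrow> p \<in> mp.span (insert v B)" by blast
  qed
  have ind: "mp.independent (insert v B)"
    using B v by (intro mp.independent_insertI) auto
  have "v \<notin> B" using B v by blast
  then have card: "card (insert v B) = Kdim J + 1" using B by simp
  show "Kdim ?W = Kdim J + 1"
    unfolding W by (rule Kdim_unique[OF mp.span_superset subset_refl ind card])
  show "fin_dim ?W" unfolding W fin_dim_def using B(2) by (intro exI[of _ "insert v B"]) simp
  show "mp.subspace ?W" unfolding W by (rule mp.subspace_span)
qed

lemma Kdim_functional:
  assumes V: "fin_dim V" "mp.subspace V"
    and l: "\<And>p q. l (p + q) = l p + l q" "\<And>c p. l (Const c * p) = c * (l p :: 'k::field)"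
  shows "Kdim V = Kdim {p\<in>V. l p = 0} + (if \<exists>p\<in>V. l p \<noteq> 0 then 1 else 0)"
proof (cases "\<exists>p\<in>V. l p \<noteq> 0")
  case False
  then have "{p\<in>V. l p = 0} = V" by auto
  then show ?thesis using False by auto
next
  case True
  then obtain v where v: "v \<in> V" "l v \<noteq> 0" by blast
  let ?J = "{p\<in>V. l p = 0}"
  have l0: "l 0 = 0" using l(2)[of 0 0] by simp
  have J: "mp.subspace ?J"
    using V(2) unfolding subspace_Const by (simp add: l l0)
  have Jf: "fin_dim ?J" by (rule fin_dim_subset[OF V(1)]) auto
  have eqV: "V = {p. \<exists>j\<in>?J. \<exists>c. p = j + Const c * v}"
  proof (intro set_eqI iffI)
    fix p assume p: "p \<in> V"
    define c where "c = l p / l v"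
    define j where "j = p + Const (- c) * v"
    have "j \<in> V" unfolding j_def using V(2) p v(1) unfolding subspace_Const by blast
    moreover have "l j = 0" unfolding j_def l c_def using v(2) by simp
    moreover have "p = j + Const c * v"
      unfolding j_def by (simp add: single_uminus)
    ultimately show "p \<in> {p. \<exists>j\<in>?J. \<exists>c. p = j + Const c * v}" by blast
  next
    fix p assume "p \<in> {p. \<exists>j\<in>?J. \<exists>c. p = j + Const c * v}"
    then show "p \<in> V" using V(2) v(1) unfolding subspace_Const by blast
  qed
  have vJ: "v \<notin> ?J" using v by simp
  have "Kdim V = Kdim ?J + 1"
    by (rule trans[OF arg_cong[OF eqV, of Kdim] Kdim_add_vector(1)[OF Jf J vJ]])
  then show ?thesis using True by simp
qed

text \<open>
  Dimension formula for the sum of \<open>W\<close> and the image of \<open>T\<close> on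
  \<open>P\<close>, by extending a basis of \<open>U\<close> to one of \<open>P\<close>: the
  images of the new basis vectors are independent modulo \<open>W\<close>.
\<close>

lemma Kdim_sum_image:
  assumes W: "fin_dim W" "mp.subspace W" and P: "fin_dim P" "mp.subspace P"
    and T: "\<And>p q. T (p + q) = T p + T q" "\<And>c p. T (Const c * p) = Const c * (T p :: ('i, 'k::field) mpoly)"
    and U: "U = {p\<in>P. T p \<in> W}"
  shows "Kdim {x. \<exists>w\<in>W. \<exists>p\<in>P. x = w + T p} + Kdim U = Kdim W + Kdim P"
proof -
  have T0: "T 0 = 0" using T(2)[of 0 0] by simp
  have Us: "mp.subspace U"
    using W(2) P(2) unfolding U subspace_Const by (simp add: T T0)
  have Uf: "fin_dim U" unfolding U by (rule fin_dim_subset[OF P(1)]) auto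
  obtain B where B: "B \<subseteq> U" "finite B" "mp.independent B" "mp.span B = U" "card B = Kdim U"
    by (rule Kdim_basis[OF Uf Us])
  have "B \<subseteq> P" using B(1) U by auto
  then obtain C where C: "B \<subseteq> C" "finite C" "mp.independent C" "mp.span C = P" "card C = Kdim P"
    by (rule Kdim_extend[OF P _ B(3)])
  define J where "J D = {x. \<exists>w\<in>W. \<exists>p\<in>mp.span (B \<union> D). x = w + T p}" for D
  have "Kdim (J D) = Kdim W + card D \<and> fin_dim (J D) \<and> mp.subspace (J D)"
    if "finite D" "D \<subseteq> C - B" for D
    using that
  proof (induction D)
    case empty
    have "J {} = W"
    proof (intro set_eqI iffI)
      fix x assume "x \<in> J {}"
      then obtain w p where "w \<in> W" "p \<in> U" "x = w + T p" by (auto simp: J_def B(4))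
      then show "x \<in> W" using W(2) U unfolding subspace_Const by blast
    next
      fix x assume "x \<in> W"
      moreover have "0 \<in> mp.span (B \<union> {})" by (rule mp.span_zero)
      ultimately show "x \<in> J {}" unfolding J_def using T0 by (intro CollectI bexI[of _ x] bexI[of _ 0]) auto
    qed
    then show ?case using W by simp
  next
    case (insert d D)
    then have IH: "Kdim (J D) = Kdim W + card D" "fin_dim (J D)" "mp.subspace (J D)" by auto
    have dC: "d \<in> C" "d \<notin> B \<union> D" using insert by auto
    have "mp.independent (insert d (B \<union> D))"
      using C(3) by (rule mp.independent_mono) (use insert.prems C(1) in auto)
    then have dsp: "d \<notin> mp.span (B \<union> D)" using dC(2) by (simp add: mp.independent_insert)
    have spP: "mp.span (B \<union> D) \<subseteq> P" "d \<in> P"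
      using insert.prems C(1,4) mp.span_mono[of "B \<union> D" C] mp.span_superset[of C] by auto
    have Td: "T d \<notin> J D"
    proof
      assume "T d \<in> J D"
      then obtain w p where wp: "w \<in> W" "p \<in> mp.span (B \<union> D)" "T d = w + T p"
        unfolding J_def by blast
      have "T (d + Const (- 1) * p) = w" unfolding T wp(3) by (simp add: single_uminus)
      moreover have "d + Const (- 1) * p \<in> P"
        using P(2) spP wp(2) unfolding subspace_Const by blast
      ultimately have "d + Const (- 1) * p \<in> U" unfolding U using wp(1) by simp
      then have "d + Const (- 1) * p \<in> mp.span (B \<union> D)"
        using B(4) mp.span_mono[of B "B \<union> D"] by auto
      then have "(d + Const (- 1) * p) + p \<in> mp.span (B \<union> D)" using wp(2) by (rule mp.span_add)
      then show False using dsp by (simp add: single_uminus)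
    qed
    have "J (insert d D) = {x. \<exists>j\<in>J D. \<exists>c. x = j + Const c * T d}"
    proof (intro set_eqI iffI)
      fix x assume "x \<in> J (insert d D)"
      then obtain w p where wp: "w \<in> W" "p \<in> mp.span (insert d (B \<union> D))" "x = w + T p"
        unfolding J_def by auto
      from wp(2) obtain c where c: "p - Const c * d \<in> mp.span (B \<union> D)"
        unfolding mp.span_insert by auto
      have "p = (p - Const c * d) + Const c * d" by simp
      then have "T p = T (p - Const c * d) + Const c * T d" using T by metis
      then have "x = (w + T (p - Const c * d)) + Const c * T d" using wp(3) by simp
      moreover have "w + T (p - Const c * d) \<in> J D" unfolding J_def using wp(1) c by blast
      ultimately show "x \<in> {x. \<exists>j\<in>J D. \<exists>c. x = j + Const c * T d}" by blast
    next
      fix x assume "x \<in> {x. \<exists>j\<in>J D. \<exists>c. x = j + Const c * T d}"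
      then obtain w p c where wp: "w \<in> W" "p \<in> mp.span (B \<union> D)" "x = w + T p + Const c * T d"
        unfolding J_def by blast
      have "p + Const c * d \<in> mp.span (B \<union> insert d D)"
        using wp(2) mp.span_mono[of "B \<union> D" "B \<union> insert d D"] mp.span_base[of d "B \<union> insert d D"]
        by (intro mp.span_add mp.span_scale) auto
      moreover have "x = w + T (p + Const c * d)" unfolding wp(3) T by (rule add.assoc)
      ultimately show "x \<in> J (insert d D)" unfolding J_def using wp(1) by blast
    qed
    then show ?case
      using Kdim_add_vector[OF IH(2,3) Td] IH(1) insert.hyps by simp
  qed
  from this[of "C - B"] have "Kdim (J (C - B)) = Kdim W + card (C - B)" using C(2) by simp
  moreover have "B \<union> (C - B) = C" using C(1) by auto
  then have "J (C - B) = {x. \<exists>w\<in>W. \<exists>p\<in>P. x = w + T p}" by (simp add: J_def C(4))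
  moreover have "card (C - B) + card B = card C"
    using C(1,2) B(2) by (metis card_Diff_subset card_mono le_add_diff_inverse2)
  ultimately show ?thesis using B(5) C(5) by simp
qed

lemma whom_subspace: "additive_wt wt \<Longrightarrow> mp.subspace (whom wt d)"
  unfolding subspace_Const by (simp add: whom_add whom_scale)

lemma ideal_subspace: "is_ideal J \<Longrightarrow> mp.subspace J"
  unfolding subspace_Const by (simp add: ideal_zero ideal_add ideal_mult)

lemma fin_dim_whom:
  fixes wt :: "('a \<Rightarrow>\<^sub>0 nat) \<Rightarrow> 'w"
  assumes "finite {t. wt t = d}"
  shows "fin_dim (whom wt d :: ('a, 'b::field) mpoly set)"
  unfolding fin_dim_def
proof (intro exI conjI subsetI)
  show "finite ((\<lambda>t. Poly_Mapping.single t (1::'b)) ` {t. wt t = d})" using assms by simp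
  fix p :: "('a, 'b) mpoly" assume p: "p \<in> whom wt d"
  have "(\<Sum>t\<in>Poly_Mapping.keys p. Const (Poly_Mapping.lookup p t) * Poly_Mapping.single t 1)
      \<in> mp.span ((\<lambda>t. Poly_Mapping.single t (1::'b)) ` {t. wt t = d})"
    using p by (intro mp.span_sum mp.span_scale mp.span_base) (auto simp: whom_def)
  then show "p \<in> mp.span ((\<lambda>t. Poly_Mapping.single t (1::'b)) ` {t. wt t = d})"
    using mpoly_sum_monomials[of p] by (simp add: mult_single)
qed

lemma finite_tdeg_le: "finite {t :: 'i::finite \<Rightarrow>\<^sub>0 nat. tdeg t \<le> d}"
proof -
  have "Poly_Mapping.lookup ` {t :: 'i \<Rightarrow>\<^sub>0 nat. tdeg t \<le> d} \<subseteq> PiE UNIV (\<lambda>_. {..d})"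
  proof (intro image_subsetI)
    fix t :: "'i \<Rightarrow>\<^sub>0 nat" assume "t \<in> {t. tdeg t \<le> d}"
    moreover have "Poly_Mapping.lookup t v \<le> tdeg t" for v
      unfolding tdeg_def by (rule member_le_sum) auto
    ultimately show "Poly_Mapping.lookup t \<in> PiE UNIV (\<lambda>_. {..d})"
      by (auto intro: order_trans)
  qed
  then have "finite (Poly_Mapping.lookup ` {t :: 'i \<Rightarrow>\<^sub>0 nat. tdeg t \<le> d})"
    by (rule finite_subset) (simp add: finite_PiE)
  then show ?thesis by (rule finite_imageD) (rule inj_onI, rule poly_mapping_eqI, simp)
qed

lemma fin_dim_hom_comp: "fin_dim (hom_comp d :: ('i::finite, 'k::field) mpoly set)"
  unfolding hom_comp_whom
  by (rule fin_dim_whom) (rule finite_subset[OF _ finite_tdeg_le[of d]], auto)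

lemma tdeg_bideg: "tdeg t = fst (bideg t) + snd (bideg t)"
proof -
  have "(\<Sum>v\<in>(UNIV :: ('a + 'b) set). Poly_Mapping.lookup t v)
     = (\<Sum>v\<in>UNIV. Poly_Mapping.lookup t (Inl v)) + (\<Sum>v\<in>UNIV. Poly_Mapping.lookup t (Inr v))"
    by (subst UNIV_Plus_UNIV[symmetric], subst sum.Plus) (simp_all add: comp_def)
  then show ?thesis by (simp add: tdeg_def bideg_def)
qed

lemma fin_dim_bihom_comp: "fin_dim (bihom_comp i j :: ('m::finite, 'n::finite, 'k::field) bipoly set)"
  unfolding bihom_comp_whom
  by (rule fin_dim_whom) (rule finite_subset[OF _ finite_tdeg_le[of "i + j"]], auto simp: tdeg_bideg)

lemma subspace_Int: "mp.subspace U \<Longrightarrow> mp.subspace V \<Longrightarrow> mp.subspace (U \<inter> V)"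
  unfolding subspace_Const by blast

section \<open>Evaluation at finitely many vectors\<close>

definition vanish_in :: "('i, 'k::field) mpoly set \<Rightarrow> ('i \<Rightarrow> 'k) set \<Rightarrow> ('i, 'k) mpoly set" where
  "vanish_in C N = {F\<in>C. \<forall>u\<in>N. peval u F = 0}"

lemma vanish_in_subspace: "mp.subspace C \<Longrightarrow> mp.subspace (vanish_in C N)"
  unfolding subspace_Const vanish_in_def by simp

lemma vanish_in_subset: "vanish_in C N \<subseteq> C"
  by (auto simp: vanish_in_def)

text \<open>
  The rank of evaluating the polynomials of \<open>C\<close> at the vectors of \<open>N\<close>.
  On a graded component this is the Hilbert function of the points.
\<close>

definition eval_rank :: "('i, 'k::field) mpoly set \<Rightarrow> ('i \<Rightarrow> 'k) set \<Rightarrow> nat" where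
  "eval_rank C N = Kdim C - Kdim (vanish_in C N)"

definition separates :: "('i, 'k::field) mpoly set \<Rightarrow> ('i \<Rightarrow> 'k) set \<Rightarrow> ('i \<Rightarrow> 'k) \<Rightarrow> bool" where
  "separates C N u \<longleftrightarrow> (\<exists>F\<in>C. (\<forall>w\<in>N. peval w F = 0) \<and> peval u F \<noteq> 0)"

lemma Kdim_vanish_insert:
  assumes "fin_dim C" "mp.subspace C"
  shows "Kdim (vanish_in C N) = Kdim (vanish_in C (insert u N)) + (if separates C N u then 1 else 0)"
proof -
  have "{p \<in> vanish_in C N. peval u p = 0} = vanish_in C (insert u N)" by (auto simp: vanish_in_def)
  moreover have "(\<exists>p\<in>vanish_in C N. peval u p \<noteq> 0) \<longleftrightarrow> separates C N u"
    by (auto simp: vanish_in_def separates_def)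
  ultimately show ?thesis
    using Kdim_functional[OF fin_dim_subset[OF assms(1) vanish_in_subset] vanish_in_subspace[OF assms(2)],
        of "peval u" N] by simp
qed

lemma eval_rank_insert:
  assumes "fin_dim C" "mp.subspace C"
  shows "eval_rank C (insert u N) = eval_rank C N + (if separates C N u then 1 else 0)"
proof -
  have "Kdim (vanish_in C N) \<le> Kdim C"
    by (rule Kdim_mono[OF assms(1) vanish_in_subspace[OF assms(2)] assms(2) vanish_in_subset])
  then show ?thesis using Kdim_vanish_insert[OF assms, of N u] by (auto simp: eval_rank_def)
qed

lemma eval_rank_empty [simp]: "eval_rank C {} = 0"
  by (simp add: eval_rank_def vanish_in_def)

lemma eval_rank_le_card:
  assumes "fin_dim C" "mp.subspace C" "finite N"
  shows "eval_rank C N \<le> card N"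
  using assms(3) by (induction N) (auto simp: eval_rank_insert[OF assms(1,2)])

text \<open>
  Adding a point raises the rank by one iff it is separated from the previous ones; the rank is
  full iff this happens in every order, that is, for every point taken last.
\<close>

lemma eval_rank_eq_card:
  assumes C: "fin_dim C" "mp.subspace C" and N: "finite N"
  shows "eval_rank C N = card N \<longleftrightarrow> (\<forall>u\<in>N. separates C (N - {u}) u)"
proof
  assume eq: "eval_rank C N = card N"
  show "\<forall>u\<in>N. separates C (N - {u}) u"
  proof
    fix u assume u: "u \<in> N"
    have "eval_rank C N = eval_rank C (N - {u}) + (if separates C (N - {u}) u then 1 else 0)"
      using eval_rank_insert[OF C, of u "N - {u}"] u by (simp add: insert_absorb)
    moreover have "eval_rank C (N - {u}) \<le> card N - 1"
      using eval_rank_le_card[OF C, of "N - {u}"] N u by simp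
    moreover have "card N \<noteq> 0" using N u by auto
    ultimately show "separates C (N - {u}) u" using eq by (auto split: if_splits)
  qed
next
  assume "\<forall>u\<in>N. separates C (N - {u}) u"
  with N show "eval_rank C N = card N"
  proof (induction N)
    case (insert u N)
    have "separates C (N - {w}) w" if "w \<in> N" for w
      using insert.prems[rule_format, of w] that insert.hyps unfolding separates_def by auto
    moreover have "separates C N u" using insert.prems[rule_format, of u] insert.hyps by simp
    ultimately show ?case using insert by (simp add: eval_rank_insert[OF C])
  qed simp
qed

lemma eval_rank_remove:
  assumes C: "fin_dim C" "mp.subspace C" and "u \<in> N"
  shows "eval_rank C (N - {u}) + (if separates C (N - {u}) u then 1 else 0) = eval_rank C N"
  using eval_rank_insert[OF C, of u "N - {u}"] assms(3) by (simp add: insert_absorb)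

text \<open>
  The restrictions to \<open>Z\<close> of the members of \<open>V\<close> form a subspace of the
  functions on \<open>Z\<close>, and the \<open>w q\<close> describe a linear projection onto
  it. Applied to one of the two groups of variables it reduces bihomogeneous polynomials, modulo
  those vanishing on \<open>Z\<close>, to sums of products.
\<close>

lemma projection_forms:
  fixes V :: "('i, 'k::field) mpoly set"
  assumes "mp.subspace V" "finite Z"
  shows "\<exists>w. (\<forall>q\<in>Z. w q \<in> V) \<and> (\<forall>p\<in>V. \<forall>z\<in>Z. peval z p = (\<Sum>q\<in>Z. peval q p * peval z (w q)))"
  using assms(2,1)
proof (induction Z arbitrary: V)
  case (insert a Z)
  show ?case
  proof (cases "\<exists>e\<in>V. peval a e \<noteq> 0")
    case False
    obtain w where w: "\<forall>q\<in>Z. w q \<in> V" "\<forall>p\<in>V. \<forall>z\<in>Z. peval z p = (\<Sum>q\<in>Z. peval q p * peval z (w q))"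
      using insert.IH[OF insert.prems] by blast
    have eq: "(\<Sum>q\<in>insert a Z. peval q p * peval z ((w(a := 0)) q)) = (\<Sum>q\<in>Z. peval q p * peval z (w q))" for p z
      using insert.hyps by (auto intro!: sum.cong)
    have "\<forall>q\<in>insert a Z. (w(a := 0)) q \<in> V"
      using w(1) insert.prems by (auto simp: subspace_Const)
    moreover have "\<forall>p\<in>V. \<forall>z\<in>insert a Z. peval z p = (\<Sum>q\<in>insert a Z. peval q p * peval z ((w(a := 0)) q))"
      unfolding eq
    proof (intro ballI)
      fix p z assume pz: "p \<in> V" "z \<in> insert a Z"
      show "peval z p = (\<Sum>q\<in>Z. peval q p * peval z (w q))"
      proof (cases "z = a")
        case True
        have "peval a (w q) = 0" if "q \<in> Z" for q using w(1) that False by blast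
        moreover have "peval a p = 0" using False pz(1) by blast
        ultimately show ?thesis unfolding True by simp
      next
        case False
        then show ?thesis using w(2) pz by blast
      qed
    qed
    ultimately show ?thesis by (intro exI conjI)
  next
    case True
    then obtain e0 where e0: "e0 \<in> V" "peval a e0 \<noteq> 0" by blast
    define e where "e = Const (1 / peval a e0) * e0"
    have e: "e \<in> V" "peval a e = 1"
      unfolding e_def using e0 insert.prems by (simp_all add: subspace_Const)
    let ?V = "{p\<in>V. peval a p = 0}"
    have V': "mp.subspace ?V" using insert.prems unfolding subspace_Const by simp
    obtain w where w: "\<forall>q\<in>Z. w q \<in> ?V" "\<forall>p\<in>?V. \<forall>z\<in>Z. peval z p = (\<Sum>q\<in>Z. peval q p * peval z (w q))"
      using insert.IH[OF V'] by blast
    define wa where "wa = e + Const (- 1) * (\<Sum>q\<in>Z. Const (peval q e) * w q)"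
    have sumV: "(\<Sum>q\<in>Z. Const (peval q e) * w q) \<in> V"
      using w(1) insert.prems by (intro mp.subspace_sum) (auto simp: subspace_Const)
    then have waV: "wa \<in> V" unfolding wa_def using e(1) insert.prems unfolding subspace_Const by blast
    have wa_z: "peval z wa = peval z e - (\<Sum>q\<in>Z. peval q e * peval z (w q))" for z
      by (simp add: wa_def)
    have eq: "(\<Sum>q\<in>insert a Z. peval q p * peval z ((w(a := wa)) q))
        = peval a p * peval z wa + (\<Sum>q\<in>Z. peval q p * peval z (w q))" for p z
      using insert.hyps by (auto intro!: sum.cong)
    have main: "peval z p = peval a p * peval z wa + (\<Sum>q\<in>Z. peval q p * peval z (w q))"
      if p: "p \<in> V" and z: "z \<in> insert a Z" for p z
    proof (cases "z = a")
      case True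
      have "peval a (w q) = 0" if "q \<in> Z" for q using w(1) that by blast
      then show ?thesis unfolding wa_z True using e(2) by simp
    next
      case False
      then have zZ: "z \<in> Z" using z by simp
      let ?r = "p + Const (- peval a p) * e"
      have "?r \<in> V" using p e(1) insert.prems unfolding subspace_Const by blast
      moreover have "peval a ?r = 0" using e(2) by simp
      ultimately have "?r \<in> ?V" by blast
      then have "peval z ?r = (\<Sum>q\<in>Z. peval q ?r * peval z (w q))" using w(2) zZ by blast
      also have "\<dots> = (\<Sum>q\<in>Z. peval q p * peval z (w q)) - peval a p * (\<Sum>q\<in>Z. peval q e * peval z (w q))"
      proof -
        have "(x + (- y) * v) * t = x * t - y * (v * t)" for x y v t :: 'k
          by (simp add: left_diff_distrib)
        then have "peval q ?r * t = peval q p * t - peval a p * (peval q e * t)" for q t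
          by (simp only: peval_add peval_mult peval_Const)
        then show ?thesis by (simp only: sum_subtractf sum_distrib_left)
      qed
      finally have h: "peval z ?r = (\<Sum>q\<in>Z. peval q p * peval z (w q))
          - peval a p * (\<Sum>q\<in>Z. peval q e * peval z (w q))" .
      have alg: "x = y * (v - t) + s" if "x + (- y) * v = s - y * t" for x y v s t :: 'k
      proof -
        have "x = (x + (- y) * v) + y * v" by simp
        also have "\<dots> = (s - y * t) + y * v" by (simp only: that)
        finally show ?thesis by (simp add: right_diff_distrib)
      qed
      show ?thesis
        unfolding wa_z by (rule alg) (use h in \<open>simp only: peval_add peval_mult peval_Const\<close>)
    qed
    have "\<forall>q\<in>insert a Z. (w(a := wa)) q \<in> V" using w(1) waV by auto
    moreover have "\<forall>p\<in>V. \<forall>z\<in>insert a Z. peval z p = (\<Sum>q\<in>insert a Z. peval q p * peval z ((w(a := wa)) q))"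
      unfolding eq using main by (intro ballI)
    ultimately show ?thesis by (intro exI conjI)
  qed
qed simp

section \<open>Homogeneous vanishing ideals\<close>

definition hvan :: "(('i \<Rightarrow>\<^sub>0 nat) \<Rightarrow> 'w) \<Rightarrow> ('i \<Rightarrow> 'k::field) set \<Rightarrow> ('i, 'k) mpoly set" where
  "hvan wt N = ideal_gen {F. (\<exists>d. F \<in> whom wt d) \<and> (\<forall>u\<in>N. peval u F = 0)}"

lemma is_ideal_hvan [simp]: "is_ideal (hvan wt N)"
  by (simp add: hvan_def)

text \<open>
  A homogeneous ideal defined through its homogeneous members is determined by the homogeneous
  components of its members.
\<close>

lemma hvan_iff:
  assumes wt: "additive_wt wt"
  shows "x \<in> hvan wt N \<longleftrightarrow> (\<forall>d. \<forall>u\<in>N. peval u (pcomp wt d x) = 0)"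
proof
  let ?J = "{x. \<forall>d. \<forall>u\<in>N. peval u (pcomp wt d x) = 0}"
  have mono: "peval u (pcomp wt e (Poly_Mapping.single t c * a)) = 0" if "a \<in> ?J" "u \<in> N" for t c a e u
  proof (cases "\<exists>e'. e = wt t + e'")
    case True
    then obtain e' where e: "e = wt t + e'" by blast
    have "pcomp wt e (Poly_Mapping.single t c * a) = Poly_Mapping.single t c * pcomp wt e' a"
      unfolding e by (rule pcomp_mult_whom[OF wt whom_single[OF refl]])
    moreover have "peval u (pcomp wt e' a) = 0" using that by blast
    ultimately show ?thesis by simp
  next
    case False
    then have "pcomp wt e (Poly_Mapping.single t c * a) = 0"
      by (intro pcomp_mult_whom_0[OF wt whom_single[OF refl]]) blast
    then show ?thesis by simp
  qed
  have J: "is_ideal ?J"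
  proof (rule is_idealI)
    show "0 \<in> ?J" by simp
    show "a + b \<in> ?J" if "a \<in> ?J" "b \<in> ?J" for a b using that by simp
    show "c * a \<in> ?J" if a: "a \<in> ?J" for a c
    proof (induction c rule: mpoly_induct)
      case (monom t c)
      then show ?case using mono[OF a] by blast
    next
      case (add p q)
      then show ?case by (simp add: distrib_right)
    qed
  qed
  have "{F. (\<exists>d. F \<in> whom wt d) \<and> (\<forall>u\<in>N. peval u F = 0)} \<subseteq> ?J"
    by (auto simp: pcomp_whom)
  from ideal_gen_least[OF J this] show "x \<in> hvan wt N \<Longrightarrow> \<forall>d. \<forall>u\<in>N. peval u (pcomp wt d x) = 0"
    unfolding hvan_def by blast
next
  assume x: "\<forall>d. \<forall>u\<in>N. peval u (pcomp wt d x) = 0"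
  have "(\<Sum>d\<in>wt ` Poly_Mapping.keys x. pcomp wt d x) \<in> hvan wt N"
  proof (rule ideal_sum)
    fix d
    have "pcomp wt d x \<in> whom wt d" by simp
    then show "pcomp wt d x \<in> hvan wt N"
      unfolding hvan_def using x by (intro ideal_gen_superset) blast
  qed simp
  then show "x \<in> hvan wt N" using sum_pcomp[of x wt] by simp
qed

lemma hvan_whom_iff:
  assumes "additive_wt wt" "x \<in> whom wt d"
  shows "x \<in> hvan wt N \<longleftrightarrow> (\<forall>u\<in>N. peval u x = 0)"
  unfolding hvan_iff[OF assms(1)] using assms(2) by (auto simp: pcomp_whom)

lemma hvan_Int: "additive_wt wt \<Longrightarrow> hvan wt N \<inter> whom wt d = vanish_in (whom wt d) N"
  by (auto simp: hvan_whom_iff vanish_in_def)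

lemma hvan_cong:
  assumes "\<And>d F. F \<in> whom wt d \<Longrightarrow> (\<forall>u\<in>N. peval u F = 0) \<longleftrightarrow> (\<forall>u\<in>N'. peval u F = 0)"
  shows "hvan wt N = hvan wt N'"
  unfolding hvan_def by (rule arg_cong[of _ _ ideal_gen]) (use assms in blast)

section \<open>Hilbert series of homogeneous regular sequences\<close>

definition homog_ideal :: "('i::finite, 'k::field) mpoly set \<Rightarrow> bool" where
  "homog_ideal I \<longleftrightarrow> is_ideal I \<and> (\<forall>x\<in>I. \<forall>e. pcomp tdeg e x \<in> I)"

lemma homog_ideal_gen:
  "(\<And>b. b \<in> B \<Longrightarrow> \<exists>d. b \<in> hom_comp d) \<Longrightarrow> homog_ideal (ideal_gen B)"
  unfolding homog_ideal_def hom_comp_whom by (auto intro: ideal_gen_homogeneous)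

text \<open>
  The Hilbert series of the quotient by \<open>I\<close>. Integer coefficients avoid truncated
  subtraction in products with \<open>1 - fps_X ^ d\<close>.
\<close>

definition hilb :: "('i::finite, 'k::field) mpoly set \<Rightarrow> int fps" where
  "hilb I = Abs_fps (\<lambda>e. int (Kdim (hom_comp e :: ('i, 'k) mpoly set)) - int (Kdim (I \<inter> hom_comp e)))"

text \<open>
  Multiplication by the nonzerodivisor \<open>f\<close> embeds the quotient by \<open>I\<close>,
  shifted by \<open>d\<close>, with the quotient by \<open>f\<close> and \<open>I\<close> as
  cokernel.
\<close>

lemma hilb_step:
  assumes I: "homog_ideal I" and f: "f \<in> hom_comp d" and nzd: "\<And>g. f * g \<in> I \<Longrightarrow> g \<in> I"
  shows "hilb (ideal_gen (insert f I)) = (1 - fps_X ^ d) * hilb I"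
proof (rule fps_ext)
  fix e
  let ?J = "ideal_gen (insert f I)"
  have I': "is_ideal I" "\<And>x e. x \<in> I \<Longrightarrow> pcomp tdeg e x \<in> I" using I by (auto simp: homog_ideal_def)
  have IJ: "I \<subseteq> ?J" by (auto intro: ideal_gen_superset)
  have fJ: "f \<in> ?J" by (rule ideal_gen_superset) simp
  have fw: "f \<in> whom tdeg d" using f by (simp add: hom_comp_whom)
  have rep: "\<exists>g. x - f * g \<in> I" if "x \<in> ?J" for x
    using ideal_gen_insert[OF that] by (metis ideal_gen_ideal[OF I'(1)] mult.commute)
  have sub: "mp.subspace (I \<inter> hom_comp k)" "fin_dim (I \<inter> hom_comp k)"
    "mp.subspace (hom_comp k :: ('a, 'b) mpoly set)" for k
    using fin_dim_subset[OF fin_dim_hom_comp, of "I \<inter> hom_comp k" k] whom_subspace[OF additive_tdeg]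
      subspace_Int[OF ideal_subspace[OF I'(1)] whom_subspace[OF additive_tdeg]]
    by (simp_all add: hom_comp_whom)
  have "int (Kdim (?J \<inter> hom_comp e)) = int (Kdim (I \<inter> hom_comp e))
      + (if d \<le> e then int (Kdim (hom_comp (e - d) :: ('a, 'b) mpoly set)) - int (Kdim (I \<inter> hom_comp (e - d))) else 0)"
  proof (cases "d \<le> e")
    case True
    have U: "I \<inter> hom_comp (e - d) = {p\<in>hom_comp (e - d). f * p \<in> I \<inter> hom_comp e}"
      using nzd ideal_mult[OF I'(1), of _ f] whom_mult[OF additive_tdeg fw, of _ "e - d"] True
      by (auto simp: hom_comp_whom)
    have J: "?J \<inter> hom_comp e = {x. \<exists>w\<in>I \<inter> hom_comp e. \<exists>p\<in>hom_comp (e - d). x = w + f * p}"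
    proof (intro set_eqI iffI)
      fix x assume x: "x \<in> ?J \<inter> hom_comp e"
      then obtain g where g: "x - f * g \<in> I" using rep by blast
      have "pcomp tdeg e x = x" using x pcomp_whom[of x tdeg e e] by (simp add: hom_comp_whom)
      moreover have "pcomp tdeg e (f * g) = f * pcomp tdeg (e - d) g"
        using pcomp_mult_whom[OF additive_tdeg fw, of "e - d" g] True by simp
      ultimately have "pcomp tdeg e (x - f * g) = x - f * pcomp tdeg (e - d) g"
        using pcomp_add[of tdeg e x "- (f * g)"] by simp
      then have "x - f * pcomp tdeg (e - d) g \<in> I \<inter> hom_comp e"
        using I'(2)[OF g, of e] pcomp_in_whom[of tdeg e "x - f * g"] by (simp add: hom_comp_whom)
      moreover have "pcomp tdeg (e - d) g \<in> hom_comp (e - d)" by (simp add: hom_comp_whom)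
      moreover have "x = (x - f * pcomp tdeg (e - d) g) + f * pcomp tdeg (e - d) g" by simp
      ultimately show "x \<in> {x. \<exists>w\<in>I \<inter> hom_comp e. \<exists>p\<in>hom_comp (e - d). x = w + f * p}" by blast
    next
      fix x assume "x \<in> {x. \<exists>w\<in>I \<inter> hom_comp e. \<exists>p\<in>hom_comp (e - d). x = w + f * p}"
      then obtain w p where wp: "w \<in> I" "w \<in> hom_comp e" "p \<in> hom_comp (e - d)" "x = w + f * p" by blast
      have "f * p \<in> ?J" by (rule ideal_mult_right[OF is_ideal_gen fJ])
      then have "x \<in> ?J" unfolding wp(4) using wp(1) IJ by (intro ideal_add) auto
      moreover have "f * p \<in> hom_comp e"
        using whom_mult[OF additive_tdeg fw, of p "e - d"] wp(3) True by (simp add: hom_comp_whom)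
      then have "x \<in> hom_comp e" unfolding wp(4) using wp(2) by (simp add: hom_comp_whom whom_add)
      ultimately show "x \<in> ?J \<inter> hom_comp e" by blast
    qed
    have "Kdim (?J \<inter> hom_comp e) + Kdim (I \<inter> hom_comp (e - d))
        = Kdim (I \<inter> hom_comp e) + Kdim (hom_comp (e - d) :: ('a, 'b) mpoly set)"
      unfolding J
      by (rule Kdim_sum_image[OF sub(2,1) fin_dim_hom_comp sub(3) _ _ U])
        (simp_all only: distrib_left ac_simps)
    then show ?thesis using True by simp
  next
    case False
    have "?J \<inter> hom_comp e = I \<inter> hom_comp e"
    proof (intro set_eqI iffI)
      fix x assume x: "x \<in> ?J \<inter> hom_comp e"
      then obtain g where g: "x - f * g \<in> I" using rep by blast
      have "pcomp tdeg e x = x" using x pcomp_whom[of x tdeg e e] by (simp add: hom_comp_whom)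
      moreover have "pcomp tdeg e (f * g) = 0"
        by (rule pcomp_mult_whom_0[OF additive_tdeg fw]) (use False in auto)
      ultimately have "pcomp tdeg e (x - f * g) = x"
        using pcomp_add[of tdeg e x "- (f * g)"] by simp
      then show "x \<in> I \<inter> hom_comp e" using I'(2)[OF g, of e] x by simp
    qed (use IJ in blast)
    then show ?thesis using False by simp
  qed
  then show "fps_nth (hilb ?J) e = fps_nth ((1 - fps_X ^ d) * hilb I) e"
    by (auto simp: hilb_def left_diff_distrib fps_X_power_mult_nth)
qed

definition regular_on :: "'a::comm_ring_1 list \<Rightarrow> bool" where
  "regular_on fs \<longleftrightarrow> (\<forall>k<length fs. \<forall>g. fs ! k * g \<in> ideal_gen (set (take k fs))
     \<longrightarrow> g \<in> ideal_gen (set (take k fs)))"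

lemma hilb_regular:
  fixes fs :: "('i::finite, 'k::field) mpoly list"
  assumes hom: "\<And>k. k < length fs \<Longrightarrow> fs ! k \<in> hom_comp (d k)" and reg: "regular_on fs"
    and n: "n \<le> length fs"
  shows "hilb (ideal_gen (set (take n fs))) = (\<Prod>k<n. 1 - fps_X ^ d k)
    * hilb (ideal_gen ({} :: ('i, 'k) mpoly set))"
  using n
proof (induction n)
  case 0
  show ?case by simp
next
  case (Suc n)
  let ?I = "ideal_gen (set (take n fs))"
  have I: "homog_ideal ?I"
  proof (rule homog_ideal_gen)
    fix b assume "b \<in> set (take n fs)"
    then obtain i where "i < n" "b = fs ! i" using Suc.prems by (auto simp: in_set_conv_nth)
    then show "\<exists>d. b \<in> hom_comp d" using hom[of i] Suc.prems by auto
  qed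
  have "ideal_gen (set (take (Suc n) fs)) = ideal_gen (insert (fs ! n) ?I)"
    using Suc.prems ideal_gen_Un_idem[of "set (take n fs)" "{fs ! n}"]
    by (simp add: take_Suc_conv_app_nth)
  moreover have "hilb (ideal_gen (insert (fs ! n) ?I)) = (1 - fps_X ^ d n) * hilb ?I"
    by (rule hilb_step[OF I hom]) (use reg Suc.prems in \<open>auto simp: regular_on_def\<close>)
  moreover have "hilb ?I = (\<Prod>k<n. 1 - fps_X ^ d k) * hilb (ideal_gen ({} :: ('i, 'k) mpoly set))"
    using Suc by simp
  ultimately have "hilb (ideal_gen (set (take (Suc n) fs)))
      = (1 - fps_X ^ d n) * ((\<Prod>k<n. 1 - fps_X ^ d k) * hilb (ideal_gen ({} :: ('i, 'k) mpoly set)))"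
    by (simp only:)
  then show ?case by (simp only: prod.lessThan_Suc mult.commute mult.left_commute)
qed

lemma in_ideal_Var:
  fixes p :: "('i, 'k::field) mpoly"
  shows "p \<in> ideal_gen (Var ` T) \<longleftrightarrow> (\<forall>t\<in>Poly_Mapping.keys p. \<exists>v\<in>T. Poly_Mapping.lookup t v \<noteq> 0)"
proof
  let ?J = "{p :: ('i, 'k) mpoly. \<forall>t\<in>Poly_Mapping.keys p. \<exists>v\<in>T. Poly_Mapping.lookup t v \<noteq> 0}"
  have "is_ideal ?J"
  proof (rule is_idealI)
    show "0 \<in> ?J" by simp
    show "a + b \<in> ?J" if ab: "a \<in> ?J" "b \<in> ?J" for a b
    proof (intro CollectI ballI)
      fix t assume "t \<in> Poly_Mapping.keys (a + b)"
      then have "t \<in> Poly_Mapping.keys a \<or> t \<in> Poly_Mapping.keys b" using keys_add[of a b] by auto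
      then show "\<exists>v\<in>T. Poly_Mapping.lookup t v \<noteq> 0" using ab by auto
    qed
    show "c * a \<in> ?J" if a: "a \<in> ?J" for a c
    proof (intro CollectI ballI)
      fix t assume "t \<in> Poly_Mapping.keys (c * a)"
      then obtain r s where rs: "t = r + s" "s \<in> Poly_Mapping.keys a" using keys_mult[of c a] by blast
      then obtain v where "v \<in> T" "Poly_Mapping.lookup s v \<noteq> 0" using a by blast
      then show "\<exists>v\<in>T. Poly_Mapping.lookup t v \<noteq> 0" unfolding rs(1) by (auto simp: lookup_add)
    qed
  qed
  moreover have "Var ` T \<subseteq> ?J" by (auto simp: Var_def lookup_single when_def)
  ultimately have "ideal_gen (Var ` T) \<subseteq> ?J" by (rule ideal_gen_least)
  then show "p \<in> ideal_gen (Var ` T) \<Longrightarrow> \<forall>t\<in>Poly_Mapping.keys p. \<exists>v\<in>T. Poly_Mapping.lookup t v \<noteq> 0"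
    by blast
next
  assume p: "\<forall>t\<in>Poly_Mapping.keys p. \<exists>v\<in>T. Poly_Mapping.lookup t v \<noteq> 0"
  have "(\<Sum>t\<in>Poly_Mapping.keys p. Poly_Mapping.single t (Poly_Mapping.lookup p t)) \<in> ideal_gen (Var ` T)"
  proof (rule ideal_sum)
    fix t assume "t \<in> Poly_Mapping.keys p"
    then obtain v where v: "v \<in> T" "Poly_Mapping.lookup t v \<noteq> 0" using p by blast
    have "t = (t - Poly_Mapping.single v 1) + Poly_Mapping.single v 1"
      by (rule poly_mapping_eqI) (use v(2) in \<open>auto simp: lookup_add lookup_minus lookup_single when_def\<close>)
    then have "Poly_Mapping.single t (Poly_Mapping.lookup p t)
        = Poly_Mapping.single (t - Poly_Mapping.single v 1) (Poly_Mapping.lookup p t) * Var v"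
      unfolding Var_def mult_single by simp
    moreover have "\<dots> \<in> ideal_gen (Var ` T)"
      using v(1) by (intro ideal_mult is_ideal_gen ideal_gen_superset) blast
    ultimately show "Poly_Mapping.single t (Poly_Mapping.lookup p t) \<in> ideal_gen (Var ` T)" by simp
  qed simp
  then show "p \<in> ideal_gen (Var ` T)" using mpoly_sum_monomials[of p] by simp
qed

text \<open>
  The variables form a regular sequence with quotient \<open>K\<close>, whose Hilbert series is
  \<open>1\<close>; \<open>hilb_regular\<close> is then read backwards.
\<close>

lemma hilb_zero: "(1 - fps_X) ^ CARD('i) * hilb (ideal_gen {} :: ('i::finite, 'k::field) mpoly set) = 1"
proof -
  obtain vs :: "'i list" where vs: "set vs = UNIV" "distinct vs"
    using finite_distinct_list[OF finite, of "UNIV :: 'i set"] by blast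
  let ?fs = "map Var vs :: ('i, 'k) mpoly list"
  have reg: "regular_on ?fs"
    unfolding regular_on_def
  proof (intro allI impI)
    fix k and g :: "('i, 'k) mpoly"
    assume k: "k < length ?fs" and g: "?fs ! k * g \<in> ideal_gen (set (take k ?fs))"
    let ?v = "vs ! k" and ?T = "set (take k vs)"
    have T: "set (take k ?fs) = Var ` ?T" by (simp add: take_map)
    have vT: "?v \<notin> ?T" using k vs(2) by (auto simp: in_set_conv_nth nth_eq_iff_index_eq)
    have g': "\<forall>t\<in>Poly_Mapping.keys (Var ?v * g). \<exists>w\<in>?T. Poly_Mapping.lookup t w \<noteq> 0"
      using g k unfolding T in_ideal_Var by simp
    show "g \<in> ideal_gen (set (take k ?fs))"
      unfolding T in_ideal_Var
    proof
      fix t assume "t \<in> Poly_Mapping.keys g"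
      then have "Poly_Mapping.single ?v 1 + t \<in> Poly_Mapping.keys (Var ?v * g)"
        unfolding Var_def in_keys_iff lookup_mult_single by simp
      then obtain w where "w \<in> ?T" "Poly_Mapping.lookup (Poly_Mapping.single ?v 1 + t) w \<noteq> 0"
        using g' by blast
      moreover from this have "w \<noteq> ?v" using vT by blast
      ultimately show "\<exists>w\<in>?T. Poly_Mapping.lookup t w \<noteq> 0"
        by (auto simp: lookup_add lookup_single)
    qed
  qed
  have "hilb (ideal_gen (set (take (length ?fs) ?fs)))
      = (\<Prod>k<length ?fs. 1 - fps_X ^ 1) * hilb (ideal_gen ({} :: ('i, 'k) mpoly set))"
    by (rule hilb_regular[OF _ reg]) (use Var_hom in auto)
  moreover have "length vs = CARD('i)" using vs by (metis distinct_card)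
  ultimately have eq: "hilb (ideal_gen (range Var :: ('i, 'k) mpoly set))
      = (1 - fps_X) ^ CARD('i) * hilb (ideal_gen ({} :: ('i, 'k) mpoly set))"
    using vs(1) by simp
  have "hilb (ideal_gen (range Var :: ('i, 'k) mpoly set)) = 1"
  proof (rule fps_ext)
    fix e
    let ?I = "ideal_gen (range Var :: ('i, 'k) mpoly set)"
    have ne: "(\<exists>v. Poly_Mapping.lookup t v \<noteq> 0) \<longleftrightarrow> tdeg t \<noteq> 0" for t :: "'i \<Rightarrow>\<^sub>0 nat"
      by (auto simp: tdeg_def)
    have ne2: "(\<exists>v. 0 < Poly_Mapping.lookup t v) \<longleftrightarrow> tdeg t \<noteq> 0" for t :: "'i \<Rightarrow>\<^sub>0 nat"
      using ne[of t] by simp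
    show "fps_nth (hilb ?I) e = fps_nth 1 e"
    proof (cases "e = 0")
      case False
      have "?I \<inter> hom_comp e = hom_comp e"
        using False by (auto simp: in_ideal_Var ne2 hom_comp_whom whom_def)
      then show ?thesis using False by (simp add: hilb_def)
    next
      case True
      have 1: "?I \<inter> hom_comp 0 = {0}"
      proof -
        have "p = 0" if "p \<in> ?I" "p \<in> hom_comp 0" for p
        proof -
          have "Poly_Mapping.keys p = {}"
            using that unfolding in_ideal_Var bex_UNIV ne hom_comp_whom whom_def by auto
          then show ?thesis by (metis mpoly_sum_monomials sum.empty)
        qed
        moreover have "0 \<in> ?I" by (simp add: ideal_zero)
        ultimately show ?thesis by (auto simp: hom_comp_whom)
      qed
      have "Kdim (hom_comp 0 :: ('i, 'k) mpoly set) = 1"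
      proof (rule Kdim_unique[of "{1}"])
        show "{1} \<subseteq> (hom_comp 0 :: ('i, 'k) mpoly set)" by (simp add: hom_comp_whom whom_one)
        show "hom_comp 0 \<subseteq> mp.span {1 :: ('i, 'k) mpoly}"
        proof
          fix p :: "('i, 'k) mpoly" assume p: "p \<in> hom_comp 0"
          have "Poly_Mapping.lookup p t = 0" if "t \<noteq> 0" for t
          proof -
            have "\<exists>v. Poly_Mapping.lookup t v \<noteq> 0"
            proof (rule ccontr)
              assume "\<not> (\<exists>v. Poly_Mapping.lookup t v \<noteq> 0)"
              then have "t = 0" by (intro poly_mapping_eqI) simp
              with that show False by blast
            qed
            then show ?thesis using p unfolding ne hom_comp_whom whom_iff by metis
          qed
          then have "p = Const (Poly_Mapping.lookup p 0)"
            by (intro poly_mapping_eqI) (auto simp: lookup_single when_def)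
          then have "p = Const (Poly_Mapping.lookup p 0) * 1" by simp
          moreover have "Const (Poly_Mapping.lookup p 0) * 1 \<in> mp.span {1 :: ('i, 'k) mpoly}"
            by (intro mp.span_scale mp.span_base) simp
          ultimately show "p \<in> mp.span {1}" by simp
        qed
        show "mp.independent {1 :: ('i, 'k) mpoly}" by (simp only: mp.dependent_single) simp
      qed simp
      then show ?thesis using True 1 by (simp add: hilb_def)
    qed
  qed
  with eq show ?thesis by simp
qed

text \<open>
  Series that are monic polynomials of degree \<open>a k\<close> have a monic product of the
  expected degree.
\<close>

lemma fps_prod_top:
  fixes G :: "'a \<Rightarrow> int fps"
  assumes "finite S" "\<And>k. k \<in> S \<Longrightarrow> fps_nth (G k) (a k) = 1"
    "\<And>k e. k \<in> S \<Longrightarrow> e > a k \<Longrightarrow> fps_nth (G k) e = 0"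
  shows "fps_nth (\<Prod>k\<in>S. G k) (\<Sum>k\<in>S. a k) = 1 \<and> (\<forall>e>(\<Sum>k\<in>S. a k). fps_nth (\<Prod>k\<in>S. G k) e = 0)"
  using assms
proof (induction S)
  case (insert x S)
  let ?P = "\<Prod>k\<in>S. G k" and ?s = "\<Sum>k\<in>S. a k"
  have IH: "fps_nth ?P ?s = 1" "\<And>e. e > ?s \<Longrightarrow> fps_nth ?P e = 0" using insert by auto
  have Gx: "fps_nth (G x) (a x) = 1" "\<And>e. e > a x \<Longrightarrow> fps_nth (G x) e = 0" using insert.prems by auto
  have "fps_nth (G x * ?P) (a x + ?s) = (\<Sum>i\<in>{a x}. fps_nth (G x) i * fps_nth ?P (a x + ?s - i))"
    unfolding fps_mult_nth
  proof (rule sum.mono_neutral_right)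
    show "\<forall>i\<in>{0..a x + ?s} - {a x}. fps_nth (G x) i * fps_nth ?P (a x + ?s - i) = 0"
    proof
      fix i assume "i \<in> {0..a x + ?s} - {a x}"
      then have "i > a x \<or> a x + ?s - i > ?s" by auto
      then show "fps_nth (G x) i * fps_nth ?P (a x + ?s - i) = 0" using IH(2) Gx(2) by auto
    qed
  qed auto
  moreover have "fps_nth (G x * ?P) e = 0" if "e > a x + ?s" for e
    unfolding fps_mult_nth
  proof (rule sum.neutral, rule ballI)
    fix i
    have "i > a x \<or> e - i > ?s" using that by auto
    then show "fps_nth (G x) i * fps_nth ?P (e - i) = 0" using IH(2) Gx(2) by auto
  qed
  ultimately show ?case using insert.hyps IH Gx by simp
qed simp

text \<open>
  As many regular forms as variables give the Hilbert series \<open>\<Prod>k. (1 + x + ... +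
  x^(d k - 1))\<close>, whose top coefficient is \<open>1\<close>.
\<close>

lemma regular_socle:
  fixes fs :: "('i::finite, 'k::field) mpoly list"
  assumes hom: "\<And>k. k < length fs \<Longrightarrow> fs ! k \<in> hom_comp (d k)" and reg: "regular_on fs"
    and len: "length fs = CARD('i)" and pos: "\<And>k. k < length fs \<Longrightarrow> d k \<ge> 1"
  shows "\<exists>p\<in>hom_comp (\<Sum>k<length fs. d k - 1). p \<notin> ideal_gen (set fs)"
proof -
  let ?n = "length fs" and ?G = "\<lambda>k. (\<Sum>i<d k. fps_X ^ i) :: int fps"
  let ?H = "hilb (ideal_gen (set fs))"
  have "?H = (\<Prod>k<?n. 1 - fps_X ^ d k) * hilb (ideal_gen ({} :: ('i, 'k) mpoly set))"
    using hilb_regular[OF hom reg, of ?n] by simp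
  moreover have "(\<Prod>k<?n. 1 - fps_X ^ d k) = (1 - fps_X) ^ CARD('i) * (\<Prod>k<?n. ?G k)"
    using len by (simp add: one_diff_power_eq prod.distrib)
  ultimately have "?H = (\<Prod>k<?n. ?G k) * ((1 - fps_X) ^ CARD('i) * hilb (ideal_gen ({} :: ('i, 'k) mpoly set)))"
    by (simp only: ac_simps)
  then have H: "?H = (\<Prod>k<?n. ?G k)" unfolding hilb_zero by simp
  have Gn: "fps_nth (?G k) e = (if e < d k then 1 else 0)" for k e
    by (simp add: fps_sum_nth fps_X_power_nth)
  have "fps_nth ?H (\<Sum>k<?n. d k - 1) = 1"
  proof -
    have "fps_nth (?G k) (d k - 1) = 1" if "k \<in> {..<?n}" for k
    proof -
      have "d k - 1 < d k" using pos[of k] that by simp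
      then show ?thesis unfolding Gn by simp
    qed
    moreover have "fps_nth (?G k) e = 0" if "k \<in> {..<?n}" "e > d k - 1" for k e
      using that unfolding Gn by simp
    ultimately show ?thesis
      unfolding H by (intro conjunct1[OF fps_prod_top]) simp_all
  qed
  then have "Kdim (ideal_gen (set fs) \<inter> hom_comp (\<Sum>k<?n. d k - 1)) \<noteq> Kdim (hom_comp (\<Sum>k<?n. d k - 1) :: ('i, 'k) mpoly set)"
    by (auto simp: hilb_def)
  then have "ideal_gen (set fs) \<inter> hom_comp (\<Sum>k<?n. d k - 1) \<noteq> hom_comp (\<Sum>k<?n. d k - 1)" by metis
  then show ?thesis by blast
qed

section \<open>Koszul syzygies and regular sequences\<close>

text \<open>
  The first Koszul homology of the \<open>F i\<close> vanishes: every syzygy is a combination of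
  the trivial ones. Vanishing on the diagonal is requested separately for the sake of
  characteristic two.
\<close>

definition koszul_on :: "'a set \<Rightarrow> ('a \<Rightarrow> 'r::comm_ring_1) \<Rightarrow> bool" where
  "koszul_on T F \<longleftrightarrow> (\<forall>G. (\<Sum>i\<in>T. G i * F i) = 0 \<longrightarrow>
     (\<exists>\<omega>. (\<forall>k\<in>T. \<forall>l\<in>T. \<omega> l k = - \<omega> k l) \<and> (\<forall>k\<in>T. \<omega> k k = 0) \<and>
          (\<forall>k\<in>T. G k = (\<Sum>l\<in>T. \<omega> k l * F l))))"

text \<open>
  Truncation by the degree of the monomials. It bounds the Koszul coefficients of a syzygy by
  the degree of the syzygy, without splitting them into homogeneous components.
\<close>

definition dfilt :: "(nat \<Rightarrow> bool) \<Rightarrow> ('i::finite, 'k::zero) mpoly \<Rightarrow> ('i, 'k) mpoly" where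
  "dfilt R p = Poly_Mapping.mapp (\<lambda>t c. if R (tdeg t) then c else 0) p"

lemma lookup_dfilt:
  "Poly_Mapping.lookup (dfilt R p) t = (if R (tdeg t) then Poly_Mapping.lookup p t else 0)"
  by (simp add: dfilt_def lookup_mapp when_def in_keys_iff)

lemma dfilt_add [simp]: "dfilt R (p + q) = dfilt R p + dfilt R q"
  for p :: "('i::finite, 'k::comm_ring_1) mpoly"
  by (rule poly_mapping_eqI) (simp add: lookup_dfilt lookup_add)

lemma dfilt_0 [simp]: "dfilt R 0 = 0"
  by (rule poly_mapping_eqI) (simp add: lookup_dfilt)

lemma dfilt_uminus: "dfilt R (- p) = - dfilt R p"
  for p :: "('i::finite, 'k::comm_ring_1) mpoly"
  by (rule poly_mapping_eqI) (simp add: lookup_dfilt)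

lemma dfilt_sum: "dfilt R (sum f S) = (\<Sum>x\<in>S. dfilt R (f x))"
  for f :: "_ \<Rightarrow> ('i::finite, 'k::comm_ring_1) mpoly"
  by (rule additive_sum) simp_all

lemma dfilt_id: "(\<And>t. t \<in> Poly_Mapping.keys p \<Longrightarrow> R (tdeg t)) \<Longrightarrow> dfilt R p = p"
  by (rule poly_mapping_eqI) (auto simp: lookup_dfilt in_keys_iff)

lemma dfilt_keys: "t \<in> Poly_Mapping.keys (dfilt R p) \<Longrightarrow> R (tdeg t)"
  by (auto simp: in_keys_iff lookup_dfilt split: if_splits)

lemma dfilt_whom: "p \<in> whom tdeg d \<Longrightarrow> dfilt R p = (if R d then p else 0)"
  by (rule poly_mapping_eqI) (auto simp: lookup_dfilt whom_iff)

lemma dfilt_mult: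
  fixes p F :: "('i::finite, 'k::comm_ring_1) mpoly"
  assumes F: "F \<in> hom_comp d"
  shows "dfilt R (p * F) = dfilt (\<lambda>e. R (e + d)) p * F"
proof (induction p rule: mpoly_induct)
  case (monom t c)
  have 1: "Poly_Mapping.single t c \<in> whom tdeg (tdeg t)" by (simp add: whom_single)
  then have "Poly_Mapping.single t c * F \<in> whom tdeg (tdeg t + d)"
    using F by (simp add: hom_comp_whom whom_mult)
  then show ?case using 1 by (simp add: dfilt_whom)
qed (simp add: distrib_right)

text \<open>
  Extend a syzygy of the smaller family by zero at \<open>n\<close> and write it as a Koszul
  syzygy. Its row \<open>n\<close> is again a syzygy of the smaller family, of degree smaller by
  \<open>d n\<close>, so by induction on the degree it is Koszul and can be absorbed into the
  other rows.
\<close>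

lemma koszul_remove:
  fixes F :: "'a \<Rightarrow> ('i::finite, 'k::comm_ring_1) mpoly"
  assumes T: "finite T" "n \<notin> T" and hom: "\<And>i. i \<in> insert n T \<Longrightarrow> F i \<in> hom_comp (d i)"
    and pos: "d n \<ge> 1" and K: "koszul_on (insert n T) F"
  shows "koszul_on T F"
proof -
  have main: "\<exists>\<omega>. (\<forall>k\<in>T. \<forall>l\<in>T. \<omega> l k = - \<omega> k l) \<and> (\<forall>k\<in>T. \<omega> k k = 0) \<and>
          (\<forall>k\<in>T. G k = (\<Sum>l\<in>T. \<omega> k l * F l))"
    if "\<forall>k\<in>T. \<forall>t\<in>Poly_Mapping.keys (G k). tdeg t + d k \<le> e" "(\<Sum>i\<in>T. G i * F i) = 0" for e G
    using that
  proof (induction e arbitrary: G rule: less_induct)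
    case (less e)
    let ?G = "G(n := 0)"
    have Geq: "?G k = G k" if "k \<in> T" for k using that T(2) by auto
    have "(\<Sum>i\<in>T. ?G i * F i) = (\<Sum>i\<in>T. G i * F i)"
      by (rule sum.cong) (simp_all add: Geq del: fun_upd_apply)
    then have G0: "(\<Sum>i\<in>insert n T. ?G i * F i) = 0" using T less.prems(2) by simp
    obtain w where w: "\<forall>k\<in>insert n T. \<forall>l\<in>insert n T. w l k = - w k l"
      "\<forall>k\<in>insert n T. w k k = 0"
      "\<forall>k\<in>insert n T. ?G k = (\<Sum>l\<in>insert n T. w k l * F l)"
      using mp[OF spec[OF K[unfolded koszul_on_def]] G0] by (elim exE conjE)
    (* cut off the parts of w that cannot contribute to G, so that row n has small degree *)
    define v where "v k l = dfilt (\<lambda>x. x + d k + d l \<le> e) (w k l)" for k l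
    have v1: "v l k = - v k l" if "k \<in> insert n T" "l \<in> insert n T" for k l
    proof -
      have "v l k = dfilt (\<lambda>x. x + d k + d l \<le> e) (- w k l)"
        unfolding v_def w(1)[rule_format, OF that] by (simp only: add.assoc add.commute[of "d l"])
      then show ?thesis by (simp add: v_def dfilt_uminus)
    qed
    have v2: "v k k = 0" if "k \<in> insert n T" for k unfolding v_def w(2)[rule_format, OF that] by simp
    have v3: "?G k = (\<Sum>l\<in>insert n T. v k l * F l)" if k: "k \<in> insert n T" for k
    proof -
      have "tdeg t + d k \<le> e" if "t \<in> Poly_Mapping.keys (?G k)" for t
        using that less.prems(1) k by (cases "k = n") auto
      then have "?G k = dfilt (\<lambda>x. x + d k \<le> e) (?G k)" by (intro dfilt_id[symmetric])
      also have "\<dots> = (\<Sum>l\<in>insert n T. dfilt (\<lambda>x. x + d k \<le> e) (w k l * F l))"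
        unfolding w(3)[rule_format, OF k] by (rule dfilt_sum)
      also have "\<dots> = (\<Sum>l\<in>insert n T. v k l * F l)"
      proof (rule sum.cong)
        fix l assume l: "l \<in> insert n T"
        have "dfilt (\<lambda>x. x + d k \<le> e) (w k l * F l) = dfilt (\<lambda>x. x + d l + d k \<le> e) (w k l) * F l"
          by (rule dfilt_mult[OF hom[OF l]])
        then show "dfilt (\<lambda>x. x + d k \<le> e) (w k l * F l) = v k l * F l"
          by (simp only: v_def add.assoc add.commute add.left_commute)
      qed simp
      finally show ?thesis .
    qed
    have vn: "(\<Sum>l\<in>T. v n l * F l) = 0"
      using v3[of n] v2[of n] T by simp
    have vk: "tdeg t + d n + d l \<le> e" if "t \<in> Poly_Mapping.keys (v n l)" for t l
      using dfilt_keys[OF that[unfolded v_def]] by simp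
    have "\<exists>\<eta>. (\<forall>k\<in>T. \<forall>l\<in>T. \<eta> l k = - \<eta> k l) \<and> (\<forall>k\<in>T. \<eta> k k = 0) \<and>
          (\<forall>k\<in>T. v n k = (\<Sum>l\<in>T. \<eta> k l * F l))"
    proof (cases "d n \<le> e")
      case True
      show ?thesis
      proof (rule less.IH[of "e - d n"])
        show "e - d n < e" using True pos by simp
        show "\<forall>k\<in>T. \<forall>t\<in>Poly_Mapping.keys (v n k). tdeg t + d k \<le> e - d n"
        proof (intro ballI)
          fix k t assume "t \<in> Poly_Mapping.keys (v n k)"
          from vk[OF this] show "tdeg t + d k \<le> e - d n" by simp
        qed
      qed (rule vn)
    next
      case False
      have "v n k = 0" for k
      proof -
        have "Poly_Mapping.keys (v n k) = {}" using vk[of _ k] False by fastforce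
        then show ?thesis by (metis mpoly_sum_monomials sum.empty)
      qed
      then show ?thesis by (intro exI[of _ "\<lambda>_ _. 0"]) simp
    qed
    then obtain \<eta> where \<eta>: "\<forall>k\<in>T. \<forall>l\<in>T. \<eta> l k = - \<eta> k l"
      "\<forall>k\<in>T. \<eta> k k = 0" "\<forall>k\<in>T. v n k = (\<Sum>l\<in>T. \<eta> k l * F l)" by (elim exE conjE)
    have "G k = (\<Sum>l\<in>T. (v k l - \<eta> k l * F n) * F l)" if k: "k \<in> T" for k
    proof -
      have "G k = v k n * F n + (\<Sum>l\<in>T. v k l * F l)"
        using v3[of k] k T Geq[OF k] by simp
      also have "v k n = - (\<Sum>l\<in>T. \<eta> k l * F l)"
        using v1[of n k] k \<eta>(3)[rule_format, OF k] by simp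
      finally have "G k = (\<Sum>l\<in>T. v k l * F l) - (\<Sum>l\<in>T. \<eta> k l * F l * F n)"
        by (simp add: sum_distrib_right)
      also have "\<dots> = (\<Sum>l\<in>T. v k l * F l - \<eta> k l * F l * F n)" by (simp only: sum_subtractf)
      also have "\<dots> = (\<Sum>l\<in>T. (v k l - \<eta> k l * F n) * F l)"
        by (rule sum.cong) (simp_all only: left_diff_distrib right_diff_distrib ac_simps)
      finally show ?thesis .
    qed
    moreover have "v l k - \<eta> l k * F n = - (v k l - \<eta> k l * F n)" if "k \<in> T" "l \<in> T" for k l
      using v1[of k l] \<eta>(1)[rule_format, OF that] that by simp
    moreover have "v k k - \<eta> k k * F n = 0" if "k \<in> T" for k
      using v2[of k] \<eta>(2)[rule_format, OF that] that by simp
    ultimately show ?case by (intro exI[of _ "\<lambda>k l. v k l - \<eta> k l * F n"] conjI ballI)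
  qed
  show ?thesis
    unfolding koszul_on_def
  proof (intro allI impI)
    fix G assume G: "(\<Sum>i\<in>T. G i * F i) = 0"
    let ?B = "\<Union>k\<in>T. (\<lambda>t. tdeg t + d k) ` Poly_Mapping.keys (G k)"
    have "finite ?B" using T(1) by simp
    then obtain e where "\<forall>x\<in>?B. x \<le> e" using finite_nat_set_iff_bounded_le by blast
    then have "\<forall>k\<in>T. \<forall>t\<in>Poly_Mapping.keys (G k). tdeg t + d k \<le> e" by blast
    from main[OF this G] show "\<exists>\<omega>. (\<forall>k\<in>T. \<forall>l\<in>T. \<omega> l k = - \<omega> k l) \<and> (\<forall>k\<in>T. \<omega> k k = 0) \<and>
          (\<forall>k\<in>T. G k = (\<Sum>l\<in>T. \<omega> k l * F l))" .
  qed
qed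

text \<open>
  A relation \<open>F n * g = \<Sum>i. c i * F i\<close> is a syzygy; its entry \<open>g\<close>
  at \<open>n\<close> is a combination of the other \<open>F l\<close> because the diagonal
  vanishes.
\<close>

lemma koszul_nzd:
  assumes T: "finite T" "n \<notin> T" and K: "koszul_on (insert n T) F"
    and g: "F n * g \<in> ideal_gen (F ` T)"
  shows "g \<in> ideal_gen (F ` T)"
proof -
  obtain c where c: "F n * g = (\<Sum>i\<in>T. c i * F i)" using g ideal_gen_image[OF T(1)] by blast
  let ?G = "\<lambda>i. if i = n then g else - c i"
  have "(\<Sum>i\<in>T. ?G i * F i) = (\<Sum>i\<in>T. - (c i * F i))"
    using T(2) by (intro sum.cong) auto
  then have G0: "(\<Sum>i\<in>insert n T. ?G i * F i) = 0"
    using T c by (simp add: sum_negf mult.commute[of g])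
  obtain w where w: "\<forall>k\<in>insert n T. w k k = 0"
      "\<forall>k\<in>insert n T. ?G k = (\<Sum>l\<in>insert n T. w k l * F l)"
    using mp[OF spec[OF K[unfolded koszul_on_def]] G0] by (elim exE conjE)
  have "g = (\<Sum>l\<in>insert n T. w n l * F l)" using bspec[OF w(2), of n] by simp
  also have "\<dots> = (\<Sum>l\<in>T. w n l * F l)" using T bspec[OF w(1), of n] by simp
  finally show ?thesis using ideal_gen_image[OF T(1)] by blast
qed

text \<open>
  Removing the last forms one by one keeps the Koszul property, and it makes the last of the
  remaining forms a nonzerodivisor modulo the others.
\<close>

lemma koszul_regular:
  fixes F :: "'a \<Rightarrow> ('i::finite, 'k::comm_ring_1) mpoly"
  assumes vs: "distinct vs" and hom: "\<And>i. i \<in> set vs \<Longrightarrow> F i \<in> hom_comp (d i)"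
    and pos: "\<And>i. i \<in> set vs \<Longrightarrow> d i \<ge> 1" and K: "koszul_on (set vs) F"
  shows "regular_on (map F vs)"
proof -
  have step: "set (take (Suc k) vs) = insert (vs ! k) (set (take k vs))"
    "vs ! k \<notin> set (take k vs)" "vs ! k \<in> set vs" if "k < length vs" for k
    using that vs by (auto simp: take_Suc_conv_app_nth in_set_conv_nth nth_eq_iff_index_eq)
  have sub: "i \<in> set vs" if "i \<in> set (take k vs)" for i k using that by (rule in_set_takeD)
  have Kk: "koszul_on (set (take k vs)) F" if "k \<le> length vs" for k
    using that
  proof (induction k rule: inc_induct)
    case base
    then show ?case using K by simp
  next
    case (step k)
    note s = \<open>\<And>k. k < length vs \<Longrightarrow> set (take (Suc k) vs) = insert (vs ! k) (set (take k vs))\<close>[OF step.hyps(2)]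
    show ?case
    proof (rule koszul_remove[of _ "vs ! k" F d])
      show "finite (set (take k vs))" by simp
      show "vs ! k \<notin> set (take k vs)" by (rule \<open>\<And>k. k < length vs \<Longrightarrow> vs ! k \<notin> set (take k vs)\<close>[OF step.hyps(2)])
      show "F i \<in> hom_comp (d i)" if "i \<in> insert (vs ! k) (set (take k vs))" for i
        using that step.hyps(2) by (intro hom) (auto dest: in_set_takeD)
      show "d (vs ! k) \<ge> 1" using step.hyps(2) by (intro pos) simp
      show "koszul_on (insert (vs ! k) (set (take k vs))) F" using step.IH unfolding s .
    qed
  qed
  show ?thesis
    unfolding regular_on_def
  proof (intro allI impI)
    fix k g assume k: "k < length (map F vs)"
      and g: "map F vs ! k * g \<in> ideal_gen (set (take k (map F vs)))"
    have T: "set (take k (map F vs)) = F ` set (take k vs)" by (simp add: take_map)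
    have kl: "k < length vs" using k by simp
    show "g \<in> ideal_gen (set (take k (map F vs)))"
      unfolding T
    proof (rule koszul_nzd[of _ "vs ! k"])
      show "koszul_on (insert (vs ! k) (set (take k vs))) F"
        using Kk[of "Suc k"] kl step(1)[OF kl] by simp
      show "F (vs ! k) * g \<in> ideal_gen (F ` set (take k vs))" using g kl unfolding T by simp
      show "vs ! k \<notin> set (take k vs)" by (rule step(2)[OF kl])
    qed simp
  qed
qed

section \<open>Separators of affine points\<close>

lemma Var_power_hom: "Var v ^ n \<in> whom tdeg n"
  unfolding Var_power by (simp add: whom_single)

lemma separates_mono:
  assumes sep: "separates (hom_comp d) N u" and "d \<le> e" "u None = 1"
  shows "separates (hom_comp e) N u"
proof -
  obtain F where F: "F \<in> hom_comp d" "\<forall>w\<in>N. peval w F = 0" "peval u F \<noteq> 0"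
    using sep unfolding separates_def by blast
  have "Var None ^ (e - d) * F \<in> whom tdeg ((e - d) + d)"
    using F(1) by (intro whom_mult additive_tdeg Var_power_hom) (simp add: hom_comp_whom)
  then have "Var None ^ (e - d) * F \<in> hom_comp e" using assms(2) by (simp add: hom_comp_whom)
  moreover have "\<forall>w\<in>N. peval w (Var None ^ (e - d) * F) = 0" using F(2) by simp
  moreover have "peval u (Var None ^ (e - d) * F) \<noteq> 0" using F(3) assms(3) by simp
  ultimately show ?thesis unfolding separates_def by blast
qed

text \<open>
  A product of linear forms, each vanishing at one of the other points.
\<close>

lemma separates_exists:
  fixes A :: "('m::finite option \<Rightarrow> 'k::field) set"
  assumes "finite A" "\<And>q. q \<in> A \<Longrightarrow> q None = 1" "u \<in> A"
  shows "\<exists>d. separates (hom_comp d) (A - {u}) u"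
proof -
  have "\<exists>j. q (Some j) \<noteq> u (Some j)" if "q \<in> A - {u}" for q
  proof (rule ccontr)
    assume "\<not> (\<exists>j. q (Some j) \<noteq> u (Some j))"
    then have "q v = u v" for v using assms(2)[of q] assms(2)[of u] assms(3) that by (cases v) auto
    then have "q = u" by (rule ext)
    then show False using that by blast
  qed
  then obtain j where j: "\<And>q. q \<in> A - {u} \<Longrightarrow> q (Some (j q)) \<noteq> u (Some (j q))" by metis
  define F where "F = (\<Prod>q\<in>A - {u}. xi q (j q))"
  have xi1: "xi q i \<in> whom tdeg 1" for q :: "'m option \<Rightarrow> 'k" and i
    using Var_hom[of "Some i"] Var_hom[of None] unfolding xi_def hom_comp_whom
    by (intro whom_diff whom_scale additive_tdeg)
  have "F \<in> hom_comp (\<Sum>q\<in>A - {u}. 1)"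
    unfolding F_def hom_comp_whom by (rule whom_prod[OF additive_tdeg xi1])
  moreover have "peval w F = 0" if w: "w \<in> A - {u}" for w
  proof -
    have "peval w (xi w (j w)) = 0" using w assms(2) by (simp add: xi_def)
    then show ?thesis
      unfolding F_def peval_prod using w assms(1) by (intro prod_zero) auto
  qed
  moreover have "peval u F \<noteq> 0"
    unfolding F_def peval_prod using j assms(1) assms(2)[OF assms(3)] by (force simp: xi_def)
  ultimately show ?thesis unfolding separates_def by blast
qed

text \<open>
  The projection \<open>projection_forms\<close> reproduces the values of forms of degree
  \<open>d\<close>, so every point \<open>z\<close> gives a linear relation between these
  values, with coefficients \<open>c z q\<close>. If \<open>u\<close> occurred in none of the
  relations, then \<open>w u\<close> would separate \<open>u\<close>.
\<close>

lemma functional_exists: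
  fixes A :: "('i::finite \<Rightarrow> 'k::field) set"
  assumes A: "finite A" "u \<in> A" and ns: "\<not> separates (hom_comp d) (A - {u}) u"
  shows "\<exists>c. (\<forall>G\<in>hom_comp d. (\<Sum>q\<in>A. c q * peval q G) = 0) \<and> c u \<noteq> 0"
proof -
  obtain w where w: "\<forall>q\<in>A. w q \<in> hom_comp d"
    "\<forall>p\<in>hom_comp d. \<forall>z\<in>A. peval z p = (\<Sum>q\<in>A. peval q p * peval z (w q))"
    using projection_forms[OF _ A(1), of "hom_comp d"] whom_subspace[OF additive_tdeg]
    by (auto simp: hom_comp_whom)
  define c where "c z q = (if q = z then 1 else 0) - peval z (w q)" for z q
  have kill: "(\<Sum>q\<in>A. c z q * peval q G) = 0" if "G \<in> hom_comp d" "z \<in> A" for G z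
  proof -
    have "(\<Sum>q\<in>A. c z q * peval q G) = (\<Sum>q\<in>A. (if q = z then peval q G else 0) - peval q G * peval z (w q))"
      unfolding c_def by (rule sum.cong) (auto simp: left_diff_distrib)
    also have "\<dots> = peval z G - (\<Sum>q\<in>A. peval q G * peval z (w q))"
      using A(1) that(2) by (simp add: sum_subtractf)
    finally show ?thesis using w(2) that by simp
  qed
  have "\<exists>z\<in>A. c z u \<noteq> 0"
  proof (rule ccontr)
    assume "\<not> (\<exists>z\<in>A. c z u \<noteq> 0)"
    then have "\<forall>z\<in>A. peval z (w u) = (if u = z then 1 else 0)" unfolding c_def by simp
    then have "separates (hom_comp d) (A - {u}) u"
      unfolding separates_def using w(1) A(2) by (intro bexI[of _ "w u"]) auto
    then show False using ns by blast
  qed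
  then show ?thesis using kill by blast
qed

text \<open>
  If the ideal of the \<open>f r\<close> contains elements with an invertible diagonal Jacobian
  at a common zero \<open>P\<close>, then so has the family \<open>f\<close> itself: at
  \<open>P\<close> the product rule turns the representation of \<open>h\<close> by
  \<open>f\<close> into a matrix factorization.
\<close>

lemma jacobian_nonzero:
  fixes f :: "'c::finite \<Rightarrow> ('i, 'k::field) mpoly" and col :: "'c \<Rightarrow> 'i"
  assumes f: "\<And>r. peval P (f r) = 0"
    and h: "\<And>c. h c \<in> ideal_gen (range f)"
      "\<And>c c'. peval P (partial_deriv (col c') (h c)) = (if c' = c then \<kappa> c else 0)"
    and \<kappa>: "\<And>c. \<kappa> c \<noteq> 0"
  shows "det (\<chi> r c. peval P (partial_deriv (col c) (f r))) \<noteq> 0"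
proof -
  let ?J = "\<chi> r c. peval P (partial_deriv (col c) (f r))"
  have "\<exists>g. h c = (\<Sum>r\<in>UNIV. g r * f r)" for c
    using h(1)[of c] ideal_gen_image[of UNIV "h c" f] by auto
  then obtain g where g: "\<And>c. h c = (\<Sum>r\<in>UNIV. g c r * f r)" by metis
  let ?C = "\<chi> c r. peval P (g c r)"
  have "(?C ** ?J) $ c $ c' = (if c' = c then \<kappa> c else 0)" for c c'
  proof -
    have "(if c' = c then \<kappa> c else 0) = peval P (partial_deriv (col c') (\<Sum>r\<in>UNIV. g c r * f r))"
      using h(2)[of c' c] unfolding g by (rule sym)
    also have "\<dots> = (\<Sum>r\<in>UNIV. peval P (g c r) * peval P (partial_deriv (col c') (f r)))"
      by (simp add: partial_deriv_mult f)
    finally show ?thesis by (simp add: matrix_matrix_mult_def)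
  qed
  then have "det (?C ** ?J) = (\<Prod>c\<in>UNIV. \<kappa> c)"
    by (subst det_diagonal) auto
  then have "det ?C * det ?J = (\<Prod>c\<in>UNIV. \<kappa> c)" by (simp only: det_mul)
  moreover have "(\<Prod>c\<in>UNIV. \<kappa> c) \<noteq> 0" using \<kappa> by simp
  ultimately show ?thesis by (metis mult_zero_right)
qed

lemma hvan_Var_nzd:
  assumes A: "\<And>q. q \<in> A \<Longrightarrow> q None = 1" and g: "Var None * g \<in> hvan tdeg A"
  shows "g \<in> hvan tdeg A"
  unfolding hvan_iff[OF additive_tdeg]
proof (intro allI ballI)
  fix d u assume u: "u \<in> A"
  have V: "Var None \<in> whom tdeg 1" using Var_hom[of None] by (simp add: hom_comp_whom)
  have "peval u (pcomp tdeg (1 + d) (Var None * g)) = 0"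
    using g u unfolding hvan_iff[OF additive_tdeg] by blast
  then show "peval u (pcomp tdeg d g) = 0"
    using pcomp_mult_whom[OF additive_tdeg V, of d g] A[OF u] by simp
qed

context jacobian_forms
begin

lemma bez_separates: "q \<in> A \<Longrightarrow> jac q \<noteq> 0 \<Longrightarrow> separates (hom_comp rho) (A - {q}) q"
  unfolding separates_def
  by (intro bexI[of _ "bez q"] conjI ballI) (auto simp: bez_hom bez_other bez_self)

lemma bez_separates_ge: "q \<in> A \<Longrightarrow> jac q \<noteq> 0 \<Longrightarrow> rho \<le> e \<Longrightarrow> separates (hom_comp e) (A - {q}) q"
  using separates_mono[OF bez_separates] normalized by blast

text \<open>
  A functional on forms of degree \<open>rho - 1\<close> kills all lower degrees too, since
  multiplying by a power of \<open>X_0\<close> does not change the values.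
\<close>

lemma kills_exists:
  assumes u: "u \<in> A" and ns: "\<And>k. k < rho \<Longrightarrow> \<not> separates (hom_comp k) (A - {u}) u"
  obtains c where "kills c" "c u \<noteq> 0"
proof (cases "rho = 0")
  case True
  then have "kills (\<lambda>_. 1)" by (simp add: kills_def)
  then show thesis using that by force
next
  case False
  then obtain c where c: "\<forall>G\<in>hom_comp (rho - 1). (\<Sum>q\<in>A. c q * peval q G) = 0" "c u \<noteq> 0"
    using functional_exists[OF finite_A u ns[of "rho - 1"]] by auto
  have "kills c"
    unfolding kills_def
  proof (intro allI impI ballI)
    fix k and G :: "('m option, 'k) mpoly" assume k: "k < rho" "G \<in> hom_comp k"
    let ?G = "Var None ^ (rho - 1 - k) * G"
    have "?G \<in> whom tdeg ((rho - 1 - k) + k)"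
      using k(2) by (intro whom_mult additive_tdeg Var_power_hom) (simp add: hom_comp_whom)
    then have "?G \<in> hom_comp (rho - 1)" using k(1) by (simp add: hom_comp_whom)
    then have "(\<Sum>q\<in>A. c q * peval q ?G) = 0" using c(1) by blast
    moreover have "(\<Sum>q\<in>A. c q * peval q ?G) = (\<Sum>q\<in>A. c q * peval q G)"
      by (rule sum.cong) (simp_all add: normalized)
    ultimately show "(\<Sum>q\<in>A. c q * peval q G) = 0" by simp
  qed
  then show thesis using that c(2) by blast
qed

lemma F_in_hvan: "F i \<in> hvan tdeg A"
  using hvan_whom_iff[of tdeg "F i" "d i" A] F_hom[of i] F_vanish by (simp add: hom_comp_whom)

lemma ideal_F_subset: "ideal_gen (range F) \<subseteq> hvan tdeg A"
  by (rule ideal_gen_least) (auto simp: F_in_hvan)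

theorem jacobian_generates:
  assumes u: "u \<in> A" "jac u \<noteq> 0" and ns: "\<And>k. k < rho \<Longrightarrow> \<not> separates (hom_comp k) (A - {u}) u"
    and two: "(2 :: 'k) \<noteq> 0"
  shows "ideal_gen (range F) = hvan tdeg A" and "koszul_on UNIV F"
proof -
  obtain c where c: "kills c" "c u \<noteq> 0" using kills_exists[OF u(1) ns] by blast
  obtain \<gamma> where \<gamma>: "(\<Sum>q\<in>A. Const (c q) * bez q) = Const \<gamma> * Var None ^ rho"
    "\<And>q. q \<in> A \<Longrightarrow> c q * jac q = \<gamma>" using residue[OF c(1)] by blast
  have \<gamma>0: "\<gamma> \<noteq> 0" using \<gamma>(2)[OF u(1)] c(2) u(2) by auto
  have "hvan tdeg A \<subseteq> ideal_gen (range F)"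
    unfolding hvan_def
  proof (rule ideal_gen_least)
    show "{G. (\<exists>d. G \<in> whom tdeg d) \<and> (\<forall>u\<in>A. peval u G = 0)} \<subseteq> ideal_gen (range F)"
    proof
      fix G assume "G \<in> {G. (\<exists>d. G \<in> whom tdeg d) \<and> (\<forall>u\<in>A. peval u G = 0)}"
      then obtain d where G: "G \<in> hom_comp d" "\<forall>u\<in>A. peval u G = 0" by (auto simp: hom_comp_whom)
      show "G \<in> ideal_gen (range F)"
        by (rule generate[OF c(1) \<gamma>(1) \<gamma>0]) (simp add: tops_hom[OF G(1)] normalized G(2))
    qed
  qed simp
  with ideal_F_subset show "ideal_gen (range F) = hvan tdeg A" by blast
  show "koszul_on UNIV F"
    unfolding koszul_on_def
  proof (intro allI impI)
    fix G assume "(\<Sum>i\<in>UNIV. G i * F i) = 0"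
    from koszul[OF c(1) \<gamma>(1) \<gamma>0 two this] obtain \<omega> where
      "\<And>k l. \<omega> l k = - \<omega> k l" "\<And>k. \<omega> k k = 0" "\<And>k. G k = (\<Sum>l\<in>UNIV. \<omega> k l * F l)" by blast
    then show "\<exists>\<omega>. (\<forall>k\<in>UNIV. \<forall>l\<in>UNIV. \<omega> l k = - \<omega> k l) \<and> (\<forall>k\<in>UNIV. \<omega> k k = 0) \<and>
          (\<forall>k\<in>UNIV. G k = (\<Sum>l\<in>UNIV. \<omega> k l * F l))" by (intro exI[of _ \<omega>] conjI ballI)
  qed
qed

text \<open>
  The vanishing ideal contains the products of a separator of \<open>q\<close> with the linear
  forms \<open>X_j - q_j * X_0\<close>, whose Jacobian at \<open>q\<close> is diagonal.
\<close>

lemma jac_nonzero: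
  assumes gen: "ideal_gen (range F) = hvan tdeg A" and q: "q \<in> A"
  shows "jac q \<noteq> 0"
proof -
  obtain e S where S: "S \<in> hom_comp e" "\<forall>w\<in>A - {q}. peval w S = 0" "peval q S \<noteq> 0"
    using separates_exists[OF finite_A _ q] normalized unfolding separates_def by blast
  have xi0: "peval q (xi q j) = 0" for j using normalized[OF q] by (simp add: peval_xi)
  show ?thesis
    unfolding jac_def
  proof (rule jacobian_nonzero[where h = "\<lambda>j. S * xi q j" and \<kappa> = "\<lambda>_. peval q S"])
    fix j
    have "xi q j \<in> whom tdeg 1"
      using Var_hom[of "Some j"] Var_hom[of None] unfolding xi_def hom_comp_whom
      by (intro whom_diff whom_scale additive_tdeg)
    then have "S * xi q j \<in> whom tdeg (e + 1)"
      using S(1) by (intro whom_mult additive_tdeg) (simp_all add: hom_comp_whom)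
    moreover have "peval w (S * xi q j) = 0" if "w \<in> A" for w
      using S(2) xi0[of j] that by (cases "w = q") simp_all
    ultimately show "S * xi q j \<in> ideal_gen (range F)"
      unfolding gen using hvan_whom_iff[OF additive_tdeg, of "S * xi q j" "e + 1" A] by blast
    fix j'
    have "partial_deriv (Some j') (xi q j) = (if j' = j then 1 else 0)"
      by (simp add: xi_def partial_deriv_mult partial_deriv_Var)
    then show "peval q (partial_deriv (Some j') (S * xi q j)) = (if j' = j then peval q S else 0)"
      by (simp add: partial_deriv_mult xi0)
  qed (use F_vanish q S(3) in auto)
qed

text \<open>
  If every point had a separator of degree \<open>rho - 1\<close>, these would interpolate every
  form of degree \<open>rho\<close> modulo \<open>X_0\<close>, so all forms of degree
  \<open>rho\<close> would lie in the ideal of the \<open>F i\<close> and \<open>X_0\<close>;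
  but the socle of this Artinian quotient sits in degree \<open>rho\<close>. So there are
  weights killing the forms of degree below \<open>rho\<close> with one nonzero entry. By the
  Euler-Jacobi formula all entries are nonzero, which excludes separators of small degree for
  every point.
\<close>

theorem complete_intersection_separators:
  assumes gen: "ideal_gen (range F) = hvan tdeg A" and reg: "regular_on (map F vs)"
    and vs: "distinct vs" "set vs = UNIV" and q: "q \<in> A"
  shows "separates (hom_comp e) (A - {q}) q \<longleftrightarrow> rho \<le> e"
proof -
  have low: "\<not> separates (hom_comp k) (A - {q}) q" if k: "k < rho" for k
  proof -
    have "\<exists>u\<in>A. \<not> separates (hom_comp (rho - 1)) (A - {u}) u"
    proof (rule ccontr)
      assume "\<not> (\<exists>u\<in>A. \<not> separates (hom_comp (rho - 1)) (A - {u}) u)"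
      then have "\<forall>u\<in>A. \<exists>S. S \<in> hom_comp (rho - 1) \<and> (\<forall>w\<in>A - {u}. peval w S = 0) \<and> peval u S \<noteq> 0"
        unfolding separates_def by blast
      then obtain S where S: "\<And>u. u \<in> A \<Longrightarrow> S u \<in> hom_comp (rho - 1)"
        "\<And>u w. u \<in> A \<Longrightarrow> w \<in> A - {u} \<Longrightarrow> peval w (S u) = 0" "\<And>u. u \<in> A \<Longrightarrow> peval u (S u) \<noteq> 0"
        by metis
      (* X_0 is regular modulo the vanishing ideal, so the sequence can be prolonged by it *)
      let ?fs = "map F vs @ [Var None]"
      have len: "length vs = CARD('m)" using vs by (metis distinct_card)
      have rF: "F ` UNIV = set (map F vs)" using vs(2) by simp
      have reg': "regular_on ?fs"
        unfolding regular_on_def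
      proof (intro allI impI)
        fix k g assume k: "k < length ?fs" and g: "?fs ! k * g \<in> ideal_gen (set (take k ?fs))"
        show "g \<in> ideal_gen (set (take k ?fs))"
        proof (cases "k < length vs")
          case True
          then show ?thesis using reg g unfolding regular_on_def by (auto simp: nth_append)
        next
          case False
          then have "k = length vs" using k by simp
          then have "Var None * g \<in> ideal_gen (range F)" "set (take k ?fs) = range F"
            using g rF by (auto simp: nth_append)
          then show ?thesis using hvan_Var_nzd[of A g] normalized by (simp add: gen)
        qed
      qed
      let ?d = "\<lambda>k. if k < length vs then d (vs ! k) else 1"
      have "\<exists>p\<in>hom_comp (\<Sum>k<length ?fs. ?d k - 1). p \<notin> ideal_gen (set ?fs)"
      proof (rule regular_socle[OF _ reg'])
        fix k assume k: "k < length ?fs"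
        have kk: "?fs ! k \<in> hom_comp (?d k) \<and> ?d k \<ge> 1"
        proof (cases "k < length vs")
          case True
          then have "?fs ! k = F (vs ! k)" "?d k = d (vs ! k)" by (simp_all add: nth_append)
          then show ?thesis using F_hom[of "vs ! k"] d_pos[of "vs ! k"] by (simp only: simp_thms)
        next
          case False
          then have "?fs ! k = Var None" "?d k = 1" using k by (simp_all add: nth_append)
          then show ?thesis using Var_hom[of None] by (simp only: simp_thms order_refl)
        qed
        show "?fs ! k \<in> hom_comp (?d k)" by (rule conjunct1[OF kk])
        show "?d k \<ge> 1" by (rule conjunct2[OF kk])
      qed (use len in simp)
      moreover have "(\<Sum>k<length ?fs. ?d k - 1) = rho"
      proof -
        have "(\<Sum>k<length ?fs. ?d k - 1) = (\<Sum>k<length vs. d (vs ! k) - 1)" by simp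
        also have "\<dots> = rho"
          unfolding rho_def using sum.reindex_bij_betw[OF bij_betw_nth[OF vs(1) refl refl], of "\<lambda>i. d i - 1"] vs(2)
          by simp
        finally show ?thesis .
      qed
      ultimately obtain p where p: "p \<in> hom_comp rho" "p \<notin> ideal_gen (set ?fs)" by auto
      (* the interpolant of p of degree rho - 1; X_0 has the value 1 on A *)
      define G where "G = (\<Sum>u\<in>A. Const (peval u p / peval u (S u)) * S u)"
      have G: "G \<in> whom tdeg (rho - 1)"
        unfolding G_def by (intro whom_sum whom_scale additive_tdeg) (use S(1) in \<open>simp add: hom_comp_whom\<close>)
      have Gq: "peval w G = peval w p" if w: "w \<in> A" for w
      proof -
        have "peval w G = (\<Sum>u\<in>A. if u = w then peval w p else 0)"
          unfolding G_def peval_sum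
        proof (rule sum.cong)
          fix u assume u: "u \<in> A"
          show "peval w (Const (peval u p / peval u (S u)) * S u) = (if u = w then peval w p else 0)"
            using S(2)[OF u, of w] S(3)[OF u] w by (cases "u = w") auto
        qed simp
        then show ?thesis using w finite_A by simp
      qed
      have V: "Var None \<in> whom tdeg 1" using Var_hom[of None] by (simp add: hom_comp_whom)
      have "Var None * G \<in> whom tdeg (1 + (rho - 1))" by (rule whom_mult[OF additive_tdeg V G])
      then have "Var None * G \<in> whom tdeg rho" using k by simp
      then have "p - Var None * G \<in> whom tdeg rho" using p(1) by (simp add: hom_comp_whom whom_diff)
      moreover have "\<forall>w\<in>A. peval w (p - Var None * G) = 0" using Gq normalized by simp
      ultimately have "p - Var None * G \<in> ideal_gen (range F)"
        unfolding gen using hvan_whom_iff[OF additive_tdeg] by blast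
      then have "p - Var None * G \<in> ideal_gen (set ?fs)"
        using ideal_gen_mono[of "range F" "set ?fs"] rF by auto
      moreover have "Var None * G \<in> ideal_gen (set ?fs)"
        by (rule ideal_mult_right[OF is_ideal_gen ideal_gen_superset]) simp
      ultimately have "(p - Var None * G) + Var None * G \<in> ideal_gen (set ?fs)"
        by (rule ideal_add[OF is_ideal_gen])
      then show False using p(2) by simp
    qed
    then obtain u where u: "u \<in> A" "\<not> separates (hom_comp (rho - 1)) (A - {u}) u" by blast
    have ns: "\<not> separates (hom_comp k) (A - {u}) u" if "k < rho" for k
    proof
      assume "separates (hom_comp k) (A - {u}) u"
      then have "separates (hom_comp (rho - 1)) (A - {u}) u"
        using separates_mono[of k "A - {u}" u "rho - 1"] normalized[OF u(1)] that by simp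
      then show False using u(2) by blast
    qed
    obtain c where c: "kills c" "c u \<noteq> 0" using kills_exists[OF u(1) ns] by blast
    obtain \<gamma> where \<gamma>: "\<And>q. q \<in> A \<Longrightarrow> c q * jac q = \<gamma>" using residue[OF c(1)] by blast
    have "\<gamma> \<noteq> 0" using \<gamma>[OF u(1)] c(2) jac_nonzero[OF gen u(1)] by auto
    then have cq: "c q \<noteq> 0" using \<gamma>[OF q] by auto
    show ?thesis
    proof
      assume "separates (hom_comp k) (A - {q}) q"
      then obtain S where S: "S \<in> hom_comp k" "\<forall>w\<in>A - {q}. peval w S = 0" "peval q S \<noteq> 0"
        unfolding separates_def by blast
      have "(\<Sum>w\<in>A. c w * peval w S) = (\<Sum>w\<in>A. if w = q then c q * peval q S else 0)"
        by (rule sum.cong) (use S(2) in auto)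
      also have "\<dots> = c q * peval q S" using finite_A q by simp
      finally show False using c(1) k S(1,3) cq unfolding kills_def by auto
    qed
  qed
  show ?thesis
    using low[of e] bez_separates_ge[OF q jac_nonzero[OF gen q], of e] by (cases "rho \<le> e") auto
qed

end

section \<open>Points of projective space\<close>

lemma proj_mem:
  assumes "P \<in> proj_space" "u \<in> P" "w \<in> P"
  shows "\<exists>c. c \<noteq> 0 \<and> w = (\<lambda>i. c * u i)"
proof -
  obtain v where v: "P = proj_point v" using assms(1) by (auto simp: proj_space_def)
  obtain a b where "a \<noteq> 0" "u = (\<lambda>i. a * v i)" "b \<noteq> 0" "w = (\<lambda>i. b * v i)"
    using assms(2,3) unfolding v proj_point_def by blast
  then have "b / a \<noteq> 0 \<and> w = (\<lambda>i. (b / a) * u i)" by (simp add: fun_eq_iff)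
  then show ?thesis by blast
qed

lemma proj_scale:
  assumes "P \<in> proj_space" "u \<in> P" "c \<noteq> 0"
  shows "(\<lambda>i. c * u i) \<in> P"
proof -
  obtain v where v: "P = proj_point v" using assms(1) by (auto simp: proj_space_def)
  obtain a where a: "a \<noteq> 0" "u = (\<lambda>i. a * v i)" using assms(2) unfolding v proj_point_def by blast
  then have "(\<lambda>i. c * u i) = (\<lambda>i. (c * a) * v i)" "c * a \<noteq> 0" using assms(3) by (auto simp: fun_eq_iff)
  then show ?thesis unfolding v proj_point_def by blast
qed

lemma proj_nonzero:
  assumes "P \<in> proj_space" "u \<in> P"
  shows "u \<noteq> (\<lambda>_. 0)"
proof -
  obtain v where v: "P = proj_point v" "v \<noteq> (\<lambda>_. 0)" using assms(1) by (auto simp: proj_space_def)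
  obtain a where "a \<noteq> 0" "u = (\<lambda>i. a * v i)" using assms(2) unfolding v(1) proj_point_def by blast
  then show ?thesis using v(2) by (auto simp: fun_eq_iff)
qed

lemma proj_nonempty:
  assumes "P \<in> proj_space"
  shows "\<exists>u. u \<in> P"
proof -
  obtain v where "P = proj_point v" using assms by (auto simp: proj_space_def)
  then have "(\<lambda>i. 1 * v i) \<in> P" unfolding proj_point_def using one_neq_zero by blast
  then show ?thesis by blast
qed

lemma proj_eq:
  assumes "P \<in> proj_space" "Q \<in> proj_space" "u \<in> P" "u \<in> Q"
  shows "P = Q"
proof -
  have "P' \<subseteq> Q'" if "P' \<in> proj_space" "Q' \<in> proj_space" "u \<in> P'" "u \<in> Q'" for P' Q'
    using proj_mem[OF that(1,3)] proj_scale[OF that(2,4)] by blast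
  then show ?thesis using assms by blast
qed

definition nvec :: "('m option \<Rightarrow> 'k::field) set \<Rightarrow> 'm option \<Rightarrow> 'k" where
  "nvec P = (SOME u. u \<in> P \<and> u None = 1)"

lemma nvec:
  assumes "P \<in> proj_space" "u \<in> P" "u None \<noteq> 0"
  shows "nvec P \<in> P" "nvec P None = 1"
proof -
  have "(\<lambda>i. (1 / u None) * u i) \<in> P" by (rule proj_scale[OF assms(1,2)]) (use assms(3) in simp)
  moreover have "(1 / u None) * u None = 1" using assms(3) by simp
  ultimately have "\<exists>w. w \<in> P \<and> w None = 1" by blast
  from someI_ex[OF this] show "nvec P \<in> P" "nvec P None = 1" by (simp_all add: nvec_def)
qed

locale affine_points =
  fixes Z :: "('m::finite option \<Rightarrow> 'k::field) set set"
  assumes Z_proj: "Z \<subseteq> proj_space" and finite_Z: "finite Z"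
    and Z_None: "P \<in> Z \<Longrightarrow> \<exists>u\<in>P. u None \<noteq> 0"
begin

definition reps :: "('m option \<Rightarrow> 'k) set" where "reps = nvec ` Z"

lemma nvec_Z:
  assumes "P \<in> Z"
  shows "nvec P \<in> P" "nvec P None = 1"
proof -
  obtain u where u: "u \<in> P" "u None \<noteq> 0" using Z_None[OF assms] by (elim bexE)
  have P: "P \<in> proj_space" by (rule subsetD[OF Z_proj assms])
  show "nvec P \<in> P" "nvec P None = 1" by (rule nvec[OF P u])+
qed

lemma finite_reps: "finite reps"
  by (simp add: reps_def finite_Z)

lemma reps_None: "q \<in> reps \<Longrightarrow> q None = 1"
  unfolding reps_def using nvec_Z(2) by (elim imageE) simp

lemma inj_nvec: "inj_on nvec Z"
proof (rule inj_onI)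
  fix P Q assume PQ: "P \<in> Z" "Q \<in> Z" "nvec P = nvec Q"
  show "P = Q"
    by (rule proj_eq[of _ _ "nvec P"])
      (use PQ Z_proj nvec_Z(1)[OF PQ(1)] nvec_Z(1)[OF PQ(2)] in auto)
qed

lemma card_reps: "card reps = card Z"
  by (simp add: reps_def card_image[OF inj_nvec])

lemma peval_rep_iff:
  assumes "P \<in> Z" "F \<in> hom_comp d"
  shows "(\<forall>u\<in>P. peval u F = 0) \<longleftrightarrow> peval (nvec P) F = 0"
proof
  assume "peval (nvec P) F = 0"
  show "\<forall>u\<in>P. peval u F = 0"
  proof
    fix u assume "u \<in> P"
    then obtain c where "u = (\<lambda>i. c * nvec P i)"
      using proj_mem[OF _ nvec_Z(1)[OF assms(1)]] Z_proj assms(1) by blast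
    then show "peval u F = 0" using \<open>peval (nvec P) F = 0\<close> by (simp add: peval_scale_hom[OF assms(2)])
  qed
qed (use nvec_Z assms in blast)

lemma van_ideal_reps: "van_ideal Z = hvan tdeg reps"
proof -
  have "van_ideal Z = hvan tdeg (\<Union>Z)"
    unfolding van_ideal_def hvan_def hom_comp_whom by (rule arg_cong[of _ _ ideal_gen]) auto
  also have "\<dots> = hvan tdeg reps"
  proof (rule hvan_cong)
    fix d and F :: "('m option, 'k) mpoly" assume "F \<in> whom tdeg d"
    then have "F \<in> hom_comp d" by (simp add: hom_comp_whom)
    from peval_rep_iff[OF _ this] show "(\<forall>u\<in>\<Union>Z. peval u F = 0) \<longleftrightarrow> (\<forall>u\<in>reps. peval u F = 0)"
      unfolding reps_def by blast
  qed
  finally show ?thesis .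
qed

lemma HF_proj_reps: "HF_proj Z d = eval_rank (hom_comp d) reps"
  unfolding HF_proj_def comp_dim_def eval_rank_def van_ideal_reps
  by (simp add: hvan_Int hom_comp_whom)

lemma HF_proj_full: "HF_proj Z d = card Z \<longleftrightarrow> (\<forall>u\<in>reps. separates (hom_comp d) (reps - {u}) u)"
  unfolding HF_proj_reps card_reps[symmetric]
  by (rule eval_rank_eq_card[OF fin_dim_hom_comp _ finite_reps])
    (simp add: hom_comp_whom whom_subspace)

lemma reg_index_eq:
  assumes ne: "Z \<noteq> {}"
    and sep: "\<And>u e. u \<in> reps \<Longrightarrow> separates (hom_comp e) (reps - {u}) u \<longleftrightarrow> r \<le> e"
  shows "reg_index Z = r"
  unfolding reg_index_def HF_proj_full
proof (rule Least_equality)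
  show "\<forall>i\<ge>r. \<forall>u\<in>reps. separates (hom_comp i) (reps - {u}) u" using sep by blast
next
  fix i0 assume "\<forall>i\<ge>i0. \<forall>u\<in>reps. separates (hom_comp i) (reps - {u}) u"
  moreover obtain u where "u \<in> reps" using ne by (auto simp: reps_def)
  ultimately have "separates (hom_comp i0) (reps - {u}) u" by blast
  then show "r \<le> i0" using sep[OF \<open>u \<in> reps\<close>] by simp
qed

end

section \<open>The bigraded ring and its two factors\<close>

text \<open>
  \<open>embX\<close> and \<open>embY\<close> include the coordinate rings of the factors into
  the bigraded ring; \<open>atY w\<close> and \<open>atX u\<close> specialize one group of
  variables and are retractions of these inclusions.
\<close>

definition embX :: "('a, 'k::comm_ring_1) mpoly \<Rightarrow> ('a + 'b, 'k) mpoly" where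
  "embX = subst (\<lambda>v. Var (Inl v))"

definition embY :: "('b, 'k::comm_ring_1) mpoly \<Rightarrow> ('a + 'b, 'k) mpoly" where
  "embY = subst (\<lambda>v. Var (Inr v))"

definition atY :: "('b \<Rightarrow> 'k::comm_ring_1) \<Rightarrow> ('a + 'b, 'k) mpoly \<Rightarrow> ('a, 'k) mpoly" where
  "atY w = subst (case_sum Var (\<lambda>v. Const (w v)))"

definition atX :: "('a \<Rightarrow> 'k::comm_ring_1) \<Rightarrow> ('a + 'b, 'k) mpoly \<Rightarrow> ('b, 'k) mpoly" where
  "atX u = subst (case_sum (\<lambda>v. Const (u v)) Var)"

lemma embX_simps [simp]: "embX 0 = 0" "embX 1 = 1" "embX (p + q) = embX p + embX q"
  "embX (p - q) = embX p - embX q" "embX (p * q) = embX p * embX q" "embX (Const c) = Const c"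
  "embX (sum f S) = (\<Sum>x\<in>S. embX (f x))" "embX (Var v) = Var (Inl v)"
  by (simp_all add: embX_def)

lemma embY_simps [simp]: "embY 0 = 0" "embY 1 = 1" "embY (p + q) = embY p + embY q"
  "embY (p - q) = embY p - embY q" "embY (p * q) = embY p * embY q" "embY (Const c) = Const c"
  "embY (sum f S) = (\<Sum>x\<in>S. embY (f x))" "embY (Var v) = Var (Inr v)"
  by (simp_all add: embY_def)

lemma atY_simps [simp]: "atY w 0 = 0" "atY w 1 = 1" "atY w (p + q) = atY w p + atY w q"
  "atY w (p - q) = atY w p - atY w q" "atY w (p * q) = atY w p * atY w q" "atY w (Const c) = Const c"
  "atY w (sum f S) = (\<Sum>x\<in>S. atY w (f x))" "atY w (Var (Inl v)) = Var v" "atY w (Var (Inr v')) = Const (w v')"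
  by (simp_all add: atY_def)

lemma atX_simps [simp]: "atX u 0 = 0" "atX u 1 = 1" "atX u (p + q) = atX u p + atX u q"
  "atX u (p - q) = atX u p - atX u q" "atX u (p * q) = atX u p * atX u q" "atX u (Const c) = Const c"
  "atX u (sum f S) = (\<Sum>x\<in>S. atX u (f x))" "atX u (Var (Inl v)) = Const (u v)" "atX u (Var (Inr v')) = Var v'"
  by (simp_all add: atX_def)

lemma atY_embX [simp]: "atY w (embX p) = p"
  by (induction p rule: mpoly_ring_induct) simp_all

lemma atX_embY [simp]: "atX u (embY p) = p"
  by (induction p rule: mpoly_ring_induct) simp_all

lemma atY_embY [simp]: "atY w (embY p) = Const (peval w p)"
  by (induction p rule: mpoly_ring_induct) (simp_all add: single_add mult_single)

lemma atX_embX [simp]: "atX u (embX p) = Const (peval u p)"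
  by (induction p rule: mpoly_ring_induct) (simp_all add: single_add mult_single)

lemma peval_embX [simp]: "peval (case_sum u w) (embX p) = peval u p"
  by (induction p rule: mpoly_ring_induct) simp_all

lemma peval_embY [simp]: "peval (case_sum u w) (embY p) = peval w p"
  by (induction p rule: mpoly_ring_induct) simp_all

lemma peval_atY: "peval u (atY w p) = peval (case_sum u w) p"
proof (induction p rule: mpoly_ring_induct)
  case (Var v) show ?case by (cases v) simp_all
qed simp_all

lemma peval_atX: "peval w (atX u p) = peval (case_sum u w) p"
proof (induction p rule: mpoly_ring_induct)
  case (Var v) show ?case by (cases v) simp_all
qed simp_all

lemma peval_partial_Inl:
  "peval (case_sum u w) (partial_deriv (Inl v) p) = peval u (partial_deriv v (atY w p))"
proof (induction p rule: mpoly_ring_induct)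
  case (Var x) show ?case by (cases x) (simp_all add: partial_deriv_Var)
qed (simp_all add: partial_deriv_mult peval_atY)

lemma peval_partial_Inr:
  "peval (case_sum u w) (partial_deriv (Inr v) p) = peval w (partial_deriv v (atX u p))"
proof (induction p rule: mpoly_ring_induct)
  case (Var x) show ?case by (cases x) (simp_all add: partial_deriv_Var)
qed (simp_all add: partial_deriv_mult peval_atX)

lemma single_split:
  fixes t :: "('a::finite + 'b::finite) \<Rightarrow>\<^sub>0 nat" and c :: "'k::comm_ring_1"
  defines "M \<equiv> \<Prod>v\<in>UNIV. Var v ^ Poly_Mapping.lookup t (Inl v) :: ('a, 'k) mpoly"
    and "N \<equiv> \<Prod>v\<in>UNIV. Var v ^ Poly_Mapping.lookup t (Inr v) :: ('b, 'k) mpoly"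
  shows "Poly_Mapping.single t c = embX (Const c * M) * embY N"
    and "Const c * M \<in> hom_comp (fst (bideg t))" and "N \<in> hom_comp (snd (bideg t))"
proof -
  have "Poly_Mapping.single t c = Const c * mon Var t" by (rule single_eq_mon)
  also have "mon Var t = embX M * (embY N :: ('a + 'b, 'k) mpoly)"
    unfolding mon_UNIV prod_UNIV_sum M_def N_def embX_def embY_def by simp
  finally show "Poly_Mapping.single t c = embX (Const c * M) * embY N"
    by (simp only: embX_simps mult.assoc)
  have "M \<in> whom tdeg (\<Sum>v\<in>UNIV. Poly_Mapping.lookup t (Inl v))"
    unfolding M_def by (rule whom_prod[OF additive_tdeg Var_power_hom])
  then show "Const c * M \<in> hom_comp (fst (bideg t))"
    unfolding hom_comp_whom bideg_def fst_conv by (rule whom_scale[OF additive_tdeg])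
  have "N \<in> whom tdeg (\<Sum>v\<in>UNIV. Poly_Mapping.lookup t (Inr v))"
    unfolding N_def by (rule whom_prod[OF additive_tdeg Var_power_hom])
  then show "N \<in> hom_comp (snd (bideg t))"
    unfolding hom_comp_whom bideg_def snd_conv .
qed

lemma sum_Pair_0: "(\<Sum>v\<in>S. (f v, 0 :: nat)) = (\<Sum>v\<in>S. f v :: nat, 0)"
  by (induction S rule: infinite_finite_induct) (simp_all add: zero_prod_def)

lemma sum_0_Pair: "(\<Sum>v\<in>S. (0 :: nat, f v)) = (0, \<Sum>v\<in>S. f v :: nat)"
  by (induction S rule: infinite_finite_induct) (simp_all add: zero_prod_def)

lemma embX_hom:
  fixes p :: "('a::finite, 'k::comm_ring_1) mpoly"
  assumes "p \<in> hom_comp i"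
  shows "(embX p :: ('a + 'b::finite, 'k) mpoly) \<in> whom bideg (i, 0)"
proof -
  have m: "(mon (\<lambda>v. Var (Inl v)) t :: ('a + 'b, 'k) mpoly) \<in> whom bideg (tdeg t, 0)" for t
  proof -
    have "Var (Inl v) ^ n \<in> whom bideg (n, 0)" for v :: 'a and n
      unfolding Var_power by (simp add: whom_single)
    then have "(mon (\<lambda>v. Var (Inl v)) t :: ('a + 'b, 'k) mpoly) \<in> whom bideg (\<Sum>v\<in>UNIV. (Poly_Mapping.lookup t v, 0))"
      unfolding mon_UNIV by (intro whom_prod additive_bideg)
    then show ?thesis by (simp add: sum_Pair_0 tdeg_def)
  qed
  show ?thesis
    unfolding embX_def subst_def lin_ext_def
  proof (rule whom_sum)
    fix t assume "t \<in> Poly_Mapping.keys p"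
    then have "tdeg t = i" using assms by (simp add: hom_comp_whom whom_def)
    then show "(Const (Poly_Mapping.lookup p t) * mon (\<lambda>v. Var (Inl v)) t :: ('a + 'b, 'k) mpoly) \<in> whom bideg (i, 0)"
      using m[of t] by (intro whom_scale additive_bideg) simp
  qed
qed

lemma embY_hom:
  fixes p :: "('b::finite, 'k::comm_ring_1) mpoly"
  assumes "p \<in> hom_comp i"
  shows "(embY p :: ('a::finite + 'b, 'k) mpoly) \<in> whom bideg (0, i)"
proof -
  have m: "(mon (\<lambda>v. Var (Inr v)) t :: ('a + 'b, 'k) mpoly) \<in> whom bideg (0, tdeg t)" for t
  proof -
    have "Var (Inr v) ^ n \<in> whom bideg (0, n)" for v :: 'b and n
      unfolding Var_power by (simp add: whom_single)
    then have "(mon (\<lambda>v. Var (Inr v)) t :: ('a + 'b, 'k) mpoly) \<in> whom bideg (\<Sum>v\<in>UNIV. (0, Poly_Mapping.lookup t v))"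
      unfolding mon_UNIV by (intro whom_prod additive_bideg)
    then show ?thesis by (simp add: sum_0_Pair tdeg_def)
  qed
  show ?thesis
    unfolding embY_def subst_def lin_ext_def
  proof (rule whom_sum)
    fix t assume "t \<in> Poly_Mapping.keys p"
    then have "tdeg t = i" using assms by (simp add: hom_comp_whom whom_def)
    then show "(Const (Poly_Mapping.lookup p t) * mon (\<lambda>v. Var (Inr v)) t :: ('a + 'b, 'k) mpoly) \<in> whom bideg (0, i)"
      using m[of t] by (intro whom_scale additive_bideg) simp
  qed
qed

lemma embXY_hom:
  assumes "p \<in> hom_comp i" "q \<in> hom_comp j"
  shows "embX p * embY q \<in> whom bideg (i, j)"
  using whom_mult[OF additive_bideg embX_hom[OF assms(1)] embY_hom[OF assms(2)]] by simp

text \<open>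
  Additive properties of a bihomogeneous polynomial need to be checked only on products of a
  form in \<open>X\<close> and a form in \<open>Y\<close>.
\<close>

lemma sum_single_split:
  fixes f :: "('a::finite + 'b::finite, 'k::comm_ring_1) mpoly"
  assumes add: "\<And>(S :: (('a + 'b) \<Rightarrow>\<^sub>0 nat) set) g. finite S \<Longrightarrow> (\<And>t. t \<in> S \<Longrightarrow> Q (g t)) \<Longrightarrow> Q (\<Sum>t\<in>S. g t)"
    and base: "\<And>t M N. t \<in> Poly_Mapping.keys f \<Longrightarrow> M \<in> hom_comp (fst (bideg t)) \<Longrightarrow> N \<in> hom_comp (snd (bideg t))
      \<Longrightarrow> Q (embX M * embY N)"
  shows "Q f"
proof -
  have "Q (\<Sum>t\<in>Poly_Mapping.keys f. Poly_Mapping.single t (Poly_Mapping.lookup f t))"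
  proof (rule add)
    fix t assume t: "t \<in> Poly_Mapping.keys f"
    show "Q (Poly_Mapping.single t (Poly_Mapping.lookup f t))"
      using base[OF t single_split(2)[where t = t and c = "Poly_Mapping.lookup f t"] single_split(3)[where t = t]]
        single_split(1)[where t = t and c = "Poly_Mapping.lookup f t"]
      by (simp only:)
  qed simp
  then show ?thesis using mpoly_sum_monomials[of f] by simp
qed

lemma atY_hom:
  fixes f :: "('a::finite + 'b::finite, 'k::comm_ring_1) mpoly"
  assumes "f \<in> whom bideg (i, j)"
  shows "atY w f \<in> hom_comp i"
  unfolding hom_comp_whom
proof (rule sum_single_split[where Q = "\<lambda>f. atY w f \<in> whom tdeg i"])
  fix t and M :: "('a, 'k) mpoly" and N :: "('b, 'k) mpoly"
  assume "t \<in> Poly_Mapping.keys f" "M \<in> hom_comp (fst (bideg t))" "N \<in> hom_comp (snd (bideg t))"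
  then have "M \<in> whom tdeg i" using assms by (simp add: whom_def hom_comp_whom)
  then have "Const (peval w N) * M \<in> whom tdeg i" by (rule whom_scale[OF additive_tdeg])
  then show "atY w (embX M * embY N) \<in> whom tdeg i" by (simp add: mult.commute)
qed (simp only: atY_simps atX_simps, rule whom_sum, blast)

lemma atX_hom:
  fixes f :: "('a::finite + 'b::finite, 'k::comm_ring_1) mpoly"
  assumes "f \<in> whom bideg (i, j)"
  shows "atX u f \<in> hom_comp j"
  unfolding hom_comp_whom
proof (rule sum_single_split[where Q = "\<lambda>f. atX u f \<in> whom tdeg j"])
  fix t and M :: "('a, 'k) mpoly" and N :: "('b, 'k) mpoly"
  assume "t \<in> Poly_Mapping.keys f" "M \<in> hom_comp (fst (bideg t))" "N \<in> hom_comp (snd (bideg t))"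
  then have "N \<in> whom tdeg j" using assms by (simp add: whom_def hom_comp_whom)
  then have "Const (peval u M) * N \<in> whom tdeg j" by (rule whom_scale[OF additive_tdeg])
  then show "atX u (embX M * embY N) \<in> whom tdeg j" by simp
qed (simp only: atY_simps atX_simps, rule whom_sum, blast)

lemma hom_comp_0_Const:
  fixes p :: "('i::finite, 'k::comm_ring_1) mpoly"
  assumes "p \<in> hom_comp 0"
  shows "p = Const (Poly_Mapping.lookup p 0)"
proof (rule poly_mapping_eqI)
  fix t
  show "Poly_Mapping.lookup p t = Poly_Mapping.lookup (Const (Poly_Mapping.lookup p 0)) t"
  proof (cases "t = 0")
    case False
    then have "\<exists>v. Poly_Mapping.lookup t v \<noteq> 0" by (metis lookup_zero poly_mapping_eqI)
    then have "tdeg t \<noteq> 0" by (auto simp: tdeg_def)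
    then have "Poly_Mapping.lookup p t = 0" using assms unfolding hom_comp_whom whom_iff by metis
    then show ?thesis using False by (simp add: lookup_single when_def)
  qed simp
qed

lemma embX_atY:
  fixes f :: "('a::finite + 'b::finite, 'k::comm_ring_1) mpoly"
  assumes "f \<in> whom bideg (i, 0)"
  shows "embX (atY w f) = f"
proof (rule sum_single_split[where Q = "\<lambda>f. embX (atY w f) = f"])
  fix t and M :: "('a, 'k) mpoly" and N :: "('b, 'k) mpoly"
  assume "t \<in> Poly_Mapping.keys f" "M \<in> hom_comp (fst (bideg t))" "N \<in> hom_comp (snd (bideg t))"
  then have N: "N \<in> hom_comp 0" using assms by (simp add: whom_def)
  obtain c where c: "N = Const c" using hom_comp_0_Const[OF N] by blast
  show "embX (atY w (embX M * embY N)) = embX M * embY N" unfolding c by simp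
qed (simp only: atY_simps embX_simps, rule sum.cong, simp_all)

lemma embY_atX:
  fixes f :: "('a::finite + 'b::finite, 'k::comm_ring_1) mpoly"
  assumes "f \<in> whom bideg (0, j)"
  shows "embY (atX u f) = f"
proof (rule sum_single_split[where Q = "\<lambda>f. embY (atX u f) = f"])
  fix t and M :: "('a, 'k) mpoly" and N :: "('b, 'k) mpoly"
  assume "t \<in> Poly_Mapping.keys f" "M \<in> hom_comp (fst (bideg t))" "N \<in> hom_comp (snd (bideg t))"
  then have M: "M \<in> hom_comp 0" using assms by (simp add: whom_def)
  obtain c where c: "M = Const c" using hom_comp_0_Const[OF M] by blast
  show "embY (atX u (embX M * embY N)) = embX M * embY N" unfolding c by simp
qed (simp only: atX_simps embY_simps, rule sum.cong, simp_all)

section \<open>Products of finite sets of vectors\<close>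

definition vpairs :: "('a \<Rightarrow> 'k) set \<Rightarrow> ('b \<Rightarrow> 'k) set \<Rightarrow> ('a + 'b \<Rightarrow> 'k) set" where
  "vpairs A B = {case_sum u w |u w. u \<in> A \<and> w \<in> B}"

lemma case_sum_eq_iff: "case_sum u w = case_sum u' w' \<longleftrightarrow> u = u' \<and> w = w'"
proof
  assume eq: "case_sum u w = case_sum u' w'"
  have "u x = u' x" for x using fun_cong[OF eq, of "Inl x"] by simp
  moreover have "w x = w' x" for x using fun_cong[OF eq, of "Inr x"] by simp
  ultimately show "u = u' \<and> w = w'" by (simp add: fun_eq_iff)
qed simp

text \<open>
  The projection of \<open>projection_forms\<close> applied to the \<open>X\<close>-variables:
  on a product \<open>M * N\<close> it replaces \<open>M\<close> by the combination of the
  \<open>w q\<close> with the same values on \<open>A\<close>.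
\<close>

lemma projection_X:
  fixes f :: "('a::finite + 'b::finite, 'k::field) mpoly"
  assumes f: "f \<in> whom bideg (i, j)"
    and w: "\<forall>q\<in>A. w q \<in> hom_comp i"
      "\<forall>p\<in>hom_comp i. \<forall>z\<in>A. peval z p = (\<Sum>q\<in>A. peval q p * peval z (w q))"
  shows "f - (\<Sum>q\<in>A. embX (w q) * embY (atX q f)) \<in> ideal_gen (embX ` hvan tdeg A)"
proof (rule sum_single_split[where Q = "\<lambda>f. f - (\<Sum>q\<in>A. embX (w q) * embY (atX q f)) \<in> ideal_gen (embX ` hvan tdeg A)"])
  fix S and g :: "_ \<Rightarrow> ('a + 'b, 'k) mpoly"
  assume g: "\<And>t. t \<in> S \<Longrightarrow> g t - (\<Sum>q\<in>A. embX (w q) * embY (atX q (g t))) \<in> ideal_gen (embX ` hvan tdeg A)"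
  have "(\<Sum>t\<in>S. g t) - (\<Sum>q\<in>A. embX (w q) * embY (atX q (\<Sum>t\<in>S. g t)))
      = (\<Sum>t\<in>S. g t) - (\<Sum>q\<in>A. \<Sum>t\<in>S. embX (w q) * embY (atX q (g t)))"
    by (simp only: atX_simps embY_simps sum_distrib_left)
  also have "\<dots> = (\<Sum>t\<in>S. g t - (\<Sum>q\<in>A. embX (w q) * embY (atX q (g t))))"
    by (subst sum.swap) (simp only: sum_subtractf)
  also have "\<dots> \<in> ideal_gen (embX ` hvan tdeg A)" by (intro ideal_sum is_ideal_gen g)
  finally show "(\<Sum>t\<in>S. g t) - (\<Sum>q\<in>A. embX (w q) * embY (atX q (\<Sum>t\<in>S. g t))) \<in> ideal_gen (embX ` hvan tdeg A)" .
next
  fix t and M :: "('a, 'k) mpoly" and N :: "('b, 'k) mpoly"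
  assume "t \<in> Poly_Mapping.keys f" "M \<in> hom_comp (fst (bideg t))"
  then have M: "M \<in> hom_comp i" using f by (simp add: whom_def)
  define D where "D = M - (\<Sum>q\<in>A. Const (peval q M) * w q)"
  have "D \<in> whom tdeg i"
    unfolding D_def using M w(1)
    by (intro whom_diff whom_sum whom_scale additive_tdeg) (auto simp: hom_comp_whom)
  moreover have "\<forall>z\<in>A. peval z D = 0" using w(2) M by (simp add: D_def)
  ultimately have D: "D \<in> hvan tdeg A" using hvan_whom_iff[OF additive_tdeg] by blast
  have "embX M * embY N - (\<Sum>q\<in>A. embX (w q) * embY (atX q (embX M * embY N)))
      = embX M * embY N - (\<Sum>q\<in>A. embX (Const (peval q M) * w q) * embY N)"
    by (simp only: atX_simps atX_embX atX_embY embY_simps embX_simps ac_simps)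
  also have "\<dots> = embY N * embX D"
    unfolding D_def embX_simps(4,7) right_diff_distrib sum_distrib_left by (simp only: ac_simps)
  also have "\<dots> \<in> ideal_gen (embX ` hvan tdeg A)"
    by (intro ideal_mult is_ideal_gen ideal_gen_superset imageI D)
  finally show "embX M * embY N - (\<Sum>q\<in>A. embX (w q) * embY (atX q (embX M * embY N)))
      \<in> ideal_gen (embX ` hvan tdeg A)" .
qed

lemma projection_hom:
  fixes A :: "('i::finite \<Rightarrow> 'k::field) set"
  assumes "finite A"
  obtains w where "\<forall>q\<in>A. w q \<in> hom_comp i"
      "\<forall>p\<in>hom_comp i. \<forall>z\<in>A. peval z p = (\<Sum>q\<in>A. peval q p * peval z (w q))"
proof -
  have "mp.subspace (hom_comp i :: ('i, 'k) mpoly set)" by (simp add: hom_comp_whom whom_subspace)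
  from projection_forms[OF this assms] show thesis using that by blast
qed

lemma hvan_embX:
  fixes A :: "('a::finite \<Rightarrow> 'k::field) set" and B :: "('b::finite \<Rightarrow> 'k) set"
  assumes p: "p \<in> hvan tdeg A"
  shows "embX p \<in> hvan bideg (vpairs A B)"
proof -
  have "(\<Sum>d\<in>tdeg ` Poly_Mapping.keys p. embX (pcomp tdeg d p)) \<in> hvan bideg (vpairs A B)"
  proof (rule ideal_sum)
    fix d
    have "embX (pcomp tdeg d p) \<in> whom bideg (d, 0)" by (rule embX_hom) (simp add: hom_comp_whom)
    moreover have "\<forall>v\<in>vpairs A B. peval v (embX (pcomp tdeg d p)) = 0"
      using p by (auto simp: vpairs_def hvan_iff[OF additive_tdeg])
    ultimately show "embX (pcomp tdeg d p) \<in> hvan bideg (vpairs A B)"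
      using hvan_whom_iff[OF additive_bideg] by blast
  qed simp
  moreover have "(embX p :: ('a + 'b, 'k) mpoly) = (\<Sum>d\<in>tdeg ` Poly_Mapping.keys p. embX (pcomp tdeg d p))"
    using arg_cong[OF sum_pcomp[of p tdeg], of embX] by (simp only: embX_simps)
  ultimately show ?thesis by simp
qed

lemma hvan_embY:
  fixes A :: "('a::finite \<Rightarrow> 'k::field) set" and B :: "('b::finite \<Rightarrow> 'k) set"
  assumes p: "p \<in> hvan tdeg B"
  shows "embY p \<in> hvan bideg (vpairs A B)"
proof -
  have "(\<Sum>d\<in>tdeg ` Poly_Mapping.keys p. embY (pcomp tdeg d p)) \<in> hvan bideg (vpairs A B)"
  proof (rule ideal_sum)
    fix d
    have "embY (pcomp tdeg d p) \<in> whom bideg (0, d)" by (rule embY_hom) (simp add: hom_comp_whom)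
    moreover have "\<forall>v\<in>vpairs A B. peval v (embY (pcomp tdeg d p)) = 0"
      using p by (auto simp: vpairs_def hvan_iff[OF additive_tdeg])
    ultimately show "embY (pcomp tdeg d p) \<in> hvan bideg (vpairs A B)"
      using hvan_whom_iff[OF additive_bideg] by blast
  qed simp
  moreover have "(embY p :: ('a + 'b, 'k) mpoly) = (\<Sum>d\<in>tdeg ` Poly_Mapping.keys p. embY (pcomp tdeg d p))"
    using arg_cong[OF sum_pcomp[of p tdeg], of embY] by (simp only: embY_simps)
  ultimately show ?thesis by simp
qed

lemma hvan_atX:
  assumes "f \<in> whom bideg (i, j)" "\<forall>v\<in>vpairs A B. peval v f = 0" "u \<in> A"
  shows "atX u f \<in> hvan tdeg B"
proof -
  have "atX u f \<in> whom tdeg j" using atX_hom[OF assms(1)] by (simp add: hom_comp_whom)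
  moreover have "\<forall>w\<in>B. peval w (atX u f) = 0" using assms(2,3) by (auto simp: peval_atX vpairs_def)
  ultimately show ?thesis using hvan_whom_iff[OF additive_tdeg] by blast
qed

text \<open>
  After a projection in \<open>X\<close>, the remaining coefficients \<open>atX q f\<close>
  vanish on \<open>B\<close>.
\<close>

lemma hvan_vpairs:
  fixes A :: "('a::finite \<Rightarrow> 'k::field) set" and B :: "('b::finite \<Rightarrow> 'k) set"
  assumes A: "finite A"
  shows "hvan bideg (vpairs A B) = ideal_gen (embX ` hvan tdeg A \<union> embY ` hvan tdeg B)"
proof
  show "ideal_gen (embX ` hvan tdeg A \<union> embY ` hvan tdeg B) \<subseteq> hvan bideg (vpairs A B)"
    by (rule ideal_gen_least) (auto intro: hvan_embX hvan_embY)
next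
  let ?J = "ideal_gen (embX ` hvan tdeg A \<union> embY ` hvan tdeg B) :: ('a + 'b, 'k) mpoly set"
  have "{F :: ('a + 'b, 'k) mpoly. (\<exists>d. F \<in> whom bideg d) \<and> (\<forall>u\<in>vpairs A B. peval u F = 0)} \<subseteq> ?J"
  proof
    fix f :: "('a + 'b, 'k) mpoly"
    assume "f \<in> {F. (\<exists>d. F \<in> whom bideg d) \<and> (\<forall>u\<in>vpairs A B. peval u F = 0)}"
    then obtain i j where f: "f \<in> whom bideg (i, j)" "\<forall>u\<in>vpairs A B. peval u f = 0" by auto
    obtain w :: "_ \<Rightarrow> ('a, 'k) mpoly" where w: "\<forall>q\<in>A. w q \<in> hom_comp i"
      "\<forall>p\<in>hom_comp i. \<forall>z\<in>A. peval z p = (\<Sum>q\<in>A. peval q p * peval z (w q))"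
      using projection_hom[OF A] by blast
    have "f - (\<Sum>q\<in>A. embX (w q) * embY (atX q f)) \<in> ?J"
      using projection_X[OF f(1) w] ideal_gen_mono[of "embX ` hvan tdeg A" "embX ` hvan tdeg A \<union> embY ` hvan tdeg B"]
      by blast
    moreover have "(\<Sum>q\<in>A. embX (w q) * embY (atX q f)) \<in> ?J"
    proof (rule ideal_sum)
      fix q assume "q \<in> A"
      then have "atX q f \<in> hvan tdeg B" by (rule hvan_atX[OF f])
      then show "embX (w q) * embY (atX q f) \<in> ?J"
        by (intro ideal_mult is_ideal_gen ideal_gen_superset) blast
    qed simp
    ultimately have "(f - (\<Sum>q\<in>A. embX (w q) * embY (atX q f))) + (\<Sum>q\<in>A. embX (w q) * embY (atX q f)) \<in> ?J"
      by (rule ideal_add[OF is_ideal_gen])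
    then show "f \<in> ?J" by simp
  qed
  then show "hvan bideg (vpairs A B) \<subseteq> ?J" unfolding hvan_def by (rule ideal_gen_least[OF is_ideal_gen])
qed

text \<open>
  Specializing a separator of a pair in one coordinate gives a separator of the other
  coordinate, and the product of two separators separates the pair.
\<close>

lemma separates_vpairs:
  fixes A :: "('a::finite \<Rightarrow> 'k::field) set" and B :: "('b::finite \<Rightarrow> 'k) set"
  assumes u: "u \<in> A" and w: "w \<in> B"
  shows "separates (whom bideg (i, j)) (vpairs A B - {case_sum u w}) (case_sum u w) \<longleftrightarrow>
    separates (hom_comp i) (A - {u}) u \<and> separates (hom_comp j) (B - {w}) w"
proof
  assume "separates (whom bideg (i, j)) (vpairs A B - {case_sum u w}) (case_sum u w)"
  then obtain f where f: "f \<in> whom bideg (i, j)" "\<forall>v\<in>vpairs A B - {case_sum u w}. peval v f = 0"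
    "peval (case_sum u w) f \<noteq> 0" unfolding separates_def by blast
  have "peval u' (atY w f) = 0" if "u' \<in> A - {u}" for u'
    using f(2) w that unfolding peval_atY vpairs_def by (auto simp: case_sum_eq_iff)
  then have "separates (hom_comp i) (A - {u}) u"
    unfolding separates_def using atY_hom[OF f(1), of w] f(3)
    by (intro bexI[of _ "atY w f"]) (auto simp: peval_atY)
  moreover have "peval w' (atX u f) = 0" if "w' \<in> B - {w}" for w'
    using f(2) u that unfolding peval_atX vpairs_def by (auto simp: case_sum_eq_iff)
  then have "separates (hom_comp j) (B - {w}) w"
    unfolding separates_def using atX_hom[OF f(1), of u] f(3)
    by (intro bexI[of _ "atX u f"]) (auto simp: peval_atX)
  ultimately show "separates (hom_comp i) (A - {u}) u \<and> separates (hom_comp j) (B - {w}) w" by blast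
next
  assume "separates (hom_comp i) (A - {u}) u \<and> separates (hom_comp j) (B - {w}) w"
  then obtain p q where p: "p \<in> hom_comp i" "\<forall>x\<in>A - {u}. peval x p = 0" "peval u p \<noteq> 0"
    and q: "q \<in> hom_comp j" "\<forall>x\<in>B - {w}. peval x q = 0" "peval w q \<noteq> 0"
    unfolding separates_def by blast
  have "peval v (embX p * embY q) = 0" if vv: "v \<in> vpairs A B - {case_sum u w}" for v
  proof -
    obtain u' w' where v: "v = case_sum u' w'" "u' \<in> A" "w' \<in> B"
      using vv unfolding vpairs_def by blast
    moreover have "u' \<noteq> u \<or> w' \<noteq> w" using vv v(1) by blast
    ultimately show ?thesis using p(2) q(2) by auto
  qed
  moreover have "peval (case_sum u w) (embX p * embY q) \<noteq> 0" using p(3) q(3) by simp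
  ultimately show "separates (whom bideg (i, j)) (vpairs A B - {case_sum u w}) (case_sum u w)"
    unfolding separates_def using embXY_hom[OF p(1) q(1)] by blast
qed

section \<open>Sets of points in a product of projective spaces\<close>

lemma bivan_ideal_reps:
  fixes X :: "('m::finite, 'n::finite, 'k::field) bipoint set"
  assumes X: "X \<subseteq> proj_space \<times> proj_space"
    and r: "\<And>P Q. (P, Q) \<in> X \<Longrightarrow> r P \<in> P" "\<And>P Q. (P, Q) \<in> X \<Longrightarrow> s Q \<in> Q"
  shows "bivan_ideal X = hvan bideg ((\<lambda>(P, Q). case_sum (r P) (s Q)) ` X)"
proof -
  have "{F :: ('m, 'n, 'k) bipoly. (\<exists>i j. F \<in> bihom_comp i j) \<and>
     (\<forall>(P, Q)\<in>X. \<forall>u\<in>P. \<forall>w\<in>Q. peval (case_sum u w) F = 0)}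
    = {F. (\<exists>d. F \<in> whom bideg d) \<and> (\<forall>u\<in>(\<lambda>(P, Q). case_sum (r P) (s Q)) ` X. peval u F = 0)}"
  proof (intro set_eqI iffI)
    fix F :: "('m, 'n, 'k) bipoly"
    assume "F \<in> {F. (\<exists>i j. F \<in> bihom_comp i j) \<and>
     (\<forall>(P, Q)\<in>X. \<forall>u\<in>P. \<forall>w\<in>Q. peval (case_sum u w) F = 0)}"
    then show "F \<in> {F. (\<exists>d. F \<in> whom bideg d) \<and> (\<forall>u\<in>(\<lambda>(P, Q). case_sum (r P) (s Q)) ` X. peval u F = 0)}"
      using r by (auto simp: bihom_comp_whom)
  next
    fix F :: "('m, 'n, 'k) bipoly"
    assume "F \<in> {F. (\<exists>d. F \<in> whom bideg d) \<and> (\<forall>u\<in>(\<lambda>(P, Q). case_sum (r P) (s Q)) ` X. peval u F = 0)}"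
    then obtain d where d: "F \<in> whom bideg d" "\<forall>u\<in>(\<lambda>(P, Q). case_sum (r P) (s Q)) ` X. peval u F = 0"
      by blast
    obtain i j where "d = (i, j)" by (cases d)
    then have F: "F \<in> bihom_comp i j" using d(1) by (simp add: bihom_comp_whom)
    have F2: "peval (case_sum (r P) (s Q)) F = 0" if "(P, Q) \<in> X" for P Q
      using bspec[OF d(2) imageI[OF that]] by simp
    have "peval (case_sum u w) F = 0" if PQ: "(P, Q) \<in> X" and uw: "u \<in> P" "w \<in> Q" for P Q u w
    proof -
      have PQ': "P \<in> proj_space" "Q \<in> proj_space" using X PQ by auto
      obtain c where c: "u = (\<lambda>i. c * r P i)" using proj_mem[OF PQ'(1) r(1)[OF PQ] uw(1)] by blast
      obtain c' where c': "w = (\<lambda>i. c' * s Q i)" using proj_mem[OF PQ'(2) r(2)[OF PQ] uw(2)] by blast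
      show ?thesis unfolding c c' peval_scale_bihom[OF F] F2[OF PQ] by simp
    qed
    then show "F \<in> {F. (\<exists>i j. F \<in> bihom_comp i j) \<and>
     (\<forall>(P, Q)\<in>X. \<forall>u\<in>P. \<forall>w\<in>Q. peval (case_sum u w) F = 0)}" using F by blast
  qed
  then show ?thesis unfolding bivan_ideal_def hvan_def by simp
qed

lemma bivan_ideal_vpairs:
  assumes X: "X \<subseteq> proj_space \<times> proj_space" and prod: "X = X1 \<times> X2"
    and r: "\<And>P. P \<in> X1 \<Longrightarrow> r P \<in> P" "\<And>Q. Q \<in> X2 \<Longrightarrow> s Q \<in> Q"
  shows "bivan_ideal X = hvan bideg (vpairs (r ` X1) (s ` X2))"
proof -
  have "(\<lambda>(P, Q). case_sum (r P) (s Q)) ` X = vpairs (r ` X1) (s ` X2)"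
    unfolding prod vpairs_def by auto
  then show ?thesis using bivan_ideal_reps[OF X, of r s] r prod by simp
qed

lemma linear_form_separates:
  fixes P Q :: "('i::finite \<Rightarrow> 'k::field) set"
  assumes "P \<in> proj_space" "Q \<in> proj_space" "P \<noteq> Q" "u \<in> P" "w \<in> Q"
  shows "\<exists>L\<in>hom_comp 1. peval w L = 0 \<and> peval u L \<noteq> 0"
proof -
  have "\<exists>i j. w i * u j \<noteq> w j * u i"
  proof (rule ccontr)
    assume "\<not> (\<exists>i j. w i * u j \<noteq> w j * u i)"
    then have eq: "w i * u j = w j * u i" for i j by blast
    obtain i where i: "w i \<noteq> 0" using proj_nonzero[OF assms(2,5)] by auto
    have u: "u = (\<lambda>j. (u i / w i) * w j)" using eq[of i] i by (auto simp: fun_eq_iff field_simps)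
    then have "u i / w i \<noteq> 0" using proj_nonzero[OF assms(1,4)] by (metis mult_zero_left)
    then have "u \<in> Q" using proj_scale[OF assms(2,5)] u by metis
    then show False using proj_eq[OF assms(1,2,4)] assms(3) by blast
  qed
  then obtain i j where ij: "w i * u j \<noteq> w j * u i" by blast
  let ?L = "Const (w i) * Var j - Const (w j) * Var i"
  have "Var v \<in> whom tdeg 1" for v :: 'i using Var_hom[of v] by (simp add: hom_comp_whom)
  then have "?L \<in> hom_comp 1" unfolding hom_comp_whom by (intro whom_diff whom_scale additive_tdeg)
  moreover have "peval w ?L = 0" "peval u ?L \<noteq> 0" using ij by simp_all
  ultimately show ?thesis by blast
qed

lemma bihom_separates:
  fixes X :: "('m::finite, 'n::finite, 'k::field) bipoint set"
  assumes X: "X \<subseteq> proj_space \<times> proj_space" "finite X"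
    and PQ: "P \<in> proj_space" "Q \<in> proj_space" "(P, Q) \<notin> X" and uw: "u \<in> P" "w \<in> Q"
  shows "\<exists>F\<in>bivan_ideal X. peval (case_sum u w) F \<noteq> 0"
proof -
  have "\<exists>r. \<forall>P\<in>proj_space. r P \<in> P" using proj_nonempty by metis
  then obtain r :: "('m option \<Rightarrow> 'k) set \<Rightarrow> _" where r: "\<And>P. P \<in> proj_space \<Longrightarrow> r P \<in> P" by blast
  have "\<exists>r. \<forall>P\<in>proj_space. r P \<in> P" using proj_nonempty by metis
  then obtain s :: "('n option \<Rightarrow> 'k) set \<Rightarrow> _" where s: "\<And>P. P \<in> proj_space \<Longrightarrow> s P \<in> P" by blast
  have "\<exists>L d. L \<in> whom bideg d \<and> peval (case_sum (r P') (s Q')) L = 0 \<and> peval (case_sum u w) L \<noteq> 0"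
    if PQ': "(P', Q') \<in> X" for P' Q'
  proof (cases "P' = P")
    case False
    have P': "P' \<in> proj_space" using X(1) PQ' by auto
    obtain L where L: "L \<in> hom_comp 1" "peval (r P') L = 0" "peval u L \<noteq> 0"
      using linear_form_separates[OF PQ(1) P' False[symmetric] uw(1) r[OF P']] by blast
    show ?thesis using embX_hom[OF L(1)] L(2,3) by (intro exI[of _ "embX L"] exI[of _ "(1, 0)"]) simp
  next
    case True
    then have QQ: "Q \<noteq> Q'" using PQ' PQ(3) by blast
    have Q': "Q' \<in> proj_space" using X(1) PQ' by auto
    obtain L where L: "L \<in> hom_comp 1" "peval (s Q') L = 0" "peval w L \<noteq> 0"
      using linear_form_separates[OF PQ(2) Q' QQ uw(2) s[OF Q']] by blast
    show ?thesis using embY_hom[OF L(1)] L(2,3) by (intro exI[of _ "embY L"] exI[of _ "(0, 1)"]) simp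
  qed
  then have "\<forall>x\<in>X. \<exists>y. fst y \<in> whom bideg (snd y) \<and> peval (case_sum (r (fst x)) (s (snd x))) (fst y) = 0
      \<and> peval (case_sum u w) (fst y) \<noteq> 0"
    by simp
  from bchoice[OF this] obtain y where "\<forall>x\<in>X. fst (y x) \<in> whom bideg (snd (y x))
      \<and> peval (case_sum (r (fst x)) (s (snd x))) (fst (y x)) = 0
      \<and> peval (case_sum u w) (fst (y x)) \<noteq> 0" by blast
  then obtain L d where L: "\<And>x. x \<in> X \<Longrightarrow> L x \<in> whom bideg (d x)"
    "\<And>x. x \<in> X \<Longrightarrow> peval (case_sum (r (fst x)) (s (snd x))) (L x) = 0"
    "\<And>x. x \<in> X \<Longrightarrow> peval (case_sum u w) (L x) \<noteq> 0"
    using that[of "\<lambda>x. fst (y x)" "\<lambda>x. snd (y x)"] by blast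
  let ?F = "\<Prod>x\<in>X. L x"
  have "?F \<in> whom bideg (sum d X)" by (rule whom_prod[OF additive_bideg L(1)])
  moreover have "peval v ?F = 0" if "v \<in> (\<lambda>(P, Q). case_sum (r P) (s Q)) ` X" for v
  proof -
    from that obtain x where x: "x \<in> X" "v = (case x of (P, Q) \<Rightarrow> case_sum (r P) (s Q))" by blast
    have v: "v = case_sum (r (fst x)) (s (snd x))" unfolding x(2) by (simp add: case_prod_beta)
    show ?thesis
      unfolding peval_prod by (rule prod_zero[OF X(2)], rule bexI[OF _ x(1)]) (simp add: v L(2)[OF x(1)])
  qed
  ultimately have "?F \<in> hvan bideg ((\<lambda>(P, Q). case_sum (r P) (s Q)) ` X)"
    using hvan_whom_iff[OF additive_bideg] by blast
  moreover have "bivan_ideal X = hvan bideg ((\<lambda>(P, Q). case_sum (r P) (s Q)) ` X)"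
    by (rule bivan_ideal_reps[OF X(1)]) (use r s X(1) in auto)
  moreover have "peval (case_sum u w) ?F \<noteq> 0" using L(3) X(2) by simp
  ultimately show ?thesis by blast
qed

section \<open>The depth of the coordinate ring of a product\<close>

text \<open>
  Elimination of one unknown per equation, by induction on the set of equations.
\<close>

lemma linear_system_nontrivial:
  fixes a :: "'s \<Rightarrow> 'l \<Rightarrow> 'k::field"
  assumes "finite \<Lambda>" "finite S" "card \<Lambda> < card S"
  shows "\<exists>c. (\<exists>x\<in>S. c x \<noteq> 0) \<and> (\<forall>l\<in>\<Lambda>. (\<Sum>x\<in>S. c x * a x l) = 0)"
  using assms
proof (induction \<Lambda> arbitrary: S a)
  case empty
  then obtain x where "x \<in> S" by fastforce
  then show ?case by (intro exI[of _ "\<lambda>_. 1"]) auto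
next
  case (insert l \<Lambda>)
  show ?case
  proof (cases "\<exists>x\<in>S. a x l \<noteq> 0")
    case False
    have "card \<Lambda> < card S" using insert.prems insert.hyps by simp
    from insert.IH[OF insert.prems(1) this, of a] obtain c where
      c: "\<exists>x\<in>S. c x \<noteq> 0" "\<forall>l\<in>\<Lambda>. (\<Sum>x\<in>S. c x * a x l) = 0" by blast
    have "(\<Sum>x\<in>S. c x * a x l) = 0" using False by simp
    then show ?thesis using c by blast
  next
    case True
    then obtain z where z: "z \<in> S" "a z l \<noteq> 0" by blast
    define a' where "a' x l' = a x l' - (a x l / a z l) * a z l'" for x l'
    have "card \<Lambda> < card (S - {z})" using insert.prems insert.hyps z(1) by simp
    then obtain c where c: "\<exists>x\<in>S - {z}. c x \<noteq> 0" "\<forall>l\<in>\<Lambda>. (\<Sum>x\<in>S - {z}. c x * a' x l) = 0"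
      using insert.IH[of "S - {z}" a'] insert.prems(1) by blast
    define c' where "c' = c(z := - (\<Sum>x\<in>S - {z}. c x * (a x l / a z l)))"
    have sum: "(\<Sum>x\<in>S. c' x * a x l') = (\<Sum>x\<in>S - {z}. c x * a' x l')" for l'
    proof -
      let ?T = "S - {z}"
      have 1: "(\<Sum>x\<in>S. c' x * a x l') = c' z * a z l' + (\<Sum>x\<in>?T. c' x * a x l')"
        by (rule sum.remove[OF insert.prems(1) z(1)])
      have 2: "(\<Sum>x\<in>?T. c' x * a x l') = (\<Sum>x\<in>?T. c x * a x l')"
        by (rule sum.cong) (auto simp: c'_def)
      have 3: "c' z * a z l' = - (\<Sum>x\<in>?T. c x * (a x l / a z l) * a z l')"
        by (simp only: c'_def fun_upd_same mult_minus_left sum_distrib_right)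
      have 4: "c x * a' x l' = c x * a x l' - c x * (a x l / a z l) * a z l'" for x
        by (simp only: a'_def right_diff_distrib mult.assoc)
      have "(\<Sum>x\<in>?T. c x * a' x l') = (\<Sum>x\<in>?T. c x * a x l') - (\<Sum>x\<in>?T. c x * (a x l / a z l) * a z l')"
        by (simp only: 4 sum_subtractf)
      then show ?thesis unfolding 1 2 3 by (simp only: uminus_add_conv_diff)
    qed
    have "a' x l = 0" for x using z(2) by (simp add: a'_def)
    then have "\<forall>l'\<in>insert l \<Lambda>. (\<Sum>x\<in>S. c' x * a x l') = 0" unfolding sum using c(2) by simp
    moreover have "\<exists>x\<in>S. c' x \<noteq> 0" using c(1) by (auto simp: c'_def)
    ultimately show ?thesis by blast
  qed
qed

definition indep_mod :: "('i, 'k::field) mpoly set \<Rightarrow> ('c \<Rightarrow> ('i, 'k) mpoly) \<Rightarrow> 'c set \<Rightarrow> bool" where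
  "indep_mod J b S \<longleftrightarrow> (\<forall>c. (\<Sum>x\<in>S. Const (c x) * b x) \<in> J \<longrightarrow> (\<forall>x\<in>S. c x = 0))"

lemma indep_modD: "indep_mod J b S \<Longrightarrow> (\<Sum>x\<in>S. Const (c x) * b x) \<in> J \<Longrightarrow> \<forall>x\<in>S. c x = 0"
  by (simp only: indep_mod_def) blast

text \<open>
  If \<open>f\<close> is a nonzerodivisor modulo \<open>J\<close>, then the lowest power of
  \<open>f\<close> in a relation modulo \<open>J\<close> gives a relation modulo
  \<open>f\<close> and \<open>J\<close>, and one factor \<open>f\<close> can be cancelled from
  the rest.
\<close>

lemma indep_mod_powers:
  assumes J: "is_ideal J" and S: "finite S"
    and f: "\<And>g. f * g \<in> J \<Longrightarrow> g \<in> J" and b: "indep_mod (ideal_gen (insert f J)) b S"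
  shows "indep_mod J (\<lambda>(i, x). f ^ i * b x) ({..<n} \<times> S)"
proof (induction n)
  case 0
  show ?case by (simp add: indep_mod_def)
next
  case (Suc n)
  show ?case
    unfolding indep_mod_def
  proof (intro allI impI)
    fix c
    assume c: "(\<Sum>y\<in>{..<Suc n} \<times> S. Const (c y) * (case y of (i, x) \<Rightarrow> f ^ i * b x)) \<in> J"
    let ?A = "\<Sum>x\<in>S. Const (c (0, x)) * b x"
    let ?B = "\<Sum>y\<in>{..<n} \<times> S. Const (c (Suc (fst y), snd y)) * (case y of (i, x) \<Rightarrow> f ^ i * b x)"
    have "(\<Sum>y\<in>{..<Suc n} \<times> S. Const (c y) * (case y of (i, x) \<Rightarrow> f ^ i * b x))
        = (\<Sum>i<Suc n. \<Sum>x\<in>S. Const (c (i, x)) * (f ^ i * b x))"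
      by (simp add: sum.cartesian_product case_prod_unfold)
    also have "\<dots> = ?A + (\<Sum>i<n. \<Sum>x\<in>S. Const (c (Suc i, x)) * (f ^ Suc i * b x))"
      by (simp only: sum.lessThan_Suc_shift power_0 mult_1)
    also have "(\<Sum>i<n. \<Sum>x\<in>S. Const (c (Suc i, x)) * (f ^ Suc i * b x))
        = (\<Sum>i<n. \<Sum>x\<in>S. f * (Const (c (Suc i, x)) * (f ^ i * b x)))"
      by (simp only: power_Suc ac_simps)
    also have "\<dots> = f * (\<Sum>i<n. \<Sum>x\<in>S. Const (c (Suc i, x)) * (f ^ i * b x))"
      by (simp only: sum_distrib_left)
    also have "(\<Sum>i<n. \<Sum>x\<in>S. Const (c (Suc i, x)) * (f ^ i * b x)) = ?B"
      by (simp add: sum.cartesian_product case_prod_unfold)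
    finally have eq: "(\<Sum>y\<in>{..<Suc n} \<times> S. Const (c y) * (case y of (i, x) \<Rightarrow> f ^ i * b x)) = ?A + f * ?B" .
    have AB: "?A + f * ?B \<in> J" using c unfolding eq .
    have fB: "f * ?B \<in> ideal_gen (insert f J)"
      by (intro ideal_mult_right is_ideal_gen ideal_gen_superset insertI1)
    have "?A + f * ?B \<in> ideal_gen (insert f J)" using AB by (intro ideal_gen_superset insertI2)
    then have "(?A + f * ?B) - f * ?B \<in> ideal_gen (insert f J)" using fB by (rule ideal_diff[OF is_ideal_gen])
    then have "?A \<in> ideal_gen (insert f J)" by (simp only: add_diff_cancel_right')
    then have c0: "\<forall>x\<in>S. c (0, x) = 0" by (rule indep_modD[OF b, of "\<lambda>x. c (0, x)"])
    then have "?A = 0" by simp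
    then have "f * ?B \<in> J" using AB by (simp only: add_0)
    then have "?B \<in> J" by (rule f)
    then have cS: "\<forall>y\<in>{..<n} \<times> S. c (Suc (fst y), snd y) = 0"
      by (rule indep_modD[OF Suc.IH, of "\<lambda>y. c (Suc (fst y), snd y)"])
    show "\<forall>y\<in>{..<Suc n} \<times> S. c y = 0"
    proof
      fix y assume y: "y \<in> {..<Suc n} \<times> S"
      obtain i x where ix: "y = (i, x)" by (cases y)
      show "c y = 0"
      proof (cases i)
        case 0 then show ?thesis using c0 y ix by auto
      next
        case (Suc i')
        then have "(i', x) \<in> {..<n} \<times> S" using y ix by auto
        from bspec[OF cS this] show ?thesis by (simp add: ix Suc)
      qed
    qed
  qed
qed

definition deg_le :: "nat \<Rightarrow> ('i::finite, 'k::zero) mpoly \<Rightarrow> bool" where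
  "deg_le M p \<longleftrightarrow> (\<forall>t\<in>Poly_Mapping.keys p. tdeg t \<le> M)"

lemma deg_le_mult:
  fixes p q :: "('i::finite, 'k::comm_ring_1) mpoly"
  assumes "deg_le M p" "deg_le N q"
  shows "deg_le (M + N) (p * q)"
  unfolding deg_le_def
proof
  fix t assume "t \<in> Poly_Mapping.keys (p * q)"
  then obtain r s where "t = r + s" "r \<in> Poly_Mapping.keys p" "s \<in> Poly_Mapping.keys q"
    using keys_mult[of p q] by blast
  then show "tdeg t \<le> M + N" using assms by (auto simp: deg_le_def tdeg_add intro: add_mono)
qed

lemma deg_le_mono: "deg_le M p \<Longrightarrow> M \<le> N \<Longrightarrow> deg_le N p"
  by (auto simp: deg_le_def)

lemma deg_le_power:
  fixes p :: "('i::finite, 'k::comm_ring_1) mpoly"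
  assumes "deg_le M p"
  shows "deg_le (n * M) (p ^ n)"
proof (induction n)
  case 0 show ?case by (simp add: deg_le_def)
next
  case (Suc n)
  show ?case using deg_le_mult[OF assms Suc] by simp
qed

lemma deg_le_exists: "\<exists>M. deg_le M p"
proof -
  have fin: "finite (tdeg ` Poly_Mapping.keys p)" by simp
  obtain M where M: "\<forall>x\<in>tdeg ` Poly_Mapping.keys p. x \<le> M"
    using iffD1[OF finite_nat_set_iff_bounded_le fin] by (elim exE)
  have "deg_le M p" unfolding deg_le_def by (intro ballI bspec[OF M] imageI)
  then show ?thesis by (rule exI)
qed

lemma pcomp_deg_le:
  assumes "deg_le M p" "\<not> (i \<le> M \<and> j \<le> M)"
  shows "pcomp bideg (i, j) p = 0"
proof (rule poly_mapping_eqI)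
  fix t
  show "Poly_Mapping.lookup (pcomp bideg (i, j) p) t = Poly_Mapping.lookup 0 t"
  proof (cases "bideg t = (i, j) \<and> t \<in> Poly_Mapping.keys p")
    case True
    then have "tdeg t \<le> M" using assms(1) unfolding deg_le_def by blast
    moreover have "tdeg t = i + j" using True tdeg_bideg[of t] by simp
    ultimately show ?thesis using assms(2) by simp
  next
    case False
    then have "bideg t \<noteq> (i, j) \<or> Poly_Mapping.lookup p t = 0" by (simp add: in_keys_iff)
    then show ?thesis unfolding lookup_pcomp lookup_zero by (elim disjE) (simp_all only: if_False if_cancel)
  qed
qed

text \<open>
  Three regular elements \<open>f, g, h\<close> would make the \<open>n^3\<close> products
  \<open>f^i * g^j * h^k\<close> independent modulo the vanishing ideal, while their components
  have bidegrees at most \<open>(M, M)\<close> with \<open>M\<close> proportional to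
  \<open>n\<close>, which leaves only \<open>card N * (M + 1)^2\<close> conditions for
  vanishing. This replaces the dimension theory of the quotient ring.
\<close>

lemma regular_length_le_2:
  fixes N :: "('a::finite + 'b::finite \<Rightarrow> 'k::field) set"
  assumes N: "finite N" and reg: "regular_seq_mod (hvan bideg N) fs"
  shows "length fs \<le> 2"
proof (rule ccontr)
  assume "\<not> length fs \<le> 2"
  then obtain f g h fs' where fs: "fs = f # g # h # fs'"
    by (cases fs; cases "tl fs"; cases "tl (tl fs)") auto
  let ?I = "hvan bideg N"
  let ?I1 = "ideal_gen (insert f ?I)" and ?I2 = "ideal_gen (insert g (ideal_gen (insert f ?I)))"
  let ?I3 = "ideal_gen (insert h ?I2)"
  have nzd: "fs ! k * x \<in> ideal_gen (?I \<union> set (take k fs)) \<Longrightarrow> x \<in> ideal_gen (?I \<union> set (take k fs))"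
    if "k < length fs" for k x using reg that unfolding regular_seq_mod_def by blast
  have I0: "ideal_gen ?I = ?I" by (rule ideal_gen_ideal) simp
  have I2: "?I2 = ideal_gen (?I \<union> {f, g})"
    using ideal_gen_Un_idem[of "insert f ?I" "{g}"] by (simp add: insert_commute)
  have I3: "?I3 = ideal_gen (?I \<union> {f, g, h})"
    using ideal_gen_Un_idem[of "?I \<union> {f, g}" "{h}"] I2 by (simp add: insert_commute)
  have n0: "f * x \<in> ?I \<Longrightarrow> x \<in> ?I" for x using nzd[of 0 x] by (simp add: fs I0)
  have n1: "g * x \<in> ?I1 \<Longrightarrow> x \<in> ?I1" for x using nzd[of 1 x] by (simp add: fs)
  have n2: "h * x \<in> ?I2 \<Longrightarrow> x \<in> ?I2" for x using nzd[of 2 x] by (simp add: fs I2 numeral_2_eq_2)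
  have ne: "1 \<notin> ?I3"
  proof
    assume "1 \<in> ?I3"
    moreover have "?I3 \<subseteq> ideal_gen (?I \<union> set fs)" unfolding I3 by (rule ideal_gen_mono) (auto simp: fs)
    ultimately have 1: "1 \<in> ideal_gen (?I \<union> set fs)" by blast
    have "ideal_gen (?I \<union> set fs) = UNIV"
      using ideal_mult[OF is_ideal_gen 1] by fastforce
    then show False using reg unfolding regular_seq_mod_def by blast
  qed
  have b0: "indep_mod ?I3 (\<lambda>_. 1) {()}"
    unfolding indep_mod_def
  proof (intro allI impI ballI)
    fix c :: "unit \<Rightarrow> 'k" and x
    assume "(\<Sum>x\<in>{()}. Const (c x) * 1) \<in> ?I3"
    then have C: "Const (c ()) \<in> ?I3" by simp
    show "c x = 0"
    proof (rule ccontr)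
      assume "c x \<noteq> 0"
      then have "Const (1 / c ()) * Const (c ()) = (1 :: ('a + 'b, 'k) mpoly)" by (simp add: mult_single)
      then show False using ideal_mult[OF is_ideal_gen C, of "Const (1 / c ())"] ne by simp
    qed
  qed
  obtain D1 D2 D3 where D123: "deg_le D1 f" "deg_le D2 g" "deg_le D3 h"
    using deg_le_exists[of f] deg_le_exists[of g] deg_le_exists[of h] by (elim exE)
  define D where "D = D1 + D2 + D3"
  have D: "deg_le D f" "deg_le D g" "deg_le D h"
    by (rule deg_le_mono[OF D123(1)], simp add: D_def, rule deg_le_mono[OF D123(2)], simp add: D_def,
        rule deg_le_mono[OF D123(3)], simp add: D_def)
  (* chosen so that n^3 exceeds card N * (M + 1)^2 for the bound M = 3 n D of the degrees *)
  define n where "n = card N * (3 * D + 1) ^ 2 + 1"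
  let ?S1 = "{..<n} \<times> {()}"
  let ?S2 = "{..<n} \<times> ?S1"
  let ?S3 = "{..<n} \<times> ?S2"
  let ?b1 = "\<lambda>(i, x :: unit). h ^ i * 1"
  let ?b2 = "\<lambda>(i, x). g ^ i * ?b1 x"
  let ?b3 = "\<lambda>(i, x). f ^ i * ?b2 x"
  have b1: "indep_mod ?I2 ?b1 ?S1"
    by (rule indep_mod_powers[OF is_ideal_gen _ n2 b0]) simp_all
  have b2: "indep_mod ?I1 ?b2 ?S2"
    by (rule indep_mod_powers[OF is_ideal_gen _ n1 b1]) simp_all
  have b3: "indep_mod ?I ?b3 ?S3"
    by (rule indep_mod_powers[OF _ _ n0 b2]) simp_all
  define M where "M = n * D + (n * D + n * D)"
  have deg: "deg_le M (?b3 x)" if x: "x \<in> ?S3" for x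
  proof -
    obtain i j k where ijk: "x = (i, j, k, ())" "i < n" "j < n" "k < n" using x by auto
    have pw: "deg_le (n * D) (p ^ l)" if "deg_le D p" "l < n" for p :: "('a + 'b, 'k) mpoly" and l
      by (rule deg_le_mono[OF deg_le_power[OF that(1)]]) (use that(2) in simp)
    have "deg_le M (f ^ i * (g ^ j * h ^ k))"
      unfolding M_def by (intro deg_le_mult pw D ijk)
    then show ?thesis by (simp add: ijk(1))
  qed
  let ?\<Lambda> = "N \<times> ({..M} \<times> {..M})"
  have "card ?\<Lambda> < card ?S3"
  proof -
    have "n \<ge> 1" by (simp add: n_def)
    have "M + 1 \<le> n * (3 * D + 1)" using \<open>n \<ge> 1\<close> by (simp add: M_def algebra_simps)
    then have "(M + 1) ^ 2 \<le> (n * (3 * D + 1)) ^ 2" by (rule power_mono) simp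
    then have "card N * (M + 1) ^ 2 \<le> card N * (n * (3 * D + 1)) ^ 2" by simp
    also have "\<dots> = (card N * (3 * D + 1) ^ 2) * n ^ 2" by (simp only: power_mult_distrib ac_simps)
    also have "\<dots> < n * n ^ 2" using \<open>n \<ge> 1\<close> by (intro mult_strict_right_mono) (simp_all add: n_def)
    finally have "card N * (M + 1) ^ 2 < n ^ 3" by (simp add: power2_eq_square power3_eq_cube)
    moreover have "card ?\<Lambda> = card N * (M + 1) ^ 2" by (simp add: card_cartesian_product power2_eq_square)
    moreover have "card ?S3 = n ^ 3" by (simp add: card_cartesian_product power3_eq_cube)
    ultimately show ?thesis by simp
  qed
  then obtain c where c: "\<exists>x\<in>?S3. c x \<noteq> 0"
    "\<forall>l\<in>?\<Lambda>. (\<Sum>x\<in>?S3. c x * (peval (fst l) (pcomp bideg (snd l) (?b3 x)))) = 0"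
    using linear_system_nontrivial[of ?\<Lambda> ?S3 "\<lambda>x l. peval (fst l) (pcomp bideg (snd l) (?b3 x))"] N
    by (auto simp only: finite_cartesian_product finite_atMost finite_lessThan finite.intros)
  let ?p = "\<Sum>x\<in>?S3. Const (c x) * ?b3 x"
  have "?p \<in> ?I"
    unfolding hvan_iff[OF additive_bideg]
  proof (intro allI ballI)
    fix e v assume v: "v \<in> N"
    have "pcomp bideg e ?p = (\<Sum>x\<in>?S3. Const (c x) * pcomp bideg e (?b3 x))"
      unfolding pcomp_sum
      by (intro sum.cong refl)
        (use pcomp_mult_whom[OF additive_bideg whom_Const[OF additive_bideg], of e] in simp)
    then have eq: "peval v (pcomp bideg e ?p) = (\<Sum>x\<in>?S3. c x * peval v (pcomp bideg e (?b3 x)))"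
      by (simp only: peval_sum peval_mult peval_Const)
    show "peval v (pcomp bideg e ?p) = 0"
    proof (cases "fst e \<le> M \<and> snd e \<le> M")
      case True
      then have "(v, e) \<in> ?\<Lambda>" using v by (cases e) simp
      from bspec[OF c(2) this] show ?thesis unfolding eq by simp
    next
      case False
      have "pcomp bideg e (?b3 x) = 0" if "x \<in> ?S3" for x
        using pcomp_deg_le[OF deg[OF that], of "fst e" "snd e"] False by simp
      then show ?thesis unfolding eq by (intro sum.neutral ballI) simp
    qed
  qed
  then have "\<forall>x\<in>?S3. c x = 0" by (rule indep_modD[OF b3])
  then show False using c(1) by blast
qed

lemma proj_separator:
  fixes Z :: "('i::finite \<Rightarrow> 'k::field) set set"
  assumes Z: "Z \<subseteq> proj_space" "finite Z" and P: "P \<in> proj_space" "P \<notin> Z" "u \<in> P"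
  shows "\<exists>G d. G \<in> hom_comp d \<and> (\<forall>Q\<in>Z. \<forall>w\<in>Q. peval w G = 0) \<and> peval u G \<noteq> 0"
proof -
  have "\<forall>Q\<in>Z. \<exists>L. L \<in> hom_comp 1 \<and> (\<forall>w\<in>Q. peval w L = 0) \<and> peval u L \<noteq> 0"
  proof
    fix Q assume Q: "Q \<in> Z"
    have Q': "Q \<in> proj_space" using Z(1) Q by blast
    obtain w0 where w0: "w0 \<in> Q" using proj_nonempty[OF Q'] by blast
    have "P \<noteq> Q" using P(2) Q by blast
    then obtain L where L: "L \<in> hom_comp 1" "peval w0 L = 0" "peval u L \<noteq> 0"
      using linear_form_separates[OF P(1) Q' _ P(3) w0] by blast
    have "peval w L = 0" if w: "w \<in> Q" for w
    proof -
      obtain c where "w = (\<lambda>i. c * w0 i)" using proj_mem[OF Q' w0 w] by blast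
      then show ?thesis using L(2) by (simp add: peval_scale_hom[OF L(1)])
    qed
    then show "\<exists>L. L \<in> hom_comp 1 \<and> (\<forall>w\<in>Q. peval w L = 0) \<and> peval u L \<noteq> 0" using L by blast
  qed
  from bchoice[OF this] obtain L where
    L: "\<forall>Q\<in>Z. L Q \<in> hom_comp 1 \<and> (\<forall>w\<in>Q. peval w (L Q) = 0) \<and> peval u (L Q) \<noteq> 0" by blast
  have "(\<Prod>Q\<in>Z. L Q) \<in> whom tdeg (\<Sum>Q\<in>Z. 1)"
    by (rule whom_prod[OF additive_tdeg]) (use L in \<open>auto simp: hom_comp_whom\<close>)
  then have "(\<Prod>Q\<in>Z. L Q) \<in> hom_comp (\<Sum>Q\<in>Z. 1)" by (simp add: hom_comp_whom)
  moreover have "\<forall>Q\<in>Z. \<forall>w\<in>Q. peval w (\<Prod>Q\<in>Z. L Q) = 0"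
    unfolding peval_prod using L by (intro ballI prod_zero[OF Z(2)]) blast
  moreover have "peval u (\<Prod>Q\<in>Z. L Q) \<noteq> 0" unfolding peval_prod using L Z(2) by simp
  ultimately show ?thesis by blast
qed

text \<open>
  An infinite field allows perturbing a form by a multiple of one variable so as to avoid
  finitely many zeros.
\<close>

lemma general_linear_form:
  fixes N :: "('i::finite \<Rightarrow> 'k::field_char_0) set"
  assumes "finite N" "\<And>u. u \<in> N \<Longrightarrow> u \<noteq> (\<lambda>_. 0)"
  shows "\<exists>L\<in>hom_comp 1. \<forall>u\<in>N. peval u L \<noteq> 0"
  using assms
proof (induction N)
  case empty
  have "0 \<in> (hom_comp 1 :: ('i, 'k) mpoly set)" by (simp add: hom_comp_whom)
  then show ?case by blast
next
  case (insert u N)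
  then obtain L where L: "L \<in> hom_comp 1" "\<forall>u\<in>N. peval u L \<noteq> 0" by blast
  obtain i where i: "u i \<noteq> 0" using insert.prems[of u] by auto
  have "finite ((\<lambda>v. - (peval v L / v i)) ` insert u N)" using insert.hyps by simp
  then obtain e where e: "e \<notin> (\<lambda>v. - (peval v L / v i)) ` insert u N"
    using ex_new_if_finite[OF infinite_UNIV_char_0] by blast
  let ?L = "L + Const e * Var i"
  have "?L \<in> hom_comp 1"
    using L(1) Var_hom[of i] unfolding hom_comp_whom by (intro whom_add whom_scale additive_tdeg)
  moreover have "peval v ?L \<noteq> 0" if v: "v \<in> insert u N" for v
  proof (cases "v i = 0")
    case True
    then have "v \<in> N" using v i by auto
    then show ?thesis using True L(2) by simp
  next
    case False
    have "e \<noteq> - (peval v L / v i)" using e v by blast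
    then show ?thesis using False by (auto simp: field_simps eq_neg_iff_add_eq_0 add.commute)
  qed
  ultimately show ?case by blast
qed

lemma normalizing_form:
  fixes Z :: "('i::finite \<Rightarrow> 'k::field_char_0) set set"
  assumes Z: "Z \<subseteq> proj_space" "finite Z"
  obtains L r where "L \<in> hom_comp 1" "\<And>P. P \<in> Z \<Longrightarrow> r P \<in> P" "\<And>P. P \<in> Z \<Longrightarrow> peval (r P) L = 1"
proof -
  have "\<forall>P\<in>Z. \<exists>u. u \<in> P" using Z(1) proj_nonempty by blast
  from bchoice[OF this] obtain r0 where r0: "\<forall>P\<in>Z. r0 P \<in> P" by blast
  have nz: "u \<noteq> (\<lambda>_. 0)" if "u \<in> r0 ` Z" for u
  proof -
    obtain P where P: "P \<in> Z" "u = r0 P" using \<open>u \<in> r0 ` Z\<close> by (elim imageE)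
    show ?thesis unfolding P(2) by (rule proj_nonzero[OF subsetD[OF Z(1) P(1)] bspec[OF r0 P(1)]])
  qed
  have "\<exists>L\<in>hom_comp 1. \<forall>u\<in>r0 ` Z. peval u L \<noteq> 0"
    by (rule general_linear_form) (use Z(2) nz in auto)
  then obtain L where L: "L \<in> hom_comp 1" "\<forall>u\<in>r0 ` Z. peval u L \<noteq> 0" by (elim bexE)
  let ?r = "\<lambda>P i. (1 / peval (r0 P) L) * r0 P i"
  have nz': "peval (r0 P) L \<noteq> 0" if "P \<in> Z" for P
    by (rule bspec[OF L(2) imageI[OF \<open>P \<in> Z\<close>]])
  show thesis
  proof (rule that[OF L(1)])
    fix P assume P: "P \<in> Z"
    show "?r P \<in> P"
      by (rule proj_scale[OF subsetD[OF Z(1) P] bspec[OF r0 P]]) (simp add: nz'[OF P])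
    show "peval (?r P) L = 1" unfolding peval_scale_hom[OF L(1)] using nz'[OF P] by simp
  qed
qed

text \<open>
  \<open>L\<close> and \<open>L'\<close> take the value \<open>1\<close> on all points. The
  first nonzerodivisor property is immediate. For the second, a relation \<open>L' * g = h *
  L\<close> on the points shows that \<open>g\<close> and a component of \<open>h\<close> have
  the same values; projecting in the \<open>Y\<close>-variables replaces \<open>h\<close> by a
  polynomial of the bidegree needed to write \<open>g\<close> as a multiple of \<open>L\<close>
  modulo the vanishing ideal.
\<close>

lemma product_regular_sequence:
  fixes A :: "('a::finite \<Rightarrow> 'k::field) set" and B :: "('b::finite \<Rightarrow> 'k) set"
  assumes AB: "finite A" "finite B" "A \<noteq> {}" "B \<noteq> {}"
    and L: "L \<in> hom_comp 1" "\<And>u. u \<in> A \<Longrightarrow> peval u L = 1"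
    and L': "L' \<in> hom_comp 1" "\<And>w. w \<in> B \<Longrightarrow> peval w L' = 1"
  shows "regular_seq_mod (hvan bideg (vpairs A B)) [embX L, embY L']"
proof -
  let ?I = "hvan bideg (vpairs A B)" and ?f = "embX L" and ?f' = "embY L'"
  let ?J = "ideal_gen (insert ?f ?I)"
  have f: "?f \<in> whom bideg (1, 0)" by (rule embX_hom[OF L(1)])
  have f': "?f' \<in> whom bideg (0, 1)" by (rule embY_hom[OF L'(1)])
  have ev: "peval v ?f = 1" "peval v ?f' = 1" if "v \<in> vpairs A B" for v
    using that L(2) L'(2) by (auto simp: vpairs_def)
  have nzd1: "g \<in> ?I" if g: "?f * g \<in> ?I" for g
    unfolding hvan_iff[OF additive_bideg]
  proof (intro allI ballI)
    fix d v assume v: "v \<in> vpairs A B"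
    have "peval v (pcomp bideg ((1, 0) + d) (?f * g)) = 0"
      using g v unfolding hvan_iff[OF additive_bideg] by blast
    then show "peval v (pcomp bideg d g) = 0"
      unfolding pcomp_mult_whom[OF additive_bideg f] using ev[OF v] by simp
  qed
  have IJ: "?I \<subseteq> ?J" by (auto intro: ideal_gen_superset)
  have nzd2: "g \<in> ?J" if g: "?f' * g \<in> ?J" for g
  proof -
    obtain h where h: "?f' * g - h * ?f \<in> ?I"
      using ideal_gen_insert[OF g] ideal_gen_ideal[of ?I] by auto
    have comp: "pcomp bideg (i, j) g \<in> ?J" for i j
    proof -
      let ?g = "pcomp bideg (i, j) g"
      have gw: "?g \<in> whom bideg (i, j)" by simp
      have "pcomp bideg ((0, 1) + (i, j)) (?f' * g) = ?f' * ?g"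
        by (rule pcomp_mult_whom[OF additive_bideg f'])
      then have g1: "pcomp bideg (i, Suc j) (?f' * g) = ?f' * ?g" by simp
      have split: "pcomp bideg (i, Suc j) (?f' * g - h * ?f)
          = pcomp bideg (i, Suc j) (?f' * g) - pcomp bideg (i, Suc j) (?f * h)"
        using pcomp_add[of bideg "(i, Suc j)" "?f' * g" "- (h * ?f)"] by (simp add: mult.commute)
      have vals: "peval v (pcomp bideg (i, Suc j) (?f' * g)) = peval v (pcomp bideg (i, Suc j) (?f * h))"
        if v: "v \<in> vpairs A B" for v
      proof -
        have "peval v (pcomp bideg (i, Suc j) (?f' * g - h * ?f)) = 0"
          using h v unfolding hvan_iff[OF additive_bideg] by blast
        then show ?thesis unfolding split by simp
      qed
      show ?thesis
      proof (cases i)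
        case 0
        have "pcomp bideg (i, Suc j) (?f * h) = 0"
          by (rule pcomp_mult_whom_0[OF additive_bideg f]) (auto simp: 0)
        then have "peval v ?g = 0" if "v \<in> vpairs A B" for v
          using vals[OF that] ev[OF that] unfolding g1 by simp
        then have "?g \<in> ?I" using hvan_whom_iff[OF additive_bideg gw] by blast
        then show ?thesis using IJ by blast
      next
        case (Suc i')
        let ?h = "pcomp bideg (i', Suc j) h"
        have "pcomp bideg ((1, 0) + (i', Suc j)) (?f * h) = ?f * ?h"
          by (rule pcomp_mult_whom[OF additive_bideg f])
        then have h1: "pcomp bideg (i, Suc j) (?f * h) = ?f * ?h" by (simp add: Suc)
        have gh: "peval v ?g = peval v ?h" if "v \<in> vpairs A B" for v
          using vals[OF that] ev[OF that] unfolding g1 h1 by simp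
        obtain w :: "_ \<Rightarrow> ('b, 'k) mpoly" where w: "\<forall>q\<in>B. w q \<in> hom_comp j"
          "\<forall>p\<in>hom_comp j. \<forall>z\<in>B. peval z p = (\<Sum>q\<in>B. peval q p * peval z (w q))"
          using projection_hom[OF AB(2)] by blast
        define G where "G = (\<Sum>q\<in>B. embX (atY q ?h) * embY (w q))"
        have hw: "?h \<in> whom bideg (i', Suc j)" by simp
        have Gw: "G \<in> whom bideg (i', j)"
          unfolding G_def using w(1) atY_hom[OF hw] by (intro whom_sum embXY_hom) auto
        have "peval v (?g - ?f * G) = 0" if v: "v \<in> vpairs A B" for v
        proof -
          obtain a b where ab: "v = case_sum a b" "a \<in> A" "b \<in> B" using v by (auto simp: vpairs_def)
          have q: "case_sum a q \<in> vpairs A B" if "q \<in> B" for q using ab(2) that by (auto simp: vpairs_def)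
          have "peval v ?g = peval b (atX a ?g)" by (simp add: peval_atX ab(1))
          also have "\<dots> = (\<Sum>q\<in>B. peval q (atX a ?g) * peval b (w q))"
            using w(2) atX_hom[OF gw] ab(3) by blast
          also have "\<dots> = (\<Sum>q\<in>B. peval (case_sum a q) ?h * peval b (w q))"
            by (rule sum.cong) (simp_all add: peval_atX gh q)
          also have "\<dots> = peval v G" unfolding G_def ab(1) by (simp add: peval_atY)
          finally show ?thesis using ev(1)[OF v] by simp
        qed
        moreover have "?f * G \<in> whom bideg ((1, 0) + (i', j))" by (rule whom_mult[OF additive_bideg f Gw])
        then have "?g - ?f * G \<in> whom bideg (i, j)" using gw by (intro whom_diff) (simp_all add: Suc)
        ultimately have "?g - ?f * G \<in> ?I" using hvan_whom_iff[OF additive_bideg] by blast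
        then have "?g - ?f * G \<in> ?J" using IJ by blast
        moreover have "?f * G \<in> ?J" by (intro ideal_mult_right is_ideal_gen ideal_gen_superset insertI1)
        ultimately have "(?g - ?f * G) + ?f * G \<in> ?J" by (rule ideal_add[OF is_ideal_gen])
        then show ?thesis by simp
      qed
    qed
    have "(\<Sum>d\<in>bideg ` Poly_Mapping.keys g. pcomp bideg d g) \<in> ?J"
    proof (rule ideal_sum[OF is_ideal_gen])
      fix d show "pcomp bideg d g \<in> ?J" using comp by (cases d) simp
    qed
    then show ?thesis using sum_pcomp[of g bideg] by simp
  qed
  have proper: "ideal_gen (?I \<union> {?f, ?f'}) \<noteq> UNIV"
  proof
    let ?Z = "{x :: ('a + 'b, 'k) mpoly. peval (\<lambda>_. 0) x = 0}"
    have Z: "is_ideal ?Z" by (rule is_idealI) simp_all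
    have L0: "peval (\<lambda>_. 0) p = 0" if "p \<in> hom_comp 1" for p :: "('i::finite, 'k) mpoly"
      using peval_scale_hom[OF that, of 0 "\<lambda>_. 0"] by simp
    have cs0: "(\<lambda>_. 0) = case_sum (\<lambda>_. 0) (\<lambda>_. 0)" by (auto simp: fun_eq_iff split: sum.splits)
    have "{F :: ('a + 'b, 'k) mpoly. (\<exists>d. F \<in> whom bideg d) \<and> (\<forall>u\<in>vpairs A B. peval u F = 0)} \<subseteq> ?Z"
    proof
      fix F :: "('a + 'b, 'k) mpoly"
      assume "F \<in> {F. (\<exists>d. F \<in> whom bideg d) \<and> (\<forall>u\<in>vpairs A B. peval u F = 0)}"
      then obtain d where d: "F \<in> whom bideg d" "\<forall>u\<in>vpairs A B. peval u F = 0" by blast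
      obtain a b where ab: "a \<in> A" "b \<in> B" using AB by blast
      then have v0: "peval (case_sum a b) F = 0" using d(2) by (auto simp: vpairs_def)
      have "mon (case_sum (\<lambda>v. 0 * a v) (\<lambda>v. 0 * b v)) t = 0 ^ fst d * 0 ^ snd d * mon (case_sum a b) t"
        if "t \<in> Poly_Mapping.keys F" for t
        using mon_case_sum_scale[of 0 a 0 b t] d(1) that by (simp add: whom_def)
      then have "peval (case_sum (\<lambda>v. 0 * a v) (\<lambda>v. 0 * b v)) F = 0 ^ fst d * 0 ^ snd d * peval (case_sum a b) F"
        unfolding peval_eq_lin_ext lin_ext_def sum_distrib_left by (intro sum.cong refl) (simp only: ac_simps)
      then show "F \<in> ?Z" unfolding v0 by (simp add: cs0[symmetric])
    qed
    then have "?I \<subseteq> ?Z" unfolding hvan_def by (rule ideal_gen_least[OF Z])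
    moreover have "peval (\<lambda>_. 0) ?f = 0" by (subst cs0, subst peval_embX, rule L0[OF L(1)])
    moreover have "peval (\<lambda>_. 0) ?f' = 0" by (subst cs0, subst peval_embY, rule L0[OF L'(1)])
    ultimately have "ideal_gen (?I \<union> {?f, ?f'}) \<subseteq> ?Z" by (intro ideal_gen_least[OF Z]) auto
    moreover assume "ideal_gen (?I \<union> {?f, ?f'}) = UNIV"
    ultimately have "1 \<in> ?Z" by blast
    then show False by simp
  qed
  show ?thesis
    unfolding regular_seq_mod_def
  proof (intro conjI allI impI)
    fix k g assume k: "k < length [?f, ?f']" and g: "[?f, ?f'] ! k * g \<in> ideal_gen (?I \<union> set (take k [?f, ?f']))"
    have I0: "ideal_gen ?I = ?I" by (rule ideal_gen_ideal) simp
    consider "k = 0" | "k = 1" using k by (auto simp: less_Suc_eq)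
    then show "g \<in> ideal_gen (?I \<union> set (take k [?f, ?f']))"
    proof cases
      case 1 then show ?thesis using g nzd1 by (simp add: I0)
    next
      case 2 then show ?thesis using g nzd2 by simp
    qed
  qed (use proper in simp)
qed

lemma depth_product:
  fixes A :: "('a::finite \<Rightarrow> 'k::field) set" and B :: "('b::finite \<Rightarrow> 'k) set"
  assumes AB: "finite A" "finite B" "A \<noteq> {}" "B \<noteq> {}"
    and L: "L \<in> hom_comp 1" "\<And>u. u \<in> A \<Longrightarrow> peval u L = 1"
    and L': "L' \<in> hom_comp 1" "\<And>w. w \<in> B \<Longrightarrow> peval w L' = 1"
  shows "depth_mod (hvan bideg (vpairs A B)) = 2"
  unfolding depth_mod_def
proof (rule antisym)
  have "vpairs A B = (\<lambda>(u, w). case_sum u w) ` (A \<times> B)" by (auto simp: vpairs_def)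
  then have fin: "finite (vpairs A B)" using AB(1,2) by simp
  show "(SUP fs\<in>{fs. set fs \<subseteq> ideal_gen (range Var) \<and> regular_seq_mod (hvan bideg (vpairs A B)) fs}.
     enat (length fs)) \<le> 2"
  proof (rule SUP_least)
    fix fs assume "fs \<in> {fs. set fs \<subseteq> ideal_gen (range Var) \<and> regular_seq_mod (hvan bideg (vpairs A B)) fs}"
    then have "length fs \<le> 2" using regular_length_le_2[OF fin] by blast
    then show "enat (length fs) \<le> 2" by (simp add: numeral_eq_enat)
  qed
  have pos: "p \<in> ideal_gen (range Var)" if "p \<in> whom bideg e" "e \<noteq> (0, 0)" for p :: "('a + 'b, 'k) mpoly" and e
    unfolding in_ideal_Var
  proof
    fix t assume "t \<in> Poly_Mapping.keys p"
    then have "bideg t \<noteq> (0, 0)" using that by (auto simp: whom_def)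
    then show "\<exists>v\<in>UNIV. Poly_Mapping.lookup t v \<noteq> 0" by (auto simp: bideg_def)
  qed
  let ?fs = "[embX L, embY L'] :: ('a + 'b, 'k) mpoly list"
  have "?fs \<in> {fs. set fs \<subseteq> ideal_gen (range Var) \<and> regular_seq_mod (hvan bideg (vpairs A B)) fs}"
    using product_regular_sequence[OF assms] pos[OF embX_hom[OF L(1)]] pos[OF embY_hom[OF L'(1)]] by simp
  moreover have "2 \<le> enat (length ?fs)" by (simp add: numeral_eq_enat)
  ultimately show "2 \<le> (SUP fs\<in>{fs. set fs \<subseteq> ideal_gen (range Var) \<and> regular_seq_mod (hvan bideg (vpairs A B)) fs}.
     enat (length fs))" by (rule SUP_upper2)
qed

lemma product_arith_CM:
  fixes X :: "('m::finite, 'n::finite, 'k::field_char_0) bipoint set"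
  assumes X: "X \<subseteq> proj_space \<times> proj_space" "finite X" "X \<noteq> {}" and prod: "X = (fst ` X) \<times> (snd ` X)"
  shows "arith_CM X"
proof -
  have sub: "fst ` X \<subseteq> proj_space" "snd ` X \<subseteq> proj_space" using X(1) by auto
  obtain L r where L: "L \<in> hom_comp 1" "\<And>P. P \<in> fst ` X \<Longrightarrow> r P \<in> P" "\<And>P. P \<in> fst ` X \<Longrightarrow> peval (r P) L = 1"
    using normalizing_form[OF sub(1)] X(2) by blast
  obtain L' s where L': "L' \<in> hom_comp 1" "\<And>P. P \<in> snd ` X \<Longrightarrow> s P \<in> P" "\<And>P. P \<in> snd ` X \<Longrightarrow> peval (s P) L' = 1"
    using normalizing_form[OF sub(2)] X(2) by blast
  have I: "bivan_ideal X = hvan bideg (vpairs (r ` fst ` X) (s ` snd ` X))"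
    by (rule bivan_ideal_vpairs[OF X(1) prod L(2) L'(2)])
  show ?thesis
    unfolding arith_CM_def I
  proof (rule depth_product)
    show "L \<in> hom_comp 1" "L' \<in> hom_comp 1" by (fact L(1), fact L'(1))
    show "peval u L = 1" if "u \<in> r ` fst ` X" for u
    proof -
      obtain P where P: "P \<in> fst ` X" "u = r P" using \<open>u \<in> r ` fst ` X\<close> by (rule imageE)
      show ?thesis unfolding P(2) by (rule L(3)[OF P(1)])
    qed
    show "peval w L' = 1" if "w \<in> s ` snd ` X" for w
    proof -
      obtain P where P: "P \<in> snd ` X" "w = s P" using \<open>w \<in> s ` snd ` X\<close> by (rule imageE)
      show ?thesis unfolding P(2) by (rule L'(3)[OF P(1)])
    qed
  qed (use X(2,3) in simp_all)
qed

text \<open>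
  If \<open>X_0\<close> vanished at a point \<open>P\<close>, it would multiply a form vanishing
  at the points other than \<open>P\<close>, but not at \<open>P\<close>, into the vanishing
  ideal. For \<open>Y_0\<close> the same argument works modulo \<open>X_0\<close>: comparing
  components of \<open>X\<close>-degree \<open>0\<close> shows that a form in \<open>Y\<close>
  alone that lies in the ideal of \<open>X_0\<close> and the vanishing ideal already lies in the
  latter.
\<close>

lemma regular_coordinates_affine:
  fixes X :: "('m::finite, 'n::finite, 'k::field) bipoint set"
  assumes X: "X \<subseteq> proj_space \<times> proj_space" "finite X" and prod: "X = X1 \<times> X2" and ne: "X1 \<noteq> {}" "X2 \<noteq> {}"
    and reg: "regular_seq_mod (bivan_ideal X) [Var (Inl None), Var (Inr None)]"
  shows "affine_points X1" "affine_points X2"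
proof -
  let ?I = "bivan_ideal X" and ?x = "Var (Inl None) :: ('m, 'n, 'k) bipoly" and ?y = "Var (Inr None) :: ('m, 'n, 'k) bipoly"
  have sub: "X1 \<subseteq> proj_space" "X2 \<subseteq> proj_space" using X(1) prod ne by auto
  have fin: "finite X1" "finite X2" using X(2) prod ne by (auto simp: finite_cartesian_product_iff)
  have I: "is_ideal ?I" by (simp add: bivan_ideal_def)
  have reg1: "g \<in> ?I" if "?x * g \<in> ?I" for g
  proof -
    have "[?x, ?y] ! 0 * g \<in> ideal_gen (?I \<union> set (take 0 [?x, ?y]))" using that by (simp add: ideal_gen_ideal[OF I])
    then have "g \<in> ideal_gen (?I \<union> set (take 0 [?x, ?y]))" using reg unfolding regular_seq_mod_def by force
    then show ?thesis by (simp add: ideal_gen_ideal[OF I])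
  qed
  have reg2: "g \<in> ideal_gen (insert ?x ?I)" if "?y * g \<in> ?I" for g
  proof -
    have "[?x, ?y] ! 1 * g \<in> ideal_gen (?I \<union> set (take 1 [?x, ?y]))"
      using that ideal_gen_superset[of "?y * g" "insert ?x ?I"] by simp
    then have "g \<in> ideal_gen (?I \<union> set (take 1 [?x, ?y]))" using reg unfolding regular_seq_mod_def by force
    then show ?thesis by simp
  qed
  have gen: "F \<in> ?I" if "F \<in> bihom_comp i j" "\<And>P Q u w. P \<in> X1 \<Longrightarrow> Q \<in> X2 \<Longrightarrow> u \<in> P \<Longrightarrow> w \<in> Q \<Longrightarrow> peval (case_sum u w) F = 0" for F i j
    unfolding bivan_ideal_def by (rule ideal_gen_superset) (use that prod in blast)
  have vanI: "peval (case_sum u w) F = 0" if F: "F \<in> ?I" "F \<in> whom bideg d" and PQ: "P \<in> X1" "Q \<in> X2" "u \<in> P" "w \<in> Q" for F d P Q u w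
  proof -
    have "\<exists>r. \<forall>P'\<in>X1. r P' \<in> P'" using sub(1) proj_nonempty by (metis subsetD)
    then obtain r where r: "\<And>P'. P' \<in> X1 \<Longrightarrow> r P' \<in> P'" by blast
    have "\<exists>s. \<forall>Q'\<in>X2. s Q' \<in> Q'" using sub(2) proj_nonempty by (metis subsetD)
    then obtain s where s: "\<And>Q'. Q' \<in> X2 \<Longrightarrow> s Q' \<in> Q'" by blast
    have "?I = hvan bideg (vpairs ((r(P := u)) ` X1) ((s(Q := w)) ` X2))"
      by (rule bivan_ideal_vpairs[OF X(1) prod]) (use r s PQ in auto)
    then have "\<forall>v\<in>vpairs ((r(P := u)) ` X1) ((s(Q := w)) ` X2). peval v F = 0"
      using F hvan_whom_iff[OF additive_bideg F(2)] by simp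
    moreover have "u \<in> (r(P := u)) ` X1" "w \<in> (s(Q := w)) ` X2" using PQ(1,2) by (auto simp: image_iff)
    ultimately show ?thesis unfolding vpairs_def by blast
  qed
  have x: "?x \<in> whom bideg (1, 0)" and y: "?y \<in> whom bideg (0, 1)" by (simp_all add: Var_def whom_single)
  show "affine_points X1"
  proof (unfold_locales)
    fix P assume P: "P \<in> X1"
    show "\<exists>u\<in>P. u None \<noteq> 0"
    proof (rule ccontr)
      assume "\<not> (\<exists>u\<in>P. u None \<noteq> 0)"
      then have P0: "\<And>u. u \<in> P \<Longrightarrow> u None = 0" by blast
      have P': "P \<in> proj_space" using sub(1) P by blast
      obtain u where u: "u \<in> P" using proj_nonempty[OF P'] by blast
      obtain G d where G: "G \<in> hom_comp d" "\<forall>Q\<in>X1 - {P}. \<forall>w\<in>Q. peval w G = 0" "peval u G \<noteq> 0"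
        using proj_separator[of "X1 - {P}" P u] sub(1) fin(1) P' u by blast
      have Gw: "embX G \<in> whom bideg (d, 0)" by (rule embX_hom[OF G(1)])
      have "?x * embX G \<in> bihom_comp (d + 1) 0"
        using whom_mult[OF additive_bideg x Gw] by (simp add: bihom_comp_whom)
      then have "?x * embX G \<in> ?I"
      proof (rule gen)
        fix P'' Q u'' w assume "P'' \<in> X1" "u'' \<in> P''"
        then show "peval (case_sum u'' w) (?x * embX G) = 0" using P0 G(2) by (cases "P'' = P") auto
      qed
      then have "embX G \<in> ?I" by (rule reg1)
      moreover obtain Q where Q: "Q \<in> X2" using ne(2) by blast
      moreover obtain w where w: "w \<in> Q" using proj_nonempty sub(2) Q by blast
      ultimately have "peval (case_sum u w) (embX G) = 0" using vanI[OF _ Gw P Q u w] by blast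
      then show False using G(3) by simp
    qed
  qed (use sub fin in auto)
  show "affine_points X2"
  proof (unfold_locales)
    fix Q assume Q: "Q \<in> X2"
    show "\<exists>w\<in>Q. w None \<noteq> 0"
    proof (rule ccontr)
      assume "\<not> (\<exists>w\<in>Q. w None \<noteq> 0)"
      then have Q0: "\<And>w. w \<in> Q \<Longrightarrow> w None = 0" by blast
      have Q': "Q \<in> proj_space" using sub(2) Q by blast
      obtain w where w: "w \<in> Q" using proj_nonempty[OF Q'] by blast
      obtain G d where G: "G \<in> hom_comp d" "\<forall>Q'\<in>X2 - {Q}. \<forall>w\<in>Q'. peval w G = 0" "peval w G \<noteq> 0"
        using proj_separator[of "X2 - {Q}" Q w] sub(2) fin(2) Q' w by blast
      have Gw: "embY G \<in> whom bideg (0, d)" by (rule embY_hom[OF G(1)])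
      have "?y * embY G \<in> bihom_comp 0 (d + 1)"
        using whom_mult[OF additive_bideg y Gw] by (simp add: bihom_comp_whom)
      then have "?y * embY G \<in> ?I"
      proof (rule gen)
        fix P Q'' u w'' assume "Q'' \<in> X2" "w'' \<in> Q''"
        then show "peval (case_sum u w'') (?y * embY G) = 0" using Q0 G(2) by (cases "Q'' = Q") auto
      qed
      then have "embY G \<in> ideal_gen (insert ?x ?I)" by (rule reg2)
      then obtain h where h: "embY G - h * ?x \<in> ?I"
        using ideal_gen_insert ideal_gen_ideal[OF I] by metis
      have inI: "pcomp bideg (0, d) (embY G - h * ?x) \<in> ?I"
        unfolding bivan_ideal_def
        by (rule ideal_gen_homogeneous[OF additive_bideg]) (use h in \<open>auto simp: bihom_comp_whom bivan_ideal_def\<close>)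
      have "pcomp bideg (0, d) (?x * h) = 0"
        by (rule pcomp_mult_whom_0[OF additive_bideg x]) auto
      moreover have "pcomp bideg (0, d) (embY G) = embY G" using pcomp_whom[OF Gw, of "(0, d)"] by simp
      ultimately have "pcomp bideg (0, d) (embY G - h * ?x) = embY G"
        using pcomp_add[of bideg "(0, d)" "embY G" "- (h * ?x)"] by (simp add: mult.commute)
      then have "embY G \<in> ?I" using inI by (simp only:)
      moreover obtain P where P: "P \<in> X1" using ne(1) by blast
      moreover obtain u where u: "u \<in> P" using proj_nonempty sub(1) P by blast
      ultimately have "peval (case_sum u w) (embY G) = 0" using vanI[OF _ Gw P Q u w] by blast
      then show False using G(3) by simp
    qed
  qed (use sub fin in auto)
qed

section \<open>Transfer of regular sequences between a factor and the bigraded ring\<close>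

definition part_X :: "(('a::finite + 'b) \<Rightarrow>\<^sub>0 nat) \<Rightarrow> 'a \<Rightarrow>\<^sub>0 nat" where
  "part_X t = (\<Sum>v\<in>UNIV. Poly_Mapping.single v (Poly_Mapping.lookup t (Inl v)))"

definition part_Y :: "(('a + 'b::finite) \<Rightarrow>\<^sub>0 nat) \<Rightarrow> 'b \<Rightarrow>\<^sub>0 nat" where
  "part_Y t = (\<Sum>v\<in>UNIV. Poly_Mapping.single v (Poly_Mapping.lookup t (Inr v)))"

lemma lookup_part_X [simp]: "Poly_Mapping.lookup (part_X t) v = Poly_Mapping.lookup t (Inl v)"
  by (simp add: part_X_def lookup_sum lookup_single when_def)

lemma lookup_part_Y [simp]: "Poly_Mapping.lookup (part_Y t) v = Poly_Mapping.lookup t (Inr v)"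
  by (simp add: part_Y_def lookup_sum lookup_single when_def)

lemma single_parts:
  fixes t :: "('a::finite + 'b::finite) \<Rightarrow>\<^sub>0 nat"
  shows "Poly_Mapping.single t (c :: 'k::comm_ring_1)
    = embX (Poly_Mapping.single (part_X t) c) * embY (Poly_Mapping.single (part_Y t) 1)"
proof -
  have "embX (Poly_Mapping.single (part_X t) c) * embY (Poly_Mapping.single (part_Y t) 1)
     = Const c * (mon (\<lambda>v. Var (Inl v)) (part_X t) * mon (\<lambda>v. Var (Inr v)) (part_Y t) :: ('a + 'b, 'k) mpoly)"
    unfolding embX_def embY_def subst_single by (simp only: single_one mult_1 mult.assoc)
  also have "mon (\<lambda>v. Var (Inl v)) (part_X t) * mon (\<lambda>v. Var (Inr v)) (part_Y t) = (mon Var t :: ('a + 'b, 'k) mpoly)"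
    unfolding mon_UNIV prod_UNIV_sum lookup_part_X lookup_part_Y ..
  finally show ?thesis by (simp only: single_eq_mon[of t c])
qed

text \<open>
  The coefficient of the monomial with exponent \<open>\<beta>\<close> in the
  \<open>Y\<close>-variables.
\<close>

definition coef_Y :: "('b \<Rightarrow>\<^sub>0 nat) \<Rightarrow> ('a::finite + 'b::finite, 'k::comm_ring_1) mpoly \<Rightarrow> ('a, 'k) mpoly" where
  "coef_Y \<beta> = lin_ext Const (\<lambda>t. if part_Y t = \<beta> then Poly_Mapping.single (part_X t) 1 else 0)"

lemma coef_Y_add [simp]: "coef_Y \<beta> (p + q) = coef_Y \<beta> p + coef_Y \<beta> q"
  by (simp add: coef_Y_def lin_ext_add)

lemma coef_Y_0 [simp]: "coef_Y \<beta> 0 = 0"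
  by (simp add: coef_Y_def lin_ext_zero)

lemma coef_Y_sum: "coef_Y \<beta> (sum f S) = (\<Sum>x\<in>S. coef_Y \<beta> (f x))"
  by (rule additive_sum) simp_all

lemma coef_Y_single:
  "coef_Y \<beta> (Poly_Mapping.single t c) = (if part_Y t = \<beta> then Poly_Mapping.single (part_X t) c else 0)"
  by (simp add: coef_Y_def lin_ext_single mult_single)

lemma coef_Y_embX:
  fixes F :: "('a::finite, 'k::comm_ring_1) mpoly" and g :: "('a + 'b::finite, 'k) mpoly"
  shows "coef_Y \<beta> (embX F * g) = F * coef_Y \<beta> g"
proof (induction F arbitrary: g rule: mpoly_ring_induct)
  case (Const c)
  show ?case
  proof (induction g rule: mpoly_induct)
    case (monom t d)
    show ?case by (simp add: mult_single coef_Y_single)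
  qed (simp add: distrib_left)
next
  case (Var v)
  show ?case
  proof (induction g rule: mpoly_induct)
    case (monom t d)
    have 1: "part_Y (Poly_Mapping.single (Inl v) 1 + t) = part_Y t"
      by (rule poly_mapping_eqI) (simp add: lookup_add lookup_single)
    have 2: "part_X (Poly_Mapping.single (Inl v) 1 + t) = Poly_Mapping.single v 1 + part_X t"
      by (rule poly_mapping_eqI) (simp add: lookup_add lookup_single when_def)
    show ?case unfolding embX_simps(8)[of v] unfolding Var_def mult_single coef_Y_single 1 2
      by (simp add: mult_single)
  qed (simp add: distrib_left)
next
  case (add p q)
  then show ?case by (simp add: distrib_right)
next
  case (mult p q)
  show ?case unfolding embX_simps mult.assoc mult.IH ..
qed

lemma coef_Y_expand:
  fixes g :: "('a::finite + 'b::finite, 'k::comm_ring_1) mpoly"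
  shows "g = (\<Sum>\<beta>\<in>part_Y ` Poly_Mapping.keys g. embX (coef_Y \<beta> g) * embY (Poly_Mapping.single \<beta> 1))"
proof -
  let ?S = "part_Y ` Poly_Mapping.keys g"
  let ?R = "\<lambda>p. \<Sum>\<beta>\<in>?S. embX (coef_Y \<beta> p) * embY (Poly_Mapping.single \<beta> 1) :: ('a + 'b, 'k) mpoly"
  have add: "?R (p + q) = ?R p + ?R q" for p q by (simp add: distrib_right sum.distrib)
  have "?R (\<Sum>t\<in>Poly_Mapping.keys g. Poly_Mapping.single t (Poly_Mapping.lookup g t))
      = (\<Sum>t\<in>Poly_Mapping.keys g. ?R (Poly_Mapping.single t (Poly_Mapping.lookup g t)))"
    by (rule additive_sum[of ?R]) (simp, rule add)
  also have "\<dots> = (\<Sum>t\<in>Poly_Mapping.keys g. Poly_Mapping.single t (Poly_Mapping.lookup g t))"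
  proof (rule sum.cong)
    fix t assume t: "t \<in> Poly_Mapping.keys g"
    let ?c = "Poly_Mapping.lookup g t"
    have "?R (Poly_Mapping.single t ?c) = (\<Sum>\<beta>\<in>?S. if \<beta> = part_Y t then Poly_Mapping.single t ?c else 0)"
    proof (rule sum.cong)
      fix \<beta> assume "\<beta> \<in> ?S"
      show "embX (coef_Y \<beta> (Poly_Mapping.single t ?c)) * embY (Poly_Mapping.single \<beta> 1)
          = (if \<beta> = part_Y t then Poly_Mapping.single t ?c else 0)"
        unfolding coef_Y_single using single_parts[of t ?c] by (cases "\<beta> = part_Y t") auto
    qed simp
    also have "\<dots> = Poly_Mapping.single t ?c" using t by (simp add: sum.delta)
    finally show "?R (Poly_Mapping.single t ?c) = Poly_Mapping.single t ?c" .
  qed simp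
  also have "\<dots> = g" by (rule mpoly_sum_monomials[symmetric])
  finally show ?thesis using mpoly_sum_monomials[of g] by simp
qed

lemma embX_ideal: "x \<in> ideal_gen B \<Longrightarrow> embX x \<in> ideal_gen (embX ` B)"
  unfolding embX_def by (rule ideal_gen_subst)

lemma embY_ideal: "x \<in> ideal_gen B \<Longrightarrow> embY x \<in> ideal_gen (embY ` B)"
  unfolding embY_def by (rule ideal_gen_subst)

text \<open>
  The bigraded ring is free over the coordinate ring of the first factor, with the monomials in
  \<open>Y\<close> as a basis.
\<close>

lemma embX_nzd:
  fixes F :: "'c \<Rightarrow> ('a::finite, 'k::comm_ring_1) mpoly" and g :: "('a + 'b::finite, 'k) mpoly"
  assumes T: "finite T" and nzd: "\<And>h. f * h \<in> ideal_gen (F ` T) \<Longrightarrow> h \<in> ideal_gen (F ` T)"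
    and g: "embX f * g \<in> ideal_gen ((\<lambda>i. embX (F i)) ` T)"
  shows "g \<in> ideal_gen ((\<lambda>i. embX (F i)) ` T)"
proof -
  obtain c where c: "embX f * g = (\<Sum>i\<in>T. c i * embX (F i))" 
    using g unfolding ideal_gen_image[OF T] by (elim exE)
  have "coef_Y \<beta> g \<in> ideal_gen (F ` T)" for \<beta>
  proof (rule nzd)
    have "embX f * g = (\<Sum>i\<in>T. embX (F i) * c i)"
      unfolding c by (rule sum.cong[OF refl mult.commute])
    from arg_cong[OF this, of "coef_Y \<beta>"]
    have "f * coef_Y \<beta> g = coef_Y \<beta> (\<Sum>i\<in>T. embX (F i) * c i)"
      unfolding coef_Y_embX .
    also have "\<dots> = (\<Sum>i\<in>T. F i * coef_Y \<beta> (c i))" by (simp only: coef_Y_sum coef_Y_embX)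
    also have "\<dots> \<in> ideal_gen (F ` T)"
      by (intro ideal_sum ideal_mult_right is_ideal_gen ideal_gen_superset imageI)
    finally show "f * coef_Y \<beta> g \<in> ideal_gen (F ` T)" .
  qed
  then have "embX (coef_Y \<beta> g) \<in> ideal_gen (embX ` F ` T)" for \<beta> by (rule embX_ideal)
  then have "embX (coef_Y \<beta> g) \<in> ideal_gen ((\<lambda>i. embX (F i)) ` T)" for \<beta> by (simp only: image_image)
  then have "(\<Sum>\<beta>\<in>part_Y ` Poly_Mapping.keys g. embX (coef_Y \<beta> g) * embY (Poly_Mapping.single \<beta> 1))
      \<in> ideal_gen ((\<lambda>i. embX (F i)) ` T)"
    by (intro ideal_sum ideal_mult_right is_ideal_gen)
  then show ?thesis by (simp only: coef_Y_expand[of g, symmetric])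
qed

text \<open>
  Modulo the vanishing ideal of \<open>A\<close>, a bihomogeneous polynomial is determined by
  its specializations \<open>atX u\<close> with \<open>u\<close> in \<open>A\<close>, by the
  projection in the \<open>X\<close>-variables; each specialization only sees the \<open>G
  j\<close>.
\<close>

lemma embY_nzd:
  fixes F :: "'c::finite \<Rightarrow> ('a::finite, 'k::field) mpoly" and G :: "'d \<Rightarrow> ('b::finite, 'k) mpoly"
  assumes A: "finite A" and F: "ideal_gen (range F) = hvan tdeg A"
    and Fh: "\<And>i. \<exists>e. F i \<in> hom_comp e" and Gh: "\<And>j. j \<in> insert n T \<Longrightarrow> \<exists>e. G j \<in> hom_comp e"
    and nzd: "\<And>h. G n * h \<in> ideal_gen (G ` T) \<Longrightarrow> h \<in> ideal_gen (G ` T)"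
    and g: "embY (G n) * g \<in> ideal_gen (range (\<lambda>i. embX (F i)) \<union> (\<lambda>j. embY (G j)) ` T)"
  shows "g \<in> ideal_gen (range (\<lambda>i. embX (F i)) \<union> (\<lambda>j. embY (G j)) ` T)"
proof -
  let ?B = "range (\<lambda>i. embX (F i)) \<union> (\<lambda>j. embY (G j)) ` T :: ('a + 'b, 'k) mpoly set"
  let ?J = "ideal_gen ?B"
  have hom: "\<exists>d. b \<in> whom bideg d" if "b \<in> ?B" for b
  proof -
    consider i where "b = embX (F i)" | j where "j \<in> T" "b = embY (G j)" using \<open>b \<in> ?B\<close> by auto
    then show ?thesis
    proof cases
      case 1 then show ?thesis using Fh[of i] embX_hom by blast
    next
      case 2 then show ?thesis using Gh[of j] embY_hom by blast
    qed
  qed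
  have sub1: "ideal_gen (embX ` hvan tdeg A) \<subseteq> ?J"
  proof (rule ideal_gen_least[OF is_ideal_gen], rule image_subsetI)
    fix x assume "x \<in> hvan tdeg A"
    then have "x \<in> ideal_gen (range F)" unfolding F .
    then have "embX x \<in> ideal_gen (embX ` range F)" by (rule embX_ideal)
    then show "embX x \<in> ?J" using ideal_gen_mono[of "embX ` range F" ?B] by (auto simp: image_image)
  qed
  have sub2: "embY x \<in> ?J" if "x \<in> ideal_gen (G ` T)" for x
  proof -
    have "embY x \<in> ideal_gen (embY ` G ` T)" using that by (rule embY_ideal)
    then show ?thesis using ideal_gen_mono[of "embY ` G ` T" ?B] by (auto simp: image_image)
  qed
  obtain e where e: "G n \<in> hom_comp e" using Gh[of n] by blast
  have Gw: "embY (G n) \<in> whom bideg (0, e)" by (rule embY_hom[OF e])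
  have comp: "pcomp bideg (i, j) g \<in> ?J" for i j
  proof -
    let ?g = "pcomp bideg (i, j) g"
    have gw: "?g \<in> whom bideg (i, j)" by simp
    have "pcomp bideg ((0, e) + (i, j)) (embY (G n) * g) \<in> ?J"
      by (rule ideal_gen_homogeneous[OF additive_bideg hom g])
    then have Gg: "embY (G n) * ?g \<in> ?J" unfolding pcomp_mult_whom[OF additive_bideg Gw] .
    have at: "atX u ?g \<in> ideal_gen (G ` T)" if u: "u \<in> A" for u
    proof (rule nzd)
      have "atX u (embX (F i)) = 0" for i
      proof -
        have "F i \<in> hvan tdeg A" unfolding F[symmetric] by (rule ideal_gen_superset) simp
        moreover obtain e where "F i \<in> whom tdeg e" using Fh[of i] by (auto simp: hom_comp_whom)
        ultimately have "peval u (F i) = 0" using hvan_whom_iff[OF additive_tdeg] u by blast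
        then show ?thesis by simp
      qed
      then have sub: "atX u ` ?B \<subseteq> insert 0 (G ` T)" by auto
      have "atX u (embY (G n) * ?g) \<in> ideal_gen (atX u ` ?B)"
        using Gg unfolding atX_def by (rule ideal_gen_subst)
      then have "atX u (embY (G n) * ?g) \<in> ideal_gen (insert 0 (G ` T))" using ideal_gen_mono[OF sub] by blast
      then show "G n * atX u ?g \<in> ideal_gen (G ` T)" by (simp add: ideal_gen_insert_zero)
    qed
    obtain w :: "_ \<Rightarrow> ('a, 'k) mpoly" where w: "\<forall>q\<in>A. w q \<in> hom_comp i"
      "\<forall>p\<in>hom_comp i. \<forall>z\<in>A. peval z p = (\<Sum>q\<in>A. peval q p * peval z (w q))"
      using projection_hom[OF A] by blast
    have "?g - (\<Sum>q\<in>A. embX (w q) * embY (atX q ?g)) \<in> ?J" using projection_X[OF gw w] sub1 by blast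
    moreover have "(\<Sum>q\<in>A. embX (w q) * embY (atX q ?g)) \<in> ?J"
      by (intro ideal_sum ideal_mult is_ideal_gen sub2 at)
    ultimately have "(?g - (\<Sum>q\<in>A. embX (w q) * embY (atX q ?g))) + (\<Sum>q\<in>A. embX (w q) * embY (atX q ?g)) \<in> ?J"
      by (rule ideal_add[OF is_ideal_gen])
    then show ?thesis by (simp only: diff_add_cancel)
  qed
  have "(\<Sum>d\<in>bideg ` Poly_Mapping.keys g. pcomp bideg d g) \<in> ?J"
  proof (rule ideal_sum[OF is_ideal_gen])
    fix d show "pcomp bideg d g \<in> ?J" using comp[of "fst d" "snd d"] by simp
  qed
  then show ?thesis by (simp only: sum_pcomp[of g bideg, symmetric])
qed

text \<open>
  Regularity descends along a retraction that kills the first part of the sequence. With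
  \<open>Us\<close> empty this gives the forms in \<open>X\<close>, and with \<open>Us\<close>
  the forms in \<open>X\<close> it gives the forms in \<open>Y\<close>.
\<close>

lemma regular_on_retract:
  assumes reg: "regular_on (Us @ Vs)" and Vs: "Vs = map (subst a) Ws"
    and ret: "\<And>p. subst b (subst a p) = p" and zero: "\<And>u. u \<in> set Us \<Longrightarrow> subst b u = 0"
  shows "regular_on Ws"
  unfolding regular_on_def
proof (intro allI impI)
  fix k g assume k: "k < length Ws" and g: "Ws ! k * g \<in> ideal_gen (set (take k Ws))"
  let ?l = "length Us + k"
  have t: "set (take ?l (Us @ Vs)) = set Us \<union> subst a ` set (take k Ws)" by (simp add: Vs take_map)
  have nth: "(Us @ Vs) ! ?l = subst a (Ws ! k)" using k by (simp add: Vs)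
  have "subst a (Ws ! k * g) \<in> ideal_gen (subst a ` set (take k Ws))" using g by (rule ideal_gen_subst)
  then have "(Us @ Vs) ! ?l * subst a g \<in> ideal_gen (set (take ?l (Us @ Vs)))"
    unfolding nth t using ideal_gen_mono[of "subst a ` set (take k Ws)" "set Us \<union> subst a ` set (take k Ws)"] by auto
  moreover have "?l < length (Us @ Vs)" using k by (simp add: Vs)
  ultimately have "subst a g \<in> ideal_gen (set (take ?l (Us @ Vs)))"
    using reg unfolding regular_on_def by blast
  then have "subst b (subst a g) \<in> ideal_gen (subst b ` set (take ?l (Us @ Vs)))" by (rule ideal_gen_subst)
  moreover have "subst b ` set (take ?l (Us @ Vs)) \<subseteq> insert 0 (set (take k Ws))"
    unfolding t using zero ret by auto
  ultimately have "subst b (subst a g) \<in> ideal_gen (insert 0 (set (take k Ws)))" using ideal_gen_mono by blast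
  then show "g \<in> ideal_gen (set (take k Ws))" unfolding ret ideal_gen_insert_zero .
qed

lemma regular_on_take:
  assumes "regular_on (Us @ Vs)"
  shows "regular_on Us"
  unfolding regular_on_def
proof (intro allI impI)
  fix k g assume k: "k < length Us" "Us ! k * g \<in> ideal_gen (set (take k Us))"
  have "take k (Us @ Vs) = take k Us" "(Us @ Vs) ! k = Us ! k" "k < length (Us @ Vs)"
    using k(1) by (simp_all add: nth_append)
  then show "g \<in> ideal_gen (set (take k Us))" using assms k(2) unfolding regular_on_def by metis
qed

section \<open>Jacobian minors\<close>

definition jmat :: "('m::finite + 'n::finite \<Rightarrow> ('m, 'n, 'k::comm_ring_1) bipoly) \<Rightarrow> (('m, 'n, 'k) bipoly)^('m + 'n)^('m + 'n)" where
  "jmat r = (\<chi> k (c::'m + 'n). partial_deriv (map_sum Some Some c) (r k))"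

lemma jacobian_minors_jmat: "jacobian_minors Fs = {det (jmat r) |r. inj r \<and> range r \<subseteq> Fs}"
  unfolding jacobian_minors_def jmat_def ..

lemma jmat_term:
  fixes r :: "'m::finite + 'n::finite \<Rightarrow> ('m, 'n, 'k::comm_ring_1) bipoly"
  assumes r: "\<And>k. r k \<in> whom bideg (a k, b k)" and \<sigma>: "\<sigma> permutes UNIV"
    and nz: "(\<Prod>k\<in>UNIV. jmat r $ k $ \<sigma> k) \<noteq> 0"
  shows "CARD('m) \<le> sum a UNIV" "CARD('n) \<le> sum b UNIV"
    "(\<Prod>k\<in>UNIV. jmat r $ k $ \<sigma> k) \<in> whom bideg (sum a UNIV - CARD('m), sum b UNIV - CARD('n))"
proof -
  let ?p = "\<lambda>k. partial_deriv (map_sum Some Some (\<sigma> k)) (r k)"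
  have P: "(\<Prod>k\<in>UNIV. jmat r $ k $ \<sigma> k) = (\<Prod>k\<in>UNIV. ?p k)" by (simp add: jmat_def)
  have pnz: "?p k \<noteq> 0" for k
  proof
    assume "?p k = 0"
    then have "(\<Prod>k\<in>UNIV. ?p k) = 0" by (intro prod_zero) auto
    then show False using nz unfolding P by blast
  qed
  define \<delta> where "\<delta> k = (case \<sigma> k of Inl _ \<Rightarrow> 1 | Inr _ \<Rightarrow> (0::nat))" for k
  define \<epsilon> where "\<epsilon> k = (case \<sigma> k of Inl _ \<Rightarrow> 0 | Inr _ \<Rightarrow> (1::nat))" for k
  have le: "\<delta> k \<le> a k \<and> \<epsilon> k \<le> b k \<and> ?p k \<in> whom bideg (a k - \<delta> k, b k - \<epsilon> k)" for k
  proof (cases "\<sigma> k")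
    case (Inl x)
    have "1 \<le> a k"
    proof (rule ccontr)
      assume "\<not> 1 \<le> a k"
      then have "?p k = 0" unfolding Inl map_sum.simps
        by (intro partial_deriv_whom_0[OF r[of k] additive_bideg]) auto
      then show False using pnz by blast
    qed
    then have "?p k \<in> whom bideg (a k - 1, b k)"
      unfolding Inl map_sum.simps by (intro partial_deriv_whom[OF r[of k] additive_bideg]) auto
    then show ?thesis using \<open>1 \<le> a k\<close> by (simp add: \<delta>_def \<epsilon>_def Inl)
  next
    case (Inr x)
    have "1 \<le> b k"
    proof (rule ccontr)
      assume "\<not> 1 \<le> b k"
      then have "?p k = 0" unfolding Inr map_sum.simps
        by (intro partial_deriv_whom_0[OF r[of k] additive_bideg]) auto
      then show False using pnz by blast
    qed
    then have "?p k \<in> whom bideg (a k, b k - 1)"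
      unfolding Inr map_sum.simps by (intro partial_deriv_whom[OF r[of k] additive_bideg]) auto
    then show ?thesis using \<open>1 \<le> b k\<close> by (simp add: \<delta>_def \<epsilon>_def Inr)
  qed
  have re: "(\<Sum>k\<in>UNIV. f (\<sigma> k)) = (\<Sum>k\<in>UNIV. f k)" for f :: "'m + 'n \<Rightarrow> nat"
    using sum.permute[OF \<sigma>, of f] by (simp add: comp_def)
  have sumP: "(\<Sum>k\<in>(UNIV :: ('m + 'n) set). f k) = (\<Sum>x\<in>UNIV. f (Inl x)) + (\<Sum>y\<in>UNIV. f (Inr y))" for f :: "'m + 'n \<Rightarrow> nat"
    by (subst UNIV_Plus_UNIV[symmetric], subst sum.Plus) (simp_all add: comp_def)
  have s\<delta>: "sum \<delta> UNIV = CARD('m)"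
    unfolding \<delta>_def by (subst re[of "\<lambda>c. case c of Inl _ \<Rightarrow> 1 | Inr _ \<Rightarrow> 0"]) (simp add: sumP)
  have s\<epsilon>: "sum \<epsilon> UNIV = CARD('n)"
    unfolding \<epsilon>_def by (subst re[of "\<lambda>c. case c of Inl _ \<Rightarrow> 0 | Inr _ \<Rightarrow> 1"]) (simp add: sumP)
  show "CARD('m) \<le> sum a UNIV" unfolding s\<delta>[symmetric] by (rule sum_mono) (use le in blast)
  show "CARD('n) \<le> sum b UNIV" unfolding s\<epsilon>[symmetric] by (rule sum_mono) (use le in blast)
  have "(\<Prod>k\<in>UNIV. ?p k) \<in> whom bideg (\<Sum>k\<in>UNIV. (a k - \<delta> k, b k - \<epsilon> k))"
    by (rule whom_prod[OF additive_bideg]) (use le in blast)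
  moreover have "(\<Sum>k\<in>UNIV. (a k - \<delta> k, b k - \<epsilon> k)) = (sum a UNIV - CARD('m), sum b UNIV - CARD('n))"
  proof -
    have pr: "(\<Sum>k\<in>S. (f k, g k)) = (sum f S, sum g S)" for f g :: "'m + 'n \<Rightarrow> nat" and S
      by (induction S rule: infinite_finite_induct) (simp_all add: zero_prod_def)
    have 1: "(\<Sum>k\<in>UNIV. a k - \<delta> k) = sum a UNIV - sum \<delta> UNIV" by (rule sum_subtractf_nat) (use le in blast)
    have 2: "(\<Sum>k\<in>UNIV. b k - \<epsilon> k) = sum b UNIV - sum \<epsilon> UNIV" by (rule sum_subtractf_nat) (use le in blast)
    show ?thesis unfolding pr 1 2 s\<delta> s\<epsilon> ..
  qed
  ultimately show "(\<Prod>k\<in>UNIV. jmat r $ k $ \<sigma> k) \<in> whom bideg (sum a UNIV - CARD('m), sum b UNIV - CARD('n))"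
    unfolding P by (simp only:)
qed

text \<open>
  Every product along a permutation uses each column once, so it loses one degree in
  \<open>X\<close> for each of the \<open>m\<close> columns of the first kind and one degree in
  \<open>Y\<close> for each of the \<open>n\<close> columns of the second kind.
\<close>

lemma jmat_whom:
  fixes r :: "'m::finite + 'n::finite \<Rightarrow> ('m, 'n, 'k::comm_ring_1) bipoly"
  assumes r: "\<And>k. r k \<in> whom bideg (a k, b k)"
  shows "det (jmat r) \<in> whom bideg (sum a UNIV - CARD('m), sum b UNIV - CARD('n))"
    and "det (jmat r) \<noteq> 0 \<Longrightarrow> CARD('m) \<le> sum a UNIV \<and> CARD('n) \<le> sum b UNIV"
proof -
  show "det (jmat r) \<in> whom bideg (sum a UNIV - CARD('m), sum b UNIV - CARD('n))"
  proof (rule det_whom[OF additive_bideg])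
    fix \<sigma> :: "'m + 'n \<Rightarrow> 'm + 'n" assume "\<sigma> permutes UNIV"
    from jmat_term(3)[OF r this] show "(\<Prod>k\<in>UNIV. jmat r $ k $ \<sigma> k) \<in> whom bideg (sum a UNIV - CARD('m), sum b UNIV - CARD('n))"
      by (cases "(\<Prod>k\<in>UNIV. jmat r $ k $ \<sigma> k) = 0") (simp_all only: whom_0)
  qed
  assume "det (jmat r) \<noteq> 0"
  then obtain \<sigma> where "\<sigma> permutes UNIV" "(\<Prod>k\<in>UNIV. jmat r $ k $ \<sigma> k) \<noteq> 0"
    unfolding det_def by (metis (mono_tags, lifting) mem_Collect_eq mult_zero_right sum.neutral)
  from jmat_term(1,2)[OF r this] show "CARD('m) \<le> sum a UNIV \<and> CARD('n) \<le> sum b UNIV" by (rule conjI)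
qed

lemma prod_cong_ideal:
  assumes I: "is_ideal I" and fg: "\<And>k. k \<in> S \<Longrightarrow> f k - g k \<in> I"
  shows "(\<Prod>k\<in>S. f k) - (\<Prod>k\<in>S. g k) \<in> I"
  using fg
proof (induction S rule: infinite_finite_induct)
  case (insert x S)
  have "f x * (\<Prod>k\<in>S. f k) - g x * (\<Prod>k\<in>S. g k)
      = f x * ((\<Prod>k\<in>S. f k) - (\<Prod>k\<in>S. g k)) + (\<Prod>k\<in>S. g k) * (f x - g x)"
    by (simp only: right_diff_distrib mult.commute) simp
  moreover have "f x * ((\<Prod>k\<in>S. f k) - (\<Prod>k\<in>S. g k)) + (\<Prod>k\<in>S. g k) * (f x - g x) \<in> I"
    using insert by (intro ideal_add[OF I] ideal_mult[OF I]) auto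
  ultimately show ?case using insert.hyps by simp
qed (simp_all add: ideal_zero[OF I])

lemma det_cong_ideal:
  fixes M M' :: "'r::comm_ring_1^'n^'n"
  assumes I: "is_ideal I" and MM: "\<And>i j. M $ i $ j - M' $ i $ j \<in> I"
  shows "det M - det M' \<in> I"
proof -
  have "det M - det M' = (\<Sum>p\<in>{p. p permutes UNIV}. of_int (sign p) *
      ((\<Prod>i\<in>UNIV. M $ i $ p i) - (\<Prod>i\<in>UNIV. M' $ i $ p i)))"
    unfolding det_def by (simp only: right_diff_distrib sum_subtractf)
  also have "\<dots> \<in> I" by (intro ideal_sum[OF I] ideal_mult[OF I] prod_cong_ideal[OF I] MM)
  finally show ?thesis .
qed

text \<open>
  Expand row by row; \<open>K\<close> collects the rows that still carry the full linear
  combination.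
\<close>

lemma det_rows_in_ideal:
  fixes D :: "'f \<Rightarrow> 'r::comm_ring_1^'n" and c :: "'n \<Rightarrow> 'f \<Rightarrow> 'r"
  assumes J: "is_ideal J" and S: "finite S"
    and base: "\<And>\<phi>. (\<And>k. \<phi> k \<in> S) \<Longrightarrow> det (\<chi> k. D (\<phi> k)) \<in> J"
  shows "det (\<chi> k. \<Sum>f\<in>S. c k f *s D f) \<in> J"
proof -
  have "det (\<chi> k. if k \<in> K then (\<Sum>f\<in>S. c k f *s D f) else D (\<phi> k)) \<in> J"
    if "finite K" "\<And>k. k \<notin> K \<Longrightarrow> \<phi> k \<in> S" for K \<phi>
    using that
  proof (induction K arbitrary: \<phi>)
    case empty
    then show ?case using base[of \<phi>] by simp
  next
    case (insert z K)
    let ?c = "\<lambda>k. if k \<in> K then (\<Sum>f\<in>S. c k f *s D f) else D (\<phi> k)"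
    have "(\<chi> k. if k \<in> insert z K then (\<Sum>f\<in>S. c k f *s D f) else D (\<phi> k))
        = (\<chi> k. if k = z then sum (\<lambda>f. c z f *s D f) S else ?c k)"
      by (simp add: vec_eq_iff)
    then have "det (\<chi> k. if k \<in> insert z K then (\<Sum>f\<in>S. c k f *s D f) else D (\<phi> k))
        = (\<Sum>f\<in>S. det (\<chi> k. if k = z then c z f *s D f else ?c k))"
      using det_linear_row_sum[OF S, of z "\<lambda>_ f. c z f *s D f" ?c] by simp
    also have "\<dots> = (\<Sum>f\<in>S. c z f * det (\<chi> k. if k = z then D f else ?c k))"
      by (intro sum.cong refl det_row_mul)
    also have "\<dots> \<in> J"
    proof (intro ideal_sum[OF J] ideal_mult[OF J])
      fix f assume f: "f \<in> S"
      have "(\<chi> k. if k = z then D f else ?c k)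
          = (\<chi> k. if k \<in> K then (\<Sum>f\<in>S. c k f *s D f) else D ((\<phi>(z := f)) k))"
        using insert.hyps(2) by (auto simp: vec_eq_iff)
      moreover have "det (\<chi> k. if k \<in> K then (\<Sum>f\<in>S. c k f *s D f) else D ((\<phi>(z := f)) k)) \<in> J"
        by (rule insert.IH) (use insert.prems f in auto)
      ultimately show "det (\<chi> k. if k = z then D f else ?c k) \<in> J" by simp
    qed
    finally show ?case .
  qed
  from this[of UNIV "\<lambda>_. undefined"] show ?thesis by simp
qed

text \<open>
  Differentiating \<open>H k = \<Sum>f. c f * f\<close> gives a combination of the rows of the
  generators, up to terms in the vanishing ideal. This is the independence of the Kaehler
  different from the choice of generators, in the direction needed here.
\<close>

lemma jmat_in_kaehler:
  fixes Fs :: "('m::finite, 'n::finite, 'k::field) bipoly set" and H :: "'m + 'n \<Rightarrow> ('m, 'n, 'k) bipoly"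
  assumes Fs: "finite Fs" "ideal_gen Fs = bivan_ideal X" and H: "\<And>k. H k \<in> bivan_ideal X"
  shows "det (jmat H) \<in> kaehler_different Fs X"
proof -
  let ?J = "kaehler_different Fs X"
  have J: "is_ideal ?J" by (simp add: kaehler_different_def)
  have I: "is_ideal (bivan_ideal X)" by (simp add: bivan_ideal_def)
  have IJ: "bivan_ideal X \<subseteq> ?J" unfolding kaehler_different_def by (auto intro: ideal_gen_superset)
  have "\<exists>c. H k = (\<Sum>f\<in>Fs. c f * f)" for k
    using H[of k] ideal_gen_image[OF Fs(1), of "H k" "\<lambda>f. f"] unfolding Fs(2)[symmetric] by simp
  then have "\<forall>k. \<exists>c. H k = (\<Sum>f\<in>Fs. c f * f)" ..
  from choice[OF this] obtain c where c': "\<forall>k. H k = (\<Sum>f\<in>Fs. c k f * f)" ..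
  have c: "H k = (\<Sum>f\<in>Fs. c k f * f)" for k using c' ..
  define D where "D f = (\<chi> j. partial_deriv (map_sum Some Some j) f)" for f :: "('m, 'n, 'k) bipoly"
  let ?M = "\<chi> k. \<Sum>f\<in>Fs. c k f *s D f"
  have "det ?M \<in> ?J"
  proof (rule det_rows_in_ideal[OF J Fs(1)])
    fix \<phi> :: "'m + 'n \<Rightarrow> ('m, 'n, 'k) bipoly" assume \<phi>: "\<And>k. \<phi> k \<in> Fs"
    have Dj: "(\<chi> k. D (\<phi> k)) = jmat \<phi>" by (simp add: D_def jmat_def vec_eq_iff)
    show "det (\<chi> k. D (\<phi> k)) \<in> ?J"
    proof (cases "inj \<phi>")
      case True
      then have "det (jmat \<phi>) \<in> jacobian_minors Fs" unfolding jacobian_minors_jmat using \<phi> by auto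
      then show ?thesis unfolding Dj kaehler_different_def by (intro ideal_gen_superset) blast
    next
      case False
      then obtain k l where kl: "k \<noteq> l" "\<phi> k = \<phi> l" by (auto simp: inj_def)
      have "det (\<chi> k. D (\<phi> k)) = 0"
        by (rule det_identical_rows[OF kl(1)]) (simp add: row_def kl(2))
      then show ?thesis by (simp add: ideal_zero[OF J])
    qed
  qed
  moreover have "det (jmat H) - det ?M \<in> ?J"
  proof (rule det_cong_ideal[OF J])
    fix k j :: "'m + 'n"
    let ?d = "partial_deriv (map_sum Some Some j)"
    have "jmat H $ k $ j = (\<Sum>f\<in>Fs. ?d (c k f) * f + c k f * ?d f)"
      unfolding jmat_def c by (simp add: partial_deriv_mult)
    moreover have "?M $ k $ j = (\<Sum>f\<in>Fs. c k f * ?d f)" by (simp add: D_def sum_component)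
    ultimately have "jmat H $ k $ j - ?M $ k $ j = (\<Sum>f\<in>Fs. ?d (c k f) * f)"
      by (simp only: sum.distrib add_diff_cancel_right')
    moreover have "(\<Sum>f\<in>Fs. ?d (c k f) * f) \<in> bivan_ideal X"
      unfolding Fs(2)[symmetric] by (intro ideal_sum ideal_mult is_ideal_gen ideal_gen_superset)
    ultimately show "jmat H $ k $ j - ?M $ k $ j \<in> ?J" using IJ by auto
  qed
  ultimately have "(det (jmat H) - det ?M) + det ?M \<in> ?J" by (intro ideal_add[OF J])
  then show ?thesis by (simp only: diff_add_cancel)
qed

text \<open>
  The minors that vanish on \<open>V\<close> or exceed the bidegree in one of the gradings
  contribute to the Kaehler different in bidegree \<open>(r1, r2)\<close> only elements of the
  vanishing ideal. The set \<open>?J\<close> in the proof expresses this as an ideal.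
\<close>

lemma kaehler_minor:
  fixes Fs :: "('m::finite, 'n::finite, 'k::field) bipoly set" and V :: "('m option + 'n option \<Rightarrow> 'k) set"
  assumes hom: "\<forall>F\<in>Fs. \<exists>i j. F \<in> bihom_comp i j" and gen: "ideal_gen Fs = bivan_ideal X"
    and V: "bivan_ideal X = hvan bideg V" and HF: "HF_kaehler Fs X r1 r2 \<noteq> 0"
  obtains r a b v where "\<And>k. r k \<in> Fs" "\<And>k. r k \<in> whom bideg (a k, b k)" "v \<in> V"
    "peval v (det (jmat r)) \<noteq> 0" "sum a UNIV \<le> r1 + CARD('m)" "sum b UNIV \<le> r2 + CARD('n)"
proof -
  let ?\<theta> = "kaehler_different Fs X" and ?C = "bihom_comp r1 r2 :: ('m, 'n, 'k) bipoly set" and ?I = "bivan_ideal X"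
  have I\<theta>: "?I \<subseteq> ?\<theta>" unfolding kaehler_different_def by (auto intro: ideal_gen_superset)
  obtain g where g: "g \<in> ?\<theta>" "g \<in> ?C" "g \<notin> ?I"
  proof -
    have "\<not> ?\<theta> \<inter> ?C \<subseteq> ?I \<inter> ?C"
    proof
      assume "?\<theta> \<inter> ?C \<subseteq> ?I \<inter> ?C"
      then have "?\<theta> \<inter> ?C = ?I \<inter> ?C" using I\<theta> by blast
      then show False using HF unfolding HF_kaehler_def comp_dim_def by simp
    qed
    then show thesis using that by blast
  qed
  have gw: "g \<in> whom bideg (r1, r2)" using g(2) by (simp add: bihom_comp_whom)
  (* polynomials whose components of bidegree at most (r1, r2) vanish on V *)
  let ?J = "{x :: ('m, 'n, 'k) bipoly. \<forall>i\<le>r1. \<forall>j\<le>r2. \<forall>v\<in>V. peval v (pcomp bideg (i, j) x) = 0}"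
  have J: "is_ideal ?J"
  proof (rule is_idealI)
    show "0 \<in> ?J" by simp
    show "x + y \<in> ?J" if "x \<in> ?J" "y \<in> ?J" for x y using that by simp
    show "c * x \<in> ?J" if x: "x \<in> ?J" for x c
    proof (induction c rule: mpoly_induct)
      case (monom t c)
      show ?case
      proof (intro CollectI allI impI ballI)
        fix i j v assume ij: "i \<le> r1" "j \<le> r2" and v: "v \<in> V"
        show "peval v (pcomp bideg (i, j) (Poly_Mapping.single t c * x)) = 0"
        proof (cases "\<exists>e. (i, j) = bideg t + e")
          case True
          then obtain e where e: "(i, j) = bideg t + e" by blast
          then have "fst e \<le> i" "snd e \<le> j" by (auto simp: prod_eq_iff)
          then have "fst e \<le> r1" "snd e \<le> r2" using ij by linarith+
          then have "peval v (pcomp bideg (fst e, snd e) x) = 0" using x v by blast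
          then show ?thesis
            unfolding e pcomp_mult_whom[OF additive_bideg whom_single[OF refl]] by simp
        next
          case False
          then have "pcomp bideg (i, j) (Poly_Mapping.single t c * x) = 0"
            by (intro pcomp_mult_whom_0[OF additive_bideg whom_single[OF refl]]) blast
          then show ?thesis by simp
        qed
      qed
    next
      case (add p q)
      then show ?case by (simp add: distrib_right)
    qed
  qed
  have "g \<notin> ?J"
  proof
    assume "g \<in> ?J"
    then have "\<forall>v\<in>V. peval v (pcomp bideg (r1, r2) g) = 0" by blast
    moreover have "pcomp bideg (r1, r2) g = g" using pcomp_whom[OF gw, of "(r1, r2)"] by simp
    ultimately have "g \<in> ?I" unfolding V hvan_whom_iff[OF additive_bideg gw] by simp
    then show False using g(3) by blast
  qed
  then have "\<not> ?\<theta> \<subseteq> ?J" using g(1) by blast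
  then have "\<not> ?I \<union> jacobian_minors Fs \<subseteq> ?J"
    unfolding kaehler_different_def using ideal_gen_least[OF J] by blast
  moreover have "?I \<subseteq> ?J"
  proof
    fix x assume "x \<in> ?I"
    then have x: "\<forall>d. \<forall>u\<in>V. peval u (pcomp bideg d x) = 0" unfolding V hvan_iff[OF additive_bideg] .
    then show "x \<in> ?J" by blast
  qed
  ultimately obtain \<Delta> where \<Delta>: "\<Delta> \<in> jacobian_minors Fs" "\<Delta> \<notin> ?J" by blast
  obtain r where r: "\<Delta> = det (jmat r)" "range r \<subseteq> Fs" using \<Delta>(1) unfolding jacobian_minors_jmat by blast
  have rF: "r k \<in> Fs" for k using r(2) by blast
  have "\<forall>k. \<exists>ab. r k \<in> whom bideg ab" using hom rF by (auto simp: bihom_comp_whom)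
  from choice[OF this] obtain ab where ab: "\<And>k. r k \<in> whom bideg (ab k)" by blast
  define a b where "a k = fst (ab k)" and "b k = snd (ab k)" for k
  have rw: "r k \<in> whom bideg (a k, b k)" for k using ab[of k] by (simp add: a_def b_def)
  obtain i j v where ijv: "i \<le> r1" "j \<le> r2" "v \<in> V" "peval v (pcomp bideg (i, j) \<Delta>) \<noteq> 0" using \<Delta>(2) by blast
  have \<Delta>w: "\<Delta> \<in> whom bideg (sum a UNIV - CARD('m), sum b UNIV - CARD('n))"
    unfolding r(1) by (rule jmat_whom(1)[OF rw])
  have e: "(i, j) = (sum a UNIV - CARD('m), sum b UNIV - CARD('n))"
    using ijv(4) pcomp_whom[OF \<Delta>w, of "(i, j)"] by (metis peval_0)
  then have ev: "peval v (det (jmat r)) \<noteq> 0" using ijv(4) pcomp_whom[OF \<Delta>w, of "(i, j)"] r(1) by simp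
  then have "det (jmat r) \<noteq> 0" by auto
  from jmat_whom(2)[OF rw this] have "sum a UNIV \<le> r1 + CARD('m)" "sum b UNIV \<le> r2 + CARD('n)"
    using e ijv(1,2) by auto
  then show thesis using that[OF rF rw ijv(3) ev] by blast
qed

section \<open>Splitting a nonzero determinant into two blocks\<close>

lemma det_rows_choice:
  fixes x y c :: "'n \<Rightarrow> 'k::field^'n"
  assumes "finite K" "det (\<chi> k. if k \<in> K then x k + y k else c k) \<noteq> 0"
  shows "\<exists>f. det (\<chi> k. if k \<in> K then (if f k then x k else y k) else c k) \<noteq> 0"
  using assms
proof (induction K arbitrary: c)
  case empty
  then show ?case by simp
next
  case (insert z K)
  let ?c = "\<lambda>k. if k \<in> K then x k + y k else c k"
  have "(\<chi> k. if k \<in> insert z K then x k + y k else c k) = (\<chi> k. if k = z then x k + y k else ?c k)"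
    by (simp add: vec_eq_iff)
  then have "det (\<chi> k. if k = z then x k + y k else ?c k) \<noteq> 0" using insert.prems by simp
  then have "det (\<chi> k. if k = z then x k else ?c k) \<noteq> 0 \<or> det (\<chi> k. if k = z then y k else ?c k) \<noteq> 0"
    by (auto simp: det_row_add)
  then have "\<exists>s. det (\<chi> k. if k = z then (if s then x k else y k) else ?c k) \<noteq> 0"
  proof
    assume "det (\<chi> k. if k = z then x k else ?c k) \<noteq> 0"
    then show ?thesis by (intro exI[of _ True]) (simp only: if_True not_False_eq_True)
  next
    assume "det (\<chi> k. if k = z then y k else ?c k) \<noteq> 0"
    then show ?thesis by (intro exI[of _ False]) (simp only: if_False not_False_eq_True)
  qed
  then obtain s where s: "det (\<chi> k. if k = z then (if s then x k else y k) else ?c k) \<noteq> 0" ..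
  let ?c' = "\<lambda>k. if k = z then (if s then x k else y k) else c k"
  have "(\<chi> k. if k = z then (if s then x k else y k) else ?c k) = (\<chi> k. if k \<in> K then x k + y k else ?c' k)"
    using insert.hyps(2) by (auto simp: vec_eq_iff)
  then obtain f where f: "det (\<chi> k. if k \<in> K then (if f k then x k else y k) else ?c' k) \<noteq> 0"
    using insert.IH[of ?c'] s by auto
  have "(\<chi> k. if k \<in> K then (if f k then x k else y k) else ?c' k)
      = (\<chi> k. if k \<in> insert z K then (if (f(z := s)) k then x k else y k) else c k)"
    using insert.hyps(2) by (auto simp: vec_eq_iff)
  then show ?case using f by (intro exI[of _ "f(z := s)"]) simp
qed

text \<open>
  Nonsingularity as linear independence of the rows, with plain functions as coefficient
  vectors.
\<close>

lemma det_transpose_kernel: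
  fixes M :: "'k::field^'n^'n"
  shows "det M \<noteq> 0 \<longleftrightarrow> (\<forall>z. (\<forall>j. (\<Sum>i\<in>UNIV. z i * M $ i $ j) = 0) \<longrightarrow> (\<forall>i. z i = 0))"
proof -
  have "det M \<noteq> 0 \<longleftrightarrow> invertible (transpose M)" by (simp only: invertible_det_nz det_transpose)
  also have "\<dots> \<longleftrightarrow> (\<forall>x. transpose M *v x = 0 \<longrightarrow> x = 0)"
    by (simp only: invertible_left_inverse matrix_left_invertible_ker)
  also have "\<dots> \<longleftrightarrow> (\<forall>z. (\<forall>j. (\<Sum>i\<in>UNIV. z i * M $ i $ j) = 0) \<longrightarrow> (\<forall>i. z i = 0))"
  proof
    assume *: "\<forall>x. transpose M *v x = 0 \<longrightarrow> x = 0"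
    show "\<forall>z. (\<forall>j. (\<Sum>i\<in>UNIV. z i * M $ i $ j) = 0) \<longrightarrow> (\<forall>i. z i = 0)"
    proof (intro allI impI)
      fix z i assume z: "\<forall>j. (\<Sum>i\<in>UNIV. z i * M $ i $ j) = 0"
      have "transpose M *v (\<chi> i. z i) = 0"
        using z by (simp add: matrix_vector_mult_def transpose_def vec_eq_iff mult.commute)
      then have "(\<chi> i. z i) = 0" using * by blast
      then show "z i = 0" by (simp add: vec_eq_iff)
    qed
  next
    assume *: "\<forall>z. (\<forall>j. (\<Sum>i\<in>UNIV. z i * M $ i $ j) = 0) \<longrightarrow> (\<forall>i. z i = 0)"
    show "\<forall>x. transpose M *v x = 0 \<longrightarrow> x = 0"
    proof (intro allI impI)
      fix x assume x: "transpose M *v x = 0"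
      have "\<forall>j. (\<Sum>i\<in>UNIV. x $ i * M $ i $ j) = 0"
        using x by (simp add: matrix_vector_mult_def transpose_def vec_eq_iff mult.commute)
      then show "x = 0" using *[rule_format, of "\<lambda>i. x $ i"] by (simp add: vec_eq_iff)
    qed
  qed
  finally show ?thesis .
qed

lemma sum_UNIV_sum: "(\<Sum>k\<in>(UNIV :: ('m::finite + 'n::finite) set). f k) = (\<Sum>x\<in>UNIV. f (Inl x)) + (\<Sum>y\<in>UNIV. f (Inr y))"
  by (subst UNIV_Plus_UNIV[symmetric], subst sum.Plus) (simp_all add: comp_def)

text \<open>
  Split each row into its two parts and expand: some choice of parts gives a nonzero
  determinant. A permutation contributing to it matches the rows of the first kind with the
  columns of the first kind, so the matrix is block diagonal up to a reordering of rows, and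
  both blocks are nonsingular. This replaces the Laplace expansion along the two groups of
  columns.
\<close>

lemma det_two_blocks:
  fixes x :: "'m::finite + 'n::finite \<Rightarrow> 'm \<Rightarrow> 'k::field" and y :: "'m + 'n \<Rightarrow> 'n \<Rightarrow> 'k"
  assumes "det (\<chi> k c. case c of Inl i \<Rightarrow> x k i | Inr j \<Rightarrow> y k j) \<noteq> 0"
  obtains g h where "inj (g :: 'm \<Rightarrow> 'm + 'n)" "det (\<chi> i j. x (g i) j) \<noteq> 0"
    "inj (h :: 'n \<Rightarrow> 'm + 'n)" "det (\<chi> i j. y (h i) j) \<noteq> 0"
proof -
  define X :: "'m + 'n \<Rightarrow> 'k^('m + 'n)" where "X k = (\<chi> c. case c of Inl i \<Rightarrow> x k i | Inr _ \<Rightarrow> 0)" for k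
  define Y :: "'m + 'n \<Rightarrow> 'k^('m + 'n)" where "Y k = (\<chi> c. case c of Inl _ \<Rightarrow> 0 | Inr j \<Rightarrow> y k j)" for k
  have "(\<chi> k c. case c of Inl i \<Rightarrow> x k i | Inr j \<Rightarrow> y k j) = (\<chi> k. if k \<in> UNIV then X k + Y k else 0)"
    by (auto simp: vec_eq_iff X_def Y_def split: sum.splits)
  then obtain f where "det (\<chi> k. if k \<in> UNIV then (if f k then X k else Y k) else 0) \<noteq> 0"
    using det_rows_choice[OF finite, of UNIV X Y "\<lambda>_. 0"] assms by auto
  then have dM: "det (\<chi> k. if f k then X k else Y k) \<noteq> 0" by simp
  define M where "M = (\<chi> k. if f k then X k else Y k)"
  have M: "det M \<noteq> 0" using dM unfolding M_def .
  have Mx: "M $ k $ Inl i = (if f k then x k i else 0)" and My: "M $ k $ Inr j = (if f k then 0 else y k j)" for k i j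
    by (simp_all add: M_def X_def Y_def)
  have "\<exists>\<sigma>. \<sigma> permutes UNIV \<and> (\<Prod>k\<in>UNIV. M $ k $ \<sigma> k) \<noteq> 0"
  proof (rule ccontr)
    assume no: "\<not> ?thesis"
    have "det M = 0" unfolding det_def
    proof (rule sum.neutral, rule ballI)
      fix \<sigma> assume "\<sigma> \<in> {p. p permutes (UNIV :: ('m + 'n) set)}"
      then have "(\<Prod>k\<in>UNIV. M $ k $ \<sigma> k) = 0" using no by blast
      then show "of_int (sign \<sigma>) * (\<Prod>k\<in>UNIV. M $ k $ \<sigma> k) = 0" by (simp only: mult_zero_right)
    qed
    then show False using M by blast
  qed
  then obtain \<sigma> where \<sigma>: "\<sigma> permutes UNIV" "(\<Prod>k\<in>UNIV. M $ k $ \<sigma> k) \<noteq> 0" by (elim exE conjE)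
  have Mnz: "M $ k $ \<sigma> k \<noteq> 0" for k
    using \<sigma>(2) by (simp add: prod_zero_iff)
  let ?i = "inv \<sigma>"
  have inv: "\<sigma> (?i c) = c" for c using \<sigma>(1) by (simp add: permutes_inverses)
  have \<iota>: "?i permutes UNIV" by (rule permutes_inv[OF \<sigma>(1)])
  have fx: "f (?i (Inl i))" for i using Mnz[of "?i (Inl i)"] by (auto simp: inv Mx split: if_splits)
  have fy: "\<not> f (?i (Inr j))" for j using Mnz[of "?i (Inr j)"] by (auto simp: inv My split: if_splits)
  have inji: "inj ?i" using \<iota> by (rule permutes_inj)
  have inj: "inj (\<lambda>i. ?i (Inl i))" "inj (\<lambda>j. ?i (Inr j))" using inji by (auto simp: inj_def)
  have re: "(\<Sum>k\<in>UNIV. F k) = (\<Sum>i\<in>UNIV. F (?i (Inl i))) + (\<Sum>j\<in>UNIV. F (?i (Inr j)))" for F :: "'m + 'n \<Rightarrow> 'k"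
    using sum.permute[OF \<iota>, of F] by (simp add: comp_def sum_UNIV_sum)
  have ker: "\<forall>k. z k = 0" if "\<forall>c. (\<Sum>k\<in>UNIV. z k * M $ k $ c) = 0" for z
    using M that unfolding det_transpose_kernel by blast
  have "det (\<chi> i j. x (?i (Inl i)) j) \<noteq> 0"
    unfolding det_transpose_kernel
  proof (intro allI impI)
    fix z i assume z: "\<forall>j. (\<Sum>i\<in>UNIV. z i * (\<chi> i j. x (?i (Inl i)) j) $ i $ j) = 0"
    (* a relation between the rows of one block is extended by zero to the whole matrix *)
    define zz where "zz k = (case \<sigma> k of Inl i \<Rightarrow> z i | Inr _ \<Rightarrow> 0)" for k
    have "(\<Sum>k\<in>UNIV. zz k * M $ k $ c) = 0" for c
    proof -
      have "(\<Sum>k\<in>UNIV. zz k * M $ k $ c) = (\<Sum>i\<in>UNIV. z i * M $ ?i (Inl i) $ c)"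
        unfolding re by (simp add: zz_def inv)
      also have "\<dots> = 0"
      proof (cases c)
        case (Inl j) then show ?thesis using z by (simp add: Mx fx)
      next
        case (Inr j) then show ?thesis by (simp add: My fx)
      qed
      finally show ?thesis .
    qed
    then have "zz (?i (Inl i)) = 0" using ker by blast
    then show "z i = 0" by (simp add: zz_def inv)
  qed
  moreover have "det (\<chi> i j. y (?i (Inr i)) j) \<noteq> 0"
    unfolding det_transpose_kernel
  proof (intro allI impI)
    fix z i assume z: "\<forall>j. (\<Sum>i\<in>UNIV. z i * (\<chi> i j. y (?i (Inr i)) j) $ i $ j) = 0"
    define zz where "zz k = (case \<sigma> k of Inl _ \<Rightarrow> 0 | Inr i \<Rightarrow> z i)" for k
    have "(\<Sum>k\<in>UNIV. zz k * M $ k $ c) = 0" for c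
    proof -
      have "(\<Sum>k\<in>UNIV. zz k * M $ k $ c) = (\<Sum>i\<in>UNIV. z i * M $ ?i (Inr i) $ c)"
        unfolding re by (simp add: zz_def inv)
      also have "\<dots> = 0"
      proof (cases c)
        case (Inl j) then show ?thesis by (simp add: Mx fy)
      next
        case (Inr j) then show ?thesis using z by (simp add: My fy)
      qed
      finally show ?thesis .
    qed
    then have "zz (?i (Inr i)) = 0" using ker by blast
    then show "z i = 0" by (simp add: zz_def inv)
  qed
  ultimately show thesis using that inj by blast
qed

section \<open>The Cayley-Bacharach property of a product\<close>

lemma bivan_ideal_vanish:
  fixes X :: "('m::finite, 'n::finite, 'k::field) bipoint set"
  assumes F: "F \<in> bivan_ideal X" and P: "(P, Q) \<in> X" "u \<in> P" "w \<in> Q"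
  shows "peval (case_sum u w) F = 0"
proof -
  have "bivan_ideal X \<subseteq> {F. peval (case_sum u w) F = 0}"
    unfolding bivan_ideal_def
  proof (rule ideal_gen_least)
    show "is_ideal {F :: ('m, 'n, 'k) bipoly. peval (case_sum u w) F = 0}"
      by (rule is_idealI) simp_all
  qed (use P in blast)
  then show ?thesis using F by blast
qed

locale product_points =
  L: affine_points X1 + R: affine_points X2
  for X1 :: "('m::finite option \<Rightarrow> 'k::field) set set" and X2 :: "('n::finite option \<Rightarrow> 'k) set set" +
  assumes nonempty: "X1 \<noteq> {}" "X2 \<noteq> {}"
begin

lemma proj: "X1 \<times> X2 \<subseteq> proj_space \<times> proj_space"
  using L.Z_proj R.Z_proj by blast

lemma bivan: "bivan_ideal (X1 \<times> X2) = hvan bideg (vpairs L.reps R.reps)"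
  unfolding L.reps_def R.reps_def
  by (rule bivan_ideal_vpairs[OF proj refl L.nvec_Z(1) R.nvec_Z(1)])

lemma bivan_pair: "F \<in> bivan_ideal (X1 \<times> X2) \<Longrightarrow> u \<in> L.reps \<Longrightarrow> w \<in> R.reps \<Longrightarrow> peval (case_sum u w) F = 0"
  unfolding L.reps_def R.reps_def
  using bivan_ideal_vanish[of F "X1 \<times> X2"] L.nvec_Z(1) R.nvec_Z(1) by blast

lemma reps_nonempty: "\<exists>u. u \<in> L.reps" "\<exists>w. w \<in> R.reps"
  using nonempty by (auto simp: L.reps_def R.reps_def)

text \<open>
  Removing a point lowers the evaluation rank iff the point was separated, and pairs are
  separated coordinatewise.
\<close>

lemma HF_remove:
  assumes P: "P \<in> X1" and Q: "Q \<in> X2"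
  shows "HF_bi (X1 \<times> X2 - {(P, Q)}) i j
    + (if separates (hom_comp i) (L.reps - {nvec P}) (nvec P) \<and> separates (hom_comp j) (R.reps - {nvec Q}) (nvec Q)
       then 1 else 0) = eval_rank (bihom_comp i j) (vpairs L.reps R.reps)"
proof -
  let ?X = "X1 \<times> X2 - {(P, Q)}" and ?f = "\<lambda>(P, Q). case_sum (nvec P) (nvec Q)"
  let ?N = "vpairs L.reps R.reps" and ?v = "case_sum (nvec P) (nvec Q)"
  have N: "?f ` (X1 \<times> X2) = ?N" unfolding vpairs_def L.reps_def R.reps_def by auto
  have inj: "inj_on ?f (X1 \<times> X2)"
  proof (rule inj_onI)
    fix x y assume x: "x \<in> X1 \<times> X2" and y: "y \<in> X1 \<times> X2" and eq: "?f x = ?f y"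
    obtain a b c d where xy: "x = (a, b)" "y = (c, d)" by (cases x, cases y)
    have "nvec a = nvec c" "nvec b = nvec d" using eq unfolding xy by (simp_all add: case_sum_eq_iff)
    then have "a = c" "b = d" using x y inj_onD[OF L.inj_nvec] inj_onD[OF R.inj_nvec] unfolding xy by auto
    then show "x = y" unfolding xy by simp
  qed
  have im: "?f ` ?X = ?N - {?v}"
    using inj_on_image_set_diff[OF inj, of "X1 \<times> X2" "{(P, Q)}"] P Q unfolding N by simp
  have "bivan_ideal ?X = hvan bideg (?f ` ?X)"
    by (rule bivan_ideal_reps) (use proj L.nvec_Z(1) R.nvec_Z(1) in auto)
  then have "HF_bi ?X i j = eval_rank (bihom_comp i j) (?N - {?v})"
    unfolding HF_bi_def comp_dim_def eval_rank_def bihom_comp_whom im by (simp add: hvan_Int[OF additive_bideg])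
  moreover have "nvec P \<in> L.reps" "nvec Q \<in> R.reps" using P Q by (auto simp: L.reps_def R.reps_def)
  moreover from this have "?v \<in> ?N" unfolding vpairs_def by blast
  moreover have "mp.subspace (bihom_comp i j :: ('m, 'n, 'k) bipoly set)"
    unfolding bihom_comp_whom by (rule whom_subspace[OF additive_bideg])
  ultimately show ?thesis
    using eval_rank_remove[OF fin_dim_bihom_comp, of i j ?v ?N] separates_vpairs[of "nvec P" L.reps "nvec Q" R.reps i j]
    unfolding bihom_comp_whom by simp
qed

lemma cayley_bacharach_iff:
  "cayley_bacharach (X1 \<times> X2) \<longleftrightarrow>
    (\<forall>u\<in>L.reps. \<forall>w\<in>R.reps. \<forall>u'\<in>L.reps. \<forall>w'\<in>R.reps. \<forall>i j.
      (separates (hom_comp i) (L.reps - {u}) u \<and> separates (hom_comp j) (R.reps - {w}) w) =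
      (separates (hom_comp i) (L.reps - {u'}) u' \<and> separates (hom_comp j) (R.reps - {w'}) w'))"
proof -
  let ?S = "\<lambda>P Q i j. separates (hom_comp i) (L.reps - {nvec P}) (nvec P) \<and> separates (hom_comp j) (R.reps - {nvec Q}) (nvec Q)"
  have "HF_bi (X1 \<times> X2 - {(P, Q)}) = HF_bi (X1 \<times> X2 - {(P', Q')}) \<longleftrightarrow> (\<forall>i j. ?S P Q i j = ?S P' Q' i j)"
    if "P \<in> X1" "Q \<in> X2" "P' \<in> X1" "Q' \<in> X2" for P Q P' Q'
  proof -
    have "HF_bi (X1 \<times> X2 - {(P, Q)}) i j = HF_bi (X1 \<times> X2 - {(P', Q')}) i j \<longleftrightarrow> ?S P Q i j = ?S P' Q' i j" for i j
    proof -
      have "HF_bi (X1 \<times> X2 - {(P, Q)}) i j + (if ?S P Q i j then 1 else 0)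
          = HF_bi (X1 \<times> X2 - {(P', Q')}) i j + (if ?S P' Q' i j then 1 else 0)"
        using HF_remove[OF that(1,2), of i j] HF_remove[OF that(3,4), of i j] by (rule trans[OF _ sym])
      moreover have "(a = b) = (p = q)" if "a + (if p then 1 else 0) = b + (if q then 1 else 0)"
        for a b :: nat and p q using that by (cases p; cases q) simp_all
      ultimately show ?thesis by blast
    qed
    then show ?thesis by (simp only: fun_eq_iff)
  qed
  moreover have "(\<forall>p\<in>X1 \<times> X2. \<forall>q\<in>X1 \<times> X2. E p q)
      \<longleftrightarrow> (\<forall>P\<in>X1. \<forall>Q\<in>X2. \<forall>P'\<in>X1. \<forall>Q'\<in>X2. E (P, Q) (P', Q'))" for E by force
  ultimately have "cayley_bacharach (X1 \<times> X2) \<longleftrightarrow>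
      (\<forall>P\<in>X1. \<forall>Q\<in>X2. \<forall>P'\<in>X1. \<forall>Q'\<in>X2. \<forall>i j. ?S P Q i j = ?S P' Q' i j)"
    unfolding cayley_bacharach_def by (simp only: cong: ball_cong)
  then show ?thesis unfolding L.reps_def R.reps_def by (simp only: ball_simps)
qed

text \<open>
  Fixing a degree in which a point of the second factor is separated, the Cayley-Bacharach
  property compares the points of the first factor alone; their common minimal separator degree
  is the regularity index.
\<close>

lemma cayley_bacharach_separates:
  assumes CB: "cayley_bacharach (X1 \<times> X2)"
  shows "u \<in> L.reps \<Longrightarrow> separates (hom_comp e) (L.reps - {u}) u \<longleftrightarrow> reg_index X1 \<le> e"
    and "w \<in> R.reps \<Longrightarrow> separates (hom_comp e) (R.reps - {w}) w \<longleftrightarrow> reg_index X2 \<le> e"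
proof -
  let ?S = "\<lambda>u i. separates (hom_comp i) (L.reps - {u}) u" and ?T = "\<lambda>w j. separates (hom_comp j) (R.reps - {w}) w"
  obtain u0 w0 where u0: "u0 \<in> L.reps" and w0: "w0 \<in> R.reps" using reps_nonempty by (elim exE)
  have ST: "(?S u i \<and> ?T w j) = (?S u' i \<and> ?T w' j)"
    if "u \<in> L.reps" "w \<in> R.reps" "u' \<in> L.reps" "w' \<in> R.reps" for u w u' w' i j
    using CB that unfolding cayley_bacharach_iff by (elim ballE allE) auto
  obtain i0 where i0: "?S u0 i0" using separates_exists[OF L.finite_reps _ u0] L.reps_None by blast
  obtain j0 where j0: "?T w0 j0" using separates_exists[OF R.finite_reps _ w0] R.reps_None by blast
  define r where "r = (LEAST i. ?S u0 i)"
  have r: "?S u0 e \<longleftrightarrow> r \<le> e" for e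
  proof
    show "?S u0 e \<Longrightarrow> r \<le> e" unfolding r_def by (rule Least_le)
    have "?S u0 r" unfolding r_def by (rule LeastI[of "?S u0", OF i0])
    then show "r \<le> e \<Longrightarrow> ?S u0 e" using separates_mono[of r "L.reps - {u0}" u0 e] L.reps_None[OF u0] by blast
  qed
  have S: "?S u e \<longleftrightarrow> r \<le> e" if "u \<in> L.reps" for u e
    using ST[OF that w0 u0 w0, of e j0] j0 r by blast
  from L.reg_index_eq[OF nonempty(1) S] have "reg_index X1 = r" by blast
  then show "u \<in> L.reps \<Longrightarrow> ?S u e \<longleftrightarrow> reg_index X1 \<le> e" using S by blast
  define t where "t = (LEAST i. ?T w0 i)"
  have t: "?T w0 e \<longleftrightarrow> t \<le> e" for e
  proof
    show "?T w0 e \<Longrightarrow> t \<le> e" unfolding t_def by (rule Least_le)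
    have "?T w0 t" unfolding t_def by (rule LeastI[of "?T w0", OF j0])
    then show "t \<le> e \<Longrightarrow> ?T w0 e" using separates_mono[of t "R.reps - {w0}" w0 e] R.reps_None[OF w0] by blast
  qed
  have T: "?T w e \<longleftrightarrow> t \<le> e" if "w \<in> R.reps" for w e
    using ST[OF u0 that u0 w0, of i0 e] i0 t by blast
  from R.reg_index_eq[OF nonempty(2) T] have "reg_index X2 = t" by blast
  then show "w \<in> R.reps \<Longrightarrow> ?T w e \<longleftrightarrow> reg_index X2 \<le> e" using T by blast
qed

end

section \<open>Complete intersections are products\<close>

text \<open>
  A generator depends on one group of variables only. If \<open>(P, Q')\<close> and \<open>(P',
  Q)\<close> are in \<open>X\<close>, then all generators vanish at \<open>(P, Q)\<close>, and
  the vanishing ideal of \<open>X\<close> has no zeros outside \<open>X\<close>.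
\<close>

lemma complete_intersection_product:
  fixes X :: "('m::finite, 'n::finite, 'k::field) bipoint set"
  assumes X: "X \<subseteq> proj_space \<times> proj_space" "finite X" and CI: "complete_intersection ds ds' X"
  shows "X = fst ` X \<times> snd ` X"
proof
  show "X \<subseteq> fst ` X \<times> snd ` X" by force
  obtain Fs Gs where len: "length Fs = CARD('m)" "length Gs = CARD('n)"
    and F: "\<forall>i<CARD('m). Fs ! i \<in> bihom_comp (ds ! i) 0" and G: "\<forall>j<CARD('n). Gs ! j \<in> bihom_comp 0 (ds' ! j)"
    and gen: "ideal_gen (set (Fs @ Gs)) = bivan_ideal X"
    using CI unfolding complete_intersection_def by (elim exE conjE)
  have "(P, Q) \<in> X" if PQ': "(P, Q') \<in> X" and P'Q: "(P', Q) \<in> X" for P Q P' Q'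
  proof (rule ccontr)
    assume no: "(P, Q) \<notin> X"
    have PP: "P \<in> proj_space" "Q' \<in> proj_space" "P' \<in> proj_space" "Q \<in> proj_space"
      using X(1) PQ' P'Q by auto
    obtain u where u: "u \<in> P" using proj_nonempty[OF PP(1)] by (elim exE)
    obtain w' where w': "w' \<in> Q'" using proj_nonempty[OF PP(2)] by (elim exE)
    obtain u' where u': "u' \<in> P'" using proj_nonempty[OF PP(3)] by (elim exE)
    obtain w where w: "w \<in> Q" using proj_nonempty[OF PP(4)] by (elim exE)
    obtain f where f: "f \<in> bivan_ideal X" "peval (case_sum u w) f \<noteq> 0"
      using bihom_separates[OF X PP(1,4) no u w] by (elim bexE)
    have "ideal_gen (set (Fs @ Gs)) \<subseteq> {F. peval (case_sum u w) F = 0}"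
    proof (rule ideal_gen_least)
      show "is_ideal {F :: ('m, 'n, 'k) bipoly. peval (case_sum u w) F = 0}" by (rule is_idealI) simp_all
      show "set (Fs @ Gs) \<subseteq> {F. peval (case_sum u w) F = 0}"
      proof
        fix g assume g: "g \<in> set (Fs @ Gs)"
        have gI: "g \<in> bivan_ideal X" unfolding gen[symmetric] using g by (rule ideal_gen_superset)
        consider k where "k < CARD('m)" "g = Fs ! k" | k where "k < CARD('n)" "g = Gs ! k"
          using g len by (auto simp: in_set_conv_nth)
        then have "peval (case_sum u w) g = 0"
        proof cases
          case 1
          then have "g \<in> whom bideg (ds ! k, 0)" using F by (simp add: bihom_comp_whom)
          then have e: "embX (atY w' g) = g" by (rule embX_atY)
          have "peval (case_sum u w) (embX (atY w' g)) = 0"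
            using bivan_ideal_vanish[OF gI PQ' u w'] by (simp add: peval_atY)
          then show ?thesis unfolding e .
        next
          case 2
          then have "g \<in> whom bideg (0, ds' ! k)" using G by (simp add: bihom_comp_whom)
          then have e: "embY (atX u' g) = g" by (rule embY_atX)
          have "peval (case_sum u w) (embY (atX u' g)) = 0"
            using bivan_ideal_vanish[OF gI P'Q u' w] by (simp add: peval_atX)
          then show ?thesis unfolding e .
        qed
        then show "g \<in> {F. peval (case_sum u w) F = 0}" by simp
      qed
    qed
    then show False using f unfolding gen by blast
  qed
  note rect = this
  show "fst ` X \<times> snd ` X \<subseteq> X"
  proof
    fix x assume "x \<in> fst ` X \<times> snd ` X"
    then obtain p q where pq: "x = (fst p, snd q)" "p \<in> X" "q \<in> X" by (elim SigmaE imageE) simp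
    have "(fst p, snd p) \<in> X" "(fst q, snd q) \<in> X" using pq(2,3) by simp_all
    then show "x \<in> X" unfolding pq(1) by (rule rect)
  qed
qed

text \<open>
  Complete intersections are given by lists, Jacobians by families over the type of variables;
  this passes from one to the other.
\<close>

lemma list_as_family:
  assumes "length xs = CARD('i::finite)"
  obtains vs :: "'i::finite list" and h where "distinct vs" "set vs = UNIV" "map h vs = xs"
proof -
  obtain vs :: "'i list" where vs: "set vs = UNIV" "distinct vs" using finite_distinct_list[of "UNIV :: 'i set"] by auto
  have len: "length vs = length xs" using distinct_card[OF vs(2)] vs(1) assms by simp
  define h where "h v = xs ! (SOME k. k < length vs \<and> vs ! k = v)" for v
  have "h (vs ! k) = xs ! k" if k: "k < length vs" for k
  proof -
    have "(SOME l. l < length vs \<and> vs ! l = vs ! k) = k"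
      by (rule some_equality) (use k vs(2) in \<open>auto simp: nth_eq_iff_index_eq\<close>)
    then show ?thesis by (simp add: h_def)
  qed
  then have "map h vs = xs" using len by (intro nth_equalityI) simp_all
  then show thesis using that vs by blast
qed

text \<open>
  Specializing \<open>Y = w0\<close> recovers the forms in \<open>X\<close> and kills the forms
  in \<open>Y\<close>, as the latter vanish at \<open>w0\<close>. It therefore maps the
  vanishing ideal of the product onto that of the first factor.
\<close>

lemma ci_factor_X:
  fixes Fs Gs :: "('m::finite, 'n::finite, 'k::field) bipoly list"
  assumes len: "length Fs = CARD('m)" "length ds = CARD('m)" "length Gs = CARD('n)"
    and F: "\<forall>i<CARD('m). Fs ! i \<in> bihom_comp (ds ! i) 0" and G: "\<forall>j<CARD('n). Gs ! j \<in> bihom_comp 0 (ds' ! j)"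
    and reg: "regular_on (Fs @ Gs)" and gen: "ideal_gen (set (Fs @ Gs)) = hvan bideg (vpairs A B)"
    and u0: "u0 \<in> A" and w0: "w0 \<in> B"
  obtains vs F d where "distinct vs" "set vs = (UNIV :: 'm set)" "\<And>v. F v \<in> hom_comp (d v)" "\<And>v. d v \<in> set ds"
    "regular_on (map F vs)" "ideal_gen (range F) = hvan tdeg A"
proof -
  have "length (zip ds Fs) = CARD('m)" using len by simp
  from list_as_family[OF this] obtain vs :: "'m list" and h
    where vs: "distinct vs" "set vs = UNIV" "map h vs = zip ds Fs" by blast
  define F' where "F' v = atY w0 (snd (h v))" for v
  define d where "d v = fst (h v)" for v
  have hz: "h v \<in> set (zip ds Fs)" for v unfolding vs(3)[symmetric] using vs(2) by simp
  have FI: "f \<in> hvan bideg (vpairs A B)" if "f \<in> set (Fs @ Gs)" for f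
    unfolding gen[symmetric] using that by (rule ideal_gen_superset)
  have hv: "snd (h v) \<in> whom bideg (d v, 0)" "d v \<in> set ds" "snd (h v) \<in> set Fs" for v
  proof -
    obtain k where "k < CARD('m)" "h v = (ds ! k, Fs ! k)" using hz[of v] len by (auto simp: set_zip)
    then show "snd (h v) \<in> whom bideg (d v, 0)" "d v \<in> set ds" "snd (h v) \<in> set Fs"
      using F len by (auto simp: d_def bihom_comp_whom)
  qed
  have F'hom: "F' v \<in> hom_comp (d v)" for v unfolding F'_def by (rule atY_hom[OF hv(1)])
  have emb: "embX (F' v) = snd (h v)" for v unfolding F'_def by (rule embX_atY[OF hv(1)])
  have mapF: "map (\<lambda>v. snd (h v)) vs = Fs"
  proof -
    have "map (\<lambda>v. snd (h v)) vs = map snd (map h vs)" by simp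
    then show ?thesis unfolding vs(3) using len by simp
  qed
  have Fs: "Fs = map (subst (\<lambda>v. Var (Inl v))) (map F' vs)"
    unfolding mapF[symmetric] emb[symmetric] embX_def by simp
  have rF: "regular_on (map F' vs)"
  proof (rule regular_on_retract[where Us = "[]" and b = "case_sum Var (\<lambda>v. Const (w0 v))"])
    show "regular_on ([] @ Fs)" using regular_on_take[OF reg] by simp
    show "Fs = map (subst (\<lambda>v. Var (Inl v))) (map F' vs)" by (rule Fs)
    show "subst (case_sum Var (\<lambda>v. Const (w0 v))) (subst (\<lambda>v. Var (Inl v :: 'm option + 'n option)) p) = p" for p :: "('m option, 'k) mpoly"
      using atY_embX[of w0 p] unfolding atY_def embX_def .
  qed simp
  have "ideal_gen (range F') = hvan tdeg A"
  proof
    show "ideal_gen (range F') \<subseteq> hvan tdeg A"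
    proof (rule ideal_gen_least[OF is_ideal_hvan], rule image_subsetI)
      fix v
      have "peval u (F' v) = 0" if u: "u \<in> A" for u
      proof -
        have "snd (h v) \<in> hvan bideg (vpairs A B)" by (rule FI) (simp add: hv(3))
        then have "\<forall>x\<in>vpairs A B. peval x (snd (h v)) = 0" using hvan_whom_iff[OF additive_bideg hv(1)] by simp
        moreover have "case_sum u w0 \<in> vpairs A B" unfolding vpairs_def using u w0 by blast
        ultimately show ?thesis unfolding F'_def peval_atY by simp
      qed
      then show "F' v \<in> hvan tdeg A" using hvan_whom_iff[OF additive_tdeg, of "F' v" "d v" A] F'hom[of v]
        by (simp add: hom_comp_whom)
    qed
    show "hvan tdeg A \<subseteq> ideal_gen (range F')"
    proof
      fix x assume "x \<in> hvan tdeg A"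
      then have "(embX x :: ('m, 'n, 'k) bipoly) \<in> ideal_gen (set (Fs @ Gs))" unfolding gen by (rule hvan_embX)
      then have x: "atY w0 (embX x :: ('m, 'n, 'k) bipoly) \<in> ideal_gen (atY w0 ` set (Fs @ Gs))"
        unfolding atY_def by (rule ideal_gen_subst)
      have "atY w0 g = 0" if g: "g \<in> set Gs" for g
      proof -
        obtain k where k: "k < CARD('n)" "g = Gs ! k" using g len(3) by (auto simp: in_set_conv_nth)
        then have gw: "g \<in> whom bideg (0, ds' ! k)" using G by (simp add: bihom_comp_whom)
        have "g \<in> hvan bideg (vpairs A B)" by (rule FI) (simp add: g)
        then have "\<forall>x\<in>vpairs A B. peval x g = 0" using hvan_whom_iff[OF additive_bideg gw] by simp
        moreover have "case_sum u0 w0 \<in> vpairs A B" unfolding vpairs_def using u0 w0 by blast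
        ultimately have "peval w0 (atX u0 g) = 0" unfolding peval_atX by simp
        then have "atY w0 (embY (atX u0 g) :: ('m, 'n, 'k) bipoly) = 0" by simp
        then show ?thesis unfolding embY_atX[OF gw] .
      qed
      moreover have "atY w0 g \<in> range F'" if "g \<in> set Fs" for g
      proof -
        have "g \<in> (\<lambda>v. snd (h v)) ` set vs" using that unfolding mapF[symmetric] by simp
        then obtain v where "g = snd (h v)" by (elim imageE)
        then show ?thesis unfolding F'_def by blast
      qed
      ultimately have "atY w0 ` set (Fs @ Gs) \<subseteq> insert 0 (range F')" by auto
      from ideal_gen_mono[OF this] show "x \<in> ideal_gen (range F')"
        using x unfolding ideal_gen_insert_zero atY_embX by (rule subsetD)
    qed
  qed
  then show thesis by (rule that[OF vs(1,2) F'hom hv(2) rF])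
qed

lemma ci_factor_Y:
  fixes Fs Gs :: "('m::finite, 'n::finite, 'k::field) bipoly list"
  assumes len: "length Fs = CARD('m)" "length Gs = CARD('n)" "length ds' = CARD('n)"
    and F: "\<forall>i<CARD('m). Fs ! i \<in> bihom_comp (ds ! i) 0" and G: "\<forall>j<CARD('n). Gs ! j \<in> bihom_comp 0 (ds' ! j)"
    and reg: "regular_on (Fs @ Gs)" and gen: "ideal_gen (set (Fs @ Gs)) = hvan bideg (vpairs A B)"
    and u0: "u0 \<in> A" and w0: "w0 \<in> B"
  obtains vs G d where "distinct vs" "set vs = (UNIV :: 'n set)" "\<And>v. G v \<in> hom_comp (d v)" "\<And>v. d v \<in> set ds'"
    "regular_on (map G vs)" "ideal_gen (range G) = hvan tdeg B"
proof -
  have "length (zip ds' Gs) = CARD('n)" using len by simp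
  from list_as_family[OF this] obtain vs :: "'n list" and h
    where vs: "distinct vs" "set vs = UNIV" "map h vs = zip ds' Gs" by blast
  define G' where "G' v = atX u0 (snd (h v))" for v
  define d where "d v = fst (h v)" for v
  have hz: "h v \<in> set (zip ds' Gs)" for v unfolding vs(3)[symmetric] using vs(2) by simp
  have FI: "f \<in> hvan bideg (vpairs A B)" if "f \<in> set (Fs @ Gs)" for f
    unfolding gen[symmetric] using that by (rule ideal_gen_superset)
  have hv: "snd (h v) \<in> whom bideg (0, d v)" "d v \<in> set ds'" "snd (h v) \<in> set Gs" for v
  proof -
    obtain k where "k < CARD('n)" "h v = (ds' ! k, Gs ! k)" using hz[of v] len by (auto simp: set_zip)
    then show "snd (h v) \<in> whom bideg (0, d v)" "d v \<in> set ds'" "snd (h v) \<in> set Gs"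
      using G len by (auto simp: d_def bihom_comp_whom)
  qed
  have G'hom: "G' v \<in> hom_comp (d v)" for v unfolding G'_def by (rule atX_hom[OF hv(1)])
  have emb: "embY (G' v) = snd (h v)" for v unfolding G'_def by (rule embY_atX[OF hv(1)])
  have mapG: "map (\<lambda>v. snd (h v)) vs = Gs"
  proof -
    have "map (\<lambda>v. snd (h v)) vs = map snd (map h vs)" by simp
    then show ?thesis unfolding vs(3) using len by simp
  qed
  have Gs: "Gs = map (subst (\<lambda>v. Var (Inr v))) (map G' vs)"
    unfolding mapG[symmetric] emb[symmetric] embY_def by simp
  have F0: "atX u0 f = 0" if f: "f \<in> set Fs" for f
  proof -
    obtain k where k: "k < CARD('m)" "f = Fs ! k" using f len(1) by (auto simp: in_set_conv_nth)
    then have fw: "f \<in> whom bideg (ds ! k, 0)" using F by (simp add: bihom_comp_whom)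
    have "f \<in> hvan bideg (vpairs A B)" by (rule FI) (simp add: f)
    then have "\<forall>x\<in>vpairs A B. peval x f = 0" using hvan_whom_iff[OF additive_bideg fw] by simp
    moreover have "case_sum u0 w0 \<in> vpairs A B" unfolding vpairs_def using u0 w0 by blast
    ultimately have "peval u0 (atY w0 f) = 0" unfolding peval_atY by simp
    then have "atX u0 (embX (atY w0 f) :: ('m, 'n, 'k) bipoly) = 0" by simp
    then show ?thesis unfolding embX_atY[OF fw] .
  qed
  have rG: "regular_on (map G' vs)"
  proof (rule regular_on_retract[OF reg, where b = "case_sum (\<lambda>v. Const (u0 v)) Var"])
    show "Gs = map (subst (\<lambda>v. Var (Inr v))) (map G' vs)" by (rule Gs)
    show "subst (case_sum (\<lambda>v. Const (u0 v)) Var) (subst (\<lambda>v. Var (Inr v :: 'm option + 'n option)) p) = p" for p :: "('n option, 'k) mpoly"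
      using atX_embY[of u0 p] unfolding atX_def embY_def .
    show "subst (case_sum (\<lambda>v. Const (u0 v)) Var) f = 0" if "f \<in> set Fs" for f
      using F0[OF that] unfolding atX_def .
  qed
  have "ideal_gen (range G') = hvan tdeg B"
  proof
    show "ideal_gen (range G') \<subseteq> hvan tdeg B"
    proof (rule ideal_gen_least[OF is_ideal_hvan], rule image_subsetI)
      fix v
      have "peval w (G' v) = 0" if w: "w \<in> B" for w
      proof -
        have "snd (h v) \<in> hvan bideg (vpairs A B)" by (rule FI) (simp add: hv(3))
        then have "\<forall>x\<in>vpairs A B. peval x (snd (h v)) = 0" using hvan_whom_iff[OF additive_bideg hv(1)] by simp
        moreover have "case_sum u0 w \<in> vpairs A B" unfolding vpairs_def using u0 w by blast
        ultimately show ?thesis unfolding G'_def peval_atX by simp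
      qed
      then show "G' v \<in> hvan tdeg B" using hvan_whom_iff[OF additive_tdeg, of "G' v" "d v" B] G'hom[of v]
        by (simp add: hom_comp_whom)
    qed
    show "hvan tdeg B \<subseteq> ideal_gen (range G')"
    proof
      fix x assume "x \<in> hvan tdeg B"
      then have "(embY x :: ('m, 'n, 'k) bipoly) \<in> ideal_gen (set (Fs @ Gs))" unfolding gen by (rule hvan_embY)
      then have x: "atX u0 (embY x :: ('m, 'n, 'k) bipoly) \<in> ideal_gen (atX u0 ` set (Fs @ Gs))"
        unfolding atX_def by (rule ideal_gen_subst)
      have "atX u0 g \<in> range G'" if "g \<in> set Gs" for g
      proof -
        have "g \<in> (\<lambda>v. snd (h v)) ` set vs" using that unfolding mapG[symmetric] by simp
        then obtain v where "g = snd (h v)" by (elim imageE)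
        then show ?thesis unfolding G'_def by blast
      qed
      then have "atX u0 ` set (Fs @ Gs) \<subseteq> insert 0 (range G')" using F0 by auto
      from ideal_gen_mono[OF this] show "x \<in> ideal_gen (range G')"
        using x unfolding ideal_gen_insert_zero atX_embY by (rule subsetD)
    qed
  qed
  then show thesis by (rule that[OF vs(1,2) G'hom hv(2) rG])
qed

section \<open>The Kaehler different of a complete intersection\<close>

context product_points
begin

lemma one_not_in_bivan: "1 \<notin> bivan_ideal (X1 \<times> X2)"
proof
  assume "1 \<in> bivan_ideal (X1 \<times> X2)"
  moreover obtain u w where "u \<in> L.reps" "w \<in> R.reps" using reps_nonempty by (elim exE)
  ultimately have "peval (case_sum u w) (1 :: ('m, 'n, 'k) bipoly) = 0" by (rule bivan_pair)
  then show False by simp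
qed

lemma gens_in_bivan:
  assumes F: "ideal_gen (range F) = hvan tdeg L.reps" and G: "ideal_gen (range G) = hvan tdeg R.reps"
  shows "(embX (F i) :: ('m, 'n, 'k) bipoly) \<in> bivan_ideal (X1 \<times> X2)"
    and "(embY (G j) :: ('m, 'n, 'k) bipoly) \<in> bivan_ideal (X1 \<times> X2)"
proof -
  have "F i \<in> hvan tdeg L.reps" unfolding F[symmetric] by (rule ideal_gen_superset) simp
  then show "(embX (F i) :: ('m, 'n, 'k) bipoly) \<in> bivan_ideal (X1 \<times> X2)" unfolding bivan by (rule hvan_embX)
  have "G j \<in> hvan tdeg R.reps" unfolding G[symmetric] by (rule ideal_gen_superset) simp
  then show "(embY (G j) :: ('m, 'n, 'k) bipoly) \<in> bivan_ideal (X1 \<times> X2)" unfolding bivan by (rule hvan_embY)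
qed

lemma bivan_generated:
  assumes F: "ideal_gen (range F) = hvan tdeg L.reps" and G: "ideal_gen (range G) = hvan tdeg R.reps"
  shows "ideal_gen (range (\<lambda>i. embX (F i)) \<union> range (\<lambda>j. embY (G j))) = bivan_ideal (X1 \<times> X2)"
proof
  let ?B = "range (\<lambda>i. embX (F i)) \<union> range (\<lambda>j. embY (G j)) :: ('m, 'n, 'k) bipoly set"
  have I: "is_ideal (bivan_ideal (X1 \<times> X2))" by (simp add: bivan)
  show "ideal_gen ?B \<subseteq> bivan_ideal (X1 \<times> X2)"
    by (rule ideal_gen_least[OF I]) (use gens_in_bivan[OF F G] in blast)
  show "bivan_ideal (X1 \<times> X2) \<subseteq> ideal_gen ?B"
    unfolding bivan hvan_vpairs[OF L.finite_reps]
  proof (rule ideal_gen_least[OF is_ideal_gen], rule Un_least; rule image_subsetI)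
    fix x assume "x \<in> hvan tdeg L.reps"
    then have "embX x \<in> ideal_gen (embX ` range F)" unfolding F[symmetric] by (rule embX_ideal)
    moreover have "embX ` range F \<subseteq> ?B" by blast
    ultimately show "embX x \<in> ideal_gen ?B" using ideal_gen_mono by blast
  next
    fix x assume "x \<in> hvan tdeg R.reps"
    then have "embY x \<in> ideal_gen (embY ` range G)" unfolding G[symmetric] by (rule embY_ideal)
    moreover have "embY ` range G \<subseteq> ?B" by blast
    ultimately show "embY x \<in> ideal_gen ?B" using ideal_gen_mono by blast
  qed
qed

text \<open>
  A separator of the point times the forms \<open>X_i - u_i * X_0\<close> and \<open>Y_j - w_j *
  Y_0\<close> lies in the vanishing ideal and has a diagonal Jacobian there, so
  \<open>jacobian_nonzero\<close> applies.
\<close>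

lemma jacobian_at_point:
  fixes F :: "'m \<Rightarrow> ('m option, 'k) mpoly" and G :: "'n \<Rightarrow> ('n option, 'k) mpoly"
  assumes F: "ideal_gen (range F) = hvan tdeg L.reps" and G: "ideal_gen (range G) = hvan tdeg R.reps"
    and u: "u \<in> L.reps" and w: "w \<in> R.reps"
  shows "peval (case_sum u w) (det (jmat (case_sum (\<lambda>i. embX (F i)) (\<lambda>j. embY (G j))))) \<noteq> 0"
proof -
  let ?H = "case_sum (\<lambda>i. embX (F i)) (\<lambda>j. embY (G j)) :: 'm + 'n \<Rightarrow> ('m, 'n, 'k) bipoly"
  let ?P = "case_sum u w"
  have rH: "range ?H = range (\<lambda>i. embX (F i)) \<union> range (\<lambda>j. embY (G j))"
  proof
    show "range ?H \<subseteq> range (\<lambda>i. embX (F i)) \<union> range (\<lambda>j. embY (G j))" by (auto split: sum.splits)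
    have "embX (F i) = ?H (Inl i)" "embY (G j) = ?H (Inr j)" for i j by simp_all
    then show "range (\<lambda>i. embX (F i)) \<union> range (\<lambda>j. embY (G j)) \<subseteq> range ?H" by blast
  qed
  have gen: "ideal_gen (range ?H) = bivan_ideal (X1 \<times> X2)" unfolding rH by (rule bivan_generated[OF F G])
  obtain e S where S: "S \<in> hom_comp e" "\<forall>v\<in>L.reps - {u}. peval v S = 0" "peval u S \<noteq> 0"
    using separates_exists[OF L.finite_reps _ u] L.reps_None unfolding separates_def by blast
  obtain e' T where T: "T \<in> hom_comp e'" "\<forall>v\<in>R.reps - {w}. peval v T = 0" "peval w T \<noteq> 0"
    using separates_exists[OF R.finite_reps _ w] R.reps_None unfolding separates_def by blast
  let ?S = "embX S * embY T :: ('m, 'n, 'k) bipoly"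
  have Sw: "?S \<in> whom bideg (e, e')" by (rule embXY_hom[OF S(1) T(1)])
  define \<xi> :: "'m + 'n \<Rightarrow> ('m, 'n, 'k) bipoly"
    where "\<xi> c = (case c of Inl i \<Rightarrow> embX (xi u i) | Inr j \<Rightarrow> embY (xi w j))" for c
  have xi1: "xi q i \<in> hom_comp 1" for q :: "'c::finite option \<Rightarrow> 'k" and i
    unfolding xi_def hom_comp_whom using Var_hom[of "Some i"] Var_hom[of None]
    unfolding hom_comp_whom by (intro whom_diff whom_scale additive_tdeg)
  have xi0: "peval u (xi u i) = 0" "peval w (xi w j) = 0" for i j
    using L.reps_None[OF u] R.reps_None[OF w] by (simp_all add: xi_def)
  have \<xi>w: "\<exists>d. \<xi> c \<in> whom bideg d" for c
  proof (cases c)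
    case (Inl i) then show ?thesis using embX_hom[OF xi1, of u i] unfolding \<xi>_def by auto
  next
    case (Inr j) then show ?thesis using embY_hom[OF xi1, of w j] unfolding \<xi>_def by auto
  qed
  have \<xi>0: "peval ?P (\<xi> c) = 0" for c by (cases c) (simp_all add: \<xi>_def xi0)
  have dx: "partial_deriv (Some i') (xi q i) = (if i' = i then 1 else 0)" for q :: "'c::finite option \<Rightarrow> 'k" and i i'
    by (simp add: xi_def partial_deriv_mult partial_deriv_Var)
  have d\<xi>: "peval ?P (partial_deriv (map_sum Some Some c') (\<xi> c)) = (if c' = c then 1 else 0)" for c c'
    by (cases c; cases c') (simp_all add: \<xi>_def peval_partial_Inl peval_partial_Inr dx)
  have "det (\<chi> r c. peval ?P (partial_deriv (map_sum Some Some c) (?H r))) \<noteq> 0"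
  proof (rule jacobian_nonzero[where h = "\<lambda>c. ?S * \<xi> c" and \<kappa> = "\<lambda>_. peval ?P ?S"])
    fix r show "peval ?P (?H r) = 0"
      by (rule bivan_pair[OF _ u w]) (cases r, simp_all add: gens_in_bivan[OF F G])
  next
    fix c
    obtain d where "\<xi> c \<in> whom bideg d" using \<xi>w[of c] by (elim exE)
    then have h: "?S * \<xi> c \<in> whom bideg ((e, e') + d)" by (rule whom_mult[OF additive_bideg Sw])
    have "peval v (?S * \<xi> c) = 0" if v: "v \<in> vpairs L.reps R.reps" for v
    proof -
      obtain u' w' where v': "v = case_sum u' w'" "u' \<in> L.reps" "w' \<in> R.reps" using v unfolding vpairs_def by blast
      show ?thesis
      proof (cases "u' = u \<and> w' = w")
        case True then show ?thesis using \<xi>0[of c] v'(1) by simp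
      next
        case False
        then have "peval u' S = 0 \<or> peval w' T = 0" using S(2) T(2) v'(2,3) by blast
        then show ?thesis unfolding v'(1) by auto
      qed
    qed
    then show "?S * \<xi> c \<in> ideal_gen (range ?H)"
      unfolding gen bivan using hvan_whom_iff[OF additive_bideg h] by blast
    fix c'
    show "peval ?P (partial_deriv (map_sum Some Some c') (?S * \<xi> c)) = (if c' = c then peval ?P ?S else 0)"
      unfolding partial_deriv_mult[of _ ?S] using \<xi>0[of c] d\<xi>[of c' c] by simp
  next
    show "peval ?P ?S \<noteq> 0" using S(3) T(3) by simp
  qed
  then show ?thesis unfolding peval_det jmat_def by simp
qed

lemma complete_intersection_kaehler:
  assumes Fs: "finite Fs" "ideal_gen Fs = bivan_ideal (X1 \<times> X2)"
    and CI: "complete_intersection ds ds' (X1 \<times> X2)" and pos: "\<forall>d\<in>set ds. d \<ge> 1" "\<forall>d\<in>set ds'. d \<ge> 1"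
  shows "cayley_bacharach (X1 \<times> X2)"
    and "HF_kaehler Fs (X1 \<times> X2) (reg_index X1) (reg_index X2) \<noteq> 0"
proof -
  obtain As Bs where len: "length ds = CARD('m)" "length As = CARD('m)" "length ds' = CARD('n)" "length Bs = CARD('n)"
    and A: "\<forall>i<CARD('m). As ! i \<in> bihom_comp (ds ! i) 0" and B: "\<forall>j<CARD('n). Bs ! j \<in> bihom_comp 0 (ds' ! j)"
    and rs: "regular_seq_mod {0} (As @ Bs)" and gen: "ideal_gen (set (As @ Bs)) = bivan_ideal (X1 \<times> X2)"
    using CI unfolding complete_intersection_def by (elim exE conjE)
  have ins: "ideal_gen ({0} \<union> S) = ideal_gen S" for S :: "('m, 'n, 'k) bipoly set"
    using ideal_gen_insert_zero[of S] by simp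
  have reg: "regular_on (As @ Bs)" using rs unfolding regular_seq_mod_def regular_on_def ins by (elim conjE)
  obtain u w where u: "u \<in> L.reps" and w: "w \<in> R.reps" using reps_nonempty by (elim exE)
  obtain vs F d where F: "distinct vs" "set vs = (UNIV :: 'm set)" "\<And>v. F v \<in> hom_comp (d v)" "\<And>v. d v \<in> set ds"
    "regular_on (map F vs)" "ideal_gen (range F) = hvan tdeg L.reps"
    by (rule ci_factor_X[OF len(2,1,4) A B reg gen[unfolded bivan] u w]) blast
  obtain ws G d' where G: "distinct ws" "set ws = (UNIV :: 'n set)" "\<And>v. G v \<in> hom_comp (d' v)" "\<And>v. d' v \<in> set ds'"
    "regular_on (map G ws)" "ideal_gen (range G) = hvan tdeg R.reps"
    by (rule ci_factor_Y[OF len(2,4,3) A B reg gen[unfolded bivan] u w]) blast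
  have dpos: "d v \<ge> 1" "d' v' \<ge> 1" for v v' using pos F(4) G(4) by blast+
  have vF: "peval q (F i) = 0" if q: "q \<in> L.reps" for q i
  proof -
    have "F i \<in> hvan tdeg L.reps" unfolding F(6)[symmetric] by (rule ideal_gen_superset) simp
    moreover have "F i \<in> whom tdeg (d i)" using F(3)[of i] by (simp add: hom_comp_whom)
    ultimately show ?thesis using hvan_whom_iff[OF additive_tdeg, of "F i" "d i" L.reps] q by blast
  qed
  have vG: "peval q (G i) = 0" if q: "q \<in> R.reps" for q i
  proof -
    have "G i \<in> hvan tdeg R.reps" unfolding G(6)[symmetric] by (rule ideal_gen_superset) simp
    moreover have "G i \<in> whom tdeg (d' i)" using G(3)[of i] by (simp add: hom_comp_whom)
    ultimately show ?thesis using hvan_whom_iff[OF additive_tdeg, of "G i" "d' i" R.reps] q by blast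
  qed
  interpret JF: jacobian_forms L.reps F d
    by unfold_locales (use L.finite_reps L.reps_None F(3) dpos vF in blast)+
  interpret JG: jacobian_forms R.reps G d'
    by unfold_locales (use R.finite_reps R.reps_None G(3) dpos vG in blast)+
  note S = JF.complete_intersection_separators[OF F(6,5,1,2)]
  note T = JG.complete_intersection_separators[OF G(6,5,1,2)]
  have r1: "reg_index X1 = JF.rho" using L.reg_index_eq[OF nonempty(1) S] by blast
  have r2: "reg_index X2 = JG.rho" using R.reg_index_eq[OF nonempty(2) T] by blast
  show "cayley_bacharach (X1 \<times> X2)" unfolding cayley_bacharach_iff using S T by (intro ballI allI) simp
  define H where "H = case_sum (\<lambda>i. embX (F i)) (\<lambda>j. embY (G j) :: ('m, 'n, 'k) bipoly)"
  let ?\<Delta> = "det (jmat H)" and ?\<theta> = "kaehler_different Fs (X1 \<times> X2)" and ?I = "bivan_ideal (X1 \<times> X2)"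
  let ?C = "bihom_comp (reg_index X1) (reg_index X2) :: ('m, 'n, 'k) bipoly set"
  have HI: "H k \<in> ?I" for k by (cases k) (simp_all add: H_def gens_in_bivan[OF F(6) G(6)])
  have \<Delta>\<theta>: "?\<Delta> \<in> ?\<theta>" by (rule jmat_in_kaehler[OF Fs HI])
  have Hw: "H k \<in> whom bideg (case_sum d (\<lambda>_. 0) k, case_sum (\<lambda>_. 0) d' k)" for k
    by (cases k) (simp_all add: H_def embX_hom[OF F(3)] embY_hom[OF G(3)])
  have sums: "sum (case_sum d (\<lambda>_. 0)) (UNIV :: ('m + 'n) set) - CARD('m) = JF.rho"
    "sum (case_sum (\<lambda>_. 0) d') (UNIV :: ('m + 'n) set) - CARD('n) = JG.rho"
    unfolding sum_UNIV_sum JF.rho_def JG.rho_def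
    using sum_subtractf_nat[of UNIV "\<lambda>_. 1" d] sum_subtractf_nat[of UNIV "\<lambda>_. 1" d'] dpos by simp_all
  have \<Delta>C: "?\<Delta> \<in> ?C" using jmat_whom(1)[of H "case_sum d (\<lambda>_. 0)" "case_sum (\<lambda>_. 0) d'", OF Hw]
    unfolding sums r1 r2 bihom_comp_whom .
  have \<Delta>n: "?\<Delta> \<notin> ?I" using jacobian_at_point[OF F(6) G(6) u w] bivan_pair[OF _ u w, of ?\<Delta>] unfolding H_def by blast
  have I: "is_ideal ?I" by (simp add: bivan)
  have \<theta>: "is_ideal ?\<theta>" by (simp add: kaehler_different_def)
  have I\<theta>: "?I \<subseteq> ?\<theta>" unfolding kaehler_different_def by (auto intro: ideal_gen_superset)
  have C: "mp.subspace ?C" unfolding bihom_comp_whom by (rule whom_subspace[OF additive_bideg])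
  have fin: "fin_dim (?\<theta> \<inter> ?C)" by (rule fin_dim_subset[OF fin_dim_bihom_comp]) blast
  have sub: "mp.subspace (?I \<inter> ?C)" "mp.subspace (?\<theta> \<inter> ?C)"
    using subspace_Int[OF ideal_subspace[OF I] C] subspace_Int[OF ideal_subspace[OF \<theta>] C] .
  have le: "?I \<inter> ?C \<subseteq> ?\<theta> \<inter> ?C" using I\<theta> by blast
  show "HF_kaehler Fs (X1 \<times> X2) (reg_index X1) (reg_index X2) \<noteq> 0"
  proof
    assume "HF_kaehler Fs (X1 \<times> X2) (reg_index X1) (reg_index X2) = 0"
    then have "Kdim (?\<theta> \<inter> ?C) \<le> Kdim (?I \<inter> ?C)" unfolding HF_kaehler_def comp_dim_def by simp
    then have "Kdim (?I \<inter> ?C) = Kdim (?\<theta> \<inter> ?C)" using Kdim_mono[OF fin sub le] by simp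
    then have "?I \<inter> ?C = ?\<theta> \<inter> ?C" by (rule Kdim_eq_imp[OF fin sub le])
    then show False using \<Delta>\<theta> \<Delta>C \<Delta>n by blast
  qed
qed

end

section \<open>Complete intersections from a nonzero Kaehler different\<close>

context product_points
begin

lemma complete_intersection_of_forms:
  fixes F :: "'m \<Rightarrow> ('m option, 'k) mpoly" and G :: "'n \<Rightarrow> ('n option, 'k) mpoly"
  assumes F: "\<And>i. F i \<in> hom_comp (d i)" "\<And>i. d i \<ge> 1" "koszul_on UNIV F" "ideal_gen (range F) = hvan tdeg L.reps"
    and G: "\<And>j. G j \<in> hom_comp (d' j)" "\<And>j. d' j \<ge> 1" "koszul_on UNIV G" "ideal_gen (range G) = hvan tdeg R.reps"
  shows "\<exists>ds ds'. (\<forall>d\<in>set ds. d \<ge> 1) \<and> (\<forall>d\<in>set ds'. d \<ge> 1) \<and> complete_intersection ds ds' (X1 \<times> X2)"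
proof -
  obtain vs :: "'m list" where vs: "set vs = UNIV" "distinct vs" using finite_distinct_list[of "UNIV :: 'm set"] by auto
  obtain ws :: "'n list" where ws: "set ws = UNIV" "distinct ws" using finite_distinct_list[of "UNIV :: 'n set"] by auto
  have len: "length vs = CARD('m)" "length ws = CARD('n)"
    using distinct_card[OF vs(2)] distinct_card[OF ws(2)] vs(1) ws(1) by simp_all
  have rF: "regular_on (map F vs)" by (rule koszul_regular[OF vs(2) F(1,2)]) (simp add: vs(1) F(3))
  have rG: "regular_on (map G ws)" by (rule koszul_regular[OF ws(2) G(1,2)]) (simp add: ws(1) G(3))
  define As where "As = map (\<lambda>i. embX (F i) :: ('m, 'n, 'k) bipoly) vs"
  define Bs where "Bs = map (\<lambda>j. embY (G j) :: ('m, 'n, 'k) bipoly) ws"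
  have setAB: "set (As @ Bs) = range (\<lambda>i. embX (F i)) \<union> range (\<lambda>j. embY (G j))"
    by (simp add: As_def Bs_def vs(1) ws(1))
  have gen: "ideal_gen (set (As @ Bs)) = bivan_ideal (X1 \<times> X2)"
    unfolding setAB by (rule bivan_generated[OF F(4) G(4)])
  have ins: "ideal_gen ({0} \<union> S) = ideal_gen S" for S :: "('m, 'n, 'k) bipoly set"
    using ideal_gen_insert_zero[of S] by simp
  have "regular_seq_mod {0} (As @ Bs)"
    unfolding regular_seq_mod_def ins gen
  proof (intro conjI allI impI)
    fix k g assume k: "k < length (As @ Bs)" and g: "(As @ Bs) ! k * g \<in> ideal_gen (set (take k (As @ Bs)))"
    show "g \<in> ideal_gen (set (take k (As @ Bs)))"
    proof (cases "k < length vs")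
      case True
      then have e: "(As @ Bs) ! k = embX (F (vs ! k))" "set (take k (As @ Bs)) = (\<lambda>i. embX (F i)) ` set (take k vs)"
        by (simp_all add: As_def nth_append take_map)
      show ?thesis
        unfolding e
      proof (rule embX_nzd[OF finite_set])
        show "embX (F (vs ! k)) * g \<in> ideal_gen ((\<lambda>i. embX (F i)) ` set (take k vs))" using g unfolding e .
        fix h assume "F (vs ! k) * h \<in> ideal_gen (F ` set (take k vs))"
        then show "h \<in> ideal_gen (F ` set (take k vs))"
          using rF[unfolded regular_on_def, rule_format, of k h] True by (simp add: take_map)
      qed
    next
      case False
      define l where "l = k - length vs"
      have l: "k = length vs + l" "l < length ws" using False k by (auto simp: l_def As_def Bs_def)
      have e: "(As @ Bs) ! k = embY (G (ws ! l))"
        "set (take k (As @ Bs)) = range (\<lambda>i. embX (F i)) \<union> (\<lambda>j. embY (G j)) ` set (take l ws)"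
        using l by (simp_all add: As_def Bs_def nth_append take_map vs(1))
      show ?thesis
        unfolding e
      proof (rule embY_nzd[OF L.finite_reps F(4)])
        show "embY (G (ws ! l)) * g \<in> ideal_gen (range (\<lambda>i. embX (F i)) \<union> (\<lambda>j. embY (G j)) ` set (take l ws))"
          using g unfolding e .
        fix h assume "G (ws ! l) * h \<in> ideal_gen (G ` set (take l ws))"
        then show "h \<in> ideal_gen (G ` set (take l ws))"
          using rG[unfolded regular_on_def, rule_format, of l h] l(2) by (simp add: take_map)
      qed (use F(1) G(1) in blast)+
    qed
  next
    show "bivan_ideal (X1 \<times> X2) \<noteq> UNIV" using one_not_in_bivan by blast
  qed
  moreover have "\<forall>i<CARD('m). As ! i \<in> bihom_comp (map d vs ! i) 0"
    by (simp add: As_def len(1)[symmetric] bihom_comp_whom embX_hom[OF F(1)])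
  moreover have "\<forall>j<CARD('n). Bs ! j \<in> bihom_comp 0 (map d' ws ! j)"
    by (simp add: Bs_def len(2)[symmetric] bihom_comp_whom embY_hom[OF G(1)])
  moreover have "length (map d vs) = CARD('m)" "length As = CARD('m)" "length (map d' ws) = CARD('n)" "length Bs = CARD('n)"
    by (simp_all add: As_def Bs_def len)
  ultimately have "complete_intersection (map d vs) (map d' ws) (X1 \<times> X2)"
    unfolding complete_intersection_def using gen by (intro exI conjI)
  moreover have "\<forall>e\<in>set (map d vs). e \<ge> 1" "\<forall>e\<in>set (map d' ws). e \<ge> 1" using F(2) G(2) by auto
  ultimately show ?thesis by (intro exI conjI)
qed

text \<open>
  The selected rows have nonzero Jacobian at \<open>u\<close> and at \<open>w\<close>. Their
  degrees are bounded by the bidegree of the minor, so \<open>rho\<close> does not exceed the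
  regularity index, below which the Cayley-Bacharach property forbids separators.
\<close>

lemma kaehler_complete_intersection:
  assumes hom: "\<forall>F\<in>Fs. \<exists>i j. F \<in> bihom_comp i j" and gen: "ideal_gen Fs = bivan_ideal (X1 \<times> X2)"
    and CB: "cayley_bacharach (X1 \<times> X2)"
    and HF: "HF_kaehler Fs (X1 \<times> X2) (reg_index X1) (reg_index X2) \<noteq> 0" and two: "(2 :: 'k) \<noteq> 0"
  shows "\<exists>ds ds'. (\<forall>d\<in>set ds. d \<ge> 1) \<and> (\<forall>d\<in>set ds'. d \<ge> 1) \<and> complete_intersection ds ds' (X1 \<times> X2)"
proof -
  from kaehler_minor[OF hom gen bivan HF] obtain r a b v where rF: "\<And>k. r k \<in> Fs"
    and rw: "\<And>k. r k \<in> whom bideg (a k, b k)" and v: "v \<in> vpairs L.reps R.reps"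
    and nz: "peval v (det (jmat r)) \<noteq> 0"
    and ab: "sum a UNIV \<le> reg_index X1 + CARD('m)" "sum b UNIV \<le> reg_index X2 + CARD('n)" by blast
  obtain u w where uw: "v = case_sum u w" and u: "u \<in> L.reps" and w: "w \<in> R.reps"
    using v unfolding vpairs_def by blast
  have rI: "r k \<in> bivan_ideal (X1 \<times> X2)" for k unfolding gen[symmetric] using rF by (rule ideal_gen_superset)
  define x where "x k i = peval u (partial_deriv (Some i) (atY w (r k)))" for k i
  define y where "y k j = peval w (partial_deriv (Some j) (atX u (r k)))" for k j
  have "(\<chi> k c. peval v (jmat r $ k $ c)) = (\<chi> k c. case c of Inl i \<Rightarrow> x k i | Inr j \<Rightarrow> y k j)"
    by (auto simp: vec_eq_iff jmat_def uw x_def y_def peval_partial_Inl peval_partial_Inr split: sum.splits)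
  then have "det (\<chi> k c. case c of Inl i \<Rightarrow> x k i | Inr j \<Rightarrow> y k j) \<noteq> 0" using nz unfolding peval_det by simp
  then obtain g h where g: "inj (g :: 'm \<Rightarrow> 'm + 'n)" "det (\<chi> i j. x (g i) j) \<noteq> 0"
    and h: "inj (h :: 'n \<Rightarrow> 'm + 'n)" "det (\<chi> i j. y (h i) j) \<noteq> 0"
    by (rule det_two_blocks)
  define F where "F i = atY w (r (g i))" for i
  define G where "G j = atX u (r (h j))" for j
  have Fh: "F i \<in> hom_comp (a (g i))" for i unfolding F_def by (rule atY_hom[OF rw])
  have Gh: "G j \<in> hom_comp (b (h j))" for j unfolding G_def by (rule atX_hom[OF rw])
  have vF: "peval q (F i) = 0" if "q \<in> L.reps" for q i
    unfolding F_def peval_atY by (rule bivan_pair[OF rI that w])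
  have vG: "peval q (G j) = 0" if "q \<in> R.reps" for q j
    unfolding G_def peval_atX by (rule bivan_pair[OF rI u that])
  have apos: "a (g i) \<ge> 1" for i
  proof (rule ccontr)
    assume "\<not> a (g i) \<ge> 1"
    then have "a (g i) = 0" by simp
    then have "F i \<in> hom_comp 0" using Fh[of i] by simp
    from hom_comp_0_Const[OF this] obtain c where c: "F i = Const c" by blast
    have "det (\<chi> i j. x (g i) j) = 0"
      by (rule det_zero_row(2)[of i]) (simp add: row_def vec_eq_iff x_def F_def[symmetric] c)
    then show False using g(2) by simp
  qed
  have bpos: "b (h j) \<ge> 1" for j
  proof (rule ccontr)
    assume "\<not> b (h j) \<ge> 1"
    then have "b (h j) = 0" by simp
    then have "G j \<in> hom_comp 0" using Gh[of j] by simp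
    from hom_comp_0_Const[OF this] obtain c where c: "G j = Const c" by blast
    have "det (\<chi> i j. y (h i) j) = 0"
      by (rule det_zero_row(2)[of j]) (simp add: row_def vec_eq_iff y_def G_def[symmetric] c)
    then show False using h(2) by simp
  qed
  interpret JF: jacobian_forms L.reps F "\<lambda>i. a (g i)"
    by unfold_locales (use L.finite_reps L.reps_None Fh apos vF in blast)+
  interpret JG: jacobian_forms R.reps G "\<lambda>j. b (h j)"
    by unfold_locales (use R.finite_reps R.reps_None Gh bpos vG in blast)+
  have jF: "JF.jac u \<noteq> 0" using g(2) unfolding JF.jac_def x_def F_def .
  have jG: "JG.jac w \<noteq> 0" using h(2) unfolding JG.jac_def y_def G_def .
  have le: "(\<Sum>i\<in>UNIV. c (f i) - 1) \<le> s" if f: "inj f" and c: "sum c UNIV \<le> s + CARD('c)" and pos: "\<And>i. c (f i) \<ge> 1"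
    for f :: "'c::finite \<Rightarrow> 'm + 'n" and c :: "'m + 'n \<Rightarrow> nat" and s
  proof -
    have "(\<Sum>i\<in>UNIV. c (f i)) = sum c (range f)" using sum.reindex[OF f, of c] by simp
    also have "\<dots> \<le> sum c UNIV" by (rule sum_mono2) auto
    finally have "(\<Sum>i\<in>UNIV. c (f i)) \<le> s + CARD('c)" using c by simp
    moreover have "(\<Sum>i\<in>UNIV. c (f i) - 1) = (\<Sum>i\<in>UNIV. c (f i)) - CARD('c)"
      using sum_subtractf_nat[of UNIV "\<lambda>_. 1" "\<lambda>i. c (f i)"] pos by simp
    ultimately show ?thesis by simp
  qed
  have r1: "JF.rho \<le> reg_index X1" unfolding JF.rho_def by (rule le[OF g(1) ab(1) apos])
  have r2: "JG.rho \<le> reg_index X2" unfolding JG.rho_def by (rule le[OF h(1) ab(2) bpos])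
  have nsF: "\<not> separates (hom_comp k) (L.reps - {u}) u" if "k < JF.rho" for k
    using cayley_bacharach_separates(1)[OF CB u, of k] r1 that by simp
  have nsG: "\<not> separates (hom_comp k) (R.reps - {w}) w" if "k < JG.rho" for k
    using cayley_bacharach_separates(2)[OF CB w, of k] r2 that by simp
  show ?thesis
    by (rule complete_intersection_of_forms[OF Fh apos JF.jacobian_generates(2)[OF u jF nsF two]
        JF.jacobian_generates(1)[OF u jF nsF two] Gh bpos JG.jacobian_generates(2)[OF w jG nsG two]
        JG.jacobian_generates(1)[OF w jG nsG two]])
qed

end

theorem theorem1p1:
  fixes X :: "('m::finite, 'n::finite, 'k::field_char_0) bipoint set"
    and Fs :: "('m, 'n, 'k) bipoly set"
  assumes points: "X \<subseteq> proj_space \<times> proj_space" "finite X" "X \<noteq> {}"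
    and generators: "finite Fs" "\<forall>F\<in>Fs. \<exists>i j. F \<in> bihom_comp i j" "ideal_gen Fs = bivan_ideal X"
    and coordinates: "arith_CM X \<Longrightarrow> regular_seq_mod (bivan_ideal X) [Var (Inl None), Var (Inr None)]"
  shows "(\<exists>ds ds'. (\<forall>d\<in>set ds. d \<ge> 1) \<and> (\<forall>d\<in>set ds'. d \<ge> 1) \<and> complete_intersection ds ds' X)
     \<longleftrightarrow>
         (X = (fst ` X) \<times> (snd ` X) \<and> cayley_bacharach X \<and>
          HF_kaehler Fs X (reg_index (fst ` X)) (reg_index (snd ` X)) \<noteq> 0)"
proof -
  let ?X1 = "fst ` X" and ?X2 = "snd ` X"
  have pp: "product_points ?X1 ?X2" if prod: "X = ?X1 \<times> ?X2"
  proof -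
    have ne: "?X1 \<noteq> {}" "?X2 \<noteq> {}" using points(3) by auto
    have "regular_seq_mod (bivan_ideal X) [Var (Inl None), Var (Inr None)]"
      by (rule coordinates[OF product_arith_CM[OF points prod]])
    from regular_coordinates_affine[OF points(1,2) prod ne this] ne
    show ?thesis by (intro product_points.intro product_points_axioms.intro)
  qed
  show ?thesis
  proof
    assume "\<exists>ds ds'. (\<forall>d\<in>set ds. d \<ge> 1) \<and> (\<forall>d\<in>set ds'. d \<ge> 1) \<and> complete_intersection ds ds' X"
    then obtain ds ds' where pos: "\<forall>d\<in>set ds. d \<ge> 1" "\<forall>d\<in>set ds'. d \<ge> 1" and CI: "complete_intersection ds ds' X"
      by (elim exE conjE)
    have prod: "X = ?X1 \<times> ?X2" by (rule complete_intersection_product[OF points(1,2) CI])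
    interpret product_points ?X1 ?X2 by (rule pp[OF prod])
    show "X = ?X1 \<times> ?X2 \<and> cayley_bacharach X \<and> HF_kaehler Fs X (reg_index ?X1) (reg_index ?X2) \<noteq> 0"
      using complete_intersection_kaehler[of Fs ds ds', folded prod, OF generators(1,3) CI pos] prod by (intro conjI)
  next
    assume b: "X = ?X1 \<times> ?X2 \<and> cayley_bacharach X \<and> HF_kaehler Fs X (reg_index ?X1) (reg_index ?X2) \<noteq> 0"
    then have prod: "X = ?X1 \<times> ?X2" by (elim conjE)
    interpret product_points ?X1 ?X2 by (rule pp[OF prod])
    show "\<exists>ds ds'. (\<forall>d\<in>set ds. d \<ge> 1) \<and> (\<forall>d\<in>set ds'. d \<ge> 1) \<and> complete_intersection ds ds' X"
      using kaehler_complete_intersection[of Fs, folded prod, OF generators(2,3)] b by simp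
  qed
qed

end
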